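(* Let $\mathfrak{g}$ be a finite dimensional complex simple Lie algebra of simply laced type. Let $\lambda$ be a dominant integral weight of $\mathfrak{g}$ and $\mu$ a weight of the irreducible $\mathfrak{g}$-module $V(\lambda)$ with highest weight $\lambda$. Let $M$ be the largest integer such that the $M$-th graded piece $W(\lambda)_\mu[M]$ of the $\mu$-weight space of the local Weyl module $W(\lambda)$ is non-zero. Then: (1) $M=\frac12\left((\lambda|\lambda)-(\mu|\mu)\right)$; (2) $W(\lambda)_\mu[M]$ has dimension $1$.
   Context: Fix a Cartan subalgebra $\mathfrak{h}$ of $\mathfrak{g}$ and a Borel subalgebra containing it, with triangular decomposition $\mathfrak{g}=\mathfrak{n}^-\oplus\mathfrak{h}\oplus\mathfrak{n}^+$. $(\ |\ )$ is the invariant form on $\mathfrak{h}^\star$ normalized so that $(\alpha|\alpha)=2$ for all long roots $\alpha$ (in simply laced type, for all roots). The current algebra is $\mathfrak{g}[t]=\mathfrak{g}\otimes\mathbb{C}[t]$ with bracket $[X\otimes f,Y\otimes g]=[X,Y]\otimes fg$, graded by degree in $t$. The local Weyl module $W(\lambda)$ is the cyclic $\mathfrak{g}[t]$-module generated by an element $u$ subject to the relations: $(\mathfrak{n}^+\otimes\mathbb{C}[t])u=0$; $(\mathfrak{h}\otimes t\mathbb{C}[t])u=0$; $Hu=\langle\lambda,H\rangle u$ for $H\in\mathfrak{h}$; and $\mathfrak{g}_{-\alpha}^{\langle\lambda,\alpha^\vee\rangle+1}u=0$ for every simple root $\alpha$, where $\alpha^\vee$ is the coroot and $\mathfrak{g}_{-\alpha}$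 the root space of $-\alpha$. It is finite dimensional and graded by the non-negative integers, with $u$ in grade $0$. Its $\mathfrak{h}$-weights are precisely the weights of $V(\lambda)$. $W(\lambda)_\mu$ denotes the $\mathfrak{h}$-weight space of weight $\mu$, and $W(\lambda)_\mu[M]$ its piece of grade $M$. *)

theory Defs
  imports Complex_Main "HOL-Computational_Algebra.Polynomial" "HOL-Library.Poly_Mapping"
begin

section \<open>Complex Lie algebras and their modules\<close>

locale lie_algebra = vector_space scale
  for scale :: "complex \<Rightarrow> 'g::ab_group_add \<Rightarrow> 'g" +
  fixes bracket :: "'g \<Rightarrow> 'g \<Rightarrow> 'g"
  assumes bracket_add_left: "bracket (x + y) z = bracket x z + bracket y z"
    and bracket_add_right: "bracket x (y + z) = bracket x y + bracket x z"
    and bracket_scale_left: "bracket (scale c x) y = scale c (bracket x y)"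
    and bracket_scale_right: "bracket x (scale c y) = scale c (bracket x y)"
    and bracket_self: "bracket x x = 0"
    and jacobi: "bracket x (bracket y z) + bracket y (bracket z x) + bracket z (bracket x y) = 0"
begin

definition finite_dimensional :: bool where
  "finite_dimensional \<longleftrightarrow> (\<exists>B. finite B \<and> span B = UNIV)"

definition bracket_span :: "'g set \<Rightarrow> 'g set \<Rightarrow> 'g set" where
  "bracket_span A B = span {bracket x y | x y. x \<in> A \<and> y \<in> B}"

definition subalgebra :: "'g set \<Rightarrow> bool" where
  "subalgebra A \<longleftrightarrow> subspace A \<and> (\<forall>x\<in>A. \<forall>y\<in>A. bracket x y \<in> A)"

definition lie_ideal :: "'g set \<Rightarrow> bool" where
  "lie_ideal I \<longleftrightarrow> subspace I \<and> (\<forall>x. \<forall>y\<in>I. bracket x y \<in> I)"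

definition simple :: bool where
  "simple \<longleftrightarrow> (\<exists>x y. bracket x y \<noteq> 0) \<and> (\<forall>I. lie_ideal I \<longrightarrow> I = {0} \<or> I = UNIV)"

primrec derived_series :: "'g set \<Rightarrow> nat \<Rightarrow> 'g set" where
  "derived_series A 0 = A"
| "derived_series A (Suc n) = bracket_span (derived_series A n) (derived_series A n)"

definition solvable :: "'g set \<Rightarrow> bool" where
  "solvable A \<longleftrightarrow> (\<exists>n. derived_series A n = {0})"

primrec lower_central_series :: "'g set \<Rightarrow> nat \<Rightarrow> 'g set" where
  "lower_central_series A 0 = A"
| "lower_central_series A (Suc n) = bracket_span A (lower_central_series A n)"

definition nilpotent :: "'g set \<Rightarrow> bool" where
  "nilpotent A \<longleftrightarrow> (\<exists>n. lower_central_series A n = {0})"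

definition normalizer :: "'g set \<Rightarrow> 'g set" where
  "normalizer A = {x. \<forall>y\<in>A. bracket x y \<in> A}"

definition cartan_subalgebra :: "'g set \<Rightarrow> bool" where
  "cartan_subalgebra h \<longleftrightarrow> subalgebra h \<and> nilpotent h \<and> normalizer h = h"

definition borel_subalgebra :: "'g set \<Rightarrow> bool" where
  "borel_subalgebra b \<longleftrightarrow> subalgebra b \<and> solvable b \<and>
     (\<forall>c. subalgebra c \<and> solvable c \<and> b \<subseteq> c \<longrightarrow> c = b)"

end

locale lie_module = lie_algebra scale bracket + V: vector_space scaleV
  for scale :: "complex \<Rightarrow> 'g::ab_group_add \<Rightarrow> 'g"
    and bracket :: "'g \<Rightarrow> 'g \<Rightarrow> 'g"
    and scaleV :: "complex \<Rightarrow> 'v::ab_group_add \<Rightarrow> 'v" +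
  fixes act :: "'g \<Rightarrow> 'v \<Rightarrow> 'v"
  assumes act_add_left: "act (x + y) v = act x v + act y v"
    and act_add_right: "act x (v + w) = act x v + act x w"
    and act_scale_left: "act (scale c x) v = scaleV c (act x v)"
    and act_scale_right: "act x (scaleV c v) = scaleV c (act x v)"
    and act_bracket: "act (bracket x y) v = act x (act y v) - act y (act x v)"
begin

definition irreducible_module :: bool where
  "irreducible_module \<longleftrightarrow> (\<exists>v::'v. v \<noteq> 0) \<and>
     (\<forall>S. V.subspace S \<and> (\<forall>x. \<forall>v\<in>S. act x v \<in> S) \<longrightarrow> S = {0} \<or> S = UNIV)"

end


section \<open>The current algebra\<close>

text \<open>The space \<open>\<gg>[t]\<close> is represented by polynomials with coefficients in \<open>\<gg>\<close>:
  \<open>monom X n\<close> stands for \<open>X \<otimes> t\<^sup>n\<close>.\<close>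

definition current_scale ::
    "(complex \<Rightarrow> 'g::ab_group_add \<Rightarrow> 'g) \<Rightarrow> complex \<Rightarrow> 'g poly \<Rightarrow> 'g poly" where
  "current_scale scale c p = map_poly (scale c) p"

definition current_bracket ::
    "('g::ab_group_add \<Rightarrow> 'g \<Rightarrow> 'g) \<Rightarrow> 'g poly \<Rightarrow> 'g poly \<Rightarrow> 'g poly" where
  "current_bracket bracket p q =
     (\<Sum>i\<le>degree p. \<Sum>j\<le>degree q. monom (bracket (coeff p i) (coeff q j)) (i + j))"

context lie_algebra
begin

lemma coeff_current_scale: "coeff (current_scale scale c p) n = scale c (coeff p n)"
  by (simp add: current_scale_def coeff_map_poly)

lemma bracket_zero_left: "bracket 0 y = 0"
  using bracket_add_left[of 0 0 y] by simp

lemma bracket_zero_right: "bracket y 0 = 0"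
  using bracket_add_right[of y 0 0] by simp

lemma bracket_antisym: "bracket y x = - bracket x y"
proof -
  have "bracket x y + bracket y x =
      bracket (x + y) (x + y) - bracket x x - bracket y y"
    unfolding bracket_add_left bracket_add_right by (simp add: algebra_simps)
  then have "bracket x y + bracket y x = 0" by (simp add: bracket_self)
  then show ?thesis by (simp add: add_eq_0_iff)
qed

lemma current_bracket_bound:
  assumes "degree p \<le> m" "degree q \<le> n"
  shows "current_bracket bracket p q =
     (\<Sum>i\<le>m. \<Sum>j\<le>n. monom (bracket (coeff p i) (coeff q j)) (i + j))"
proof -
  have "(\<Sum>j\<le>degree q. monom (bracket (coeff p i) (coeff q j)) (i + j)) =
      (\<Sum>j\<le>n. monom (bracket (coeff p i) (coeff q j)) (i + j))" for i
    using assms(2) by (intro sum.mono_neutral_left) (auto simp: coeff_eq_0 bracket_zero_right)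
  then have "current_bracket bracket p q =
      (\<Sum>i\<le>degree p. \<Sum>j\<le>n. monom (bracket (coeff p i) (coeff q j)) (i + j))"
    unfolding current_bracket_def by simp
  also have "\<dots> = (\<Sum>i\<le>m. \<Sum>j\<le>n. monom (bracket (coeff p i) (coeff q j)) (i + j))"
    using assms(1) by (intro sum.mono_neutral_left) (auto simp: coeff_eq_0 bracket_zero_left)
  finally show ?thesis .
qed

lemma current_bracket_monom:
  "current_bracket bracket (monom X m) (monom Y n) = monom (bracket X Y) (m + n)"
proof -
  have "current_bracket bracket (monom X m) (monom Y n) =
      (\<Sum>i\<le>m. \<Sum>j\<le>n. if j = n then if i = m then monom (bracket X Y) (m + n) else 0 else 0)"
    unfolding current_bracket_bound[OF degree_monom_le degree_monom_le]
    by (intro sum.cong) (auto simp: bracket_zero_left bracket_zero_right)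
  then show ?thesis by simp
qed

lemma current_bracket_add_left:
  "current_bracket bracket (p + q) r = current_bracket bracket p r + current_bracket bracket q r"
proof -
  define m where "m = max (degree p) (degree q)"
  have "degree (p + q) \<le> m" "degree p \<le> m" "degree q \<le> m"
    by (auto simp: m_def degree_add_le_max)
  then show ?thesis
    by (simp add: current_bracket_bound[of _ m _ "degree r"] bracket_add_left
        flip: add_monom sum.distrib)
qed

lemma current_bracket_antisym:
  "current_bracket bracket q p = - current_bracket bracket p q"
proof -
  have "current_bracket bracket q p =
      (\<Sum>j\<le>degree p. \<Sum>i\<le>degree q. monom (bracket (coeff q i) (coeff p j)) (i + j))"
    unfolding current_bracket_def by (rule sum.swap)
  also have "\<dots> = (\<Sum>j\<le>degree p. \<Sum>i\<le>degree q. - monom (bracket (coeff p j) (coeff q i)) (j + i))"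
    by (intro sum.cong refl) (metis add.commute bracket_antisym minus_monom)
  also have "\<dots> = - current_bracket bracket p q"
    by (simp add: current_bracket_def sum_negf)
  finally show ?thesis .
qed

lemma current_bracket_add_right:
  "current_bracket bracket r (p + q) = current_bracket bracket r p + current_bracket bracket r q"
  by (simp add: current_bracket_antisym[of r] current_bracket_add_left)

lemma current_vector_space: "vector_space (current_scale scale)"
  by unfold_locales (auto intro!: poly_eqI simp: coeff_current_scale algebra_simps)

lemma current_scale_monom: "current_scale scale c (monom x n) = monom (scale c x) n"
  by (auto intro!: poly_eqI simp: coeff_current_scale)

lemma current_scale_sum: "current_scale scale c (sum f A) = (\<Sum>x\<in>A. current_scale scale c (f x))"
  by (rule poly_eqI) (simp add: coeff_current_scale coeff_sum scale_sum_right)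

lemma current_bracket_scale_left:
  "current_bracket bracket (current_scale scale c p) q =
     current_scale scale c (current_bracket bracket p q)"
proof -
  have "degree (current_scale scale c p) \<le> degree p"
    by (rule degree_le) (simp add: coeff_current_scale coeff_eq_0)
  then show ?thesis
    by (simp add: current_bracket_bound[of _ "degree p" _ "degree q"] current_scale_sum
        current_scale_monom coeff_current_scale bracket_scale_left)
qed

lemma poly_additive_eq_0:
  fixes f :: "'g poly \<Rightarrow> 'g poly"
  assumes "\<And>p q. f (p + q) = f p + f q" "\<And>a n. f (monom a n) = 0"
  shows "f p = 0"
proof -
  have 0: "f 0 = 0" using assms(1)[of 0 0] by simp
  have "f (\<Sum>i\<le>n. monom (coeff p i) i) = 0" for n
    by (induction n) (simp_all add: assms)
  then show ?thesis using poly_as_sum_of_monoms[of p] by metis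
qed

lemma current_jacobi:
  fixes p q r :: "'g poly"
  defines "B \<equiv> current_bracket bracket"
  shows "B p (B q r) + B q (B r p) + B r (B p q) = 0"
proof (rule poly_additive_eq_0[where f = "\<lambda>p. B p (B q r) + B q (B r p) + B r (B p q)"],
    goal_cases)
  case (2 a k)
  show ?case
  proof (rule poly_additive_eq_0[where f = "\<lambda>q. B (monom a k) (B q r) + B q (B r (monom a k)) +
        B r (B (monom a k) q)"], goal_cases)
    case (2 b l)
    show ?case
    proof (rule poly_additive_eq_0[where f = "\<lambda>r. B (monom a k) (B (monom b l) r) +
          B (monom b l) (B r (monom a k)) + B r (B (monom a k) (monom b l))"], goal_cases)
      case (2 c m)
      show ?case
        unfolding B_def using jacobi[of a b c]
        by (simp add: current_bracket_monom ac_simps add_monom)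
    qed (simp add: B_def current_bracket_add_left current_bracket_add_right)
  qed (simp add: B_def current_bracket_add_left current_bracket_add_right)
qed (simp add: B_def current_bracket_add_left current_bracket_add_right)

lemma current_lie_algebra: "lie_algebra (current_scale scale) (current_bracket bracket)"
proof -
  interpret C: vector_space "current_scale scale" by (rule current_vector_space)
  show ?thesis
  proof (unfold_locales, goal_cases)
    case (4 x c y)
    then show ?case
      by (metis current_bracket_antisym current_bracket_scale_left C.scale_minus_right)
  next
    case (5 x)
    have "current_bracket bracket x x + current_bracket bracket x x = 0"
      using current_bracket_antisym[of x x] by (metis add.right_inverse)
    then have "current_scale scale 2 (current_bracket bracket x x) = 0"
      using C.scale_left_distrib[of 1 1 "current_bracket bracket x x"] by simp
    then show ?case by simp
  qed (simp_all add: current_bracket_add_left current_bracket_add_right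
      current_bracket_scale_left current_jacobi)
qed

end


section \<open>Root data relative to a Cartan and a Borel subalgebra\<close>

locale simple_lie_algebra = lie_algebra scale bracket
  for scale :: "complex \<Rightarrow> 'g::ab_group_add \<Rightarrow> 'g"
    and bracket :: "'g \<Rightarrow> 'g \<Rightarrow> 'g" +
  fixes h b :: "'g set"
  assumes finite_dimensional: "finite_dimensional"
    and simple: "simple"
    and cartan: "cartan_subalgebra h"
    and borel: "borel_subalgebra b"
    and cartan_subset_borel: "h \<subseteq> b"
begin

text \<open>Functionals on \<open>h\<close> are functions that vanish outside \<open>h\<close>, so that equality of
  functionals is equality of functions.\<close>

definition dual :: "('g \<Rightarrow> complex) set" where
  "dual = {f. (\<forall>x\<in>h. \<forall>y\<in>h. f (x + y) = f x + f y) \<and>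
              (\<forall>c. \<forall>x\<in>h. f (scale c x) = c * f x) \<and> (\<forall>x. x \<notin> h \<longrightarrow> f x = 0)}"

definition root_space :: "('g \<Rightarrow> complex) \<Rightarrow> 'g set" where
  "root_space \<alpha> = {x. \<forall>H\<in>h. bracket H x = scale (\<alpha> H) x}"

definition roots :: "('g \<Rightarrow> complex) set" where
  "roots = {\<alpha> \<in> dual. \<alpha> \<noteq> (\<lambda>_. 0) \<and> root_space \<alpha> \<noteq> {0}}"

definition positive_roots :: "('g \<Rightarrow> complex) set" where
  "positive_roots = {\<alpha> \<in> roots. root_space \<alpha> \<subseteq> b}"

definition simple_roots :: "('g \<Rightarrow> complex) set" where
  "simple_roots = {\<alpha> \<in> positive_roots.
     \<not> (\<exists>\<beta>\<in>positive_roots. \<exists>\<gamma>\<in>positive_roots. \<alpha> = (\<lambda>x. \<beta> x + \<gamma> x))}"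

definition nplus :: "'g set" where
  "nplus = span (\<Union>\<alpha>\<in>positive_roots. root_space \<alpha>)"

definition coroot :: "('g \<Rightarrow> complex) \<Rightarrow> 'g" where
  "coroot \<alpha> = (THE H. H \<in> bracket_span (root_space \<alpha>) (root_space (\<lambda>x. - \<alpha> x)) \<and> \<alpha> H = 2)"

definition reflection :: "('g \<Rightarrow> complex) \<Rightarrow> ('g \<Rightarrow> complex) \<Rightarrow> 'g \<Rightarrow> complex" where
  "reflection \<alpha> \<mu> = (\<lambda>x. \<mu> x - \<mu> (coroot \<alpha>) * \<alpha> x)"

text \<open>The Dynkin diagram has only simple edges.\<close>

definition simply_laced :: bool where
  "simply_laced \<longleftrightarrow>
     (\<forall>\<alpha>\<in>simple_roots. \<forall>\<beta>\<in>simple_roots. \<alpha> \<noteq> \<beta> \<longrightarrow> \<alpha> (coroot \<beta>) \<in> {0, -1})"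

text \<open>Symmetric bilinear forms on the dual of \<open>h\<close> that are invariant under the Weyl group,
  with all roots of square length 2. In simply laced type all roots are long, so this is the
  usual normalization and there is exactly one such form on \<open>dual\<close>; values at functions
  outside \<open>dual\<close> are unconstrained.\<close>

definition normalized_invariant_form ::
    "(('g \<Rightarrow> complex) \<Rightarrow> ('g \<Rightarrow> complex) \<Rightarrow> complex) \<Rightarrow> bool" where
  "normalized_invariant_form form \<longleftrightarrow>
     (\<forall>\<mu>\<in>dual. \<forall>\<nu>\<in>dual. form \<mu> \<nu> = form \<nu> \<mu>) \<and>
     (\<forall>\<mu>\<in>dual. \<forall>\<mu>'\<in>dual. \<forall>\<nu>\<in>dual. form (\<lambda>x. \<mu> x + \<mu>' x) \<nu> = form \<mu> \<nu> + form \<mu>' \<nu>) \<and>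
     (\<forall>c. \<forall>\<mu>\<in>dual. \<forall>\<nu>\<in>dual. form (\<lambda>x. c * \<mu> x) \<nu> = c * form \<mu> \<nu>) \<and>
     (\<forall>\<alpha>\<in>roots. \<forall>\<mu>\<in>dual. \<forall>\<nu>\<in>dual. form (reflection \<alpha> \<mu>) (reflection \<alpha> \<nu>) = form \<mu> \<nu>) \<and>
     (\<forall>\<alpha>\<in>roots. form \<alpha> \<alpha> = 2)"

definition dominant_integral :: "('g \<Rightarrow> complex) \<Rightarrow> bool" where
  "dominant_integral \<mu> \<longleftrightarrow>
     \<mu> \<in> dual \<and> (\<forall>\<alpha>\<in>simple_roots. \<exists>n::nat. \<mu> (coroot \<alpha>) = of_nat n)"

definition weight_space ::
    "(complex \<Rightarrow> 'v::ab_group_add \<Rightarrow> 'v) \<Rightarrow> ('g \<Rightarrow> 'v \<Rightarrow> 'v) \<Rightarrow> ('g \<Rightarrow> complex) \<Rightarrow> 'v set" where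
  "weight_space scaleV act \<mu> = {v. \<forall>H\<in>h. act H v = scaleV (\<mu> H) v}"

definition weights ::
    "(complex \<Rightarrow> 'v::ab_group_add \<Rightarrow> 'v) \<Rightarrow> ('g \<Rightarrow> 'v \<Rightarrow> 'v) \<Rightarrow> ('g \<Rightarrow> complex) set" where
  "weights scaleV act = {\<mu> \<in> dual. weight_space scaleV act \<mu> \<noteq> {0}}"

text \<open>The module is (a realization of) \<open>V(\<lambda>)\<close>.\<close>

definition irreducible_highest_weight_module ::
    "(complex \<Rightarrow> 'v::ab_group_add \<Rightarrow> 'v) \<Rightarrow> ('g \<Rightarrow> 'v \<Rightarrow> 'v) \<Rightarrow> ('g \<Rightarrow> complex) \<Rightarrow> bool" where
  "irreducible_highest_weight_module scaleV act lam \<longleftrightarrow>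
     lie_module scale bracket scaleV act \<and>
     lie_module.irreducible_module scaleV act \<and>
     (\<exists>v. v \<noteq> 0 \<and> v \<in> weight_space scaleV act lam \<and> (\<forall>x\<in>nplus. act x v = 0))"

end


section \<open>Modules over the current algebra given by generators and relations\<close>

text \<open>The tensor algebra of \<open>\<gg>[t]\<close> and all its quotients are quotients of the free complex
  vector space on words in elements of \<open>\<gg>[t]\<close>, with concatenation as product. The word
  \<open>[x\<^sub>1, \<dots>, x\<^sub>r]\<close> stands for the product \<open>x\<^sub>1 \<cdots> x\<^sub>r\<close> in the enveloping algebra.\<close>

definition free_scale :: "complex \<Rightarrow> ('w \<Rightarrow>\<^sub>0 complex) \<Rightarrow> ('w \<Rightarrow>\<^sub>0 complex)" where
  "free_scale c p = Poly_Mapping.map ((*) c) p"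

lemma lookup_free_scale: "Poly_Mapping.lookup (free_scale c p) k = c * Poly_Mapping.lookup p k"
  by (simp add: free_scale_def map.rep_eq when_def)

lemma free_vector_space: "vector_space free_scale"
  by unfold_locales
    (auto intro!: poly_mapping_eqI simp: lookup_free_scale Poly_Mapping.lookup_add algebra_simps)

abbreviation word :: "'a list \<Rightarrow> ('a list \<Rightarrow>\<^sub>0 complex)" where
  "word xs \<equiv> Poly_Mapping.single xs 1"

definition apply_word :: "('a \<Rightarrow> 'v \<Rightarrow> 'v) \<Rightarrow> 'a list \<Rightarrow> 'v \<Rightarrow> 'v" where
  "apply_word act xs v = foldr act xs v"

definition evaluate :: "(complex \<Rightarrow> 'v::ab_group_add \<Rightarrow> 'v) \<Rightarrow> ('a \<Rightarrow> 'v \<Rightarrow> 'v) \<Rightarrow> 'v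
    \<Rightarrow> ('a list \<Rightarrow>\<^sub>0 complex) \<Rightarrow> 'v" where
  "evaluate scaleV act v p =
     (\<Sum>xs\<in>Poly_Mapping.keys p. scaleV (Poly_Mapping.lookup p xs) (apply_word act xs v))"

context lie_algebra
begin

text \<open>Their span is the kernel of the projection from the free vector space on words to
  \<open>U(\<gg>[t])\<close>.\<close>

definition enveloping_relations :: "('g poly list \<Rightarrow>\<^sub>0 complex) set" where
  "enveloping_relations =
     {word (as @ [x + y] @ bs) - word (as @ [x] @ bs) - word (as @ [y] @ bs) | as bs x y. True} \<union>
     {word (as @ [current_scale scale c x] @ bs) - free_scale c (word (as @ [x] @ bs))
        | as bs c x. True} \<union>
     {word (as @ [x, y] @ bs) - word (as @ [y, x] @ bs)
        - word (as @ [current_bracket bracket x y] @ bs) | as bs x y. True}"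

end

context simple_lie_algebra
begin

text \<open>The prefix \<open>as\<close> turns the defining relations into generators of a left ideal. The four sets
  express \<open>(\<nn>\<^sup>+ \<otimes> \<complex>[t])u = 0\<close>, \<open>(\<hh> \<otimes> t\<complex>[t])u = 0\<close>, \<open>Hu = \<langle>\<lambda>,H\<rangle>u\<close>
  and \<open>\<gg>\<^sub>-\<^sub>\<alpha>\<^sup>n\<^sup>+\<^sup>1 u = 0\<close> with \<open>n = \<langle>\<lambda>,\<alpha>\<^sup>\<or>\<rangle>\<close>.\<close>

definition local_weyl_relations :: "('g \<Rightarrow> complex) \<Rightarrow> ('g poly list \<Rightarrow>\<^sub>0 complex) set" where
  "local_weyl_relations lam =
     {word (as @ [x]) | as x. \<forall>i. coeff x i \<in> nplus} \<union>
     {word (as @ [x]) | as x. coeff x 0 = 0 \<and> (\<forall>i. coeff x i \<in> h)} \<union>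
     {word (as @ [monom H 0]) - free_scale (lam H) (word as) | as H. H \<in> h} \<union>
     {word (as @ map (\<lambda>Y. monom Y 0) Ys) | as Ys \<alpha> n.
        \<alpha> \<in> simple_roots \<and> lam (coroot \<alpha>) = of_nat n \<and>
        length Ys = n + 1 \<and> set Ys \<subseteq> root_space (\<lambda>x. - \<alpha> x)}"

text \<open>The module is (a realization of) \<open>W(\<lambda>)\<close>: it is generated by \<open>u\<close>, and the
  relations satisfied by \<open>u\<close> are exactly the consequences of the defining ones.\<close>

definition local_weyl_module ::
    "(complex \<Rightarrow> 'v::ab_group_add \<Rightarrow> 'v) \<Rightarrow> ('g poly \<Rightarrow> 'v \<Rightarrow> 'v) \<Rightarrow> 'v
      \<Rightarrow> ('g \<Rightarrow> complex) \<Rightarrow> bool" where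
  "local_weyl_module scaleV act u lam \<longleftrightarrow>
     lie_module (current_scale scale) (current_bracket bracket) scaleV act \<and>
     range (evaluate scaleV act u) = UNIV \<and>
     {p. evaluate scaleV act u p = 0} =
       module.span free_scale (enveloping_relations \<union> local_weyl_relations lam)"

end

text \<open>The grading by degree in \<open>t\<close> on a module generated by \<open>u\<close>, with \<open>u\<close> in grade 0.\<close>

definition graded_piece :: "(complex \<Rightarrow> 'v::ab_group_add \<Rightarrow> 'v)
    \<Rightarrow> ('g::ab_group_add poly \<Rightarrow> 'v \<Rightarrow> 'v) \<Rightarrow> 'v \<Rightarrow> nat \<Rightarrow> 'v set" where
  "graded_piece scaleV act u k =
     module.span scaleV {apply_word act (map (\<lambda>(X, n). monom X n) ys) u
       | ys. sum_list (map snd ys) = k}"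

context simple_lie_algebra
begin

definition graded_weight_space ::
    "(complex \<Rightarrow> 'v::ab_group_add \<Rightarrow> 'v) \<Rightarrow> ('g poly \<Rightarrow> 'v \<Rightarrow> 'v) \<Rightarrow> 'v
      \<Rightarrow> ('g \<Rightarrow> complex) \<Rightarrow> nat \<Rightarrow> 'v set" where
  "graded_weight_space scaleV act u \<mu> k =
     weight_space scaleV (\<lambda>X. act (monom X 0)) \<mu> \<inter> graded_piece scaleV act u k"

end

end

theory Submission
 imports Defs "HOL-Library.Function_Algebras" "HOL-Library.Nat_Bijection"
  "HOL-Computational_Algebra.Fundamental_Theorem_Algebra"
begin

text \<open>Let the excess of a vector of weight \<open>\<nu>\<close> and degree \<open>N\<close> be \<open>- (\<nu>|\<nu>)/2 - N\<close>. It is invariant under the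
  reflections in real affine roots \<open>(\<alpha>, n)\<close>, and the operators \<open>e \<otimes> t\<^sup>n\<close> with \<open>e \<in> \<gg>\<^sub>\<alpha>\<close> map a weight space
  injectively to the reflected one when the corresponding \<open>sl\<^sub>2\<close> acts locally nilpotently. The claim is that
  the excess on \<open>W(\<lambda>)\<close> is at least that of \<open>u\<close>, with multiplicity at most one when equality holds, and that for
  every weight of \<open>V(\<lambda>)\<close> equality is attained.

  Attained: the vacuum module of level one of the affine Lie algebra, twisted by the translation of \<open>\<lambda>\<close>, carries a
  vector that satisfies the relations of \<open>W(\<lambda>)\<close>. In it, vectors of minimal excess can be moved down from
  \<open>\<lambda>\<close> along the weights of \<open>V(\<lambda>)\<close> without vanishing. The vacuum module is realized as functionals on words
  in the letters \<open>x \<otimes> t\<^sup>n\<close>, with \<open>vac\<close> the vacuum expectation value.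

  Bounded: for a cyclic module over the Iwahori subalgebra whose generator is killed by the power of each real root
  vector that its weight prescribes, the bound follows by coinduction along an affine simple root: the coinduced
  module contains a vector of the reflected weight that satisfies the relations prescribed there, and the reflection
  decreases a well-founded measure of the weight. The bound passes from the
  Iwahori subalgebra to the current algebra by induction on the height of the weight, again by the reflections.\<close>

section \<open>Traces on subspaces\<close>

text \<open>Cartan and Borel subalgebras are given abstractly, as a nilpotent self-normalizing and
  as a maximal solvable subalgebra. Root theory is therefore extracted from one principle: a
  commutator has trace zero on every subspace that both factors preserve. Level one is the right
  level for two reasons. The square of \<open>x\<close> at degree -1 kills the vacuum exactly when
  the central element acts as 1, in the normalization in which roots have square length 2. And a
  root lattice of this kind has no nonzero element that pairs to at most 1 with every root, so
  reflections lead every weight of the vacuum module back to 0. For the upper bound, the relations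
  of \<open>W\<close> are known at one weight only, while an induction over reflections has to
  change the weight. Coinduction supplies a vector of the reflected weight in a larger module,
  whatever \<open>W\<close> contains. The induction stops at weights that pair nonnegatively with
  all real roots of the Iwahori subalgebra; there the generator spans the module. Each coinduction
  turns vectors into sequences of vectors, which is why modules on sequence types appear throughout
  that part.\<close>

context finite_dimensional_vector_space
begin

abbreviation lin :: "('b => 'b) => bool" where
 "lin == Vector_Spaces.linear scale scale"

lemma lin_iff: "lin f \<longleftrightarrow> (\<forall>x y. f (x + y) = f x + f y) & (\<forall>c x. f (scale c x) = scale c (f x))"
 by (simp add: Vector_Spaces.linear_iff vector_space_axioms)

text \<open>The trace of the restriction of \<open>f\<close> to \<open>S\<close>, for a linear
  \<open>f\<close> that preserves \<open>S\<close>; the chosen basis is then immaterial by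
  \<open>trace_basis_change\<close>.\<close>

definition tr :: "'b set => ('b => 'b) => 'a" where
 "tr S f = (let B = (SOME B. independent B & span B = S)
   in \<Sum>b\<in>B. representation B (f b) b)"

lemma subspace_basis:
 assumes "subspace S"
 obtains B where "independent B" "span B = S" "finite B" "B <= S"
proof -
 obtain B where B: "B <= S" "independent B" "S <= span B" using basis_exists[of S] by metis
 have "span B = S" by (rule span_subspace[OF B(1,3) assms])
 thus ?thesis using that[OF B(2) _ finiteI_independent[OF B(2)] B(1)] by simp
qed

lemma sum_rep: "independent B ==> v \<in> span B ==> (\<Sum>b\<in>B. scale (representation B v b) b) = v"
 by (rule sum_representation_eq) (auto simp: finiteI_independent)

lemma rep_linear_comb:
 assumes B: "independent B" and v: "!!i. i \<in> I ==> v i \<in> span B"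
 shows "representation B (\<Sum>i\<in>I. scale (c i) (v i)) b = (\<Sum>i\<in>I. c i * representation B (v i) b)"
proof -
 have "representation B (\<Sum>i\<in>I. scale (c i) (v i)) =
   (%b. \<Sum>i\<in>I. representation B (scale (c i) (v i)) b)" by (rule representation_sum) (auto simp: B v span_scale)
 thus ?thesis using B v by (simp add: representation_scale)
qed

lemma lin_comb: "lin f ==> f (\<Sum>i\<in>I. scale (c i) (v i)) = (\<Sum>i\<in>I. scale (c i) (f (v i)))"
 by (simp add: Vector_Spaces.linear_iff_module_hom module_hom.sum module_hom.scale)

text \<open>Both sides equal the double sum of
  \<open>representation B (f c) b * representation C b c\<close> over \<open>b\<close> and
  \<open>c\<close>.\<close>

lemma trace_basis_change:
 assumes B: "independent B" and C: "independent C" and BC: "span B = span C"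
  and f: "lin f" and fS: "!!x. x \<in> span B ==> f x \<in> span B"
 shows "(\<Sum>b\<in>B. representation B (f b) b) = (\<Sum>c\<in>C. representation C (f c) c)"
proof -
 have "representation B (f b) b = (\<Sum>c\<in>C. representation C b c * representation B (f c) b)"
  if b: "b \<in> B" for b
 proof -
  have "f b = f (\<Sum>c\<in>C. scale (representation C b c) c)" using sum_rep[OF C] b BC span_base by metis
  also have "\<dots> = (\<Sum>c\<in>C. scale (representation C b c) (f c))" by (rule lin_comb[OF f])
  finally show ?thesis using rep_linear_comb[OF B, of C f] fS BC span_base by metis
 qed
 hence "(\<Sum>b\<in>B. representation B (f b) b) =
   (\<Sum>c\<in>C. \<Sum>b\<in>B. representation B (f c) b * representation C b c)" by (subst sum.swap) (simp add: mult.commute)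
 also have "\<dots> = (\<Sum>c\<in>C. representation C (f c) c)"
 proof (rule sum.cong[OF refl])
  fix c assume "c \<in> C"
  hence "f c = (\<Sum>b\<in>B. scale (representation B (f c) b) b)" using sum_rep[OF B, of "f c"] fS BC span_base by metis
  thus "(\<Sum>b\<in>B. representation B (f c) b * representation C b c) = representation C (f c) c"
   using rep_linear_comb[OF C, of B "%b. b"] BC span_base by metis
 qed
 finally show ?thesis .
qed

lemma tr_eq:
 assumes B: "independent B" "span B = S" and f: "lin f" and fS: "!!x. x \<in> S ==> f x \<in> S"
 shows "tr S f = (\<Sum>b\<in>B. representation B (f b) b)"
proof -
 define C where "C = (SOME B. independent B & span B = S)"
 have C: "independent C & span C = S" unfolding C_def by (rule someI[of _ B]) (use B in auto)
 have "(\<Sum>b\<in>C. representation C (f b) b) = (\<Sum>b\<in>B. representation B (f b) b)"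
  by (rule trace_basis_change) (use B C f fS in auto)
 thus ?thesis by (simp add: tr_def C_def[symmetric])
qed

lemma tr_add:
 assumes "subspace S" "lin f" "lin g" "!!x. x \<in> S ==> f x \<in> S" "!!x. x \<in> S ==> g x \<in> S"
 shows "tr S (%x. f x + g x) = tr S f + tr S g"
proof -
 obtain B where B: "independent B" "span B = S" "B <= S" using subspace_basis[OF assms(1)] by blast
 have l: "lin (%x. f x + g x)" using assms(2,3) by (simp add: lin_iff algebra_simps)
 have *: "f b \<in> span B" "g b \<in> span B" if "b \<in> B" for b using that assms B by auto
 have "tr S (%x. f x + g x) = (\<Sum>b\<in>B. representation B (f b + g b) b)" by (rule tr_eq[OF B(1,2) l]) (simp add: assms subspace_add)
 also have "\<dots> = (\<Sum>b\<in>B. representation B (f b) b) + (\<Sum>b\<in>B. representation B (g b) b)"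
  using * by (simp add: representation_add[OF B(1)] sum.distrib)
 finally show ?thesis using tr_eq[OF B(1,2)] assms by simp
qed

lemma tr_scale:
 assumes "subspace S" "lin f" "!!x. x \<in> S ==> f x \<in> S"
 shows "tr S (%x. scale c (f x)) = c * tr S f"
proof -
 obtain B where B: "independent B" "span B = S" "B <= S" using subspace_basis[OF assms(1)] by blast
 have l: "lin (%x. scale c (f x))" using assms(2) by (simp add: lin_iff algebra_simps)
 have *: "f b \<in> span B" if "b \<in> B" for b using that assms B by auto
 have "tr S (%x. scale c (f x)) = (\<Sum>b\<in>B. representation B (scale c (f b)) b)"
  by (rule tr_eq[OF B(1,2) l]) (simp add: assms subspace_scale)
 also have "\<dots> = c * (\<Sum>b\<in>B. representation B (f b) b)" using * by (simp add: representation_scale[OF B(1)] sum_distrib_left)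
 finally show ?thesis using tr_eq[OF B(1,2)] assms by simp
qed

lemma lin_compose: "lin f ==> lin g ==> lin (%x. f (g x))" by (simp add: lin_iff)

lemma tr_commute:
 assumes S: "subspace S" and fg: "lin f" "lin g" "!!x. x \<in> S ==> f x \<in> S" "!!x. x \<in> S ==> g x \<in> S"
 shows "tr S (%x. f (g x)) = tr S (%x. g (f x))"
proof -
 obtain B where B: "independent B" "span B = S" "B <= S" using subspace_basis[OF S] by blast
 have *: "tr S (%x. f (g x)) =
   (\<Sum>b\<in>B. \<Sum>c\<in>B. representation B (g b) c * representation B (f c) b)"
  if fg: "lin f" "lin g" "!!x. x \<in> S ==> f x \<in> S" "!!x. x \<in> S ==> g x \<in> S" for f g
 proof -
  have "representation B (f (g b)) b = (\<Sum>c\<in>B. representation B (g b) c * representation B (f c) b)"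
   if b: "b \<in> B" for b
  proof -
   have "g b \<in> span B" using b B fg by auto
   hence "f (g b) = f (\<Sum>c\<in>B. scale (representation B (g b) c) c)" using sum_rep[OF B(1), of "g b"] by simp
   also have "\<dots> = (\<Sum>c\<in>B. scale (representation B (g b) c) (f c))" by (rule lin_comb[OF fg(1)])
   finally show ?thesis using rep_linear_comb[OF B(1), of B f] fg B(2,3) by (metis subsetD)
  qed
  thus ?thesis using fg by (subst tr_eq[OF B(1,2)]) (auto simp: lin_compose)
 qed
 show ?thesis unfolding *[OF fg, simplified] *[OF fg(2) fg(1) fg(4) fg(3), simplified] by (subst sum.swap) (simp add: mult.commute)
qed

lemma tr_commutator:
 assumes S: "subspace S" and fg: "lin f" "lin g" "!!x. x \<in> S ==> f x \<in> S" "!!x. x \<in> S ==> g x \<in> S"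
 shows "tr S (%x. f (g x) - g (f x)) = 0"
proof -
 have "tr S (%x. f (g x) - g (f x)) = tr S (%x. f (g x) + scale (-1) (g (f x)))" by simp
 also have "\<dots> = tr S (%x. f (g x)) + tr S (%x. scale (-1) (g (f x)))"
  by (rule tr_add[OF S]) (use fg in "simp_all add: lin_iff algebra_simps subspace_neg[OF S]")
 also have "tr S (%x. scale (-1) (g (f x))) = -1 * tr S (%x. g (f x))" by (rule tr_scale[OF S]) (use fg in "simp_all add: lin_iff")
 finally show ?thesis using tr_commute[OF assms] by simp
qed

text \<open>Extend a basis of \<open>T\<close> to one of \<open>S\<close>: the added vectors are
  mapped into the span of the old ones and contribute no diagonal entry.\<close>

lemma tr_restrict:
 assumes S: "subspace S" and T: "subspace T" "T <= S" and f: "lin f" "!!x. x \<in> S ==> f x \<in> T"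
 shows "tr S f = tr T f"
proof -
 obtain B where B: "independent B" "span B = T" "finite B" "B <= T" using subspace_basis[OF T(1)] by blast
 obtain C where C: "B <= C" "C <= S" "independent C" "S <= span C" using maximal_independent_subset_extend[of B S] B T by blast
 have sC: "span C = S" using C S span_subspace by blast
 have fC: "finite C" using C(3) finiteI_independent by blast
 have "tr S f = (\<Sum>b\<in>C. representation C (f b) b)" using tr_eq[OF C(3) sC f(1)] f(2) T(2) by blast
 also have "\<dots> = (\<Sum>b\<in>C. representation B (f b) b)"
  by (rule sum.cong[OF refl], subst representation_extend[OF C(3) _ C(1)]) (use f(2) C(2) B(2) in auto)
 also have "\<dots> = (\<Sum>b\<in>B. representation B (f b) b)"
  using C fC by (intro sum.mono_neutral_right) (auto dest: representation_ne_zero)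
 also have "\<dots> = tr T f" by (rule tr_eq[OF B(1,2) f(1), symmetric]) (use f(2) T(2) in auto)
 finally show ?thesis .
qed

lemma tr_0: "lin f ==> tr {0} f = 0" using tr_eq[of "{}" "{0}" f]
 by (simp add: independent_empty Vector_Spaces.linear_iff_module_hom module_hom.zero)

section \<open>Traces of nilpotent operators and traces over direct sums\<close>

lemma nilpotent_uniform:
 assumes S: "subspace S" and f: "lin f" and nil: "!!x. x \<in> S ==> \<exists>n. (f ^^ n) x = 0"
 shows "\<exists>n. \<forall>x\<in>S. (f ^^ n) x = 0"
proof -
 obtain B where B: "independent B" "span B = S" "finite B" "B <= S" using subspace_basis[OF S] by blast
 obtain n where n: "!!b. b \<in> B ==> (f ^^ n b) b = 0" using nil B by (metis subsetD)
 have f0: "f 0 = 0" using f by (simp add: Vector_Spaces.linear_iff_module_hom module_hom.zero)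
 have f0': "(f ^^ k) 0 = 0" for k by (induction k) (auto simp: f0)
 have ln: "lin (f ^^ k)" for k by (induction k) (use f in "auto simp: lin_iff")
 define N where "N = sum n B"
 have "(f ^^ N) b = 0" if "b \<in> B" for b
 proof -
  have "n b \<le> N" unfolding N_def using B(3) that by (simp add: member_le_sum)
  hence "(f ^^ N) b = (f ^^ (N - n b)) ((f ^^ n b) b)" by (metis add.commute comp_apply funpow_add le_add_diff_inverse)
  thus ?thesis using n[OF that] f0' by simp
 qed
 hence "(f ^^ N) x = 0" if "x \<in> span B" for x
  using module_hom.eq_0_on_span[OF ln[of N, unfolded Vector_Spaces.linear_iff_module_hom] _ that] by simp
 thus ?thesis using B(2) by auto
qed

text \<open>The images of \<open>S\<close> under the powers of \<open>f\<close> shrink to zero, and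
  \<open>tr_restrict\<close> carries the trace unchanged from each to the next.\<close>

lemma tr_nilpotent:
 assumes S: "subspace S" and f: "lin f" and fS: "!!x. x \<in> S ==> f x \<in> S"
  and nil: "!!x. x \<in> S ==> \<exists>n. (f ^^ n) x = 0"
 shows "tr S f = 0"
proof -
 obtain n where n: "\<forall>x\<in>S. (f ^^ n) x = 0" using nilpotent_uniform[OF S f nil] by blast
 have st: "x \<in> S ==> (f ^^ k) x \<in> S" for k x by (induction k) (auto simp: fS)
 have ln: "lin (f ^^ k)" for k by (induction k) (use f in "auto simp: lin_iff")
 have sub: "subspace ((f ^^ k) ` S)" for k using ln[of k] S by (simp add: Vector_Spaces.linear_iff_module_hom module_hom.subspace_image)
 have mono: "(f ^^ Suc k) ` S <= (f ^^ k) ` S" for k using fS by (auto simp: funpow_swap1)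
 have "tr S f = tr ((f ^^ k) ` S) f" for k
 proof (induction k)
  case (Suc k)
  have "tr ((f ^^ k) ` S) f = tr ((f ^^ Suc k) ` S) f" by (rule tr_restrict[OF sub sub mono f]) (auto simp: funpow_swap1)
  thus ?case using Suc by simp
 qed simp
 from this[of n] have "tr S f = tr ((f ^^ n) ` S) f" .
 also have "(f ^^ n) ` S = {0}" using n subspace_0[OF S] by force
 finally show ?thesis using tr_0[OF f] by simp
qed

lemma tr_id: "subspace S ==> tr S (%x. x) = of_nat (dim S)"
proof -
 assume S: "subspace S"
 obtain B where B: "independent B" "span B = S" "finite B" using subspace_basis[OF S] by blast
 have "tr S (%x. x) = (\<Sum>b\<in>B. representation B b b)" by (rule tr_eq[OF B(1,2)]) (simp_all add: lin_iff)
 also have "\<dots> = (\<Sum>b\<in>B. 1)" by (rule sum.cong) (use B in "auto simp: representation_basis")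
 also have "\<dots> = of_nat (dim S)" using dim_span_eq_card_independent[OF B(1)] B(2) by simp
 finally show ?thesis .
qed

lemma tr_generalized_eigen:
 assumes S: "subspace S" and f: "lin f" and fS: "!!x. x \<in> S ==> f x \<in> S"
  and nil: "!!x. x \<in> S ==> \<exists>n. ((%y. f y - scale c y) ^^ n) x = 0"
 shows "tr S f = of_nat (dim S) * c"
proof -
 have "tr S f = tr S (%x. (f x - scale c x) + scale c x)" by simp
 also have "\<dots> = tr S (%x. f x - scale c x) + tr S (%x. scale c x)" by (rule tr_add[OF S])
   (use f in "simp_all add: lin_iff algebra_simps fS subspace_diff[OF S] subspace_scale[OF S]")
 also have "tr S (%x. f x - scale c x) = 0" by (rule tr_nilpotent[OF S])
   (use f nil in "simp_all add: lin_iff algebra_simps fS subspace_diff[OF S] subspace_scale[OF S]")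
 also have "tr S (%x. scale c x) = c * tr S (%x. x)" by (rule tr_scale[OF S]) (simp_all add: lin_iff)
 finally show ?thesis using tr_id[OF S] by (simp add: mult.commute)
qed

lemma tr_direct_sum:
 assumes S: "subspace S" "subspace T" "S \<inter> T = {0}"
  and f: "lin f" "!!x. x \<in> S ==> f x \<in> S" "!!x. x \<in> T ==> f x \<in> T"
 shows "tr {x + y | x y. x \<in> S & y \<in> T} f = tr S f + tr T f"
proof -
 obtain B where B: "independent B" "span B = S" "finite B" "B <= S" using subspace_basis[OF S(1)] by blast
 obtain C where C: "independent C" "span C = T" "finite C" "C <= T" using subspace_basis[OF S(2)] by blast
 have disj: "B \<inter> C = {}"
 proof -
  have "B \<inter> C <= {0}" using B(4) C(4) S(3) by auto
  thus ?thesis using dependent_zero[of B] B(1) by auto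
 qed
 have sp: "span (B \<union> C) = {x + y | x y. x \<in> S & y \<in> T}" using B C by (simp add: span_Un)
 have dims: "dim {x + y | x y. x \<in> S & y \<in> T} = dim S + dim T" using dim_sums_Int[OF S(1,2)] S(3) by simp
 have "dim S = card B" "dim T = card C" using dim_span_eq_card_independent[OF B(1)] dim_span_eq_card_independent[OF C(1)] B(2) C(2)
  by simp_all
 \<comment> \<open>A finite set with no more elements than the dimension of its span is
   independent.\<close>
 hence "card (B \<union> C) \<le> dim (span (B \<union> C))" using dims sp card_Un_disjoint[OF B(3) C(3) disj] by simp
 hence ind: "independent (B \<union> C)" by (intro card_le_dim_spanning[OF span_superset]) (simp_all add: B(3) C(3))
 have fx: "f x \<in> {x + y | x y. x \<in> S & y \<in> T}" if "x \<in> {x + y | x y. x \<in> S & y \<in> T}" for x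
 proof -
  from that obtain a b where ab: "x = a + b" "a \<in> S" "b \<in> T" by auto
  hence "f x = f a + f b" using f(1) by (simp add: lin_iff)
  thus ?thesis using ab f by blast
 qed
 have "tr {x + y | x y. x \<in> S & y \<in> T} f =
   (\<Sum>b\<in>B \<union> C. representation (B \<union> C) (f b) b)" by (rule tr_eq[OF ind sp f(1) fx])
 also have "\<dots> = (\<Sum>b\<in>B. representation (B \<union> C) (f b) b) + (\<Sum>b\<in>C. representation (B \<union> C) (f b) b)"
  by (rule sum.union_disjoint) (use B C disj in auto)
 also have "(\<Sum>b\<in>B. representation (B \<union> C) (f b) b) = (\<Sum>b\<in>B. representation B (f b) b)"
  by (rule sum.cong[OF refl], subst representation_extend[OF ind, of _ B]) (use B f in auto)
 also have "(\<Sum>b\<in>C. representation (B \<union> C) (f b) b) = (\<Sum>b\<in>C. representation C (f b) b)"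
  by (rule sum.cong[OF refl], subst representation_extend[OF ind, of _ C]) (use C f in auto)
 finally show ?thesis using tr_eq[OF B(1,2) f(1)] tr_eq[OF C(1,2) f(1)] f by simp
qed

lemma span_Union_family:
 assumes "finite F" and S: "!!i. i \<in> F ==> subspace (S i)" and "y \<in> span (\<Union>i\<in>F. S i)"
 shows "\<exists>x. (\<forall>i\<in>F. x i \<in> S i) & y = sum x F" using assms(3)
proof (induction rule: span_induct_alt)
 case base
 thus ?case using S by (intro exI[of _ "%_. 0"]) (auto simp: subspace_0)
next case (step c z y)
 then obtain x i where x: "\<forall>i\<in>F. x i \<in> S i" "y = sum x F" and i: "i \<in> F" "z \<in> S i" by auto
 have "sum (x(i := scale c z + x i)) F = scale c z + y" using i assms(1) x(2) by (simp add: sum.remove[of F i] add.assoc)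
 moreover have "\<forall>j\<in>F. (x(i := scale c z + x i)) j \<in> S j" using x i S by (auto simp: subspace_add subspace_scale)
 ultimately show ?case by metis
qed

lemma tr_direct_sum_family:
 assumes F: "finite F" and S: "!!i. i \<in> F ==> subspace (S i)"
  and ind: "!!x. (!!i. i \<in> F ==> x i \<in> S i) ==> sum x F = 0 ==> (!!i. i \<in> F ==> x i = 0)"
  and f: "lin f" "!!i x. i \<in> F ==> x \<in> S i ==> f x \<in> S i"
 shows "tr (span (\<Union>i\<in>F. S i)) f = (\<Sum>i\<in>F. tr (S i) f)" using F S ind f(2)
proof (induction F)
 case empty
 thus ?case using tr_0[OF f(1)] by simp
next case (insert a F)
 have un: "span (\<Union>i\<in>insert a F. S i) = {x + y | x y. x \<in> S a & y \<in> span (\<Union>i\<in>F. S i)}"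
  unfolding UN_insert span_Un span_eq_iff[THEN iffD2, OF insert.prems(1)[OF insertI1]] ..
 have int: "S a \<inter> span (\<Union>i\<in>F. S i) = {0}"
 proof -
  have "y = 0" if y: "y \<in> S a" "y \<in> span (\<Union>i\<in>F. S i)" for y
  proof -
   obtain x where x: "\<forall>i\<in>F. x i \<in> S i" "y = sum x F"
    using span_Union_family[OF insert.hyps(1) insert.prems(1) y(2)] by blast
   \<comment> \<open>Taking \<open>- y\<close> as the component at \<open>a\<close> turns a common
     element of both summands into a vanishing sum.\<close>
   define x' where "x' = x(a := - y)"
   have eqF: "sum x' F = sum x F" unfolding x'_def by (rule sum.cong) (use insert.hyps(2) in auto)
   have "x' a = 0"
   proof (rule insert.prems(2))
    show "x' i \<in> S i" if "i \<in> insert a F" for i using that x(1) y(1) insert.prems(1)[of a] by (auto simp: x'_def subspace_neg)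
    show "sum x' (insert a F) = 0" using insert.hyps eqF x(2) by (simp add: x'_def)
   qed simp
   thus ?thesis by (simp add: x'_def)
  qed
  thus ?thesis using subspace_0[OF insert.prems(1)[of a]] span_zero by auto
 qed
 have fst: "f x \<in> span (\<Union>i\<in>F. S i)" if "x \<in> span (\<Union>i\<in>F. S i)" for x using that
 proof (induction rule: span_induct_alt)
  case base
  thus ?case using f(1) span_zero by (simp add: Vector_Spaces.linear_iff_module_hom module_hom.zero)
 next case (step c x y)
  hence "f x \<in> span (\<Union>i\<in>F. S i)" using insert.prems(3) by (auto intro!: span_base)
  thus ?case using step f(1) by (simp add: lin_iff span_add span_scale)
 qed
 have IH: "tr (span (\<Union>i\<in>F. S i)) f = (\<Sum>i\<in>F. tr (S i) f)"
 proof (rule insert.IH)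
  show "x i = 0" if x: "!!i. i \<in> F ==> x i \<in> S i" "sum x F = 0" and i: "i \<in> F" for x i
  proof -
   have eqF: "sum (x(a := 0)) F = sum x F" by (rule sum.cong) (use insert.hyps(2) in auto)
   have "(x(a := 0)) i = 0"
   proof (rule insert.prems(2))
    show "(x(a := 0)) j \<in> S j" if "j \<in> insert a F" for j using that x(1) insert.prems(1)[of a] by (auto simp: subspace_0)
    show "sum (x(a := 0)) (insert a F) = 0" using insert.hyps x(2) eqF by simp
   qed (use i in simp)
   thus ?thesis using i insert.hyps(2) by (auto split: if_splits)
  qed
 qed (use insert.prems in auto)
 show ?case unfolding un using insert.hyps by (subst tr_direct_sum) (use insert.prems int f(1) fst IH in auto)
qed

end

section \<open>Simultaneous generalized eigenspaces\<close>

definition shifted :: "(complex => 'b::ab_group_add => 'b) => ('b => 'b) => complex => 'b => 'b" where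
 "shifted scale T c = (%y. T y - scale c y)"

locale complex_fd_space = finite_dimensional_vector_space scale Basis
 for scale :: "complex => 'b::ab_group_add => 'b" and Basis
begin

definition gen :: "('b => 'b) => complex => 'b set" where
 "gen T c = {x. \<exists>n. (shifted scale T c ^^ n) x = 0}"

lemma lin_shifted: "lin T ==> lin (shifted scale T c)" by (simp add: lin_iff shifted_def algebra_simps)

lemma lin_0: "lin f ==> f 0 = 0" by (simp add: Vector_Spaces.linear_iff_module_hom module_hom.zero)

lemma lin_diff: "lin f ==> f (x - y) = f x - f y" by (simp add: Vector_Spaces.linear_iff_module_hom module_hom.diff)

lemma lin_sum: "lin f ==> f (sum g A) = (\<Sum>a\<in>A. f (g a))" by (simp add: Vector_Spaces.linear_iff_module_hom module_hom.sum)

lemma lin_funpow: "lin f ==> lin (f ^^ n)" by (induction n) (simp_all add: lin_iff)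

lemma funpow_zero_mono:
 assumes "lin f" "(f ^^ n) x = 0" "n \<le> m"
 shows "(f ^^ m) x = 0"
proof -
 have "(f ^^ m) x = (f ^^ (m - n)) ((f ^^ n) x)" using assms(3) by (metis add.commute comp_apply funpow_add le_add_diff_inverse)
 thus ?thesis using assms(2) lin_0[OF lin_funpow[OF assms(1)]] by simp
qed

lemma subspace_gen:
 assumes "lin T"
 shows "subspace (gen T c)"
proof -
 let ?f = "shifted scale T c"
 note l = lin_shifted[OF assms, of c]
 note ln = lin_funpow[OF l, unfolded lin_iff]
 show ?thesis
 proof (rule subspaceI)
  show "0 \<in> gen T c" unfolding gen_def by (auto intro: exI[of _ 0])
  show "x + y \<in> gen T c" if xy: "x \<in> gen T c" "y \<in> gen T c" for x y
  proof -
   obtain m n where "(?f ^^ m) x = 0" "(?f ^^ n) y = 0" using xy by (auto simp: gen_def)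
   hence "(?f ^^ (m + n)) (x + y) = 0" using funpow_zero_mono[OF l, of m x "m + n"] funpow_zero_mono[OF l, of n y "m + n"]
    by (simp only: ln le_add1 le_add2) simp
   thus ?thesis by (auto simp: gen_def)
  qed
  show "scale a x \<in> gen T c" if x: "x \<in> gen T c" for a x
  proof -
   obtain m where "(?f ^^ m) x = 0" using x by (auto simp: gen_def)
   hence "(?f ^^ m) (scale a x) = 0" by (simp only: ln) simp
   thus ?thesis by (auto simp: gen_def)
  qed
 qed
qed

text \<open>On a kernel vector of the shift by \<open>c\<close> the shift by \<open>d\<close> is the
  nonzero scalar \<open>c - d\<close>, so no power of it vanishes. Induction on the exponent reduces
  to such vectors.\<close>

lemma gen_disjoint:
 assumes T: "lin T" and x: "x \<in> gen T c" "x \<in> gen T d" and "c ~= d"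
 shows "x = 0"
proof -
 have *: "x = 0" if "(shifted scale T c ^^ n) x = 0" "x \<in> gen T d" for n x using that
 proof (induction n arbitrary: x)
  case (Suc n)
  let ?y = "shifted scale T c x"
  obtain m where m: "(shifted scale T d ^^ m) x = 0" using Suc.prems(2) by (auto simp: gen_def)
  have com: "shifted scale T d (shifted scale T c z) = shifted scale T c (shifted scale T d z)" for z
   using T by (simp add: shifted_def lin_iff lin_diff[OF T] algebra_simps)
  have "(shifted scale T d ^^ k) (shifted scale T c z) = shifted scale T c ((shifted scale T d ^^ k) z)" for k z
   by (induction k) (simp_all add: com)
  hence "?y \<in> gen T d" using m lin_0[OF lin_shifted[OF T]] by (auto simp: gen_def intro!: exI[of _ m])
  hence "?y = 0" using Suc.IH[of ?y] Suc.prems(1) by (simp add: funpow_swap1)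
  hence "shifted scale T d x = scale (c - d) x" by (simp add: shifted_def algebra_simps)
  hence "(shifted scale T d ^^ k) x = scale ((c - d) ^ k) x" for k
   by (induction k) (use lin_shifted[OF T, of d] in "simp_all add: lin_iff mult.commute")
  thus ?case using m \<open>c ~= d\<close> by simp
 qed simp
 obtain n where "(shifted scale T c ^^ n) x = 0" using x(1) by (auto simp: gen_def)
 thus ?thesis using * x(2) by blast
qed

section \<open>Polynomials in one operator and its generalized eigenspace decomposition\<close>

definition ev :: "('b => 'b) => complex poly => 'b => 'b" where
 "ev T p x = (\<Sum>i\<le>degree p. scale (coeff p i) ((T ^^ i) x))"

lemma ev_bound: "degree p \<le> n ==> ev T p x = (\<Sum>i\<le>n. scale (coeff p i) ((T ^^ i) x))"
 unfolding ev_def by (rule sum.mono_neutral_left) (auto simp: coeff_eq_0)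

lemma ev_root_factor:
 assumes T: "lin T"
 shows "ev T ([:- z, 1:] * q) x = ev T q (shifted scale T z x)"
proof -
 define n where "n = degree q"
 have "degree ([:- z, 1:] * q) \<le> Suc n" using degree_mult_le[of "[:- z, 1:]" q] by (simp add: n_def)
 have e: "[:- z, 1:] * q = pCons 0 q - smult z q" by (simp add: mult_pCons_left)
 have "ev T ([:- z, 1:] * q) x =
   (\<Sum>i\<le>Suc n. scale (coeff (pCons 0 q - smult z q) i) ((T ^^ i) x))" unfolding e[symmetric] by (rule ev_bound) fact
 also have "(\<Sum>i\<le>Suc n. scale (coeff (pCons 0 q - smult z q) i) ((T ^^ i) x)) =
   (\<Sum>i\<le>Suc n. scale (coeff (pCons 0 q) i) ((T ^^ i) x)) -
   (\<Sum>i\<le>Suc n. scale (z * coeff q i) ((T ^^ i) x))" by (simp only: coeff_diff coeff_smult scale_left_diff_distrib sum_subtractf)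
 also have "(\<Sum>i\<le>Suc n. scale (coeff (pCons 0 q) i) ((T ^^ i) x)) =
   (\<Sum>i\<le>n. scale (coeff q i) ((T ^^ i) (T x)))" by (subst sum.atMost_Suc_shift) (simp add: funpow_swap1)
 also have "(\<Sum>i\<le>Suc n. scale (z * coeff q i) ((T ^^ i) x)) =
   (\<Sum>i\<le>n. scale (coeff q i) (scale z ((T ^^ i) x)))" by (simp add: n_def coeff_eq_0 mult.commute)
 also have "(\<Sum>i\<le>n. scale (coeff q i) ((T ^^ i) (T x))) -
   (\<Sum>i\<le>n. scale (coeff q i) (scale z ((T ^^ i) x))) = ev T q (shifted scale T z x)" using lin_funpow[OF T]
  by (simp add: ev_def n_def shifted_def lin_diff[OF lin_funpow[OF T]] lin_iff
    scale_right_diff_distrib sum_subtractf del: scale_scale)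
 finally show ?thesis .
qed

text \<open>The vectors \<open>(T ^^ i) x\<close> with \<open>i\<close> up to the dimension either
  repeat or are dependent; the two cases give different polynomials.\<close>

lemma annihilating_poly:
 obtains p where "p ~= 0" "ev T p x = 0"
proof -
 define d where "d = dim (UNIV :: 'b set)"
 have "\<exists>p. p ~= 0 & ev T p x = 0"
 proof (cases "inj_on (%i. (T ^^ i) x) {..d}")
  case False
  then obtain i j where ij: "i ~= j" "(T ^^ i) x = (T ^^ j) x" by (auto simp: inj_on_def)
  define p :: "complex poly" where "p = monom 1 i - monom 1 j"
  have "coeff p i = 1" using ij by (simp add: p_def)
  hence "p ~= 0" by auto
  have "degree p \<le> max i j" unfolding p_def by (rule degree_diff_le) (auto intro: order.trans[OF degree_monom_le])
  hence "ev T p x = (\<Sum>k\<le>max i j. scale (coeff p k) ((T ^^ k) x))" by (rule ev_bound)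
  also have "\<dots> = (\<Sum>k\<le>max i j. (if k = i then (T ^^ k) x else 0) - (if k = j then (T ^^ k) x else 0))"
   by (rule sum.cong) (auto simp: p_def coeff_monom)
  also have "\<dots> = 0" by (simp add: sum_subtractf ij)
  finally show ?thesis using \<open>p ~= 0\<close> by auto
 next case True
  let ?A = "(%i. (T ^^ i) x) ` {..d}"
  have "card ?A = Suc d" using card_image[OF True] by simp
  hence "dependent ?A" using independent_card_le_dim[of ?A UNIV] by (auto simp: d_def)
  then obtain u where u: "\<exists>v\<in>?A. u v ~= 0" "(\<Sum>v\<in>?A. scale (u v) v) = 0" using dependent_finite[of ?A] by auto
  define p :: "complex poly" where "p = (\<Sum>i\<le>d. monom (u ((T ^^ i) x)) i)"
  have c: "coeff p k = (if k \<le> d then u ((T ^^ k) x) else 0)" for k by (simp add: p_def coeff_sum coeff_monom)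
  have "p ~= 0" using u(1) c by (metis (no_types, lifting) atMost_iff coeff_0 imageE)
  have "degree p \<le> d" by (rule degree_le) (simp add: c)
  hence "ev T p x = (\<Sum>k\<le>d. scale (coeff p k) ((T ^^ k) x))" by (rule ev_bound)
  also have "\<dots> = (\<Sum>k\<le>d. scale (u ((T ^^ k) x)) ((T ^^ k) x))" by (rule sum.cong) (auto simp: c)
  also have "\<dots> = 0" using u(2) by (simp add: sum.reindex[OF True])
  finally show ?thesis using \<open>p ~= 0\<close> by auto
 qed
 thus ?thesis using that by blast
qed

text \<open>On the generalized eigenspace of \<open>d\<close> the shift by \<open>c\<close> is a
  nilpotent operator plus the nonzero scalar \<open>d - c\<close>, hence invertible; the preimage
  stays inside \<open>S\<close>.\<close>

lemma shifted_solve: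
 assumes T: "lin T" and S: "subspace S" "!!x. x \<in> S ==> T x \<in> S" and "c ~= d"
 shows "y \<in> S ==> (shifted scale T d ^^ n) y = 0 ==> \<exists>z\<in>S \<inter> gen T d. shifted scale T c z = y"
proof (induction n arbitrary: y)
 case 0
 thus ?case using lin_0[OF lin_shifted[OF T]] subspace_0[OF S(1)] subspace_0[OF subspace_gen[OF T]] by (intro bexI[of _ 0]) auto
next case (Suc n)
 have "shifted scale T d y \<in> S" using S Suc.prems by (simp add: shifted_def subspace_diff subspace_scale)
 then obtain z where z: "z \<in> S" "z \<in> gen T d" "shifted scale T c z = shifted scale T d y"
  using Suc.IH[of "shifted scale T d y"] Suc.prems(2) by (auto simp: funpow_swap1)
 \<comment> \<open>The two shifts of \<open>y\<close> differ by \<open>scale (d - c) y\<close>, so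
   \<open>y - z\<close> is mapped to that vector.\<close>
 let ?w = "scale (1 / (d - c)) (y - z)"
 have "y \<in> gen T d" using Suc.prems(2) unfolding gen_def by blast
 hence "?w \<in> S \<inter> gen T d" using z Suc.prems(1) by (auto intro!: subspace_scale subspace_diff S subspace_gen[OF T])
 moreover have "shifted scale T c ?w = y"
 proof -
  have "shifted scale T c y - shifted scale T d y = scale (d - c) y" by (simp add: shifted_def algebra_simps)
  hence "shifted scale T c (y - z) = scale (d - c) y" using z(3) by (simp add: lin_diff[OF lin_shifted[OF T]])
  hence "shifted scale T c ?w = scale (1 / (d - c)) (scale (d - c) y)" using lin_shifted[OF T, of c] by (simp add: lin_iff del: scale_scale)
  thus ?thesis using \<open>c ~= d\<close> by simp
 qed
 ultimately show ?case by blast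
qed

text \<open>Induction on the degree of a polynomial annihilating \<open>x\<close>, splitting off a
  complex root \<open>c\<close>. If the shift of \<open>x\<close> by \<open>c\<close> already
  decomposes, \<open>shifted_solve\<close> accounts for its components at the other eigenvalues, and
  what remains of \<open>x\<close> lies in the generalized eigenspace of \<open>c\<close>.\<close>

lemma gen_decomposition:
 assumes T: "lin T" and S: "subspace S" "!!x. x \<in> S ==> T x \<in> S"
 shows "x \<in> S ==> x \<in> span (\<Union>c. gen T c \<inter> S)"
proof -
 let ?E = "span (\<Union>c. gen T c \<inter> S)"
 have ES: "y \<in> S" if "y \<in> ?E" for y using span_minimal[of "\<Union>c. gen T c \<inter> S" S] S(1) that by auto
 have step: "x \<in> ?E" if x: "x \<in> S" and y: "shifted scale T c x \<in> ?E" for x c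
 proof -
  have "\<exists>z\<in>?E. y - shifted scale T c z \<in> gen T c \<inter> S" if "y \<in> ?E" for y using that
  proof (induction rule: span_induct_alt)
   case base
   thus ?case using lin_0[OF lin_shifted[OF T]] span_zero subspace_0[OF S(1)] subspace_0[OF subspace_gen[OF T]] by (intro bexI[of _ 0]) auto
  next case (step a v y)
   obtain z where z: "z \<in> ?E" "y - shifted scale T c z \<in> gen T c \<inter> S" using step by blast
   obtain d where d: "v \<in> gen T d" "v \<in> S" using step(1) by auto
   show ?case
   proof (cases "d = c")
    case True
    have "scale a v + y - shifted scale T c z = scale a v + (y - shifted scale T c z)" by simp
    also have "\<dots> \<in> gen T c \<inter> S" using z d True S(1) subspace_gen[OF T, of c] by (auto intro: subspace_add subspace_scale)
    finally show ?thesis using z(1) by blast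
   next case False
    obtain n where n: "(shifted scale T d ^^ n) v = 0" using d by (auto simp: gen_def)
    then obtain w where w: "w \<in> S \<inter> gen T d" "shifted scale T c w = v" using shifted_solve[OF T S] False d by metis
    have "scale a w + z \<in> ?E" using w z by (intro span_add span_scale) (auto intro: span_base)
    moreover have "scale a v + y - shifted scale T c (scale a w + z) = y - shifted scale T c z"
     using w lin_shifted[OF T, of c] by (simp add: lin_iff)
    ultimately show ?thesis using z by metis
   qed
  qed
  then obtain z where z: "z \<in> ?E" "shifted scale T c x - shifted scale T c z \<in> gen T c \<inter> S" using y by blast
  hence "shifted scale T c (x - z) \<in> gen T c" by (simp add: lin_diff[OF lin_shifted[OF T]])
  then obtain n where "(shifted scale T c ^^ n) (shifted scale T c (x - z)) = 0" by (auto simp: gen_def)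
  hence "(shifted scale T c ^^ Suc n) (x - z) = 0" by (simp add: funpow_swap1)
  hence "x - z \<in> gen T c" unfolding gen_def by blast
  hence "x - z \<in> gen T c \<inter> S" using x ES[OF z(1)] S(1) by (auto simp: subspace_diff)
  hence "x - z \<in> ?E" by (auto intro: span_base)
  hence "(x - z) + z \<in> ?E" using z(1) by (rule span_add)
  thus ?thesis by simp
 qed
 have "x \<in> ?E" if "p ~= 0" "ev T p x = 0" "x \<in> S" for p x using that
 proof (induction "degree p" arbitrary: p x)
  case 0
  hence "ev T p x = scale (coeff p 0) x" by (simp add: ev_def)
  moreover have "coeff p 0 ~= 0" using 0 leading_coeff_0_iff[of p] by simp
  ultimately show ?case using 0 by (simp add: span_zero)
 next case (Suc n)
  then obtain z where "poly p z = 0" using fundamental_theorem_of_algebra[of p] constant_degree[of p] by auto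
  then obtain q where q: "p = [:- z, 1:] * q" by (auto simp: poly_eq_0_iff_dvd)
  hence "q ~= 0" using Suc.prems by auto
  hence "degree q = n" using degree_mult_eq[of "[:- z, 1:]" q] q Suc.hyps(2) by simp
  moreover have "shifted scale T z x \<in> S" using S Suc.prems by (simp add: shifted_def subspace_diff subspace_scale)
  moreover have "ev T q (shifted scale T z x) = 0" using Suc.prems q ev_root_factor[OF T] by metis
  ultimately have "shifted scale T z x \<in> ?E" using Suc.hyps(1) \<open>q ~= 0\<close> by blast
  thus ?case using step Suc.prems by blast
 qed
 thus "x \<in> ?E" if "x \<in> S" using annihilating_poly[of T x] that by metis
qed

section \<open>Joint generalized eigenspaces of a family of operators\<close>

definition gspace :: "'i set => ('i => 'b => 'b) => ('i => complex) => 'b set" where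
 "gspace I T bt = {x. \<forall>i\<in>I. x \<in> gen (T i) (bt i)}"

lemma subspace_gspace: "(!!i. i \<in> I ==> lin (T i)) ==> subspace (gspace I T bt)" using subspace_gen[of "T _"]
 by (intro subspaceI) (simp_all add: gspace_def subspace_0 subspace_add subspace_scale)

text \<open>Either every operator has a single eigenvalue on \<open>S\<close>, which is then one
  joint eigenspace, or some operator splits \<open>S\<close> into pieces of smaller dimension,
  stable under the whole family by \<open>st\<close>. Index functions vanish off \<open>I\<close>,
  so that distinct ones differ on \<open>I\<close>.\<close>

lemma gspace_decomposition:
 fixes T :: "'i => 'b => 'b"
 assumes T: "!!i. i \<in> I ==> lin (T i)"
  and st: "!!i j c x. i \<in> I ==> j \<in> I ==> x \<in> gen (T i) c ==> T j x \<in> gen (T i) c"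
 shows "subspace S ==> (!!i x. i \<in> I ==> x \<in> S ==> T i x \<in> S) ==>
  S <= span (\<Union>bt\<in>{bt. \<forall>i. i \<notin> I --> bt i = 0}. gspace I T bt \<inter> S)"
proof (induction "dim S" arbitrary: S rule: less_induct)
 case less
 show ?case
 proof (cases "\<forall>i\<in>I. \<exists>c. S <= gen (T i) c")
  case True
  then obtain c where c: "!!i. i \<in> I ==> S <= gen (T i) (c i)" by metis
  define bt where "bt = (%i. if i \<in> I then c i else 0)"
  have "S <= gspace I T bt \<inter> S" using c by (auto simp: gspace_def bt_def)
  also have "\<dots> <= (\<Union>bt\<in>{bt. \<forall>i. i \<notin> I --> bt i = 0}. gspace I T bt \<inter> S)"
   by (rule UN_upper[of bt]) (simp add: bt_def)
  also have "\<dots> <= span \<dots>" by (rule span_superset)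
  finally show ?thesis .
 next case False
  then obtain i where i: "i \<in> I" "!!c. \<not> S <= gen (T i) c" by blast
  have "gen (T i) c \<inter> S <= span (\<Union>bt\<in>{bt. \<forall>i. i \<notin> I --> bt i = 0}. gspace I T bt \<inter> S)" for c
  proof -
   have sub: "subspace (gen (T i) c \<inter> S)" by (intro subspace_inter subspace_gen T i less.prems)
   have "gen (T i) c \<inter> S \<subset> S" using i(2)[of c] by auto
   hence "dim (gen (T i) c \<inter> S) < dim S" by (intro dim_psubset) (metis span_eq_iff sub less.prems(1))
   hence "gen (T i) c \<inter> S <=
     span (\<Union>bt\<in>{bt. \<forall>i. i \<notin> I --> bt i = 0}. gspace I T bt \<inter> (gen (T i) c \<inter> S))"
    by (rule less.hyps) (use sub st i less.prems in auto)
   also have "\<dots> <= span (\<Union>bt\<in>{bt. \<forall>i. i \<notin> I --> bt i = 0}. gspace I T bt \<inter> S)"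
    by (rule span_mono) auto
   finally show ?thesis .
  qed
  hence "span (\<Union>c. gen (T i) c \<inter> S) <=
    span (\<Union>bt\<in>{bt. \<forall>i. i \<notin> I --> bt i = 0}. gspace I T bt \<inter> S)" by (intro span_minimal subspace_span) auto
  thus ?thesis using gen_decomposition[OF T[OF i(1)] less.prems(1) less.prems(2)[OF i(1)]] by auto
 qed
qed

text \<open>A power of the shift by \<open>al i\<close> kills the component at \<open>al\<close> and
  preserves the other spaces. By induction it kills the other components too; these then lie in the
  eigenspaces of two different values.\<close>

lemma gspace_independent:
 fixes T :: "'i => 'b => 'b"
 assumes T: "!!i. i \<in> I ==> lin (T i)"
  and st: "!!i j c x. i \<in> I ==> j \<in> I ==> x \<in> gen (T i) c ==> T j x \<in> gen (T i) c"
  and F: "finite F" "!!bt. bt \<in> F ==> \<forall>i. i \<notin> I --> bt i = 0"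
 shows "(!!bt. bt \<in> F ==> x bt \<in> gspace I T bt) ==> sum x F = 0 ==> bt \<in> F ==> x bt = 0" using F
proof (induction F arbitrary: x bt)
 case (insert al F)
 have zero: "x bt = 0" if bt: "bt \<in> F" for bt
 proof -
  have "bt ~= al" using bt insert.hyps by auto
  then obtain i where i: "bt i ~= al i" "i \<in> I" using insert.prems(4) bt by (metis ext insertCI)
  let ?f = "shifted scale (T i) (al i)"
  note l = lin_shifted[OF T[OF i(2)], of "al i"]
  have "x al \<in> gen (T i) (al i)" using insert.prems(1)[of al] i(2) by (simp add: gspace_def)
  then obtain n where n: "(?f ^^ n) (x al) = 0" by (auto simp: gen_def)
  have g: "(?f ^^ k) y \<in> gspace I T ga" if "y \<in> gspace I T ga" for k y ga
  proof (induction k)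
   case (Suc k)
   have "?f z \<in> gspace I T ga" if "z \<in> gspace I T ga" for z using that st[OF _ i(2)] subspace_gen[OF T]
    by (auto simp: gspace_def shifted_def intro!: subspace_diff subspace_scale)
   thus ?case using Suc by simp
  qed (use that in simp)
  have "(?f ^^ n) (x bt) = 0"
  proof (rule insert.IH[of "%ga. (?f ^^ n) (x ga)", OF _ _ bt])
   show "(\<Sum>ga\<in>F. (?f ^^ n) (x ga)) = 0"
   proof -
    have "(?f ^^ n) (sum x (insert al F)) = 0" using insert.prems(2) lin_0[OF lin_funpow[OF l]] by simp
    thus ?thesis using insert.hyps n by (simp add: lin_sum[OF lin_funpow[OF l]] del: sum.insert) (simp add: n)
   qed
  qed (use g insert.prems in auto)
  hence "x bt \<in> gen (T i) (al i)" by (auto simp: gen_def)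
  moreover have "x bt \<in> gen (T i) (bt i)" using insert.prems(1)[of bt] bt i(2) by (simp add: gspace_def)
  ultimately show ?thesis using gen_disjoint[OF T[OF i(2)]] i(1) by metis
 qed
 hence "x al = 0" using insert.prems(2) insert.hyps by simp
 thus ?case using zero insert.prems(3) by auto
qed simp

text \<open>Engel's argument relative to a stable subspace \<open>K\<close>: the operators are
  treated one at a time, and the remaining ones preserve the subspace cut out so far because they
  commute modulo \<open>K\<close>. It is applied with \<open>K = h\<close>, to find normalizing
  elements, and with \<open>K = {0}\<close>, to find common eigenvectors.\<close>

lemma common_kernel:
 assumes lin: "!!f. f \<in> set fs ==> lin f"
  and K: "subspace K" "!!f x. f \<in> set fs ==> x \<in> K ==> f x \<in> K"
 shows "subspace V ==> \<not> V <= K ==> (!!f x. f \<in> set fs ==> x \<in> V ==> f x \<in> V) ==>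
  (!!f x. f \<in> set fs ==> x \<in> V ==> \<exists>n. (f ^^ n) x \<in> K) ==>
  (!!f g x. f \<in> set fs ==> g \<in> set fs ==> x \<in> V ==> f (g x) - g (f x) \<in> K) ==>
  \<exists>x\<in>V. x \<notin> K & (\<forall>f\<in>set fs. f x \<in> K)" using assms
proof (induction fs arbitrary: V)
 case Nil
 thus ?case by auto
next case (Cons f fs)
 define V' where "V' = {x \<in> V. f x \<in> K}"
 have lf: "lin f" using Cons.prems(6) by simp
 have sub: "subspace V'" using Cons.prems(1) K(1) lf lin_0[OF lf] unfolding V'_def
  by (intro subspaceI) (auto simp: lin_iff subspace_0 subspace_add subspace_scale)
 obtain x where x: "x \<in> V" "x \<notin> K" using Cons.prems(2) by auto
 define n where "n = (LEAST n. (f ^^ n) x \<in> K)"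
 have ex: "\<exists>n. (f ^^ n) x \<in> K" using Cons.prems(4) x(1) by simp
 hence n: "(f ^^ n) x \<in> K" unfolding n_def by (rule LeastI_ex)
 then obtain m where m: "n = Suc m" using x(2) by (cases n) auto
 have inV: "(f ^^ k) x \<in> V" for k by (induction k) (use x Cons.prems(3) in auto)
 have "(f ^^ m) x \<notin> K" using not_less_Least[of m "%n. (f ^^ n) x \<in> K"] m unfolding n_def by simp
 hence nsub: "\<not> V' <= K" using n m inV[of m] by (auto simp: V'_def)
 have stab: "g y \<in> V'" if "g \<in> set fs" "y \<in> V'" for g y
 proof -
  have y: "y \<in> V" "f y \<in> K" using that by (auto simp: V'_def)
  have "f (g y) - g (f y) \<in> K" "g (f y) \<in> K" using Cons.prems(5)[of f g y] Cons.prems(8)[of g "f y"] that y by auto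
  hence "f (g y) - g (f y) + g (f y) \<in> K" using K(1) subspace_add by blast
  thus ?thesis using Cons.prems(3)[of g y] that y by (simp add: V'_def)
 qed
 have "\<exists>x\<in>V'. x \<notin> K & (\<forall>f\<in>set fs. f x \<in> K)"
  using Cons.prems(4-8) by (intro Cons.IH sub nsub) (auto simp: stab V'_def[symmetric], auto simp: V'_def)
 thus ?case by (auto simp: V'_def)
qed

end

section \<open>The root space decomposition\<close>

context vector_space
begin

lemma span_Union_finite:
 assumes "y \<in> span (\<Union>i\<in>A. S i)"
 shows "\<exists>F. finite F & F <= A & y \<in> span (\<Union>i\<in>F. S i)" using assms
proof (induction rule: span_induct_alt)
 case base
 thus ?case by (intro exI[of _ "{}"]) (simp add: span_zero)
next case (step c z y)
 then obtain F i where F: "finite F" "F <= A" "y \<in> span (\<Union>i\<in>F. S i)" and i: "i \<in> A" "z \<in> S i" by auto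
 have "z \<in> span (\<Union>i\<in>insert i F. S i)" using i by (intro span_base) auto
 moreover have "y \<in> span (\<Union>i\<in>insert i F. S i)"
  using F(3) span_mono[of "\<Union>i\<in>F. S i" "\<Union>i\<in>insert i F. S i"] by auto
 ultimately show ?case using F i by (intro exI[of _ "insert i F"]) (simp add: span_add span_scale del: UN_insert)
qed

end

type_synonym 'g wt = "'g => complex"

locale fd_simple = simple_lie_algebra scale bracket h b + complex_fd_space scale Basis
 for scale :: "complex => 'g::ab_group_add => 'g" and bracket and h b :: "'g set" and Basis :: "'g set"
begin

lemma lin_ad: "lin (bracket x)" by (simp add: lin_iff bracket_add_right bracket_scale_right)

lemma bracket_diff_left: "bracket (x - y) z = bracket x z - bracket y z" using bracket_add_left[of "x - y" y z] by simp

lemma bracket_diff_right: "bracket z (x - y) = bracket z x - bracket z y" using bracket_add_right[of z "x - y" y] by simp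

lemma bracket_minus_left: "bracket (- x) z = - bracket x z" using bracket_diff_left[of 0 x z] by (simp add: bracket_zero_left)

lemma bracket_minus_right: "bracket z (- x) = - bracket z x" using bracket_diff_right[of z 0 x] by (simp add: bracket_zero_right)

lemma bracket_sum_left: "bracket (sum f A) y = (\<Sum>a\<in>A. bracket (f a) y)"
 by (induction A rule: infinite_finite_induct) (simp_all add: bracket_zero_left bracket_add_left)

lemma bracket_sum_right: "bracket y (sum f A) = (\<Sum>a\<in>A. bracket y (f a))"
 by (induction A rule: infinite_finite_induct) (simp_all add: bracket_zero_right bracket_add_right)

lemma bracket_bracket_right:
 "bracket x (bracket y z) = bracket (bracket x y) z + bracket y (bracket x z)"
proof -
 have "bracket (bracket x y) z = - bracket z (bracket x y)" "bracket y (bracket z x) = - bracket y (bracket x z)"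
  by (rule bracket_antisym) (simp add: bracket_antisym[of x z] bracket_minus_right)
 hence "bracket x (bracket y z) - bracket y (bracket x z) - bracket (bracket x y) z = 0" using jacobi[of x y z] by simp
 thus ?thesis by (simp add: algebra_simps)
qed

lemma bracket_bracket_left:
 "bracket (bracket x y) z = bracket x (bracket y z) - bracket y (bracket x z)" using bracket_bracket_right[of x y z] by simp

lemma h_subspace: "subspace h" using cartan by (simp add: cartan_subalgebra_def subalgebra_def)

lemma h_bracket: "x \<in> h ==> y \<in> h ==> bracket x y \<in> h" using cartan by (simp add: cartan_subalgebra_def subalgebra_def)

text \<open>The shift by \<open>c + d\<close> acts on a bracket by the Leibniz rule, through the
  shift by \<open>c\<close> on the left and by \<open>d\<close> on the right, so
  \<open>m + n\<close> applications exhaust one of the two factors.\<close>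

lemma gen_ad_bracket:
 assumes x: "x \<in> gen (bracket H) c" and y: "y \<in> gen (bracket H) d"
 shows "bracket x y \<in> gen (bracket H) (c + d)"
proof -
 let ?S = "%c. shifted scale (bracket H) c"
 have der: "?S (c + d) (bracket x y) = bracket (?S c x) y + bracket x (?S d y)" for c d x y
  by (simp add: shifted_def bracket_bracket_right[of H] bracket_diff_left bracket_diff_right
    bracket_scale_left bracket_scale_right scale_left_distrib)
 have *: "(?S (c + d) ^^ k) (bracket x y) = 0"
  if "(?S c ^^ m) x = 0" "(?S d ^^ n) y = 0" "m + n = k" for k m n x y using that
 proof (induction k arbitrary: m n x y)
  case 0
  thus ?case by (simp add: bracket_zero_left)
 next case (Suc k)
  note l = lin_funpow[OF lin_shifted[OF lin_ad], unfolded lin_iff, THEN conjunct1, rule_format]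
  show ?case
  proof (cases "m = 0 \<or> n = 0")
   case True
   hence "bracket x y = 0" using Suc.prems by (auto simp: bracket_zero_left bracket_zero_right)
   thus ?thesis using lin_0[OF lin_funpow[OF lin_shifted[OF lin_ad]]] by metis
  next case False
   then obtain m' n' where mn: "m = Suc m'" "n = Suc n'" by (metis not0_implies_Suc)
   have "(?S (c + d) ^^ k) (bracket (?S c x) y) = 0" by (rule Suc.IH[of m' _ n]) (use Suc.prems mn in "auto simp: funpow_swap1")
   moreover have "(?S (c + d) ^^ k) (bracket x (?S d y)) = 0" by (rule Suc.IH[of m _ n']) (use Suc.prems mn in "auto simp: funpow_swap1")
   ultimately show ?thesis by (simp add: funpow_swap1 der l)
  qed
 qed
 obtain m n where "(?S c ^^ m) x = 0" "(?S d ^^ n) y = 0" using x y by (auto simp: gen_def)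
 from *[OF this refl] show ?thesis unfolding gen_def by blast
qed

lemma h_gen_zero:
 assumes "H \<in> h" "Y \<in> h"
 shows "Y \<in> gen (bracket H) 0"
proof -
 obtain n where n: "lower_central_series h n = {0}" using cartan by (auto simp: cartan_subalgebra_def nilpotent_def)
 have "(bracket H ^^ k) Y \<in> lower_central_series h k" for k
 proof (induction k)
  case (Suc k)
  thus ?case using assms(1) by (auto simp: bracket_span_def intro!: span_base)
 qed (use assms in simp)
 from this[of n] have "(bracket H ^^ n) Y = 0" using n by simp
 moreover have "shifted scale (bracket H) 0 = bracket H" by (simp add: shifted_def)
 ultimately show ?thesis by (auto simp: gen_def)
qed

lemma ad_h_gen:
 "i \<in> h ==> j \<in> h ==> x \<in> gen (bracket i) c ==> bracket j x \<in> gen (bracket i) c"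
 using gen_ad_bracket[of j i 0 x c] h_gen_zero by simp

abbreviation gw :: "'g wt => 'g set" where
 "gw == gspace h bracket"

definition onh :: "'g wt => bool" where
 "onh bt \<longleftrightarrow> (\<forall>x. x \<notin> h --> bt x = 0)"

text \<open>Weights of the adjoint representation, 0 included. Linearity is not demanded; it comes
  out of the trace in \<open>WT_dual\<close>.\<close>

definition WT :: "'g wt set" where
 "WT = {bt. onh bt & gw bt ~= {0}}"

lemma onh_simps [simp]:
 "onh 0" "onh al ==> onh (- al)" "onh al ==> onh bt ==> onh (al + bt)" by (simp_all add: onh_def)

lemma gw_sub: "subspace (gw bt)" by (rule subspace_gspace) (rule lin_ad)

lemma gw_bracket: "x \<in> gw al ==> y \<in> gw bt ==> bracket x y \<in> gw (al + bt)" using gen_ad_bracket by (simp add: gspace_def)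

lemma gw_indep:
 assumes "finite F" "!!bt. bt \<in> F ==> onh bt" "!!bt. bt \<in> F ==> x bt \<in> gw bt" "sum x F = 0" "bt \<in> F"
 shows "x bt = 0" by (rule gspace_independent[where T = bracket and I = h and F = F])
  (use assms ad_h_gen lin_ad in "auto simp: onh_def")

lemma gw_disjoint:
 assumes "x \<in> gw al" "x \<in> gw bt" "onh al" "onh bt" "al ~= bt"
 shows "x = 0"
proof -
 have "(if al = al then x else - x) = 0" by (rule gw_indep[of "{al, bt}" "%ga. if ga = al then x else - x" al])
   (use assms gw_sub in "auto simp: subspace_neg")
 thus ?thesis by simp
qed

lemma gw_span_all: "span (\<Union>bt\<in>{bt. onh bt}. gw bt) = UNIV"
 using gspace_decomposition[of h bracket UNIV] ad_h_gen lin_ad by (auto simp: onh_def)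

text \<open>Finitely many basis vectors involve finitely many weights, and independence excludes any
  further weight.\<close>

lemma finite_WT: "finite WT" and span_WT: "span (\<Union>bt\<in>WT. gw bt) = UNIV"
proof -
 have "\<forall>v. \<exists>F. finite F & F <= {bt. onh bt} & v \<in> span (\<Union>bt\<in>F. gw bt)"
  using span_Union_finite[of _ gw "{bt. onh bt}"] gw_span_all by auto
 then obtain F where F: "!!v. finite (F v)" "!!v. F v <= {bt. onh bt}" "!!v. v \<in> span (\<Union>bt\<in>F v. gw bt)" by metis
 define G where "G = (\<Union>v\<in>Basis. F v)"
 have fG: "finite G" and onG: "!!bt. bt \<in> G ==> onh bt" using F finite_Basis by (auto simp: G_def)
 have "v \<in> span (\<Union>bt\<in>G. gw bt)" if "v \<in> Basis" for v
  using F(3)[of v] span_mono[of "\<Union>bt\<in>F v. gw bt" "\<Union>bt\<in>G. gw bt"] that by (auto simp: G_def)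
 hence "span Basis <= span (\<Union>bt\<in>G. gw bt)" by (intro span_minimal subspace_span) auto
 hence sG: "span (\<Union>bt\<in>G. gw bt) = UNIV" using span_Basis by auto
 have "WT <= G"
 proof
  fix al assume al: "al \<in> WT"
  show "al \<in> G"
  proof (rule ccontr)
   assume n: "al \<notin> G"
   obtain v where v: "v \<in> gw al" "v ~= 0" using al subspace_0[OF gw_sub[of al]] by (auto simp: WT_def)
   obtain x where x: "\<forall>bt\<in>G. x bt \<in> gw bt" "v = sum x G" using span_Union_family[OF fG, of gw v] gw_sub sG by auto
   have eq: "sum (x(al := - v)) G = sum x G" by (rule sum.cong) (use n in auto)
   have "(x(al := - v)) al = 0" by (rule gw_indep[of "insert al G"])
     (use fG onG x n al v gw_sub eq in "auto simp: WT_def subspace_neg")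
   thus False using v by simp
  qed
 qed
 thus "finite WT" using fG finite_subset by blast
 have "gw bt <= span (\<Union>bt\<in>WT. gw bt)" if "bt \<in> G" for bt
 proof (cases "bt \<in> WT")
  case True
  hence "gw bt <= (\<Union>bt\<in>WT. gw bt)" by auto
  thus ?thesis using span_superset by (rule order_trans)
 next case False
  thus ?thesis using that onG span_zero by (auto simp: WT_def)
 qed
 hence "span (\<Union>bt\<in>G. gw bt) <= span (\<Union>bt\<in>WT. gw bt)" by (intro span_minimal subspace_span) auto
 thus "span (\<Union>bt\<in>WT. gw bt) = UNIV" using sG by auto
qed

lemma not_WT: "onh bt ==> bt \<notin> WT ==> x \<in> gw bt ==> x = 0" by (auto simp: WT_def)

text \<open>If the zero weight space exceeded \<open>h\<close>, an element outside \<open>h\<close>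
  normalizing \<open>h\<close> would arise by going back through the lower central series of
  \<open>h\<close>, from its last term 0 to \<open>h\<close> itself. At each term
  \<open>common_kernel\<close> applies modulo \<open>h\<close>, since commutators fall into the
  following term, already known to map the element into \<open>h\<close>.\<close>

lemma gw_zero: "gw 0 = h"
proof
 show "h <= gw 0" using h_gen_zero by (auto simp: gspace_def)
 show "gw 0 <= h"
 proof (rule ccontr)
  define G where "G = gw 0"
  assume "\<not> gw 0 <= h"
  hence n: "\<not> G <= h" unfolding G_def .
  have subG: "subspace G" unfolding G_def by (rule gw_sub)
  have Ggen: "x \<in> gen (bracket Y) 0" if "x \<in> G" "Y \<in> h" for x Y using that by (simp add: G_def gspace_def)
  have Gst: "bracket Y x \<in> G" if "x \<in> G" "Y \<in> h" for x Y using that ad_h_gen by (simp add: G_def gspace_def)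
  obtain n where n0: "lower_central_series h n = {0}" using cartan by (auto simp: cartan_subalgebra_def nilpotent_def)
  have sub: "subspace (lower_central_series h k)" for k by (cases k) (auto simp: h_subspace bracket_span_def)
  have inh: "lower_central_series h k <= h" for k
  proof (induction k)
   case (Suc k)
   show ?case unfolding lower_central_series.simps bracket_span_def by (rule span_minimal[OF _ h_subspace]) (use Suc h_bracket in auto)
  qed simp
  have lc: "bracket x y \<in> lower_central_series h (Suc k)" "bracket y x \<in> lower_central_series h (Suc k)"
   if "x \<in> h" "y \<in> lower_central_series h k" for x y k
  proof -
   show "bracket x y \<in> lower_central_series h (Suc k)" using that by (auto simp: bracket_span_def intro!: span_base)
   thus "bracket y x \<in> lower_central_series h (Suc k)" using subspace_neg[OF sub] bracket_antisym[of y x] by metis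
  qed
  have dec: "lower_central_series h (Suc k) <= lower_central_series h k" for k
  proof (induction k)
   case 0
   show ?case using inh[of "Suc 0"] by simp
  next case (Suc k)
   thus ?case unfolding lower_central_series.simps(2)[of h "Suc k"] lower_central_series.simps(2)[of h k] bracket_span_def
    by (intro span_mono) auto
  qed
  have "\<exists>x\<in>G. x \<notin> h & (\<forall>Y\<in>lower_central_series h (n - k). bracket Y x \<in> h)" if "k \<le> n" for k
   using that
  proof (induction k)
   case 0
   obtain x where "x \<in> G" "x \<notin> h" using n by (meson subsetI)
   thus ?case using n0 subspace_0[OF h_subspace] by (intro bexI[of _ x]) (simp_all add: bracket_zero_left)
  next case (Suc k)
   \<comment> \<open>\<open>L'\<close> is the term that already maps some outside element into
     \<open>h\<close>; the step passes to the larger term \<open>L\<close> before it.\<close>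
   define L where "L = lower_central_series h (n - Suc k)"
   define L' where "L' = lower_central_series h (n - k)"
   have e: "n - k = Suc (n - Suc k)" using Suc.prems by simp
   define V where "V = {x \<in> G. \<forall>Y\<in>L'. bracket Y x \<in> h}"
   have LL: "bracket x y \<in> L'" "bracket y x \<in> L'" if "x \<in> h" "y \<in> L" for x y
    using lc[OF that(1), of y "n - Suc k"] that(2) e by (simp_all add: L_def L'_def del: lower_central_series.simps)
   have L'L: "bracket x y \<in> L'" "bracket y x \<in> L'" if "x \<in> h" "y \<in> L'" for x y
   proof -
    have "L' <= L" unfolding L_def L'_def e by (rule dec)
    thus "bracket x y \<in> L'" "bracket y x \<in> L'" using LL that by auto
   qed
   have subL: "subspace L" using sub by (simp add: L_def)
   obtain Bs where Bs: "independent Bs" "span Bs = L" "finite Bs" "Bs <= L" using subspace_basis[OF subL] by blast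
   obtain bs where bs: "set bs = Bs" using finite_list[OF Bs(3)] by blast
   have Lh: "L <= h" using inh by (simp add: L_def)
   have Vsub: "subspace V" unfolding V_def by (rule subspaceI)
     (auto simp: subspace_0[OF subG] subspace_add[OF subG] subspace_scale[OF subG]
      bracket_zero_right bracket_add_right bracket_scale_right subspace_0[OF h_subspace]
      subspace_add[OF h_subspace] subspace_scale[OF h_subspace])
   have "\<exists>x\<in>V. x \<notin> h & (\<forall>f\<in>set (map bracket bs). f x \<in> h)"
   proof (rule common_kernel)
    show "\<not> V <= h" using Suc by (auto simp: V_def L'_def)
    show "f x \<in> V" if asm: "f \<in> set (map bracket bs)" "x \<in> V" for f x
    proof -
     obtain Y where Y: "Y \<in> L" "f = bracket Y" using asm bs Bs(4) by auto
     have x: "x \<in> G" "!!Z. Z \<in> L' ==> bracket Z x \<in> h" using asm by (auto simp: V_def)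
     have "bracket Y x \<in> G" using x(1) Y Lh Gst by auto
     moreover have "bracket Z (bracket Y x) \<in> h" if Z: "Z \<in> L'" for Z
     proof -
      have "bracket Z Y \<in> L'" using L'L(2)[of Y Z] Z Y Lh by auto
      hence "bracket (bracket Z Y) x \<in> h" "bracket Y (bracket Z x) \<in> h" using x(2) Z Y Lh h_bracket by auto
      thus ?thesis using bracket_bracket_right[of Z Y x] subspace_add[OF h_subspace] by simp
     qed
     ultimately show ?thesis using Y(2) by (simp add: V_def)
    qed
    show "\<exists>n. (f ^^ n) x \<in> h" if asm: "f \<in> set (map bracket bs)" "x \<in> V" for f x
    proof -
     obtain Y where Y: "Y \<in> h" "f = bracket Y" using asm bs Bs(4) Lh by auto
     have "x \<in> gen (bracket Y) 0" using asm(2) Y(1) Ggen by (simp add: V_def)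
     moreover have "shifted scale (bracket Y) 0 = bracket Y" by (simp add: shifted_def)
     ultimately obtain n where "(f ^^ n) x = 0" using Y(2) by (auto simp: gen_def)
     thus ?thesis using subspace_0[OF h_subspace] by (intro exI[of _ n]) simp
    qed
    show "f (g x) - g (f x) \<in> h" if asm: "f \<in> set (map bracket bs)" "g \<in> set (map bracket bs)" "x \<in> V" for f g x
    proof -
     obtain Y Z where Y: "Y \<in> L" "f = bracket Y" and Z: "Z \<in> L" "g = bracket Z" using asm bs Bs(4) by auto
     have "bracket Y Z \<in> L'" using LL(1) Y Z Lh by auto
     hence "bracket (bracket Y Z) x \<in> h" using asm(3) by (auto simp: V_def)
     thus ?thesis using Y Z by (simp add: bracket_bracket_left)
    qed
    show "f x \<in> h" if asm: "f \<in> set (map bracket bs)" "x \<in> h" for f x using asm bs Bs(4) Lh h_bracket by auto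
   qed (use lin_ad h_subspace Vsub in auto)
   then obtain x where x: "x \<in> V" "x \<notin> h" "!!Y. Y \<in> Bs ==> bracket Y x \<in> h" using bs by auto
   have "bracket Y x \<in> h" if "Y \<in> span Bs" for Y using that by (induction rule: span_induct_alt)
     (auto simp: bracket_zero_left bracket_add_left bracket_scale_left x(3)
      subspace_0[OF h_subspace] subspace_add[OF h_subspace] subspace_scale[OF h_subspace])
   thus ?case using x Bs(2) by (auto simp: V_def L_def)
  qed
  from this[of n] obtain x where x: "x \<notin> h" "!!Y. Y \<in> h ==> bracket Y x \<in> h" by auto
  have "bracket x Y \<in> h" if "Y \<in> h" for Y using subspace_neg[OF h_subspace x(2)[OF that]] by (simp add: bracket_antisym[of x Y])
  hence "x \<in> normalizer h" by (simp add: normalizer_def)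
  thus False using x(1) cartan by (simp add: cartan_subalgebra_def)
 qed
qed

end

context finite_dimensional_vector_space
begin

lemma tr_diff:
 assumes S: "subspace S" and fg: "lin f" "lin g" "!!x. x \<in> S ==> f x \<in> S" "!!x. x \<in> S ==> g x \<in> S"
 shows "tr S (%x. f x - g x) = tr S f - tr S g"
proof -
 have "tr S (%x. (f x - g x) + g x) = tr S (%x. f x - g x) + tr S g" by (rule tr_add[OF S])
   (use fg in "simp_all add: lin_iff algebra_simps subspace_diff[OF S]")
 thus ?thesis by simp
qed

end

lemma funpow_compose_commute:
 assumes "!!x. p (q x) = q (p x)"
 shows "((%x. p (q x)) ^^ n) x = (p ^^ n) ((q ^^ n) x)"
proof (induction n)
 case (Suc n)
 have "q ((p ^^ n) y) = (p ^^ n) (q y)" for y by (induction n) (simp_all add: assms[symmetric])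
 thus ?case using Suc by simp
qed simp

context fd_simple
begin

lemma ad_fun:
 "bracket (x + y) = (%z. bracket x z + bracket y z)"
 "bracket (scale c x) = (%z. scale c (bracket x z))"
 "bracket (bracket x y) = (%z. bracket x (bracket y z) - bracket y (bracket x z))"
 "bracket 0 = (%z. scale 0 z)" by (simp_all add: fun_eq_iff bracket_add_left bracket_scale_left bracket_bracket_left bracket_zero_left)

lemma gw_h_stable: "H \<in> h ==> x \<in> gw bt ==> bracket H x \<in> gw bt" using gw_bracket[of H 0 x bt] gw_zero by simp

lemma tr_gw_sum:
 assumes F: "finite F" "!!ga. ga \<in> F ==> onh ga" and f: "lin f"
  and st: "!!ga x. ga \<in> F ==> x \<in> gw ga ==> f x \<in> gw ga"
  and nil: "!!ga x. ga \<in> F ==> x \<in> gw ga ==> \<exists>n. ((%y. f y - scale (c ga) y) ^^ n) x = 0"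
 shows "tr (span (\<Union>ga\<in>F. gw ga)) f = (\<Sum>ga\<in>F. of_nat (dim (gw ga)) * c ga)"
proof -
 have "tr (span (\<Union>ga\<in>F. gw ga)) f = (\<Sum>ga\<in>F. tr (gw ga) f)"
  by (rule tr_direct_sum_family[OF F(1) gw_sub _ f st]) (use gw_indep[of F] F in auto)
 also have "\<dots> = (\<Sum>ga\<in>F. of_nat (dim (gw ga)) * c ga)"
  by (rule sum.cong[OF refl], rule tr_generalized_eigen[OF gw_sub f]) (use st nil in auto)
 finally show ?thesis .
qed

lemma gw_nilpotent:
 assumes "H \<in> h" "x \<in> gw ga"
 shows "\<exists>n. ((%y. bracket H y - scale (ga H) y) ^^ n) x = 0" using assms by (auto simp: gspace_def gen_def shifted_def)

lemma tr_gw_ad: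
 assumes "finite F" "!!ga. ga \<in> F ==> onh ga" "H \<in> h"
 shows "tr (span (\<Union>ga\<in>F. gw ga)) (bracket H) = (\<Sum>ga\<in>F. of_nat (dim (gw ga)) * ga H)"
 by (rule tr_gw_sum) (use assms lin_ad gw_h_stable gw_nilpotent in auto)

lemma tr_gw: "H \<in> h ==> tr (gw bt) (bracket H) = of_nat (dim (gw bt)) * bt H"
 by (rule tr_generalized_eigen) (use gw_sub lin_ad gw_h_stable gw_nilpotent in auto)

lemma dim_gw_pos: "bt \<in> WT ==> 0 < dim (gw bt)"
proof -
 assume "bt \<in> WT"
 hence "gw bt ~= {0}" unfolding WT_def by blast
 hence "\<not> gw bt <= {0}" using subspace_0[OF gw_sub[of bt]] by blast
 thus "0 < dim (gw bt)" using dim_eq_0[of "gw bt"] by (metis gr0I)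
qed

lemma WT_onh: "bt \<in> WT ==> onh bt" by (simp add: WT_def)

text \<open>A weight is a trace divided by a positive dimension, and traces are linear.\<close>

lemma WT_dual: "bt \<in> WT ==> bt \<in> dual"
proof -
 assume bt: "bt \<in> WT"
 have n: "of_nat (dim (gw bt)) ~= (0::complex)" using dim_gw_pos[OF bt] by (simp del: dim_eq_0)
 have "bt (x + y) = bt x + bt y" if xy: "x \<in> h" "y \<in> h" for x y
 proof -
  have "tr (gw bt) (bracket (x + y)) = tr (gw bt) (%z. bracket x z + bracket y z)" by (simp only: ad_fun)
  also have "\<dots> = tr (gw bt) (bracket x) + tr (gw bt) (bracket y)"
   by (rule tr_add[OF gw_sub lin_ad lin_ad]) (use xy gw_h_stable in auto)
  finally show ?thesis using n xy subspace_add[OF h_subspace] by (simp add: tr_gw flip: distrib_left)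
 qed
 moreover have "bt (scale c x) = c * bt x" if x: "x \<in> h" for c x
 proof -
  have "tr (gw bt) (bracket (scale c x)) = tr (gw bt) (%z. scale c (bracket x z))" by (simp only: ad_fun)
  also have "\<dots> = c * tr (gw bt) (bracket x)" by (rule tr_scale[OF gw_sub lin_ad]) (use x gw_h_stable in auto)
  finally show ?thesis using n x subspace_scale[OF h_subspace] by (simp add: tr_gw)
 qed
 ultimately show "bt \<in> dual" using bt by (simp add: dual_def WT_def onh_def)
qed

lemma dual_props:
 assumes "f \<in> dual"
 shows "x \<in> h ==> y \<in> h ==> f (x + y) = f x + f y" "x \<in> h ==> f (scale c x) = c * f x"
  "x \<notin> h ==> f x = 0" "f 0 = 0" "onh f"
proof -
 show 1: "x \<in> h ==> y \<in> h ==> f (x + y) = f x + f y" "x \<in> h ==> f (scale c x) = c * f x"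
  "x \<notin> h ==> f x = 0" for x y c using assms by (simp_all add: dual_def)
 show "f 0 = 0" using 1(2)[of 0 0] subspace_0[OF h_subspace] by simp
 show "onh f" using assms by (simp add: dual_def onh_def)
qed

definition D :: "'g wt => 'g set" where
 "D al = span {bracket x y | x y. x \<in> gw al & y \<in> gw (- al)}"

lemma D_h: "D al <= h" unfolding D_def by (rule span_minimal[OF _ h_subspace]) (use gw_bracket gw_zero in force)

text \<open>On a string of weights the trace of a sum of commutators vanishes.\<close>

lemma string_trace:
 assumes al: "onh al" and bt: "bt \<in> WT"
 shows "\<exists>r::real. \<forall>H\<in>D al. bt H = of_real r * al H"
proof -
 define P where "P ga k \<longleftrightarrow> ga = (%x. bt x + of_int k * al x)" for ga :: "'g => complex" and k :: int
 define F where "F = {ga \<in> WT. \<exists>k. P ga k}"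
 obtain kap where kap: "!!ga. ga \<in> F ==> P ga (kap ga)"
 proof -
  have "\<forall>ga. \<exists>k. ga \<in> F --> P ga k" by (auto simp: F_def)
  thus ?thesis using that by metis
 qed
 have F: "finite F" "!!ga. ga \<in> F ==> onh ga" using finite_WT by (auto simp: F_def WT_onh)
 have btF: "bt \<in> F" using bt by (auto simp: F_def P_def intro!: exI[of _ 0])
 let ?U = "span (\<Union>ga\<in>F. gw ga)"
 have gwU: "z \<in> ?U" if "z \<in> gw ga" "onh ga" "P ga k" for z ga k
 proof (cases "ga \<in> WT")
  case True
  hence "ga \<in> F" using that by (auto simp: F_def)
  thus ?thesis using that by (auto intro: span_base)
 next case False
  thus ?thesis using not_WT[OF that(2) False that(1)] span_zero by simp
 qed
 have st: "bracket x z \<in> ?U" if x: "x \<in> gw de" and d: "de = al \<or> de = - al" and z: "z \<in> ?U" for x z de using z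
 proof (induction rule: span_induct_alt)
  case base
  thus ?case by (simp add: bracket_zero_right span_zero)
 next case (step c y z)
  then obtain ga where ga: "ga \<in> F" "y \<in> gw ga" by auto
  then obtain k where k: "P ga k" "ga \<in> WT" by (auto simp: F_def)
  have "P (de + ga) (if de = al then k + 1 else k - 1)" using k(1) d by (auto simp: P_def fun_eq_iff algebra_simps)
  moreover have "onh (de + ga)" using d al WT_onh[OF k(2)] by (auto simp: onh_def)
  ultimately have "bracket x y \<in> ?U" using gwU gw_bracket[OF x ga(2)] by blast
  thus ?case using step by (simp add: bracket_add_right bracket_scale_right span_add span_scale)
 qed
 have "H \<in> h & tr ?U (bracket H) = 0" if "H \<in> D al" for H using that unfolding D_def
 proof (induction rule: span_induct_alt)
  case base
  have "tr ?U (bracket 0) = tr ?U (%z. scale 0 z)" by (simp only: ad_fun)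
  also have "\<dots> = 0 * tr ?U (%z. z)" by (rule tr_scale) (simp_all add: lin_iff)
  finally show ?case using subspace_0[OF h_subspace] by simp
 next case (step c v y)
  then obtain p q where pq: "v = bracket p q" "p \<in> gw al" "q \<in> gw (- al)" by auto
  have yh: "y \<in> h" and vh: "v \<in> h" using step gw_bracket[OF pq(2,3)] gw_zero pq(1) by auto
  have hU: "bracket H z \<in> ?U" if H: "H \<in> h" and z: "z \<in> ?U" for H z using z
  proof (induction rule: span_induct_alt)
   case base
   thus ?case by (simp add: bracket_zero_right span_zero)
  next case (step c y z)
   hence "bracket H y \<in> ?U" using gw_h_stable[OF H] by (auto intro!: span_base)
   thus ?case using step by (simp add: bracket_add_right bracket_scale_right span_add span_scale)
  qed
  have "tr ?U (bracket v) = tr ?U (%z. bracket p (bracket q z) - bracket q (bracket p z))" by (simp only: pq ad_fun)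
  also have "\<dots> = 0" by (rule tr_commutator[OF subspace_span lin_ad lin_ad]) (use st pq in auto)
  finally have v: "tr ?U (bracket v) = 0" .
  have "tr ?U (bracket (scale c v + y)) = tr ?U (%z. scale c (bracket v z) + bracket y z)" by (simp only: ad_fun)
  also have "\<dots> = tr ?U (%z. scale c (bracket v z)) + tr ?U (bracket y)" by (rule tr_add[OF subspace_span _ lin_ad])
    (use lin_ad[of v] hU vh yh span_scale in "auto simp: lin_iff scale_right_distrib")
  also have "tr ?U (%z. scale c (bracket v z)) = c * tr ?U (bracket v)" by (rule tr_scale[OF subspace_span lin_ad]) (use hU vh in auto)
  finally show ?case using v step subspace_add[OF h_subspace subspace_scale[OF h_subspace vh] yh] by simp
 qed
 hence zero: "tr ?U (bracket H) = 0" if "H \<in> D al" for H using that by blast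
 define N where "N = (\<Sum>ga\<in>F. dim (gw ga))"
 have "dim (gw bt) \<le> N" unfolding N_def by (rule member_le_sum[OF btF _ F(1)]) simp
 hence N: "N > 0" using dim_gw_pos[OF bt] by linarith
 \<comment> \<open>Minus the mean position of the members of the string, weighted by dimension. Its
   being real lets \<open>K_nondegenerate\<close> argue with sums of squares.\<close>
 define r where "r = - real_of_int (\<Sum>ga\<in>F. int (dim (gw ga)) * kap ga) / real N"
 have "bt H = of_real r * al H" if H: "H \<in> D al" for H
 proof -
  have "0 = (\<Sum>ga\<in>F. of_nat (dim (gw ga)) * ga H)" using zero[OF H] tr_gw_ad[OF F, of H] H D_h by (metis subsetD)
  also have "\<dots> = (\<Sum>ga\<in>F. of_nat (dim (gw ga)) * bt H + of_int (int (dim (gw ga)) * kap ga) * al H)"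
  proof (rule sum.cong[OF refl])
   fix ga assume "ga \<in> F"
   from kap[OF this] have "ga H = bt H + of_int (kap ga) * al H" unfolding P_def by (rule fun_cong)
   thus "of_nat (dim (gw ga)) * ga H = of_nat (dim (gw ga)) * bt H + of_int (int (dim (gw ga)) * kap ga) * al H"
    by (simp add: algebra_simps)
  qed
  also have "\<dots> = of_nat N * bt H + of_int (\<Sum>ga\<in>F. int (dim (gw ga)) * kap ga) * al H"
   by (simp add: sum.distrib N_def sum_distrib_right)
  finally have "of_nat N * bt H = - of_int (\<Sum>ga\<in>F. int (dim (gw ga)) * kap ga) * al H" by (simp add: eq_neg_iff_add_eq_0)
  moreover have "of_nat N * (of_real r * al H) = - of_int (\<Sum>ga\<in>F. int (dim (gw ga)) * kap ga) * al H"
   using N by (simp add: r_def del: of_int_sum)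
  ultimately show ?thesis using N by (metis mult_cancel_left of_nat_eq_0_iff less_numeral_extra(3))
 qed
 thus ?thesis by blast
qed

section \<open>The Killing form\<close>

definition K :: "'g => 'g => complex" where
 "K x y = tr UNIV (%z. bracket x (bracket y z))"

lemma lin_ad2: "lin (%z. bracket x (bracket y z))" by (rule lin_compose[OF lin_ad lin_ad])

lemma K_add: "K (x + x') y = K x y + K x' y"
 using tr_add[OF subspace_UNIV lin_ad2[of x y] lin_ad2[of x' y]] by (simp add: K_def bracket_add_left)

lemma K_scale: "K (scale c x) y = c * K x y" using tr_scale[OF subspace_UNIV lin_ad2[of x y]] by (simp add: K_def bracket_scale_left)

lemma K_sym: "K x y = K y x" unfolding K_def by (rule tr_commute[OF subspace_UNIV lin_ad lin_ad]) simp_all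

lemma K_add_right: "K x (y + y') = K x y + K x y'" by (simp add: K_sym[of x] K_add)

lemma K_scale_right: "K x (scale c y) = c * K x y" by (simp add: K_sym[of x] K_scale)

lemma K_zero: "K 0 y = 0" "K y 0 = 0" using K_scale[of 0 0 y] K_sym[of y 0] by simp_all

lemma K_diff: "K (x - x') y = K x y - K x' y" using K_add[of "x - x'" x' y] by simp

lemma K_invariant: "K (bracket x y) z = K x (bracket y z)"
proof -
 have l3: "lin (%w. bracket a (bracket b (bracket c w)))" for a b c by (rule lin_compose[OF lin_ad lin_ad2])
 have "K (bracket x y) z = tr UNIV (%w. bracket x (bracket y (bracket z w)) - bracket y (bracket x (bracket z w)))"
  by (simp add: K_def bracket_bracket_left)
 also have "\<dots> = tr UNIV (%w. bracket x (bracket y (bracket z w))) - tr UNIV (%w. bracket y (bracket x (bracket z w)))"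
  by (rule tr_diff[OF subspace_UNIV l3 l3]) simp_all
 also have "tr UNIV (%w. bracket y (bracket x (bracket z w))) = tr UNIV (%w. bracket x (bracket z (bracket y w)))"
  by (rule tr_commute[OF subspace_UNIV lin_ad lin_ad2]) simp_all
 also have "tr UNIV (%w. bracket x (bracket y (bracket z w))) - tr UNIV (%w. bracket x (bracket z (bracket y w))) =
   tr UNIV (%w. bracket x (bracket y (bracket z w)) - bracket x (bracket z (bracket y w)))"
  by (rule tr_diff[OF subspace_UNIV l3 l3, symmetric]) simp_all
 also have "\<dots> = K x (bracket y z)" by (simp add: K_def bracket_bracket_left bracket_diff_right)
 finally show ?thesis .
qed

text \<open>On the weight space of \<open>ga\<close> the square of \<open>ad H\<close> minus
  \<open>(ga H)^2\<close> is the product of the commuting operators \<open>ad H + ga H\<close> and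
  \<open>ad H - ga H\<close>, the second of which is nilpotent.\<close>

lemma K_h_self: "H \<in> h ==> K H H = (\<Sum>ga\<in>WT. of_nat (dim (gw ga)) * (ga H)\<^sup>2)" unfolding K_def span_WT[symmetric]
proof (rule tr_gw_sum[OF finite_WT _ lin_ad2])
 fix ga x assume H: "H \<in> h" and ga: "ga \<in> WT" "x \<in> gw ga"
 let ?p = "%y. bracket H y + scale (ga H) y" and ?q = "%y. bracket H y - scale (ga H) y"
 have com: "?p (?q y) = ?q (?p y)" for y by (simp add: bracket_add_right bracket_diff_right bracket_scale_right algebra_simps)
 have pq: "?p (?q y) = bracket H (bracket H y) - scale ((ga H)\<^sup>2) y" for y
  by (simp add: bracket_add_right bracket_diff_right bracket_scale_right algebra_simps power2_eq_square)
 obtain n where "(?q ^^ n) x = 0" using gw_nilpotent[OF H ga(2)] by blast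
 moreover have "lin ?p" by (simp add: lin_iff bracket_add_right bracket_scale_right algebra_simps)
 ultimately have "((%x. ?p (?q x)) ^^ n) x = 0" using funpow_compose_commute[of ?p ?q n x] com lin_0[OF lin_funpow] by simp
 thus "\<exists>n. ((%y. bracket H (bracket H y) - scale ((ga H)\<^sup>2) y) ^^ n) x = 0" unfolding pq by blast
qed (use gw_h_stable in "auto simp: WT_def")

lemma K_h: "H \<in> h ==> H' \<in> h ==> K H H' = (\<Sum>ga\<in>WT. of_nat (dim (gw ga)) * (ga H * ga H'))"
proof -
 assume H: "H \<in> h" "H' \<in> h"
 have "K (H + H') (H + H') = K H H + 2 * K H H' + K H' H'" by (simp add: K_add K_add_right K_sym[of H' H])
 moreover have "K (H + H') (H + H') = (\<Sum>ga\<in>WT. of_nat (dim (gw ga)) * (ga H + ga H')\<^sup>2)"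
  using H K_h_self[of "H + H'"] subspace_add[OF h_subspace] by (simp add: dual_props(1)[OF WT_dual])
 moreover have "(\<Sum>ga\<in>WT. of_nat (dim (gw ga)) * (ga H + ga H')\<^sup>2) = K H H +
   2 * (\<Sum>ga\<in>WT. of_nat (dim (gw ga)) * (ga H * ga H')) + K H' H'"
  using H by (simp add: K_h_self power2_eq_square algebra_simps sum.distrib sum_distrib_left)
 ultimately show ?thesis by simp
qed

text \<open>The product of \<open>ad x\<close> and \<open>ad y\<close> moves weights by
  \<open>al + bt\<close>. As there are finitely many weights, it is nilpotent unless this is
  0.\<close>

lemma K_orthogonal:
 assumes x: "x \<in> gw al" and y: "y \<in> gw bt" and on: "onh al" "onh bt" and ne: "al + bt ~= 0"
 shows "K x y = 0"
proof -
 let ?f = "%z. bracket x (bracket y z)"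
 have s: "shifted scale ?f 0 = ?f" by (simp add: shifted_def)
 have g: "gw ga <= gen ?f 0" if ga: "ga \<in> WT" for ga
 proof
  fix z assume z: "z \<in> gw ga"
  define c where "c n = (%v. ga v + of_nat n * (al + bt) v)" for n
  have m: "(?f ^^ n) z \<in> gw (c n)" for n
  proof (induction n)
   case (Suc n)
   have "?f ((?f ^^ n) z) \<in> gw (al + (bt + c n))" by (intro gw_bracket x y Suc)
   moreover have "al + (bt + c n) = c (Suc n)" by (auto simp: c_def fun_eq_iff algebra_simps)
   ultimately show ?case by simp
  qed (use z in "simp add: c_def")
  have "inj c"
  proof (rule injI)
   fix m n assume e: "c m = c n"
   obtain v where "(al + bt) v ~= 0" using ne by (auto simp: fun_eq_iff)
   moreover have "c m v = c n v" using e by simp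
   ultimately show "m = n" by (simp add: c_def)
  qed
  hence "\<not> range c <= WT" using finite_WT range_inj_infinite finite_subset by blast
  then obtain n where "c n \<notin> WT" by auto
  moreover have "onh (c n)" using on ga by (auto simp: c_def onh_def WT_def)
  ultimately have "(?f ^^ n) z = 0" using not_WT m by blast
  thus "z \<in> gen ?f 0" unfolding gen_def s by blast
 qed
 have "span (\<Union>ga\<in>WT. gw ga) <= gen ?f 0" by (rule span_minimal[OF _ subspace_gen[OF lin_ad2]]) (use g in auto)
 hence "\<exists>n. (?f ^^ n) z = 0" for z using span_WT by (auto simp: gen_def s)
 thus ?thesis unfolding K_def by (intro tr_nilpotent[OF subspace_UNIV lin_ad2]) auto
qed

lemma derived_all: "span {bracket x y | x y. True} = UNIV"
proof -
 let ?I = "span {bracket x y | x y. True}"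
 have "lie_ideal ?I" unfolding lie_ideal_def by (auto intro: span_base)
 hence "?I = {0} \<or> ?I = UNIV" using simple unfolding simple_def by blast
 moreover obtain x y where "bracket x y ~= 0" using simple unfolding simple_def by blast
 moreover have "bracket x y \<in> ?I" by (auto intro: span_base)
 ultimately show ?thesis by auto
qed

text \<open>The algebra is perfect, so an element of \<open>h\<close> is a sum of brackets of weight
  vectors; its component of weight 0 only sees brackets of opposite weights.\<close>

lemma h_span_D: "h <= span (\<Union>al\<in>WT. D al)"
proof
 fix H assume H: "H \<in> h"
 let ?E = "span (\<Union>al\<in>WT. D al)" and ?O = "span (\<Union>ga\<in>WT - {0}. gw ga)"
 have Eh: "?E <= h" by (rule span_minimal[OF _ h_subspace]) (use D_h in auto)
 have sub: "subspace {x + y | x y. x \<in> ?E & y \<in> ?O}" by (rule subspace_sums) auto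
 have base: "bracket x y \<in> {x + y | x y. x \<in> ?E & y \<in> ?O}"
  if al: "al \<in> WT" "x \<in> gw al" and bt: "bt \<in> WT" "y \<in> gw bt" for x y al bt
 proof (cases "al + bt = 0")
  case True
  hence "bt = - al" by (metis add_eq_0_iff)
  hence "bracket x y \<in> D al" using al bt unfolding D_def by (auto intro: span_base)
  hence "bracket x y \<in> ?E" using al by (auto intro: span_base)
  thus ?thesis using span_zero[of "\<Union>ga\<in>WT - {0}. gw ga"] by force
 next case False
  have "bracket x y \<in> ?O"
  proof (cases "al + bt \<in> WT")
   case True
   thus ?thesis using gw_bracket[OF al(2) bt(2)] False by (intro span_base) auto
  next case f: False
   have "onh (al + bt)" using al bt by (simp add: WT_def)
   thus ?thesis using not_WT[OF _ f gw_bracket[OF al(2) bt(2)]] span_zero by simp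
  qed
  thus ?thesis using span_zero[of "\<Union>al\<in>WT. D al"] by force
 qed
 let ?T = "{x + y | x y. x \<in> ?E & y \<in> ?O}"
 have b1: "bracket x y \<in> ?T" if x: "al \<in> WT" "x \<in> gw al" for x y al
 proof -
  have "span (\<Union>bt\<in>WT. gw bt) <= {y. bracket x y \<in> ?T}" by (rule span_minimal[OF _ module_hom.subspace_linear_preimage[OF
      lin_ad[unfolded Vector_Spaces.linear_iff_module_hom] sub]])
    (use base[OF x] in blast)
  thus ?thesis by (simp add: span_WT subset_eq)
 qed
 have b2: "bracket x y \<in> ?T" for x y
 proof -
  have "lin (%x. bracket x y)" by (simp add: lin_iff bracket_add_left bracket_scale_left)
  hence "subspace {x. bracket x y \<in> ?T}"
   using sub by (intro module_hom.subspace_linear_preimage) (simp_all add: Vector_Spaces.linear_iff_module_hom)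
  hence "span (\<Union>bt\<in>WT. gw bt) <= {x. bracket x y \<in> ?T}" by (rule span_minimal[rotated]) (use b1 in blast)
  thus ?thesis by (simp add: span_WT subset_eq)
 qed
 have "span {bracket x y | x y. True} <= ?T" by (rule span_minimal[OF _ sub]) (use b2 in blast)
 hence "H \<in> ?T" unfolding derived_all by (rule subsetD) (rule UNIV_I)
 then obtain e z where ez: "H = e + z" "e \<in> ?E" "z \<in> ?O" by blast
 have "z \<in> gw 0"
 proof -
  have "z = H - e" using ez by simp
  thus ?thesis using H ez(2) Eh subspace_diff[OF h_subspace] gw_zero by auto
 qed
 obtain x where x: "\<forall>ga\<in>WT - {0}. x ga \<in> gw ga" "z = sum x (WT - {0})"
  using span_Union_family[OF _ _ ez(3)] finite_WT gw_sub by blast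
 have eq: "sum (x(0 := - z)) (WT - {0}) = sum x (WT - {0})" by (rule sum.cong) auto
 have s: "sum (x(0 := - z)) (insert 0 (WT - {0})) = 0" using finite_WT eq x(2) by (subst sum.insert) auto
 have "(x(0 := - z)) 0 = 0"
 proof (rule gw_indep[OF _ _ _ s])
  show "(x(0 := - z)) bt \<in> gw bt" if "bt \<in> insert 0 (WT - {0})" for bt
   using that x(1) subspace_neg[OF gw_sub \<open>z \<in> gw 0\<close>] by (cases "bt = 0") auto
 qed (use finite_WT WT_onh in auto)
 thus "H \<in> ?E" using ez by simp
qed

end

context fd_simple
begin

text \<open>The radical is an ideal. Were it everything, then for \<open>H\<close> in
  \<open>D al\<close> the vanishing of \<open>K H H\<close> would be that of \<open>(al H)^2\<close>
  times a sum of real squares, so all weights vanish on \<open>D al\<close> and hence on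
  \<open>h\<close>. Then \<open>h\<close> is the whole algebra, which would be nilpotent and perfect
  at once.\<close>

lemma K_nondegenerate:
 assumes "!!y. K x y = 0"
 shows "x = 0"
proof -
 let ?R = "{x. \<forall>y. K x y = 0}"
 have "lie_ideal ?R" unfolding lie_ideal_def
 proof (intro conjI allI ballI)
  show "subspace ?R" by (rule subspaceI) (auto simp: K_zero K_add K_scale)
  fix y x assume "x \<in> ?R"
  hence "K (bracket x y) z = 0" for z by (simp add: K_invariant)
  hence "K (bracket y x) z = 0" for z using K_scale[of "-1" "bracket x y" z] by (simp add: bracket_antisym[of y x])
  thus "bracket y x \<in> ?R" by simp
 qed
 hence R: "?R = {0} \<or> ?R = UNIV" using simple unfolding simple_def by metis
 have "?R ~= UNIV"
 proof
  assume U: "?R = UNIV"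
  hence KK: "K x y = 0" for x y by auto
  have D0: "bt H = 0" if al: "al \<in> WT" and H: "H \<in> D al" and bt: "bt \<in> WT" for al bt H
  proof -
   have Hh: "H \<in> h" using H D_h by auto
   obtain r where r: "!!ga. ga \<in> WT ==> ga H = of_real (r ga) * al H"
   proof -
    have "\<forall>ga. \<exists>r::real. ga \<in> WT --> ga H = of_real r * al H" using string_trace[OF WT_onh[OF al]] H by blast
    thus ?thesis using that by metis
   qed
   have "0 = (\<Sum>ga\<in>WT. of_nat (dim (gw ga)) * (ga H)\<^sup>2)" using K_h_self[OF Hh] KK by simp
   also have "\<dots> = (\<Sum>ga\<in>WT. of_real (real (dim (gw ga)) * (r ga)\<^sup>2) * (al H)\<^sup>2)"
    by (rule sum.cong[OF refl]) (simp add: r power_mult_distrib)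
   also have "\<dots> = of_real (\<Sum>ga\<in>WT. real (dim (gw ga)) * (r ga)\<^sup>2) * (al H)\<^sup>2" by (simp add: sum_distrib_right)
   finally have "of_real (\<Sum>ga\<in>WT. real (dim (gw ga)) * (r ga)\<^sup>2) * (al H)\<^sup>2 = 0" by (rule sym)
   then consider "al H = 0" | "(\<Sum>ga\<in>WT. real (dim (gw ga)) * (r ga)\<^sup>2) = 0"
    unfolding mult_eq_0_iff of_real_eq_0_iff power_eq_0_iff by auto
   thus ?thesis
   proof cases
    case 1
    thus ?thesis using r[OF bt] by simp
   next case 2
    hence "real (dim (gw bt)) * (r bt)\<^sup>2 = 0" using sum_nonneg_0[OF finite_WT _ 2 bt] by simp
    hence "r bt = 0" using dim_gw_pos[OF bt] by (simp del: dim_eq_0)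
    thus ?thesis using r[OF bt] by simp
   qed
  qed
  have b0: "bt = 0" if bt: "bt \<in> WT" for bt
  proof -
   note d = dual_props[OF WT_dual[OF bt]]
   have "H \<in> h & bt H = 0" if "H \<in> span (\<Union>al\<in>WT. D al)" for H using that
   proof (induction rule: span_induct_alt)
    case base
    thus ?case using subspace_0[OF h_subspace] d(4) by simp
   next case (step c x y)
    then obtain al where al: "al \<in> WT" "x \<in> D al" by auto
    hence "x \<in> h" "bt x = 0" using D0[OF al bt] D_h by auto
    thus ?case using step d(1,2) subspace_add[OF h_subspace] subspace_scale[OF h_subspace] by simp
   qed
   thus ?thesis using h_span_D d(3) by (auto simp: fun_eq_iff subset_eq)
  qed
  have "gw bt <= h" if "bt \<in> WT" for bt using b0[OF that] gw_zero by simp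
  hence "span (\<Union>bt\<in>WT. gw bt) <= h" by (intro span_minimal h_subspace) auto
  hence hU: "h = UNIV" using span_WT by auto
  obtain n where n: "lower_central_series UNIV n = {0}" using cartan hU by (auto simp: cartan_subalgebra_def nilpotent_def)
  have "lower_central_series UNIV n = UNIV" for n by (induction n) (simp_all add: bracket_span_def derived_all[simplified])
  hence "(UNIV :: 'g set) = {0}" using n by simp
  hence "bracket x y = 0" for x y by auto
  thus False using simple unfolding simple_def by simp
 qed
 hence "?R = {0}" using R by simp
 moreover have "x \<in> ?R" using assms by simp
 ultimately show ?thesis by auto
qed

lemma span_gw_induct:
 assumes "!!ga x. ga \<in> WT ==> x \<in> gw ga ==> x \<in> S" "subspace S"
 shows "x \<in> S"
proof -
 have "span (\<Union>bt\<in>WT. gw bt) <= S" by (rule span_minimal[OF _ assms(2)]) (use assms(1) in auto)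
 thus ?thesis by (simp add: span_WT subset_eq)
qed

lemma subspace_K: "subspace {y. K x y = 0}" by (rule subspaceI) (auto simp: K_zero K_add_right K_scale_right)

lemma gw_zero_iff: "x \<in> gw 0 \<longleftrightarrow> x \<in> h" by (simp add: gw_zero)

lemma K_nondegenerate_h:
 assumes x: "x \<in> h" and K: "!!y. y \<in> h ==> K x y = 0"
 shows "x = 0"
proof (rule K_nondegenerate)
 fix y
 have "y \<in> {y. K x y = 0}"
 proof (rule span_gw_induct[OF _ subspace_K])
  fix ga z assume ga: "ga \<in> WT" "z \<in> gw ga"
  show "z \<in> {y. K x y = 0}"
  proof (cases "ga = 0")
   case True
   thus ?thesis using ga K gw_zero by simp
  next case False
   thus ?thesis using K_orthogonal[of x 0 z ga] ga x gw_zero_iff WT_onh by simp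
  qed
 qed
 thus "K x y = 0" by simp
qed

text \<open>By the formula \<open>K_h\<close> such an \<open>H\<close> is orthogonal to
  \<open>h\<close>.\<close>

lemma h_separating:
 assumes H: "H \<in> h" and 0: "!!bt. bt \<in> WT ==> bt ~= 0 ==> bt H = 0"
 shows "H = 0"
proof (rule K_nondegenerate_h[OF H])
 fix y assume "y \<in> h"
 hence "K H y = (\<Sum>ga\<in>WT. of_nat (dim (gw ga)) * (ga H * ga y))" by (rule K_h[OF H])
 also have "\<dots> = 0" using 0 by (intro sum.neutral ballI) (metis mult_eq_0_iff zero_fun_apply)
 finally show "K H y = 0" .
qed

text \<open>A commutator acts with trace zero on each weight space, so every weight vanishes on
  it.\<close>

lemma h_abelian:
 assumes "x \<in> h" "y \<in> h"
 shows "bracket x y = 0"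
proof (rule h_separating)
 show "bracket x y \<in> h" using assms h_bracket by simp
 fix bt assume bt: "bt \<in> WT"
 have "of_nat (dim (gw bt)) * bt (bracket x y) = tr (gw bt) (bracket (bracket x y))" using tr_gw assms h_bracket by simp
 also have "\<dots> = 0" unfolding ad_fun by (rule tr_commutator[OF gw_sub lin_ad lin_ad]) (use assms gw_h_stable in auto)
 finally show "bt (bracket x y) = 0" using dim_gw_pos[OF bt] by (simp del: dim_eq_0)
qed

section \<open>Root vectors and one-dimensionality of the root spaces\<close>

lemma weight_vector:
 assumes al: "al \<in> WT"
 obtains e where "e \<in> gw al" "e ~= 0" "!!H. H \<in> h ==> bracket H e = scale (al H) e"
proof -
 obtain Bs where Bs: "independent Bs" "span Bs = h" "finite Bs" "Bs <= h" using subspace_basis[OF h_subspace] by metis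
 obtain bs where bs: "set bs = Bs" using finite_list[OF Bs(3)] by blast
 let ?f = "%H. shifted scale (bracket H) (al H)"
 \<comment> \<open>The shifts are nilpotent on the generalized weight space and commute because
   \<open>h\<close> is abelian.\<close>
 have "\<exists>x\<in>gw al. x \<notin> {0} & (\<forall>f\<in>set (map ?f bs). f x \<in> {0})"
 proof (rule common_kernel)
  show "lin f" if "f \<in> set (map ?f bs)" for f using that lin_shifted[OF lin_ad] by auto
  thus "f x \<in> {0}" if "f \<in> set (map ?f bs)" "x \<in> {0}" for f x using that lin_0[of f] by auto
  show "\<not> gw al <= {0}" using al subspace_0[OF gw_sub[of al]] unfolding WT_def by blast
  show "f x \<in> gw al" if "f \<in> set (map ?f bs)" "x \<in> gw al" for f x using that bs Bs(4) gw_h_stable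
   by (auto simp: shifted_def intro!: subspace_diff[OF gw_sub] subspace_scale[OF gw_sub])
  show "\<exists>n. (f ^^ n) x \<in> {0}" if "f \<in> set (map ?f bs)" "x \<in> gw al" for f x
   using that bs Bs(4) by (auto simp: gspace_def gen_def)
  show "f (g x) - g (f x) \<in> {0}" if asm: "f \<in> set (map ?f bs)" "g \<in> set (map ?f bs)" "x \<in> gw al" for f g x
  proof -
   obtain H H' where HH: "H \<in> h" "H' \<in> h" "f = ?f H" "g = ?f H'" using asm(1,2) bs Bs(4) by auto
   thus ?thesis using h_abelian[of H H'] bracket_bracket_right[of H H' x]
    by (simp add: shifted_def bracket_diff_right bracket_scale_right algebra_simps bracket_zero_left)
  qed
 qed (use gw_sub in auto)
 then obtain e where e: "e \<in> gw al" "e ~= 0" "!!H. H \<in> Bs ==> bracket H e = scale (al H) e" using bs by (auto simp: shifted_def)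
 have "H \<in> h & bracket H e = scale (al H) e" if "H \<in> span Bs" for H using that
 proof (induction rule: span_induct_alt)
  case base
  thus ?case using subspace_0[OF h_subspace] dual_props(4)[OF WT_dual[OF al]] by (simp add: bracket_zero_left)
 next case (step c x y)
  hence "x \<in> h" using Bs(4) by auto
  thus ?case using step e(3) subspace_add[OF h_subspace] subspace_scale[OF h_subspace]
   by (simp add: bracket_add_left bracket_scale_left dual_props[OF WT_dual[OF al]] scale_left_distrib)
 qed
 thus ?thesis using that[OF e(1,2)] Bs(2) by simp
qed

lemma K_pairing:
 assumes al: "onh al" and e: "e \<in> gw al" "e ~= 0"
 obtains f where "f \<in> gw (- al)" "K e f ~= 0"
proof (rule ccontr)
 assume n: "\<not> thesis"
 have "e = 0"
 proof (rule K_nondegenerate)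
  fix y
  have "y \<in> {y. K e y = 0}"
  proof (rule span_gw_induct[OF _ subspace_K])
   fix ga z assume ga: "ga \<in> WT" "z \<in> gw ga"
   show "z \<in> {y. K e y = 0}"
   proof (cases "al + ga = 0")
    case True
    hence "ga = - al" by (metis add_eq_0_iff)
    thus ?thesis using n that ga(2) by auto
   next case False
    thus ?thesis using K_orthogonal[OF e(1) ga(2) al WT_onh[OF ga(1)]] by simp
   qed
  qed
  thus "K e y = 0" by simp
 qed
 thus False using e by simp
qed

lemma WT_minus:
 assumes "al \<in> WT"
 shows "- al \<in> WT"
proof -
 obtain e where e: "e \<in> gw al" "e ~= 0" using assms subspace_0[OF gw_sub[of al]] unfolding WT_def by auto
 obtain f where f: "f \<in> gw (- al)" "K e f ~= 0" using K_pairing[OF WT_onh[OF assms] e] by metis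
 hence "f ~= 0" using K_zero by auto
 thus ?thesis using f WT_onh[OF assms] unfolding WT_def by auto
qed

lemma K_bracket_h:
 assumes "H \<in> h" "bracket H e = scale c e"
 shows "K H (bracket e f) = c * K e f" using K_invariant[of H e f] assms by (simp add: K_scale)

text \<open>Invariance gives \<open>K H (bracket e f) = al H * K e f\<close>, so the bracket is
  nonzero. Were \<open>al\<close> to vanish on it, \<open>string_trace\<close> would make all
  weights vanish there, against \<open>h_separating\<close>.\<close>

lemma root_triple:
 assumes al: "al \<in> WT" "al ~= 0"
 obtains e f where "e \<in> gw al" "e ~= 0" "!!H. H \<in> h ==> bracket H e = scale (al H) e"
  "f \<in> gw (- al)" "K e f ~= 0" "al (bracket e f) ~= 0"
proof -
 obtain e where e: "e \<in> gw al" "e ~= 0" and He: "!!H. H \<in> h ==> bracket H e = scale (al H) e" using weight_vector[OF al(1)] by metis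
 obtain f where f: "f \<in> gw (- al)" "K e f ~= 0" using K_pairing[OF WT_onh[OF al(1)] e] by metis
 define t where "t = bracket e f"
 have th: "t \<in> h" using gw_bracket[OF e(1) f(1)] gw_zero by (simp add: t_def)
 have Kt: "K H (bracket e y) = al H * K e y" if "H \<in> h" for H y using K_bracket_h[OF that He[OF that]] .
 have t0: "t ~= 0"
 proof
  assume "t = 0"
  hence "al H = 0" if "H \<in> h" for H using Kt[OF that, of f] f(2) by (simp add: t_def K_zero)
  thus False using al dual_props(3)[OF WT_dual[OF al(1)]] by (metis ext zero_fun_apply)
 qed
 have tD: "t \<in> D al" unfolding D_def t_def using e f by (auto intro: span_base)
 have alt: "al t ~= 0"
 proof
  assume 0: "al t = 0"
  have "t = 0"
  proof (rule h_separating[OF th])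
   show "bt t = 0" if "bt \<in> WT" for bt using string_trace[OF WT_onh[OF al(1)] that] tD 0 by auto
  qed
  thus False using t0 by simp
 qed
 thus ?thesis using that[OF e He f] by (simp add: t_def)
qed

text \<open>The span of \<open>e\<close>, of \<open>t = bracket e f\<close> and of the weight spaces
  of \<open>- k al\<close> with \<open>k > 0\<close> is stable under \<open>ad e\<close> and
  \<open>ad f\<close>, so \<open>ad t\<close> has trace zero on it. The trace is \<open>al t\<close>
  times 1 minus the sum of \<open>k\<close> times the dimension at \<open>- k al\<close>. That sum
  is therefore 1, and the term for \<open>k = 1\<close> is at least 1 already.\<close>

lemma dim_gw_minus:
 assumes al: "al \<in> WT" "al ~= 0"
 shows "dim (gw (- al)) = 1"
proof -
 obtain e f where e: "e \<in> gw al" "e ~= 0" and He: "!!H. H \<in> h ==> bracket H e = scale (al H) e"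
  and f: "f \<in> gw (- al)" "K e f ~= 0" and alef: "al (bracket e f) ~= 0" using root_triple[OF al] by metis
 define t where "t = bracket e f"
 have th: "t \<in> h" using gw_bracket[OF e(1) f(1)] gw_zero by (simp add: t_def)
 have Kt: "K H (bracket e y) = al H * K e y" if "H \<in> h" for H y using K_bracket_h[OF that He[OF that]] .
 have alt: "al t ~= 0" using alef by (simp add: t_def)
 define P where "P ga k \<longleftrightarrow> k > 0 & ga = (%x. - of_nat k * al x)" for ga :: "'g => complex" and k :: nat
 define F where "F = {ga \<in> WT. \<exists>k. P ga k}"
 obtain kap where kap: "!!ga. ga \<in> F ==> P ga (kap ga)"
 proof -
  have "\<forall>ga. \<exists>k. ga \<in> F --> P ga k" by (auto simp: F_def)
  thus ?thesis using that by metis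
 qed
 have nF: "al \<notin> F" "0 \<notin> F"
 proof -
  show "al \<notin> F"
  proof
   assume "al \<in> F"
   from kap[OF this] have "al t = - of_nat (kap al) * al t" unfolding P_def by (metis (no_types, lifting))
   hence "(1 + of_nat (kap al)) * al t = 0" by (simp add: distrib_right) (metis add.commute add.right_inverse)
   hence "(of_nat (Suc (kap al)) :: complex) = 0" using alt by simp
   thus False using of_nat_neq_0 by blast
  qed
  show "0 \<notin> F"
  proof
   assume "0 \<in> F"
   from kap[OF this] have "0 = - of_nat (kap 0) * al t" "kap 0 > 0" unfolding P_def by (metis (no_types, lifting) zero_fun_apply)+
   thus False using alt by simp
  qed
 qed
 \<comment> \<open>In the weights \<open>al\<close> and 0 only the lines of \<open>e\<close> and
   \<open>t\<close> are kept: \<open>e\<close> then counts once, whatever the dimension of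
   \<open>gw al\<close>.\<close>
 define S where "S ga = (if ga = al then span {e} else if ga = 0 then span {t} else gw ga)" for ga
 define I where "I = insert al (insert 0 F)"
 let ?U = "span (\<Union>ga\<in>I. S ga)"
 have Sgw: "S ga <= gw ga" for ga
  unfolding S_def using e th gw_zero span_minimal[OF _ gw_sub[of al], of "{e}"] span_minimal[OF _ gw_sub[of 0], of "{t}"] by auto
 have Ssub: "subspace (S ga)" for ga unfolding S_def using gw_sub by auto
 have Ifin: "finite I" and Ion: "!!ga. ga \<in> I ==> onh ga" using finite_WT WT_onh al by (auto simp: I_def F_def)
 have eU: "e \<in> ?U" and tU: "t \<in> ?U"
 proof -
  have "e \<in> S al" "t \<in> S 0" using al by (auto simp: S_def intro: span_base)
  thus "e \<in> ?U" "t \<in> ?U" by (auto simp: I_def intro!: span_base)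
 qed
 have gwU: "z \<in> ?U" if z: "z \<in> gw ga" "onh ga" "P ga k" for z ga k
 proof (cases "ga \<in> WT")
  case True
  hence "ga \<in> F" using z by (auto simp: F_def)
  moreover have "ga ~= al" "ga ~= 0" using nF calculation by auto
  ultimately have "z \<in> S ga" "ga \<in> I" using z by (auto simp: S_def I_def)
  thus ?thesis by (auto intro: span_base)
 next case False
  thus ?thesis using not_WT[OF z(2) False z(1)] span_zero by simp
 qed
 have te: "bracket e t = scale (- al t) e" using He[OF th] bracket_antisym[of e t] by simp
 have SI: "(\<exists>c. y = scale c e) \<or> (\<exists>c. y = scale c t) \<or> (\<exists>k. P ga k & y \<in> gw ga & onh ga)"
  if "ga \<in> I" "y \<in> S ga" for ga y
 proof (cases "ga = al \<or> ga = 0")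
  case True
  thus ?thesis using that(2) by (auto simp: S_def span_singleton split: if_splits)
 next case False
  hence "P ga (kap ga)" "y \<in> gw ga" using that kap by (auto simp: I_def S_def)
  thus ?thesis using Ion[OF that(1)] by blast
 qed
 have ey: "bracket e y \<in> ?U" if "ga \<in> I" "y \<in> S ga" for y ga using SI[OF that]
 proof (elim disjE exE conjE)
  fix k assume k: "P ga k" and y: "y \<in> gw ga" "onh ga"
  show ?thesis
  proof (cases "k = 1")
   case True
   hence g: "ga = - al" using k by (auto simp: P_def fun_eq_iff)
   have "bracket e y \<in> h" using gw_bracket[OF e(1) y(1)] g gw_zero by simp
   define c where "c = K e y / K e f"
   have "bracket e y - scale c t = 0"
   proof (rule K_nondegenerate_h)
    show "bracket e y - scale c t \<in> h"
     using \<open>bracket e y \<in> h\<close> th by (simp add: subspace_diff[OF h_subspace] subspace_scale[OF h_subspace])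
    fix H assume H: "H \<in> h"
    have "K H (bracket e y) = K H (scale c t)" using Kt[OF H] f(2) by (simp add: K_scale_right c_def t_def)
    thus "K (bracket e y - scale c t) H = 0" using K_sym[of H] by (simp add: K_diff)
   qed
   thus ?thesis using tU by (simp add: span_scale)
  next case False
   hence "P (al + ga) (k - 1)" using k by (auto simp: P_def fun_eq_iff of_nat_diff algebra_simps)
   thus ?thesis using gwU[OF gw_bracket[OF e(1) y(1)]] onh_simps(3)[OF WT_onh[OF al(1)] y(2)] by blast
  qed
 qed (use eU te in "auto simp: bracket_scale_right bracket_self span_zero span_scale span_neg")
 have fy: "bracket f y \<in> ?U" if "ga \<in> I" "y \<in> S ga" for y ga using SI[OF that]
 proof (elim disjE exE conjE)
  fix c assume "y = scale c e"
  hence "bracket f y = scale (- c) t" using bracket_antisym[of f e] by (simp add: bracket_scale_right t_def)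
  thus ?thesis using tU by (simp add: span_scale span_neg)
 next
  fix c assume y: "y = scale c t"
  have "P (- al) 1" by (auto simp: P_def)
  moreover have "bracket f t \<in> gw (- al + 0)" by (rule gw_bracket[OF f(1)]) (simp add: th gw_zero)
  ultimately have "bracket f t \<in> ?U" using gwU[of "bracket f t" "- al" 1] WT_onh[OF al(1)] by simp
  thus ?thesis using y by (simp add: bracket_scale_right span_scale)
 next
  fix k assume k: "P ga k" and y: "y \<in> gw ga" "onh ga"
  hence "P (- al + ga) (k + 1)" by (auto simp: P_def fun_eq_iff algebra_simps)
  thus ?thesis using gwU[OF gw_bracket[OF f(1) y(1)]] onh_simps(3)[OF onh_simps(2)[OF WT_onh[OF al(1)]] y(2)] by blast
 qed
 have stU: "bracket x z \<in> ?U" if x: "!!ga y. ga \<in> I ==> y \<in> S ga ==> bracket x y \<in> ?U" and z: "z \<in> ?U" for x z using z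
 proof (induction rule: span_induct_alt)
  case (step c y z)
  thus ?case using x by (auto simp: bracket_add_right bracket_scale_right intro!: span_add span_scale)
 qed (simp add: bracket_zero_right span_zero)
 have tS: "bracket t y \<in> S ga" if "ga \<in> I" "y \<in> S ga" for ga y
 proof (cases "ga = al \<or> ga = 0")
  case True
  thus ?thesis using that(2) He[OF th] al(2) by (auto simp: S_def span_singleton bracket_scale_right bracket_self split: if_splits)
 next case False
  thus ?thesis using that(2) gw_h_stable[OF th] by (simp add: S_def)
 qed
 have "0 = tr ?U (%z. bracket e (bracket f z) - bracket f (bracket e z))"
  by (rule tr_commutator[OF subspace_span lin_ad lin_ad, symmetric]) (use stU ey fy in auto)
 also have "\<dots> = tr ?U (bracket t)" by (simp only: t_def ad_fun)
 also have "\<dots> = (\<Sum>ga\<in>I. tr (S ga) (bracket t))"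
 proof (rule tr_direct_sum_family[OF Ifin Ssub _ lin_ad tS])
  show "x ga = 0" if "!!ga. ga \<in> I ==> x ga \<in> S ga" "sum x I = 0" "ga \<in> I" for x ga
   by (rule gw_indep[OF Ifin]) (use that Sgw Ion in auto)
 qed
 also have "\<dots> = (\<Sum>ga\<in>I. of_nat (dim (S ga)) * ga t)"
 proof (rule sum.cong[OF refl])
  fix ga assume ga: "ga \<in> I"
  show "tr (S ga) (bracket t) = of_nat (dim (S ga)) * ga t"
   using Sgw by (intro tr_generalized_eigen[OF Ssub lin_ad tS[OF ga]] gw_nilpotent[OF th]) (auto dest: subsetD)
 qed
 also have "\<dots> = al t + (\<Sum>ga\<in>F. of_nat (dim (gw ga)) * ga t)"
 proof -
  have "(\<Sum>ga\<in>F. of_nat (dim (S ga)) * ga t) = (\<Sum>ga\<in>F. of_nat (dim (gw ga)) * ga t)"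
   by (rule sum.cong) (use nF in "auto simp: S_def")
  moreover have "dim (S al) = 1" using e(2) by (simp add: S_def)
  moreover have "finite F" using Ifin by (simp add: I_def)
  ultimately show ?thesis using nF al(2) by (simp add: I_def)
 qed
 also have "\<dots> = al t - of_nat (\<Sum>ga\<in>F. dim (gw ga) * kap ga) * al t"
 proof -
  have "of_nat (dim (gw ga)) * ga t = - (of_nat (dim (gw ga) * kap ga) * al t)" if "ga \<in> F" for ga
  proof -
   have "ga t = - of_nat (kap ga) * al t" using kap[OF that] unfolding P_def by (metis (no_types, lifting))
   thus ?thesis by simp
  qed
  thus ?thesis by (simp add: sum_negf sum_distrib_right)
 qed
 finally have "(1 - of_nat (\<Sum>ga\<in>F. dim (gw ga) * kap ga)) * al t = 0" by (simp add: algebra_simps)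
 hence one: "(\<Sum>ga\<in>F. dim (gw ga) * kap ga) = 1"
  using alt by (metis diff_eq_diff_eq diff_self mult_eq_0_iff of_nat_1 of_nat_eq_iff right_minus_eq)
 have mF: "- al \<in> F" using WT_minus[OF al(1)] by (auto simp: F_def P_def intro!: exI[of _ 1])
 have "dim (gw (- al)) * kap (- al) \<le> (\<Sum>ga\<in>F. dim (gw ga) * kap ga)"
  by (rule member_le_sum[OF mF]) (use Ifin in "auto simp: I_def")
 moreover have "kap (- al) > 0" using kap[OF mF] by (simp add: P_def)
 ultimately have "dim (gw (- al)) \<le> 1"
  using one by (metis less_one linorder_not_less mult_le_cancel2 nat_mult_1_right order.strict_trans2 Suc_leI le_trans mult.right_neutral One_nat_def mult_le_mono2)
 thus ?thesis using dim_gw_pos[OF WT_minus[OF al(1)]] by linarith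
qed

lemma dim_gw: "al \<in> WT ==> al ~= 0 ==> dim (gw al) = 1" using dim_gw_minus[OF WT_minus[of al]] by simp

lemma gw_line:
 assumes "al \<in> WT" "al ~= 0" "e \<in> gw al" "e ~= 0"
 shows "gw al = span {e}"
proof -
 have "span {e} <= gw al" using assms gw_sub by (simp add: span_minimal)
 thus ?thesis using subspace_dim_equal[of "span {e}" "gw al"] gw_sub dim_gw[OF assms(1,2)] assms(4) by auto
qed

text \<open>Dimension one at nonzero weights, and commutativity of \<open>h\<close> at weight 0,
  leave no room for properly generalized weight vectors.\<close>

lemma gw_root_space:
 assumes "al \<in> WT"
 shows "gw al = root_space al"
proof
 show "gw al <= root_space al"
 proof (cases "al = 0")
  case True
  thus ?thesis using gw_zero h_abelian by (auto simp: root_space_def)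
 next case False
  obtain e where e: "e \<in> gw al" "e ~= 0" "!!H. H \<in> h ==> bracket H e = scale (al H) e" using weight_vector[OF assms] by metis
  thus ?thesis using gw_line[OF assms False e(1,2)] by (auto simp: root_space_def span_singleton bracket_scale_right mult.commute)
 qed
 show "root_space al <= gw al" by (auto simp: root_space_def gspace_def gen_def shifted_def intro!: exI[of _ 1])
qed

lemma root_space_gw: "root_space al <= gw al" by (auto simp: root_space_def gspace_def gen_def shifted_def intro!: exI[of _ 1])

lemma roots_WT: "roots = WT - {0}"
proof
 show "roots <= WT - {0}"
 proof
  fix al assume al: "al \<in> roots"
  have "0 \<in> root_space al" by (simp add: root_space_def bracket_zero_right)
  hence "gw al ~= {0}" using al root_space_gw[of al] unfolding roots_def by auto
  thus "al \<in> WT - {0}" using al dual_props(5) unfolding roots_def WT_def zero_fun_def[symmetric] by simp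
 qed
 show "WT - {0} <= roots"
 proof
  fix al assume al: "al \<in> WT - {0}"
  hence "gw al ~= {0}" by (simp add: WT_def)
  thus "al \<in> roots" using al gw_root_space WT_dual unfolding roots_def zero_fun_def[symmetric] by auto
 qed
qed

end

section \<open>Representations of \<open>sl\<^sub>2\<close>\<close>

text \<open>\<open>C c\<close> plays the role of the weight space of weight \<open>c\<close>; only the values of the
  commutator of \<open>e\<close> and \<open>f\<close> on these sets matter.\<close>

locale sl2_weights = vector_space scale
 for scale :: "complex => 'v::ab_group_add => 'v" +
 fixes e f :: "'v => 'v" and C :: "complex => 'v set"
 assumes e_add: "e (x + y) = e x + e y" and e_scale: "e (scale c x) = scale c (e x)"
  and f_add: "f (x + y) = f x + f y" and f_scale: "f (scale c x) = scale c (f x)"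
  and e_C: "x \<in> C c ==> e x \<in> C (c + 2)" and f_C: "x \<in> C c ==> f x \<in> C (c - 2)"
  and commute: "x \<in> C c ==> e (f x) - f (e x) = scale c x"
begin

lemma e_0: "e 0 = 0" using e_scale[of 0 0] by simp

lemma f_0: "f 0 = 0" using f_scale[of 0 0] by simp

lemma e_pow_0: "(e ^^ n) 0 = 0" by (induction n) (simp_all add: e_0)

lemma e_pow_C: "x \<in> C c ==> (e ^^ n) x \<in> C (c + 2 * of_nat n)"
proof (induction n)
 case (Suc n)
 thus ?case using e_C[of "(e ^^ n) x" "c + 2 * of_nat n"] by (simp add: algebra_simps)
qed simp

lemma e_pow_f:
 "x \<in> C c ==> (e ^^ n) (f x) = f ((e ^^ n) x) + scale (of_nat n * (c + of_nat n - 1)) ((e ^^ (n - 1)) x)"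
proof (induction n)
 case (Suc n)
 have 1: "e (f ((e ^^ n) x)) = f ((e ^^ Suc n) x) + scale (c + 2 * of_nat n) ((e ^^ n) x)"
  using commute[OF e_pow_C[OF Suc.prems, of n]] by (simp add: algebra_simps)
 have 2: "e (scale (of_nat n * (c + of_nat n - 1)) ((e ^^ (n - 1)) x)) =
   scale (of_nat n * (c + of_nat n - 1)) ((e ^^ n) x)" by (cases n) (simp_all add: e_scale e_0)
 have "(e ^^ Suc n) (f x) = e (f ((e ^^ n) x)) + e (scale (of_nat n * (c + of_nat n - 1)) ((e ^^ (n - 1)) x))"
  using Suc by (simp add: e_add)
 also have "\<dots> = f ((e ^^ Suc n) x) +
   (scale (c + 2 * of_nat n) ((e ^^ n) x) + scale (of_nat n * (c + of_nat n - 1)) ((e ^^ n) x))" unfolding 1 2 by simp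
 also have "scale (c + 2 * of_nat n) ((e ^^ n) x) + scale (of_nat n * (c + of_nat n - 1)) ((e ^^ n) x) =
   scale (of_nat (Suc n) * (c + of_nat (Suc n) - 1)) ((e ^^ (Suc n - 1)) x)" by (simp add: algebra_simps flip: scale_left_distrib)
 finally show ?case .
qed (simp add: f_0)

lemma lowest_e_pow:
 assumes "x \<in> C c" "f x = 0"
 shows "f ((e ^^ n) x) = scale (- of_nat n * (c + of_nat n - 1)) ((e ^^ (n - 1)) x)"
 using e_pow_f[OF assms(1), of n] assms(2) by (simp add: e_pow_0 add_eq_0_iff)

text \<open>Applying \<open>f\<close> to the power \<open>n\<close> of \<open>e\<close> gives back
  the power \<open>n - 1\<close> with coefficient \<open>n (p - n + 1)\<close>, nonzero for
  \<open>1 <= n <= p\<close>.\<close>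

lemma lowest_e_pow_nonzero:
 assumes "x \<in> C (- of_nat p)" "f x = 0" "n \<le> p" "(e ^^ n) x = 0"
 shows "x = 0" using assms(3,4)
proof (induction n)
 case (Suc n)
 have "of_nat n ~= (of_nat p :: complex)" using Suc.prems by simp
 hence "- of_nat (Suc n) * (- of_nat p + of_nat (Suc n) - 1) ~= (0 :: complex)"
  using of_nat_neq_0[of n, where 'a = complex] by (simp del: of_nat_Suc) (simp add: add_eq_0_iff)
 moreover have "0 = scale (- of_nat (Suc n) * (- of_nat p + of_nat (Suc n) - 1)) ((e ^^ n) x)"
  using lowest_e_pow[OF assms(1,2), of "Suc n"] Suc.prems(2) f_0 by simp
 ultimately have "(e ^^ n) x = 0" by (metis scale_eq_0_iff)
 thus ?case using Suc by simp
qed simp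

text \<open>The later nonvanishing arguments rest on this. By induction on \<open>s\<close>, the
  vector \<open>f x\<close>, of weight \<open>- (p + 2)\<close> and killed by the power
  \<open>p + 2\<close> of \<open>e\<close>, is zero; so \<open>x\<close> is a lowest weight vector
  and \<open>lowest_e_pow_nonzero\<close> applies. Nilpotency is asked of \<open>f\<close>
  only.\<close>

lemma e_pow_injective:
 "x \<in> C (- of_nat p) ==> (f ^^ s) x = 0 ==> (e ^^ p) x = 0 ==> x = 0"
proof (induction s arbitrary: x p)
 case (Suc s)
 have "(e ^^ (p + 2)) (f x) = f ((e ^^ (p + 2)) x) +
   scale (of_nat (p + 2) * (- of_nat p + of_nat (p + 2) - 1)) ((e ^^ (p + 1)) x)" using e_pow_f[OF Suc.prems(1), of "p + 2"] by simp
 moreover have "(e ^^ (p + k)) x = 0" for k using Suc.prems(3) e_pow_0 by (metis add.commute comp_apply funpow_add)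
 ultimately have "(e ^^ (p + 2)) (f x) = 0" by (simp only: f_0) simp
 moreover have "f x \<in> C (- of_nat (p + 2))" using f_C[OF Suc.prems(1)] by (simp add: algebra_simps)
 moreover have "(f ^^ s) (f x) = 0" using Suc.prems(2) by (simp add: funpow_swap1)
 ultimately have "f x = 0" using Suc.IH by metis
 thus ?case using lowest_e_pow_nonzero[OF Suc.prems(1) _ order_refl Suc.prems(3)] by simp
qed simp

end

lemma sl2_weights_swap:
 assumes "sl2_weights scale e f C"
 shows "sl2_weights scale f e (%c. C (- c))"
proof -
 interpret sl2_weights scale e f C by fact
 show ?thesis
 proof unfold_locales
  show "x \<in> C (- c) ==> f x \<in> C (- (c + 2))" for x c using f_C[of x "- c"] by (simp add: algebra_simps)
  show "x \<in> C (- c) ==> e x \<in> C (- (c - 2))" for x c using e_C[of x "- c"] by (simp add: algebra_simps)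
  show "x \<in> C (- c) ==> f (e x) - e (f x) = scale c x" for x c using commute[of x "- c"] by (simp add: algebra_simps)
 qed (simp_all add: e_add e_scale f_add f_scale)
qed

context sl2_weights
begin

lemma highest_weight_nat:
 assumes "x \<in> C c" "x ~= 0" "e x = 0" "(f ^^ s) x = 0"
 shows "\<exists>n::nat. c = of_nat n"
proof -
 interpret swap: sl2_weights scale f e "%c. C (- c)" by (rule sl2_weights_swap) unfold_locales
 define n where "n = (LEAST n. (f ^^ n) x = 0)"
 have n: "(f ^^ n) x = 0" unfolding n_def by (rule LeastI) (rule assms(4))
 then obtain m where m: "n = Suc m" using assms(2) by (cases n) auto
 have m0: "(f ^^ m) x ~= 0" using not_less_Least[of m "%n. (f ^^ n) x = 0"] m unfolding n_def by simp
 have "0 = scale (- of_nat (Suc m) * (- c + of_nat (Suc m) - 1)) ((f ^^ m) x)"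
  using swap.lowest_e_pow[of x "- c" "Suc m"] assms(1,3) n m e_0 by simp
 hence "of_nat (Suc m) - c = 1" using m0 of_nat_neq_0[of m, where 'a = complex] by (simp del: of_nat_Suc)
 hence "c = of_nat m" by (simp add: algebra_simps)
 thus ?thesis by blast
qed

text \<open>The last nonzero power of \<open>e\<close> on \<open>x\<close> is a highest weight
  vector, whose weight is a natural number.\<close>

lemma weight_int:
 assumes "x \<in> C c" "x ~= 0" "(e ^^ r) x = 0" and nil: "!!y. \<exists>s. (f ^^ s) y = 0"
 shows "c \<in> \<int>"
proof -
 define n where "n = (LEAST n. (e ^^ n) x = 0)"
 have n: "(e ^^ n) x = 0" unfolding n_def by (rule LeastI) (rule assms(3))
 then obtain m where m: "n = Suc m" using assms(2) by (cases n) auto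
 have m0: "(e ^^ m) x ~= 0" using not_less_Least[of m "%n. (e ^^ n) x = 0"] m unfolding n_def by simp
 obtain s where "(f ^^ s) ((e ^^ m) x) = 0" using nil by blast
 then obtain k :: nat where "c + 2 * of_nat m = of_nat k" using highest_weight_nat[OF e_pow_C[OF assms(1), of m] m0] n m by auto
 hence "c = of_int (int k - 2 * int m)" by (simp add: algebra_simps)
 thus ?thesis by simp
qed

end

section \<open>Roots\<close>

locale ade = fd_simple scale bracket h b Basis
 for scale :: "complex => 'g::ab_group_add => 'g" and bracket and h b Basis :: "'g set" +
 fixes form :: "'g wt => 'g wt => complex"
 assumes form: "normalized_invariant_form form"
begin

lemma root_gw: "al \<in> roots ==> gw al = root_space al" by (simp add: roots_WT gw_root_space)

lemma rootD: "al \<in> roots ==> al \<in> WT" "al \<in> roots ==> al ~= 0" "al \<in> roots ==> al \<in> dual"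
 by (simp_all add: roots_WT WT_dual)

lemma root_minus: "al \<in> roots ==> - al \<in> roots" by (simp add: roots_WT WT_minus)

lemma finite_roots: "finite roots" using finite_WT by (simp add: roots_WT)

lemma root_space_sub: "subspace (root_space al)" by (rule subspaceI)
  (auto simp: root_space_def bracket_zero_right bracket_add_right bracket_scale_right
   scale_right_distrib mult.commute)

lemma bracket_span_D: "al \<in> roots ==> bracket_span (root_space al) (root_space (%x. - al x)) = D al"
 using root_gw[of al] root_gw[of "- al"] root_minus[of al] unfolding bracket_span_def D_def fun_Compl_def by simp

text \<open>Brackets of the two opposite root spaces form a line on which \<open>al\<close> does not
  vanish, so the definite description in \<open>coroot\<close> has exactly one solution.\<close>

lemma coroot_exists:
 assumes al: "al \<in> roots"
 obtains e f where "e \<in> root_space al" "f \<in> root_space (- al)" "bracket e f = coroot al"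
  "coroot al \<in> h" "al (coroot al) = 2" "e ~= 0" "f ~= 0"
proof -
 obtain e f where e: "e \<in> gw al" "e ~= 0" and f: "f \<in> gw (- al)" and alef: "al (bracket e f) ~= 0"
  using root_triple[of al] rootD[OF al] by metis
 define f' where "f' = scale (2 / al (bracket e f)) f"
 have f': "f' \<in> gw (- al)" using f by (simp add: f'_def subspace_scale[OF gw_sub])
 have efh: "bracket e f \<in> h" "bracket e f' \<in> h" using gw_bracket[OF e(1) f] gw_bracket[OF e(1) f'] gw_zero by simp_all
 have 2: "al (bracket e f') = 2" using alef efh dual_props(2)[OF rootD(3)[OF al]] by (simp add: f'_def bracket_scale_right)
 have f0: "f' ~= 0" using 2 dual_props(4)[OF rootD(3)[OF al]] by (auto simp: bracket_zero_right)
 have Dsp: "D al <= span {bracket e f'}" unfolding D_def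
 proof (rule span_minimal[OF _ subspace_span], safe)
  fix x y assume "x \<in> gw al" "y \<in> gw (- al)"
  then obtain a b where "x = scale a e" "y = scale b f'"
   using gw_line[of al e] gw_line[of "- al" f'] rootD[OF al] rootD[OF root_minus[OF al]] e f' f0 by (auto simp: span_singleton)
  thus "bracket x y \<in> span {bracket e f'}" by (simp add: bracket_scale_left bracket_scale_right span_scale span_base)
 qed
 have "coroot al = bracket e f'" unfolding coroot_def bracket_span_D[OF al]
 proof (rule the_equality)
  show "bracket e f' \<in> D al & al (bracket e f') = 2" using e f' 2 unfolding D_def by (auto intro: span_base)
  fix H assume H: "H \<in> D al & al H = 2"
  then obtain c where "H = scale c (bracket e f')" using Dsp by (auto simp: span_singleton)
  moreover hence "c = 1" using H 2 efh dual_props(2)[OF rootD(3)[OF al]] by simp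
  ultimately show "H = bracket e f'" by simp
 qed
 thus ?thesis using e f' f0 efh 2 root_gw[OF al] root_gw[OF root_minus[OF al]] by (intro that[of e f']) auto
qed

lemma
 assumes "al \<in> roots"
 shows coroot_h: "coroot al \<in> h" and coroot_2: "al (coroot al) = 2" by (rule coroot_exists[OF assms], assumption)+

lemma root_space_line:
 assumes "al \<in> roots" "e \<in> root_space al" "e ~= 0" "x \<in> root_space al"
 obtains c where "x = scale c e"
proof -
 have "gw al = span {e}" by (rule gw_line[OF rootD(1)[OF assms(1)] rootD(2)[OF assms(1)] _ assms(3)])
   (simp add: root_gw[OF assms(1)] assms(2))
 hence "x \<in> range (%k. scale k e)" using assms(4) root_gw[OF assms(1)] by (simp add: span_singleton)
 thus ?thesis using that by (elim rangeE)
qed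

lemma root_partner:
 assumes al: "al \<in> roots" and e: "e \<in> root_space al" "e ~= 0"
 obtains f where "f \<in> root_space (- al)" "bracket e f = coroot al" "f ~= 0"
proof -
 obtain e' f where ef: "e' \<in> root_space al" "f \<in> root_space (- al)" "bracket e' f = coroot al" "e' ~= 0" "f ~= 0"
  by (rule coroot_exists[OF al])
 obtain c where c: "e' = scale c e" by (rule root_space_line[OF al e ef(1)])
 hence "bracket e (scale c f) = coroot al" "c ~= 0" using ef by (auto simp: bracket_scale_left bracket_scale_right)
 thus ?thesis using that[of "scale c f"] ef subspace_scale[OF root_space_sub] by simp
qed

lemma root_space_nonzero:
 assumes "al \<in> roots" obtains e where "e \<in> root_space al" "e ~= 0" by (rule coroot_exists[OF assms]) (rule that)

lemma ad_nilpotent: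
 assumes "x \<in> gw al" "al \<in> roots"
 shows "\<exists>n. (bracket x ^^ n) y = 0"
proof -
 have s: "shifted scale (bracket x) 0 = bracket x" by (simp add: shifted_def)
 have "y \<in> gen (bracket x) 0"
 proof (rule span_gw_induct[OF _ subspace_gen[OF lin_ad]])
  fix ga z assume ga: "ga \<in> WT" "z \<in> gw ga"
  define c where "c n = (%v. ga v + of_nat n * al v)" for n
  have m: "(bracket x ^^ n) z \<in> gw (c n)" for n
  proof (induction n)
   case (Suc n)
   have "bracket x ((bracket x ^^ n) z) \<in> gw (al + c n)" by (intro gw_bracket assms Suc)
   moreover have "al + c n = c (Suc n)" by (auto simp: c_def fun_eq_iff algebra_simps)
   ultimately show ?case by simp
  qed (use ga in "simp add: c_def")
  have "inj c"
  proof (rule injI)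
   fix m n assume e: "c m = c n"
   have "c m (coroot al) = c n (coroot al)" using e by simp
   thus "m = n" using coroot_2[OF assms(2)] by (simp add: c_def)
  qed
  hence "\<not> range c <= WT" using finite_WT range_inj_infinite finite_subset by metis
  then obtain n where "c n \<notin> WT" by auto
  moreover have "onh (c n)" using WT_onh[OF ga(1)] WT_onh[OF rootD(1)[OF assms(2)]] by (auto simp: c_def onh_def)
  ultimately have "(bracket x ^^ n) z = 0" using not_WT m by metis
  thus "z \<in> gen (bracket x) 0" unfolding gen_def s by auto
 qed
 thus ?thesis by (auto simp: gen_def s)
qed

lemma ad_sl2:
 assumes al: "al \<in> roots" and e: "e \<in> root_space al" and f: "f \<in> root_space (- al)" and ef: "bracket e f = coroot al"
 shows "sl2_weights scale (bracket e) (bracket f) (%c. {x. bracket (coroot al) x = scale c x})"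
proof unfold_locales
 note H = coroot_h[OF al] coroot_2[OF al]
 have he: "bracket (coroot al) e = scale 2 e" "bracket (coroot al) f = scale (- 2) f" using e f H by (simp_all add: root_space_def)
 show "bracket e x \<in> {x. bracket (coroot al) x = scale (c + 2) x}" if "x \<in> {x. bracket (coroot al) x = scale c x}" for x c
  using that by (simp add: bracket_bracket_right[of _ e] he bracket_scale_left bracket_scale_right algebra_simps)
 show "bracket f x \<in> {x. bracket (coroot al) x = scale (c - 2) x}" if "x \<in> {x. bracket (coroot al) x = scale c x}" for x c
 proof -
  have "bracket (coroot al) (bracket f x) = bracket (scale (- 2) f) x + bracket f (scale c x)"
   using that by (simp only: bracket_bracket_right[of _ f] he) simp
  thus ?thesis by (simp add: bracket_scale_left bracket_scale_right bracket_minus_left algebra_simps)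
 qed
 show "bracket e (bracket f x) - bracket f (bracket e x) = scale c x" if "x \<in> {x. bracket (coroot al) x = scale c x}" for x c
  using that by (simp add: ef flip: bracket_bracket_left)
qed (simp_all add: bracket_add_right bracket_scale_right)

lemma WT_cases: "bt \<in> WT ==> bt = 0 \<or> bt \<in> roots" by (auto simp: roots_WT)

lemma root_int:
 assumes al: "al \<in> roots" and bt: "bt \<in> roots"
 shows "bt (coroot al) \<in> \<int>"
proof -
 obtain e f where ef: "e \<in> root_space al" "f \<in> root_space (- al)" "bracket e f = coroot al" by (rule coroot_exists[OF al])
 interpret sl2_weights scale "bracket e" "bracket f" "%c. {x. bracket (coroot al) x = scale c x}" by (rule ad_sl2[OF al ef])
 obtain x where x: "x \<in> root_space bt" "x ~= 0" by (rule root_space_nonzero[OF bt])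
 obtain r where "(bracket e ^^ r) x = 0" using ad_nilpotent ef(1) al root_gw[OF al] by metis
 moreover have "\<exists>s. (bracket f ^^ s) y = 0" for y
  using ad_nilpotent[OF _ root_minus[OF al]] ef(2) root_gw[OF root_minus[OF al]] by metis
 ultimately show ?thesis using weight_int[of x "bt (coroot al)" r] x coroot_h[OF al] by (simp add: root_space_def)
qed

lemma bracket_nonzero:
 assumes al: "al \<in> roots" and bt: "bt \<in> roots" and neg: "bt (coroot al) = - of_nat (Suc n)"
  and e: "e \<in> root_space al" "e ~= 0" and x: "x \<in> root_space bt" "x ~= 0"
 shows "bracket e x ~= 0"
proof
 assume 0: "bracket e x = 0"
 obtain f where f: "f \<in> root_space (- al)" "bracket e f = coroot al" by (rule root_partner[OF al e])
 interpret sl2_weights scale "bracket e" "bracket f" "%c. {x. bracket (coroot al) x = scale c x}" by (rule ad_sl2[OF al e(1) f])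
 obtain s where s: "(bracket f ^^ s) x = 0" using ad_nilpotent[OF _ root_minus[OF al]] f(1) root_gw[OF root_minus[OF al]] by metis
 have "(bracket e ^^ Suc n) x = 0" using 0 e_pow_0[of n] by (simp add: funpow_swap1)
 moreover have "x \<in> {x. bracket (coroot al) x = scale (- of_nat (Suc n)) x}"
  using x(1) coroot_h[OF al] neg by (simp add: root_space_def)
 ultimately have "x = 0" using e_pow_injective[of x "Suc n" s] s by blast
 thus False using x by simp
qed

lemma form_facts:
 assumes "\<mu> \<in> dual" "nu \<in> dual"
 shows "form \<mu> nu = form nu \<mu>" "\<mu>' \<in> dual ==> form (\<mu> + \<mu>') nu = form \<mu> nu + form \<mu>' nu"
  "form (%x. c * \<mu> x) nu = c * form \<mu> nu"
  "al \<in> roots ==> form (reflection al \<mu>) (reflection al nu) = form \<mu> nu" "al \<in> roots ==> form al al = 2"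
 using form assms unfolding normalized_invariant_form_def plus_fun_def by blast+

lemma dual_add: "\<mu> \<in> dual ==> nu \<in> dual ==> \<mu> + nu \<in> dual" by (auto simp: dual_def algebra_simps)

lemma dual_scale: "\<mu> \<in> dual ==> (%x. c * \<mu> x) \<in> dual" by (auto simp: dual_def algebra_simps)

lemma dual_minus: "\<mu> \<in> dual ==> - \<mu> \<in> dual" by (auto simp: dual_def algebra_simps)

lemma dual_0: "0 \<in> dual" by (auto simp: dual_def)

lemma dual_diff: "\<mu> \<in> dual ==> nu \<in> dual ==> \<mu> - nu \<in> dual" using dual_add[of \<mu> "- nu"] dual_minus by simp

lemma form_minus: "\<mu> \<in> dual ==> nu \<in> dual ==> form (- \<mu>) nu = - form \<mu> nu"
 using form_facts(3)[of \<mu> nu "- 1"] by (simp add: fun_Compl_def)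

text \<open>Reflection in \<open>al\<close> negates \<open>al\<close> and subtracts
  \<open>c al\<close> from \<open>nu\<close>; invariance reads
  \<open>form nu al = - form nu al + 2 c\<close>.\<close>

lemma form_root:
 assumes al: "al \<in> roots" and nu: "nu \<in> dual"
 shows "form nu al = nu (coroot al)"
proof -
 note ald = rootD(3)[OF al]
 define c where "c = nu (coroot al)"
 have ral: "reflection al al = - al" by (auto simp: reflection_def coroot_2[OF al] fun_eq_iff)
 have rnu: "reflection al nu = nu + (%x. - c * al x)" by (auto simp: reflection_def c_def fun_eq_iff)
 have "form nu al = form (nu + (%x. - c * al x)) (- al)" using form_facts(4)[OF nu ald al] unfolding ral rnu by simp
 also have "\<dots> = form nu (- al) + form (%x. - c * al x) (- al)" by (rule form_facts(2)[OF nu dual_minus[OF ald] dual_scale[OF ald]])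
 also have "form nu (- al) = - form nu al"
  using form_facts(1)[OF nu dual_minus[OF ald]] form_facts(1)[OF nu ald] form_minus[OF ald nu] by simp
 also have "form (%x. - c * al x) (- al) = - c * form al (- al)" by (rule form_facts(3)[OF ald dual_minus[OF ald]])
 also have "form al (- al) = - 2" using form_facts(1)[OF ald dual_minus[OF ald]] form_minus[OF ald ald] form_facts(5)[OF ald ald al] by simp
 finally show ?thesis by (simp add: c_def)
qed

lemma root_sym: "al \<in> roots ==> bt \<in> roots ==> bt (coroot al) = al (coroot bt)"
 using form_root[of al bt] form_root[of bt al] form_facts(1)[of al bt] rootD by simp

text \<open>Expand the square length 2 of the sum of two roots of square length 2.\<close>

lemma root_add_dot:
 assumes al: "al \<in> roots" and bt: "bt \<in> roots" and s: "al + bt \<in> roots"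
 shows "bt (coroot al) = - 1"
proof -
 note d = rootD(3)[OF al] rootD(3)[OF bt]
 have "2 = form (al + bt) (al + bt)" using form_facts(5)[OF d s] by simp
 also have "\<dots> = form al (al + bt) + form bt (al + bt)" by (rule form_facts(2)[OF d(1) dual_add[OF d] d(2)])
 also have "\<dots> = form (al + bt) al + form (al + bt) bt"
  using form_facts(1)[OF d(1) dual_add[OF d]] form_facts(1)[OF d(2) dual_add[OF d]] by simp
 also have "\<dots> = (al + bt) (coroot al) + (al + bt) (coroot bt)"
  using form_root[OF al dual_add[OF d]] form_root[OF bt dual_add[OF d]] by simp
 also have "\<dots> = 4 + 2 * bt (coroot al)" using coroot_2[OF al] coroot_2[OF bt] root_sym[OF al bt] by simp
 finally show ?thesis by algebra
qed

lemma WT_bracket: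
 assumes "x \<in> root_space al" "y \<in> root_space bt" "bracket x y ~= 0" "onh al" "onh bt"
 shows "al + bt \<in> WT" using not_WT[of "al + bt" "bracket x y"] gw_bracket[of x al y bt] root_space_gw assms by auto

text \<open>A negative pairing makes the bracket of root vectors nonzero, so the sum is a weight; if
  it is a root, \<open>root_add_dot\<close> leaves only the pairing -1.\<close>

lemma root_add:
 assumes al: "al \<in> roots" and bt: "bt \<in> roots" and neg: "bt (coroot al) = - of_nat (Suc n)"
 shows "al + bt \<in> roots & n = 0 \<or> bt = - al"
proof -
 obtain e x where e: "e \<in> root_space al" "e ~= 0" and x: "x \<in> root_space bt" "x ~= 0"
  by (rule root_space_nonzero[OF al], rule root_space_nonzero[OF bt])
 have "al + bt \<in> WT" using WT_bracket[OF e(1) x(1) bracket_nonzero[OF al bt neg e x]] WT_onh rootD al bt by simp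
 then consider "al + bt = 0" | "al + bt \<in> roots" using WT_cases by blast
 thus ?thesis
 proof cases
  case 1
  thus ?thesis by (simp add: add_eq_0_iff)
 next case 2
  hence "- of_nat (Suc n) = (- 1 :: complex)" using root_add_dot[OF al bt] neg by simp
  hence "n = 0" by simp
  thus ?thesis using 2 by simp
 qed
qed

text \<open>Integer form of the pairing with a coroot; on weights outside \<open>intw\<close> the
  floor is a mere default.\<close>

definition ip :: "'g wt => 'g wt => int" where
 "ip nu al = \<lfloor>Re (nu (coroot al))\<rfloor>"

definition intw :: "'g wt set" where
 "intw = {nu \<in> dual. \<forall>al\<in>roots. nu (coroot al) \<in> \<int>}"

lemma ip: "nu \<in> intw ==> al \<in> roots ==> nu (coroot al) = of_int (ip nu al)" by (auto simp: intw_def ip_def elim!: Ints_cases)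

lemma ipI: "nu (coroot al) = of_int n ==> ip nu al = n" by (simp add: ip_def)

lemma intw_dual: "nu \<in> intw ==> nu \<in> dual" by (simp add: intw_def)

lemma intw_0: "0 \<in> intw" by (simp add: intw_def dual_0)

lemma intw_add: "\<mu> \<in> intw ==> nu \<in> intw ==> \<mu> + nu \<in> intw" by (simp add: intw_def dual_add)

lemma intw_minus: "\<mu> \<in> intw ==> - \<mu> \<in> intw" by (simp add: intw_def dual_minus)

lemma intw_diff: "\<mu> \<in> intw ==> nu \<in> intw ==> \<mu> - nu \<in> intw" by (simp add: intw_def dual_diff)

lemma roots_intw: "al \<in> roots ==> al \<in> intw" using root_int rootD by (simp add: intw_def)

lemma ip_add: "\<mu> \<in> intw ==> nu \<in> intw ==> al \<in> roots ==> ip (\<mu> + nu) al = ip \<mu> al + ip nu al"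
 by (rule ipI) (simp add: ip)

lemma ip_minus: "\<mu> \<in> intw ==> al \<in> roots ==> ip (- \<mu>) al = - ip \<mu> al" by (rule ipI) (simp add: ip)

lemma ip_diff: "\<mu> \<in> intw ==> nu \<in> intw ==> al \<in> roots ==> ip (\<mu> - nu) al = ip \<mu> al - ip nu al"
 by (rule ipI) (simp add: ip)

lemma ip_0 [simp]: "ip 0 al = 0" by (simp add: ip_def)

lemma ip_self: "al \<in> roots ==> ip al al = 2" by (rule ipI) (simp add: coroot_2)

lemma ip_sym: "al \<in> roots ==> bt \<in> roots ==> ip al bt = ip bt al" by (simp add: ip_def root_sym)

text \<open>Pairings of roots are symmetric, so all roots take the same value on both sides, and
  roots separate \<open>h\<close>.\<close>

lemma coroot_additive:
 assumes al: "al \<in> roots" and bt: "bt \<in> roots" and s: "al + bt \<in> roots"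
 shows "coroot (al + bt) = coroot al + coroot bt"
proof -
 note c = coroot_h[OF al] coroot_h[OF bt] coroot_h[OF s]
 have "coroot (al + bt) - (coroot al + coroot bt) = 0"
 proof (rule h_separating)
  show "coroot (al + bt) - (coroot al + coroot bt) \<in> h" using c by (simp add: subspace_add[OF h_subspace] subspace_diff[OF h_subspace])
  fix ga assume ga: "ga \<in> WT" "ga ~= 0"
  hence g: "ga \<in> roots" using WT_cases by blast
  note d = dual_props(1)[OF rootD(3)[OF g]]
  have "ga (coroot (al + bt)) = ga (coroot al + coroot bt)" using root_sym[OF s g] root_sym[OF al g] root_sym[OF bt g] c d by simp
  moreover have "ga (coroot (al + bt) - (coroot al + coroot bt)) + ga (coroot al + coroot bt) = ga (coroot (al + bt))"
   using d[of "coroot (al + bt) - (coroot al + coroot bt)" "coroot al + coroot bt"] c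
   by (simp add: subspace_add[OF h_subspace] subspace_diff[OF h_subspace])
  ultimately show "ga (coroot (al + bt) - (coroot al + coroot bt)) = 0" by simp
 qed
 thus ?thesis by simp
qed

lemma coroot_minus:
 assumes al: "al \<in> roots"
 shows "coroot (- al) = - coroot al"
proof -
 note m = root_minus[OF al]
 have "coroot (- al) + coroot al = 0"
 proof (rule h_separating)
  show "coroot (- al) + coroot al \<in> h" using coroot_h[OF al] coroot_h[OF m] by (simp add: subspace_add[OF h_subspace])
  fix ga assume ga: "ga \<in> WT" "ga ~= 0"
  hence g: "ga \<in> roots" using WT_cases by blast
  show "ga (coroot (- al) + coroot al) = 0"
   using dual_props(1)[OF rootD(3)[OF g] coroot_h[OF m] coroot_h[OF al]] root_sym[OF m g] root_sym[OF al g] by simp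
 qed
 thus ?thesis by (simp add: add_eq_0_iff)
qed

lemma ip_coroot_add: "nu \<in> intw ==> al \<in> roots ==> bt \<in> roots ==> al + bt \<in> roots ==> ip nu (al + bt) = ip nu al + ip nu bt"
 by (rule ipI) (simp add: coroot_additive dual_props(1)[OF intw_dual] coroot_h ip)

lemma ip_coroot_minus: "nu \<in> intw ==> al \<in> roots ==> ip nu (- al) = - ip nu al"
proof (rule ipI)
 assume *: "nu \<in> intw" "al \<in> roots"
 hence "nu (- coroot al) = - nu (coroot al)" using dual_props(2)[OF intw_dual coroot_h, of nu al "- 1"] by simp
 thus "nu (coroot (- al)) = of_int (- ip nu al)" using * by (simp add: coroot_minus ip)
qed

lemma ip_neg_cases:
 assumes al: "al \<in> roots" and bt: "bt \<in> roots" and "ip al bt < 0"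
 shows "bt = - al & ip al bt = - 2 \<or> al + bt \<in> roots & ip al bt = - 1"
proof -
 obtain n where n: "ip al bt = - int (Suc n)" using assms(3) by (metis negD)
 hence "bt (coroot al) = - of_nat (Suc n)" using ip[OF roots_intw[OF bt] al] ip_sym[OF al bt] by simp
 thus ?thesis using root_add[OF al bt, of n] n ip_coroot_minus[OF roots_intw[OF al] al] ip_self[OF al] by auto
qed

lemma ip_bound_cases:
 assumes al: "al \<in> roots" and bt: "bt \<in> roots"
 shows "bt = al & ip al bt = 2 \<or> bt = - al & ip al bt = - 2 \<or>
  (al + bt \<in> roots & ip al bt = - 1) \<or> (al - bt \<in> roots & ip al bt = 1) \<or> ip al bt = 0"
proof (cases "ip al bt < 0")
 case True
 thus ?thesis using ip_neg_cases[OF al bt] by blast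
next case False
 note m = ip_coroot_minus[OF roots_intw[OF al] bt]
 show ?thesis
 proof (cases "ip al bt = 0")
  case f: False
  thus ?thesis using ip_neg_cases[OF al root_minus[OF bt]] False m by auto
 qed simp
qed

lemma ip_add_root: "al \<in> roots ==> bt \<in> roots ==> al + bt \<in> roots ==> ip al bt = - 1"
 using root_add_dot[of bt al] by (intro ipI) (simp add: add.commute)

lemma root_add_iff: "al \<in> roots ==> bt \<in> roots ==> al + bt \<in> roots \<longleftrightarrow> ip al bt = - 1"
 using ip_add_root ip_neg_cases by force

lemma root_double: "al \<in> roots ==> al + al \<notin> roots" using root_add_iff[of al al] ip_self by simp

lemma bracket_root_nonzero:
 assumes "al \<in> roots" "bt \<in> roots" "al + bt \<in> roots"
  "x \<in> root_space al" "x ~= 0" "y \<in> root_space bt" "y ~= 0"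
 shows "bracket x y ~= 0" using bracket_nonzero[of al bt 0 x y] root_add_dot[of al bt] assms by simp

lemma root_space_bracket:
 assumes "x \<in> root_space al" "y \<in> root_space bt"
 shows "bracket x y \<in> root_space (al + bt)"
 using assms by (auto simp: root_space_def bracket_bracket_right[of _ x] bracket_scale_left bracket_scale_right algebra_simps)

lemma root_sum_bracket:
 assumes r: "al \<in> roots" "bt \<in> roots" "al + bt \<in> roots" and x: "x \<in> root_space (al + bt)"
 obtains y z where "y \<in> root_space al" "z \<in> root_space bt" "x = bracket y z"
proof -
 obtain y z where y: "y \<in> root_space al" "y ~= 0" and z: "z \<in> root_space bt" "z ~= 0" using root_space_nonzero r(1,2) by metis
 obtain c where "x = scale c (bracket y z)"
  by (rule root_space_line[OF r(3) root_space_bracket[OF y(1) z(1)] bracket_root_nonzero[OF r y z] x])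
 thus thesis using y(1) z(1) root_space_sub by (intro that[of "scale c y" z]) (simp_all add: subspace_scale bracket_scale_left)
qed

lemma neg_root_sum:
 assumes r: "al \<in> roots" "bt \<in> roots" "al + bt \<in> roots" and x: "x \<in> root_space (- (al + bt))"
 obtains y z where "- al \<in> roots" "- bt \<in> roots" "- al + - bt \<in> roots"
  "y \<in> root_space (- al)" "z \<in> root_space (- bt)" "x = bracket y z"
proof -
 have m: "- al \<in> roots" "- bt \<in> roots" "- al + - bt \<in> roots" using r[THEN root_minus] by simp_all
 show thesis by (rule root_sum_bracket[OF m]) (use x that[OF m] in simp_all)
qed

lemma root_space_0: "root_space 0 = h" using gw_root_space[of 0] gw_zero root_space_gw[of 0] h_abelian by (auto simp: root_space_def)

lemma bracket_not_root:
 assumes "al \<in> roots" "bt \<in> roots" "al + bt \<notin> roots" "bt ~= - al" "x \<in> root_space al" "y \<in> root_space bt"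
 shows "bracket x y = 0"
proof (rule ccontr)
 assume "bracket x y ~= 0"
 hence "al + bt \<in> WT" using WT_bracket assms WT_onh rootD by simp
 hence "al + bt = 0" using WT_cases assms(3) by metis
 thus False using assms(4) by (simp add: add_eq_0_iff)
qed

lemma reflect_root:
 assumes al: "al \<in> roots" and bt: "bt \<in> roots"
 shows "bt - (%x. of_int (ip bt al) * al x) \<in> roots"
proof -
 have e: "ip bt al = ip al bt" using ip_sym assms by simp
 show ?thesis unfolding e using ip_bound_cases[OF al bt]
 proof (elim disjE conjE)
  assume *: "bt = al" "ip al bt = 2"
  have "bt - (%x. of_int (ip al bt) * al x) = - al" unfolding *(2) using *(1) by (auto simp: fun_eq_iff)
  thus "bt - (%x. of_int (ip al bt) * al x) \<in> roots" using root_minus[OF al] by (simp only:)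
 next
  assume *: "bt = - al" "ip al bt = - 2"
  have "bt - (%x. of_int (ip al bt) * al x) = al" unfolding *(2) using *(1) by (auto simp: fun_eq_iff)
  thus "bt - (%x. of_int (ip al bt) * al x) \<in> roots" using al by (simp only:)
 next
  assume *: "al + bt \<in> roots" "ip al bt = - 1"
  have "bt - (%x. of_int (ip al bt) * al x) = al + bt" unfolding *(2) by (auto simp: fun_eq_iff)
  thus "bt - (%x. of_int (ip al bt) * al x) \<in> roots" using *(1) by (simp only:)
 next
  assume *: "al - bt \<in> roots" "ip al bt = 1"
  have "bt - (%x. of_int (ip al bt) * al x) = - (al - bt)" unfolding *(2) by (auto simp: fun_eq_iff)
  thus "bt - (%x. of_int (ip al bt) * al x) \<in> roots" using root_minus[OF *(1)] by (simp only:)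
 next
  assume *: "ip al bt = 0"
  have "bt - (%x. of_int (ip al bt) * al x) = bt" unfolding * by (auto simp: fun_eq_iff)
  thus "bt - (%x. of_int (ip al bt) * al x) \<in> roots" using bt by (simp only:)
 qed
qed

end

section \<open>The Borel subalgebra and simple roots\<close>

context ade
begin

lemma ip_sum_list:
 "set xs <= roots ==> al \<in> roots ==> sum_list xs \<in> intw & ip (sum_list xs) al = (\<Sum>bt\<leftarrow>xs. ip bt al)"
 by (induction xs) (auto simp: intw_0 ip_add intw_add roots_intw)

text \<open>Abstracts the positive roots, so that the same facts apply to the hypothetical
  enlargement in \<open>pos_or_neg\<close>.\<close>

definition closed_pos :: "'g wt set => bool" where
 "closed_pos P \<longleftrightarrow> P <= roots & (\<forall>al\<in>P. - al \<notin> P) & (\<forall>al\<in>P. \<forall>bt\<in>P. al + bt \<in> roots --> al + bt \<in> P)"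

text \<open>Pair a vanishing sum with its first member \<open>al\<close>, which contributes 2: some
  other member must pair negatively with \<open>al\<close>. Replacing the two by their sum, again in
  \<open>P\<close>, shortens the list.\<close>

lemma no_zero_sum:
 assumes P: "closed_pos P"
 shows "set xs <= P ==> xs ~= [] ==> sum_list xs ~= 0"
proof (induction "length xs" arbitrary: xs rule: less_induct)
 case less
 then obtain al ys where xs: "xs = al # ys" by (cases xs) auto
 have al: "al \<in> P" "al \<in> roots" and r: "set xs <= roots" using less.prems P xs by (auto simp: closed_pos_def)
 show ?case
 proof
  assume 0: "sum_list xs = 0"
  hence "(\<Sum>bt\<leftarrow>ys. ip bt al) = - 2" using ip_sum_list[OF r al(2)] xs ip_self[OF al(2)] by simp
  moreover have "(\<Sum>bt\<leftarrow>ys. ip bt al) \<ge> 0" if "!!bt. bt \<in> set ys ==> ip bt al \<ge> 0"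
   using that by (intro sum_list_nonneg) auto
  ultimately obtain bt where bt: "bt \<in> set ys" "ip bt al < 0" by force
  have btP: "bt \<in> P" "bt \<in> roots" using bt xs less.prems P by (auto simp: closed_pos_def)
  have "al ~= - bt" using P al btP by (auto simp: closed_pos_def)
  hence "bt + al \<in> P" using ip_neg_cases[OF btP(2) al(2) bt(2)] P al btP by (auto simp: closed_pos_def)
  hence "set ((bt + al) # remove1 bt ys) <= P" using less.prems xs set_remove1_subset[of bt ys] by auto
  moreover have "length ((bt + al) # remove1 bt ys) < length xs" using bt(1) length_pos_if_in_set[OF bt(1)] xs by (simp add: length_remove1)
  ultimately have "sum_list ((bt + al) # remove1 bt ys) ~= 0" using less.hyps by blast
  moreover have "sum_list ((bt + al) # remove1 bt ys) = sum_list xs"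
   using sum_list_map_remove1[OF bt(1), of "%x. x"] xs by (simp add: algebra_simps)
  ultimately show False using 0 by simp
 qed
qed

definition cone :: "'g wt set => 'g wt set" where
 "cone P = {sum_list xs | xs. set xs <= P}"

lemma coneI: "set xs <= P ==> sum_list xs \<in> cone P" by (auto simp: cone_def)

lemma cone_add: "x \<in> cone P ==> y \<in> cone P ==> x + y \<in> cone P"
proof -
 assume "x \<in> cone P" "y \<in> cone P"
 then obtain xs ys where *: "x = sum_list xs" "set xs <= P" "y = sum_list ys" "set ys <= P" by (auto simp: cone_def)
 thus ?thesis using coneI[of "xs @ ys" P] by simp
qed

lemma cone_0: "0 \<in> cone P" using coneI[of "[]" P] by simp

lemma cone_base: "x \<in> P ==> x \<in> cone P" using coneI[of "[x]" P] by simp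

text \<open>Counts the members of \<open>P\<close> below \<open>ga\<close> in the order defined by
  the cone; by \<open>rk_less\<close> it grows strictly under addition inside
  \<open>P\<close>.\<close>

definition rk :: "'g wt set => 'g wt => nat" where
 "rk P ga = card {de \<in> P. ga - de \<in> cone P}"

lemma rk_less:
 assumes P: "closed_pos P" and al: "al \<in> P" and bt: "bt \<in> P" and s: "al + bt \<in> P"
 shows "rk P al < rk P (al + bt)" unfolding rk_def
proof (rule psubset_card_mono)
 have fin: "finite P" using P finite_roots finite_subset by (auto simp: closed_pos_def)
 thus "finite {de \<in> P. al + bt - de \<in> cone P}" by simp
 have "{de \<in> P. al - de \<in> cone P} <= {de \<in> P. al + bt - de \<in> cone P}"
 proof
  fix de assume "de \<in> {de \<in> P. al - de \<in> cone P}"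
  hence "de \<in> P" "(al - de) + bt \<in> cone P" using cone_add cone_base[OF bt] by auto
  thus "de \<in> {de \<in> P. al + bt - de \<in> cone P}" by (simp add: algebra_simps)
 qed
 moreover have "al + bt \<in> {de \<in> P. al + bt - de \<in> cone P}" using s cone_0 by simp
 moreover have "al + bt \<notin> {de \<in> P. al - de \<in> cone P}"
 proof
  assume "al + bt \<in> {de \<in> P. al - de \<in> cone P}"
  then obtain xs where xs: "- bt = sum_list xs" "set xs <= P" by (auto simp: cone_def)
  hence "sum_list (bt # xs) = 0" by (simp flip: xs(1))
  thus False using no_zero_sum[OF P, of "bt # xs"] xs bt by simp
 qed
 ultimately show "{de \<in> P. al - de \<in> cone P} \<subset> {de \<in> P. al + bt - de \<in> cone P}" by blast
qed

lemma closed_pos_finite: "closed_pos P ==> finite P" using finite_roots finite_subset by (auto simp: closed_pos_def)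

lemma rk_pos: "closed_pos P ==> al \<in> P ==> 0 < rk P al" using closed_pos_finite cone_0 unfolding rk_def by (subst card_gt_0_iff) auto

lemma rk_bound: "closed_pos P ==> rk P al \<le> card P"
 unfolding rk_def using finite_roots finite_subset by (intro card_mono) (auto simp: closed_pos_def)

lemma bracket_span_subset:
 assumes "subspace T" "!!x y. x \<in> A ==> y \<in> B ==> bracket x y \<in> T"
 shows "bracket_span (span A) (span B) <= T"
proof -
 have 1: "bracket x y \<in> T" if "x \<in> A" "y \<in> span B" for x y
 proof -
  have "span B <= {y. bracket x y \<in> T}" by (rule span_minimal[OF _ module_hom.subspace_linear_preimage[OF
      lin_ad[unfolded Vector_Spaces.linear_iff_module_hom] assms(1)]])
    (use assms(2) that in auto)
  thus ?thesis using that by auto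
 qed
 have 2: "bracket x y \<in> T" if "x \<in> span A" "y \<in> span B" for x y
 proof -
  have "lin (%x. bracket x y)" by (simp add: lin_iff bracket_add_left bracket_scale_left)
  hence "subspace {x. bracket x y \<in> T}"
   using assms(1) by (intro module_hom.subspace_linear_preimage) (simp_all add: Vector_Spaces.linear_iff_module_hom)
  hence "span A <= {x. bracket x y \<in> T}" by (rule span_minimal[rotated]) (use 1 that in auto)
  thus ?thesis using that by auto
 qed
 show ?thesis unfolding bracket_span_def by (rule span_minimal[OF _ assms(1)]) (use 2 in auto)
qed

text \<open>Brackets raise \<open>rk\<close>, so the derived series descends through the spans
  \<open>N n\<close> of the root spaces of rank above \<open>n\<close>, and ranks are
  bounded.\<close>

lemma solvable_closed:
 assumes P: "closed_pos P"
 defines "c == span (h \<union> (\<Union>al\<in>P. root_space al))"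
 shows "subalgebra c" "solvable c"
proof -
 define N where "N n = span (\<Union>al\<in>{al\<in>P. n < rk P al}. root_space al)" for n
 have Pr: "P <= roots" and fin: "finite P" using P finite_roots finite_subset by (auto simp: closed_pos_def)
 have rr: "bracket x y = 0 \<or> (\<exists>ga\<in>P. ga = al + bt & bracket x y \<in> root_space ga & rk P al < rk P ga)"
  if "al \<in> P" "bt \<in> P" "x \<in> root_space al" "y \<in> root_space bt" for al bt x y
 proof (cases "al + bt \<in> roots")
  case True
  hence "al + bt \<in> P" using P that by (auto simp: closed_pos_def)
  thus ?thesis using root_space_bracket that rk_less[OF P] by blast
 next case False
  have "bt ~= - al" using P that by (auto simp: closed_pos_def)
  thus ?thesis using bracket_not_root[OF _ _ False] that Pr by blast
 qed
 have NN: "bracket_span (N n) (N n) <= N (Suc n)" for n unfolding N_def[of n]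
 proof (rule bracket_span_subset)
  show "subspace (N (Suc n))" by (simp add: N_def)
  fix x y assume "x \<in> (\<Union>al\<in>{al\<in>P. n < rk P al}. root_space al)" "y \<in> (\<Union>al\<in>{al\<in>P. n < rk P al}. root_space al)"
  then obtain al bt where ab: "al \<in> P" "n < rk P al" "x \<in> root_space al" "bt \<in> P" "y \<in> root_space bt" by auto
  consider "bracket x y = 0" | ga where "ga \<in> P" "bracket x y \<in> root_space ga" "rk P al < rk P ga" using rr[OF ab(1,4,3,5)] by auto
  thus "bracket x y \<in> N (Suc n)"
  proof cases
   case 1
   thus ?thesis by (simp add: N_def span_zero)
  next case (2 ga)
   thus ?thesis unfolding N_def using ab(2) by (intro span_base) auto
  qed
 qed
 have cc: "bracket_span c c <= N 0" unfolding c_def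
 proof (rule bracket_span_subset)
  show "subspace (N 0)" by (simp add: N_def)
  have N0: "z \<in> N 0" if "z \<in> root_space ga" "ga \<in> P" for z ga unfolding N_def using that rk_pos[OF P] by (intro span_base) auto
  fix x y assume xy: "x \<in> h \<union> (\<Union>al\<in>P. root_space al)" "y \<in> h \<union> (\<Union>al\<in>P. root_space al)"
  have hr: "bracket H z \<in> N 0 & bracket z H \<in> N 0" if "H \<in> h" "z \<in> root_space ga" "ga \<in> P" for H z ga
  proof -
   have "bracket H z \<in> N 0" using that N0[OF that(2,3)] by (simp add: root_space_def N_def span_scale)
   thus ?thesis using bracket_antisym[of z H] by (simp add: N_def span_neg)
  qed
  consider "x \<in> h" "y \<in> h" | bt where "x \<in> h" "bt \<in> P" "y \<in> root_space bt"
   | al where "al \<in> P" "x \<in> root_space al" "y \<in> h"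
   | al bt where "al \<in> P" "x \<in> root_space al" "bt \<in> P" "y \<in> root_space bt" using xy by auto
  thus "bracket x y \<in> N 0"
  proof cases
   case 1
   thus ?thesis by (simp add: h_abelian N_def span_zero)
  next case (4 al bt)
   hence "bracket x y = 0 \<or> (\<exists>ga\<in>P. bracket x y \<in> root_space ga)" using rr[of al bt x y] by blast
   thus ?thesis using N0 by (auto simp: N_def span_zero)
  qed (use hr in auto)
 qed
 have Nc: "N 0 <= c" unfolding N_def c_def by (rule span_mono) auto
 show "subalgebra c" unfolding subalgebra_def
 proof (intro conjI ballI)
  show "subspace c" by (simp add: c_def)
  show "bracket x y \<in> c" if "x \<in> c" "y \<in> c" for x y
   using that cc Nc span_base[of "bracket x y" "{bracket x y | x y. x \<in> c & y \<in> c}"] unfolding bracket_span_def by auto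
 qed
 have D: "derived_series c (Suc n) <= N n" for n
 proof (induction n)
  case 0
  thus ?case using cc by simp
 next case (Suc n)
  have "derived_series c (Suc (Suc n)) <= bracket_span (N n) (N n)" unfolding derived_series.simps(2)[of c "Suc n"] bracket_span_def
   by (rule span_mono) (use Suc in blast)
  thus ?case using NN by (rule order_trans)
 qed
 have "N (card P) = {0}"
 proof -
  have "{al \<in> P. card P < rk P al} = {}" using rk_bound[OF P] by (auto simp: not_less)
  thus ?thesis unfolding N_def by (simp only: UN_empty span_empty)
 qed
 moreover have "0 \<in> derived_series c (Suc (card P))" by (simp add: bracket_span_def span_zero)
 ultimately show "solvable c" using D[of "card P"] unfolding solvable_def by (intro exI[of _ "Suc (card P)"]) auto
qed

text \<open>For \<open>H\<close> on which \<open>ga\<close> and \<open>al\<close> differ,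
  \<open>ad H - al H\<close> removes the component at \<open>al\<close> and multiplies that at
  \<open>ga\<close> by a nonzero number.\<close>

lemma weight_components:
 assumes S: "subspace S" "!!H x. H \<in> h ==> x \<in> S ==> bracket H x \<in> S"
 shows "finite F ==> F <= WT ==> (!!ga. ga \<in> F ==> x ga \<in> root_space ga) ==> sum x F \<in> S ==> ga \<in> F ==> x ga \<in> S"
proof (induction F arbitrary: x ga rule: finite_induct)
 case (insert al F)
 have F: "x ga \<in> S" if ga: "ga \<in> F" for ga
 proof -
  have "ga ~= al" using ga insert.hyps by auto
  then obtain H where H: "ga H ~= al H" by auto
  have Hh: "H \<in> h"
  proof (rule ccontr)
   assume "H \<notin> h"
   thus False using H insert.prems(1) ga WT_onh[of ga] WT_onh[of al] by (auto simp: onh_def)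
  qed
  have e: "bracket H (x de) = scale (de H) (x de)" if "de \<in> insert al F" for de
   using insert.prems(2)[OF that] Hh by (simp add: root_space_def)
  have "bracket H (sum x (insert al F)) - scale (al H) (sum x (insert al F)) \<in> S"
   using S insert.prems(3) Hh by (intro subspace_diff subspace_scale) auto
  also have "bracket H (sum x (insert al F)) - scale (al H) (sum x (insert al F)) =
    (\<Sum>de\<in>insert al F. scale (de H - al H) (x de))" unfolding bracket_sum_right scale_sum_right sum_subtractf[symmetric]
   by (rule sum.cong) (simp_all add: e scale_left_diff_distrib)
  also have "\<dots> = (\<Sum>de\<in>F. scale (de H - al H) (x de))" using insert.hyps by simp
  finally have "scale (ga H - al H) (x ga) \<in> S" by (intro insert.IH[of "%de. scale (de H - al H) (x de)"])
    (use insert.prems ga in "auto intro: subspace_scale[OF root_space_sub]")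
  hence "scale (1 / (ga H - al H)) (scale (ga H - al H) (x ga)) \<in> S" by (rule subspace_scale[OF S(1)])
  thus ?thesis using H by simp
 qed
 have "sum x (insert al F) - sum x F \<in> S" by (rule subspace_diff[OF S(1) insert.prems(3) subspace_sum[OF S(1) F]])
 hence "x al \<in> S" using insert.hyps by simp
 thus ?case using F insert.prems(4) by auto
qed simp

section \<open>The positive roots of the Borel subalgebra\<close>

abbreviation pos :: "'g wt set" where
 "pos == positive_roots"

lemma borel_facts: "subspace b" "x \<in> b ==> y \<in> b ==> bracket x y \<in> b" "solvable b"
 "subalgebra c ==> solvable c ==> b <= c ==> c = b" using borel by (simp_all add: borel_subalgebra_def subalgebra_def)

lemma pos_roots: "al \<in> pos ==> al \<in> roots" by (simp add: positive_roots_def)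

lemma pos_b: "al \<in> pos ==> x \<in> root_space al ==> x \<in> b" by (auto simp: positive_roots_def)

lemma posI:
 assumes al: "al \<in> roots" "x \<in> root_space al" "x ~= 0" "x \<in> b"
 shows "al \<in> pos"
proof -
 have "y \<in> b" if y: "y \<in> root_space al" for y
 proof -
  obtain c where "y = scale c x" by (rule root_space_line[OF al(1,2,3) y])
  thus ?thesis using al(4) subspace_scale[OF borel_facts(1)] by simp
 qed
 thus ?thesis using al(1) by (auto simp: positive_roots_def)
qed

text \<open>Opposite roots cannot both occur: their root vectors and the coroot would reproduce one
  another in every term of the derived series of \<open>b\<close>.\<close>

lemma closed_pos_pos: "closed_pos pos" unfolding closed_pos_def
proof (intro conjI ballI impI)
 show "pos <= roots" using pos_roots by auto
 fix al assume al: "al \<in> pos"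
 note alr = pos_roots[OF al]
 show "- al \<notin> pos"
 proof
  assume m: "- al \<in> pos"
  obtain e f where ef: "e \<in> root_space al" "f \<in> root_space (- al)" "bracket e f = coroot al" "e ~= 0"
   by (rule coroot_exists[OF alr])
  have he: "bracket (coroot al) e = scale 2 e" "bracket (coroot al) f = scale (- 2) f"
   using ef coroot_h[OF alr] coroot_2[OF alr] by (simp_all add: root_space_def)
  have "e \<in> derived_series b n & f \<in> derived_series b n & coroot al \<in> derived_series b n" for n
  proof (induction n)
   case 0
   have "e \<in> b" "f \<in> b" using pos_b[OF al ef(1)] pos_b[OF m ef(2)] by auto
   thus ?case using coroot_h[OF alr] cartan_subset_borel by auto
  next case (Suc n)
   let ?D = "derived_series b (Suc n)"
   have sub: "subspace ?D" by (simp add: bracket_span_def)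
   have br: "bracket x y \<in> ?D" if "x \<in> derived_series b n" "y \<in> derived_series b n" for x y
    using that by (auto simp: bracket_span_def intro!: span_base)
   have "scale 2 e \<in> ?D" "scale (- 2) f \<in> ?D" "coroot al \<in> ?D"
    using br[of "coroot al" e] br[of "coroot al" f] br[of e f] Suc he ef(3) by simp_all
   moreover have "e = scale (1/2) (scale 2 e)" "f = scale (- 1/2) (scale (- 2) f)" by simp_all
   ultimately show ?case using subspace_scale[OF sub] by metis
  qed
  thus False using borel_facts(3) ef(4) unfolding solvable_def by auto
 qed
 fix bt assume bt: "bt \<in> pos" and s: "al + bt \<in> roots"
 note btr = pos_roots[OF bt]
 obtain e where e: "e \<in> root_space al" "e ~= 0" by (rule root_space_nonzero[OF alr])
 obtain x where x: "x \<in> root_space bt" "x ~= 0" by (rule root_space_nonzero[OF btr])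
 show "al + bt \<in> pos" by (rule posI[OF s root_space_bracket[OF e(1) x(1)] bracket_root_nonzero[OF alr btr s e x]
     borel_facts(2)[OF pos_b[OF al e(1)] pos_b[OF bt x(1)]]])
qed

lemma all_components:
 obtains y where "!!ga. ga \<in> WT ==> y ga \<in> root_space ga" "x = sum y WT"
proof -
 have "x \<in> span (\<Union>ga\<in>WT. gw ga)" by (simp add: span_WT)
 then obtain y where "\<forall>ga\<in>WT. y ga \<in> gw ga" "x = sum y WT" using span_Union_family[OF finite_WT, of gw x] gw_sub by auto
 thus ?thesis using that[of y] gw_root_space by simp
qed

lemma borel_span: "b <= span (h \<union> (\<Union>al\<in>pos. root_space al))"
proof
 fix x assume x: "x \<in> b"
 obtain y where y: "!!ga. ga \<in> WT ==> y ga \<in> root_space ga" "x = sum y WT" using all_components by metis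
 have yb: "y ga \<in> b" if "ga \<in> WT" for ga by (rule weight_components[OF borel_facts(1) _ finite_WT order_refl y(1) _ that])
   (use borel_facts(2) cartan_subset_borel x y(2) in auto)
 have "y ga \<in> span (h \<union> (\<Union>al\<in>pos. root_space al))" if ga: "ga \<in> WT" for ga
 proof (cases "ga = 0 \<or> y ga = 0")
  case True
  thus ?thesis using y(1)[OF ga] root_space_0 span_zero by (auto intro: span_base)
 next case False
  hence "ga \<in> pos" using posI[OF _ y(1)[OF ga] _ yb[OF ga]] WT_cases[OF ga] by simp
  thus ?thesis using y(1)[OF ga] by (intro span_base) auto
 qed
 thus "x \<in> span (h \<union> (\<Union>al\<in>pos. root_space al))" unfolding y(2) by (rule span_sum)
qed

lemma cone_insert:
 "set xs <= insert bt P ==> \<exists>k ps. set ps <= P & sum_list xs = (%v. of_nat k * bt v) + sum_list ps & k + length ps = length xs"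
proof (induction xs)
 case Nil
 thus ?case by (intro exI[of _ 0] exI[of _ "[]"]) (auto simp: fun_eq_iff)
next case (Cons x xs)
 have "set xs <= insert bt P" using Cons.prems by simp
 from Cons.IH[OF this] obtain k ps where k: "set ps <= P" "sum_list xs = (%v. of_nat k * bt v) + sum_list ps" "k + length ps = length xs"
  by (elim exE conjE)
 show ?case
 proof (cases "x \<in> P")
  case True
  thus ?thesis using k by (intro exI[of _ k] exI[of _ "x # ps"]) (auto simp: algebra_simps)
 next case False
  hence "x = bt" using Cons.prems by simp
  thus ?thesis using k by (intro exI[of _ "Suc k"] exI[of _ ps]) (auto simp: fun_eq_iff algebra_simps)
 qed
qed

lemma sum_list_replicate_fun: "sum_list (concat (replicate k xs)) v = of_nat k * (sum_list xs v :: complex)"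
 by (induction k) (simp_all add: algebra_simps)

text \<open>If \<open>bt\<close> is not positive, the roots in the cone of \<open>pos\<close> and
  \<open>bt\<close> cannot be a closed set, for its solvable subalgebra would properly contain
  \<open>b\<close>. The failure is a relation: a positive multiple of \<open>bt\<close> plus a sum
  of positive roots is 0. Together with such a relation for \<open>- bt\<close> it gives a vanishing
  sum of positive roots.\<close>

lemma pos_or_neg:
 assumes bt: "bt \<in> roots"
 shows "bt \<in> pos \<or> - bt \<in> pos"
proof (rule ccontr)
 assume n: "\<not> (bt \<in> pos \<or> - bt \<in> pos)"
 have key: "\<exists>k ps. k > 0 & set ps <= pos & (%v. of_nat k * bt v) + sum_list ps = 0"
  if bt: "bt \<in> roots" and n: "bt \<notin> pos" for bt
 proof (rule ccontr)
  assume no: "\<not> (\<exists>k ps. k > 0 & set ps <= pos & (%v. of_nat k * bt v) + sum_list ps = 0)"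
  define Q where "Q = {ga \<in> roots. \<exists>xs. set xs <= insert bt pos & xs ~= [] & ga = sum_list xs}"
  have "closed_pos Q" unfolding closed_pos_def
  proof (intro conjI ballI impI)
   show "Q <= roots" by (auto simp: Q_def)
   fix al assume "al \<in> Q"
   then obtain xs where xs: "set xs <= insert bt pos" "xs ~= []" "al = sum_list xs" by (auto simp: Q_def)
   show "- al \<notin> Q"
   proof
    assume "- al \<in> Q"
    then obtain ys where ys: "set ys <= insert bt pos" "- al = sum_list ys" by (auto simp: Q_def)
    have z: "sum_list (xs @ ys) = 0" using xs(3) by (simp flip: ys(2))
    obtain k ps where k: "set ps <= pos" "sum_list (xs @ ys) = (%v. of_nat k * bt v) + sum_list ps"
      "k + length ps = length (xs @ ys)" using cone_insert[of "xs @ ys" bt pos] xs ys by auto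
    hence "k = 0" using no z by (metis gr0I)
    hence "sum_list ps = 0" "ps ~= []" using k z xs(2) by (auto simp: fun_eq_iff)
    thus False using no_zero_sum[OF closed_pos_pos k(1)] by simp
   qed
   fix ga assume "ga \<in> Q" and s: "al + ga \<in> roots"
   then obtain ys where ys: "set ys <= insert bt pos" "ga = sum_list ys" by (auto simp: Q_def)
   thus "al + ga \<in> Q" using xs s unfolding Q_def by (auto intro!: exI[of _ "xs @ ys"])
  qed
  note c = solvable_closed[OF this]
  have "pos <= Q"
  proof
   fix ga assume "ga \<in> pos"
   thus "ga \<in> Q" using pos_roots unfolding Q_def by (auto intro!: exI[of _ "[ga]"])
  qed
  hence "b <= span (h \<union> (\<Union>al\<in>Q. root_space al))" by (intro order_trans[OF borel_span] span_mono) auto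
  hence e: "span (h \<union> (\<Union>al\<in>Q. root_space al)) = b" by (rule borel_facts(4)[OF c])
  have "bt \<in> Q" using bt unfolding Q_def by (auto intro!: exI[of _ "[bt]"])
  obtain x where x: "x \<in> root_space bt" "x ~= 0" by (rule root_space_nonzero[OF bt])
  have "x \<in> b" unfolding e[symmetric] using x \<open>bt \<in> Q\<close> by (intro span_base) auto
  thus False using posI[OF bt x] n by simp
 qed
 obtain k ps where k: "k > 0" "set ps <= pos" "(%v. of_nat k * bt v) + sum_list ps = 0" using key[OF bt] n by blast
 obtain l qs where l: "l > 0" "set qs <= pos" "(%v. of_nat l * (- bt) v) + sum_list qs = 0" using key[OF root_minus[OF bt]] n by blast
 have kv: "of_nat k * bt v + sum_list ps v = 0" and lv: "- of_nat l * bt v + sum_list qs v = 0" for v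
  using fun_cong[OF k(3), of v] fun_cong[OF l(3), of v] by simp_all
 \<comment> \<open>\<open>l\<close> times the first relation plus \<open>k\<close> times the second
   eliminates \<open>bt\<close>.\<close>
 let ?zs = "concat (replicate l ps) @ concat (replicate k qs)"
 have "ps ~= []" using kv[of "coroot bt"] coroot_2[OF bt] k(1) by auto
 hence "?zs ~= []" using l(1) by (cases l) auto
 moreover have "set ?zs <= pos" using k(2) l(2) by auto
 moreover have "sum_list ?zs = 0"
 proof
  fix v
  have "sum_list ?zs v = of_nat l * (sum_list ps v) + of_nat k * (sum_list qs v)" by (simp add: sum_list_replicate_fun)
  also have "\<dots> = of_nat l * (of_nat k * bt v + sum_list ps v) + of_nat k * (- of_nat l * bt v + sum_list qs v)"
   by (simp add: algebra_simps)
  also have "\<dots> = 0" unfolding kv lv by simp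
  finally show "sum_list ?zs v = 0 v" by simp
 qed
 ultimately show False using no_zero_sum[OF closed_pos_pos] by blast
qed

lemma pos_not_neg: "al \<in> pos ==> - al \<notin> pos" using closed_pos_pos by (simp add: closed_pos_def)

lemma pos_add: "al \<in> pos ==> bt \<in> pos ==> al + bt \<in> roots ==> al + bt \<in> pos"
 using closed_pos_pos by (simp add: closed_pos_def)

lemma simple_pos: "al \<in> simple_roots ==> al \<in> pos" by (simp add: simple_roots_def)

lemma simple_indecomposable: "al \<in> simple_roots ==> bt \<in> pos ==> ga \<in> pos ==> al ~= bt + ga"
 by (simp add: simple_roots_def plus_fun_def)

lemma pos_minus_simple:
 assumes "al \<in> simple_roots" "bt \<in> pos" "bt - al \<in> roots"
 shows "bt - al \<in> pos"
proof (rule ccontr)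
 assume "bt - al \<notin> pos"
 hence "al - bt \<in> pos" using pos_or_neg[OF assms(3)] by simp
 thus False using simple_indecomposable[OF assms(1,2), of "al - bt"] by simp
qed

lemma pos_induct_simple:
 assumes ga: "ga \<in> pos"
 shows "\<exists>xs. set xs <= simple_roots & ga = sum_list xs" using ga
proof (induction "rk pos ga" arbitrary: ga rule: less_induct)
 case less
 show ?case
 proof (cases "ga \<in> simple_roots")
  case True
  thus ?thesis by (intro exI[of _ "[ga]"]) simp
 next case False
  then obtain al bt where ab: "al \<in> pos" "bt \<in> pos" "ga = al + bt" using less.prems by (auto simp: simple_roots_def plus_fun_def)
  have "rk pos al < rk pos ga" "rk pos bt < rk pos ga"
   using rk_less[OF closed_pos_pos ab(1,2)] rk_less[OF closed_pos_pos ab(2,1)] ab less.prems by (simp_all add: add.commute)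
  then obtain xs ys where "set xs <= simple_roots" "al = sum_list xs" "set ys <= simple_roots" "bt = sum_list ys"
   using less.hyps ab by metis
  thus ?thesis using ab by (intro exI[of _ "xs @ ys"]) simp
 qed
qed

text \<open>As a sum of simple roots \<open>ga\<close> pairs with itself to 2, so some simple root
  pairs positively with \<open>ga\<close> and can be subtracted.\<close>

lemma pos_simple_step:
 assumes ga: "ga \<in> pos" "ga \<notin> simple_roots"
 obtains al where "al \<in> simple_roots" "ga - al \<in> pos"
proof -
 note gar = pos_roots[OF ga(1)]
 obtain xs where xs: "set xs <= simple_roots" "ga = sum_list xs" using pos_induct_simple[OF ga(1)] by auto
 hence r: "set xs <= roots" using simple_pos pos_roots by auto
 have "(\<Sum>bt\<leftarrow>xs. ip bt ga) = 2" using ip_sum_list[OF r gar] ip_self[OF gar] xs by simp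
 moreover have "(\<Sum>bt\<leftarrow>xs. ip bt ga) \<le> 0" if "!!bt. bt \<in> set xs ==> ip bt ga \<le> 0"
  using that by (intro sum_list_nonpos) auto
 ultimately obtain al where al: "al \<in> set xs" "ip al ga > 0" by force
 have als: "al \<in> simple_roots" "al \<in> roots" using al xs r by auto
 have "al ~= ga" using als ga(2) by auto
 hence "al - ga \<in> roots" using ip_bound_cases[OF als(2) gar] al(2) by auto
 hence "ga - al \<in> roots" using root_minus[of "al - ga"] by simp
 thus ?thesis using that[OF als(1)] pos_minus_simple[OF als(1) ga(1)] by simp
qed

lemma pos_induct [consumes 1, case_names simple add]:
 assumes "ga \<in> pos" and s: "!!al. al \<in> simple_roots ==> P al"
  and a: "!!al bt. al \<in> simple_roots ==> bt \<in> pos ==> al + bt \<in> pos ==> P bt ==> P (al + bt)"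
 shows "P ga" using assms(1)
proof (induction "rk pos ga" arbitrary: ga rule: less_induct)
 case less
 show ?case
 proof (cases "ga \<in> simple_roots")
  case False
  obtain al where al: "al \<in> simple_roots" "ga - al \<in> pos" by (rule pos_simple_step[OF less.prems False])
  have "rk pos (ga - al) < rk pos ga" using rk_less[OF closed_pos_pos al(2) simple_pos[OF al(1)]] less.prems by simp
  hence "P (ga - al)" using less.hyps al(2) by blast
  thus ?thesis using a[OF al, of] less.prems by simp
 qed (use s in simp)
qed

text \<open>Pairing with the sum of the positive coroots, that is, twice the usual height.\<close>

definition ht :: "'g wt => int" where
 "ht nu = (\<Sum>bt\<in>pos. ip nu bt)"

lemma ht_add: "\<mu> \<in> intw ==> nu \<in> intw ==> ht (\<mu> + nu) = ht \<mu> + ht nu" by (simp add: ht_def ip_add pos_roots sum.distrib)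

lemma ht_minus: "\<mu> \<in> intw ==> ht (- \<mu>) = - ht \<mu>" by (simp add: ht_def ip_minus pos_roots sum_negf)

lemma finite_pos: "finite pos" using finite_roots finite_subset pos_roots by (metis subsetI)

text \<open>Reflection in \<open>al\<close> permutes the other positive roots and negates their
  pairings with \<open>al\<close>; these cancel and \<open>al\<close> itself contributes 2.\<close>

lemma ht_simple:
 assumes al: "al \<in> simple_roots"
 shows "ht al = 2"
proof -
 note alp = simple_pos[OF al]
 note alr = pos_roots[OF alp]
 define s where "s bt = bt - (%x. of_int (ip bt al) * al x)" for bt
 have s: "s bt \<in> pos - {al} & ip al (s bt) = - ip al bt & s (s bt) = bt" if bt: "bt \<in> pos - {al}" for bt
 proof -
  have btp: "bt \<in> pos" and btr: "bt \<in> roots" and ne: "bt ~= al" "bt ~= - al" using bt pos_roots pos_not_neg[OF alp] by auto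
  have sr: "s bt \<in> roots" unfolding s_def by (rule reflect_root[OF alr btr])
  have i: "ip (s bt) al = - ip bt al" by (rule ipI) (simp add: s_def ip[OF roots_intw[OF btr] alr] coroot_2[OF alr])
  hence "ip al (s bt) = - ip al bt" using ip_sym[OF alr sr] ip_sym[OF alr btr] by simp
  moreover have "s (s bt) = bt"
  proof
   show "s (s bt) x = bt x" for x unfolding s_def[of "s bt"] i by (simp add: s_def)
  qed
  moreover have "s bt \<in> pos"
  proof -
   consider "ip bt al = 0" | "ip bt al = 1" | "ip bt al = - 1" using ip_bound_cases[OF btr alr] ne by auto
   thus ?thesis
   proof cases
    case 1
    hence "s bt = bt" by (auto simp: s_def fun_eq_iff)
    thus ?thesis using btp by simp
   next case 2
    hence "s bt = bt - al" by (auto simp: s_def fun_eq_iff)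
    thus ?thesis using pos_minus_simple[OF al btp] sr by simp
   next case 3
    hence "s bt = bt + al" by (auto simp: s_def fun_eq_iff)
    thus ?thesis using pos_add[OF btp alp] sr by simp
   qed
  qed
  moreover have "s bt ~= al"
  proof
   assume "s bt = al"
   hence "ip bt al = - 2" using i ip_self[OF alr] by simp
   thus False using ip_bound_cases[OF btr alr] ne by auto
  qed
  ultimately show ?thesis by blast
 qed
 have "(\<Sum>bt\<in>pos - {al}. ip al bt) = (\<Sum>bt\<in>pos - {al}. - ip al bt)"
  by (rule sum.reindex_bij_witness[of _ s s]) (use s in auto)
 hence "(\<Sum>bt\<in>pos - {al}. ip al bt) = 0" by (simp add: sum_negf)
 thus ?thesis using sum.remove[OF finite_pos alp, of "ip al"] ip_self[OF alr] by (simp add: ht_def)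
qed

lemma ht_pos: "ga \<in> pos ==> ht ga \<ge> 2"
proof (induction rule: pos_induct)
 case (add al bt)
 have "ht (al + bt) \<ge> 2" using ht_add[OF roots_intw[of al] roots_intw[of bt]] add ht_simple simple_pos pos_roots by simp
 thus ?case .
qed (simp add: ht_simple)

lemma dominant_intw:
 assumes "dominant_integral nu"
 shows "nu \<in> intw" "ga \<in> pos ==> ip nu ga \<ge> 0"
proof -
 have nu: "nu \<in> dual" "!!al. al \<in> simple_roots ==> \<exists>n::nat. nu (coroot al) = of_nat n"
  using assms by (auto simp: dominant_integral_def)
 have n: "\<exists>n::nat. nu (coroot ga) = of_nat n" if "ga \<in> pos" for ga using that
 proof (induction rule: pos_induct)
  case (add al bt)
  hence r: "al \<in> roots" "bt \<in> roots" "al + bt \<in> roots" using simple_pos pos_roots by auto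
  obtain m n :: nat where "nu (coroot al) = of_nat m" "nu (coroot bt) = of_nat n" using nu(2)[OF add(1)] add.IH by auto
  hence "\<exists>n::nat. nu (coroot (al + bt)) = of_nat n"
   using coroot_additive[OF r] dual_props(1)[OF nu(1) coroot_h[OF r(1)] coroot_h[OF r(2)]] by (intro exI[of _ "m + n"]) simp
  thus ?case .
 qed (use nu in auto)
 have "nu (coroot ga) \<in> \<int>" if ga: "ga \<in> roots" for ga using pos_or_neg[OF ga]
 proof
  assume "- ga \<in> pos"
  then obtain m :: nat where "nu (coroot (- ga)) = of_nat m" using n by auto
  hence "nu (coroot ga) = - of_nat m" using coroot_minus[OF ga] dual_props(2)[OF nu(1) coroot_h[OF ga], of "- 1"]
   by (simp add: equation_minus_iff)
  thus ?thesis by simp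
 qed (use n in force)
 thus 1: "nu \<in> intw" using nu(1) by (simp add: intw_def)
 show "ip nu ga \<ge> 0" if ga: "ga \<in> pos"
 proof -
  obtain m :: nat where "nu (coroot ga) = of_nat m" using n[OF ga] by auto
  hence "ip nu ga = int m" by (intro ipI) simp
  thus ?thesis by simp
 qed
qed

end

section \<open>The normalized invariant form\<close>

context ade
begin

lemma K_coroot:
 assumes al: "al \<in> roots"
 obtains c where "c ~= 0" "!!H. H \<in> h ==> K H (coroot al) = c * al H"
proof -
 obtain e f where ef: "e \<in> root_space al" "f \<in> root_space (- al)" "bracket e f = coroot al" by (rule coroot_exists[OF al])
 have 1: "K H (coroot al) = K e f * al H" if "H \<in> h" for H
  using K_bracket_h[OF that, of e "al H" f] ef that by (simp add: root_space_def mult.commute)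
 have "K e f ~= 0"
 proof
  assume "K e f = 0"
  hence "K (coroot al) y = 0" if "y \<in> h" for y using 1[OF that] K_sym[of y] by simp
  hence "coroot al = 0" by (rule K_nondegenerate_h[OF coroot_h[OF al]])
  thus False using coroot_2[OF al] dual_props(4)[OF rootD(3)[OF al]] by simp
 qed
 thus ?thesis using that 1 by blast
qed

text \<open>The scalar \<open>c\<close> does not depend on the root, since orthogonal families of roots span ideals.\<close>

lemma K_coroot_uniform: "\<exists>c. c ~= 0 & (\<forall>al\<in>roots. \<forall>H\<in>h. K H (coroot al) = c * al H)"
proof (cases "roots = {}")
 case False
 then obtain al where al: "al \<in> roots" by auto
 obtain c where c: "c ~= 0" "!!H. H \<in> h ==> K H (coroot al) = c * al H" by (rule K_coroot[OF al]) blast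
 define R where "R = {bt \<in> roots. \<forall>H\<in>h. K H (coroot bt) = c * bt H}"
 have orth: "ip bt ga = 0" if bt: "bt \<in> R" and ga: "ga \<in> roots" "ga \<notin> R" for bt ga
 proof (rule ccontr)
  assume n: "ip bt ga ~= 0"
  have btr: "bt \<in> roots" "!!H. H \<in> h ==> K H (coroot bt) = c * bt H" using bt by (auto simp: R_def)
  obtain d where d: "!!H. H \<in> h ==> K H (coroot ga) = d * ga H" by (rule K_coroot[OF ga(1)]) blast
  have "c * bt (coroot ga) = d * bt (coroot ga)"
   using btr(2)[OF coroot_h[OF ga(1)]] d[OF coroot_h[OF btr(1)]] K_sym root_sym[OF btr(1) ga(1)] by metis
  moreover have "bt (coroot ga) ~= 0" using n ip[OF roots_intw[OF btr(1)] ga(1)] by simp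
  ultimately have "d = c" by simp
  thus False using ga d by (auto simp: R_def)
 qed
 define G where "G = (\<Union>bt\<in>R. insert (coroot bt) (root_space bt))"
 have Rr: "R <= roots" by (auto simp: R_def)
 have G: "bracket x y \<in> span G" if x: "x \<in> root_space ga" "ga \<in> WT" and y: "y \<in> G" for x y ga
 proof -
  obtain bt where bt: "bt \<in> R" "bt \<in> roots" and y': "y = coroot bt \<or> y \<in> root_space bt" using y Rr by (auto simp: G_def)
  have xG: "x \<in> span G" if "ga \<in> R" using that x by (auto simp: G_def intro: span_base)
  show ?thesis
  proof (cases "ga = 0")
   case True
   hence xh: "x \<in> h" using x root_space_0 by simp
   have yG: "y \<in> span G" using y by (rule span_base)
   show ?thesis using y'
   proof
    assume "y = coroot bt"
    thus ?thesis using h_abelian[OF xh coroot_h[OF bt(2)]] span_zero by simp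
   next
    assume "y \<in> root_space bt"
    thus ?thesis using xh yG by (simp add: root_space_def span_scale)
   qed
  next case False
   hence gar: "ga \<in> roots" using WT_cases x by blast
   show ?thesis using y'
   proof
    assume y: "y = coroot bt"
    have e: "bracket x y = scale (- ga (coroot bt)) x" using x coroot_h[OF bt(2)] bracket_antisym[of x y] by (simp add: y root_space_def)
    show ?thesis
    proof (cases "ga \<in> R")
     case True
     thus ?thesis unfolding e using xG by (intro span_scale)
    next case False
     hence "ga (coroot bt) = 0" using orth[OF bt(1) gar] ip[OF roots_intw[OF bt(2)] gar] root_sym[OF bt(2) gar] by simp
     thus ?thesis unfolding e using span_zero by simp
    qed
   next
    assume y: "y \<in> root_space bt"
    consider "ga + bt \<in> roots" | "bt = - ga" | "ga + bt \<notin> roots" "bt ~= - ga" by blast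
    thus ?thesis
    proof cases
     case 1
     have "ip bt (ga + bt) = 1" using ip_coroot_add[OF roots_intw[OF bt(2)] gar bt(2) 1] ip_self[OF bt(2)]
       ip_add_root[OF gar bt(2) 1] ip_sym[OF gar bt(2)] by simp
     hence "ga + bt \<in> R" using orth[OF bt(1) 1] by auto
     thus ?thesis using root_space_bracket[OF x(1) y] by (auto simp: G_def intro: span_base)
    next case 2
     have "bracket x y \<in> span {coroot bt}"
     proof (cases "x = 0")
      case False
      obtain f where f: "f \<in> root_space (- ga)" "bracket x f = coroot ga" "f ~= 0" by (rule root_partner[OF gar x(1) False])
      obtain a where "y = scale a f" using root_space_line[OF root_minus[OF gar] f(1,3)] y 2 by metis
      hence "bracket x y = scale (- a) (coroot bt)" using f(2) 2 coroot_minus[OF gar] by (simp add: bracket_scale_right)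
      thus ?thesis by (simp add: span_scale span_base span_neg)
     qed (simp add: bracket_zero_left span_zero)
     moreover have "span {coroot bt} <= span G" using bt(1) by (intro span_mono) (auto simp: G_def)
     ultimately show ?thesis by auto
    next case 3
     thus ?thesis using bracket_not_root[OF gar bt(2) 3 x(1) y] span_zero by simp
    qed
   qed
  qed
 qed
 have G': "bracket x y \<in> span G" if y: "y \<in> G" for x y
 proof -
  obtain z where z: "!!ga. ga \<in> WT ==> z ga \<in> root_space ga" "x = sum z WT" using all_components[of x] by metis
  show ?thesis unfolding z(2) bracket_sum_left by (rule span_sum) (use G z(1) y in auto)
 qed
 have "bracket x y \<in> span G" if "y \<in> span G" for x y
 proof -
  have "bracket x y \<in> bracket_span (span UNIV) (span G)" using that by (auto simp: bracket_span_def intro!: span_base)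
  also have "\<dots> <= span G" by (rule bracket_span_subset) (use G' in auto)
  finally show ?thesis .
 qed
 hence "lie_ideal (span G)" by (auto simp: lie_ideal_def)
 moreover have "span G ~= {0}"
 proof -
  have "al \<in> R" using al c by (auto simp: R_def)
  hence "coroot al \<in> span G" by (auto simp: G_def intro: span_base)
  moreover have "coroot al ~= 0" using coroot_2[OF al] dual_props(4)[OF rootD(3)[OF al]] by auto
  ultimately show ?thesis by auto
 qed
 ultimately have U: "span G = UNIV" using simple unfolding simple_def by metis
 have "ga \<in> R" if ga: "ga \<in> roots" for ga
 proof (rule ccontr)
  assume n: "ga \<notin> R"
  have "G <= {y. bracket (coroot ga) y = 0}"
  proof
   fix y assume "y \<in> G"
   then obtain bt where bt: "bt \<in> R" "bt \<in> roots" and y': "y = coroot bt \<or> y \<in> root_space bt" using Rr by (auto simp: G_def)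
   have "bt (coroot ga) = 0" using orth[OF bt(1) ga n] ip[OF roots_intw[OF bt(2)] ga] by simp
   thus "y \<in> {y. bracket (coroot ga) y = 0}"
    using y' h_abelian[OF coroot_h[OF ga] coroot_h[OF bt(2)]] coroot_h[OF ga] by (auto simp: root_space_def)
  qed
  moreover have "subspace {y. bracket (coroot ga) y = 0}"
   by (rule subspaceI) (auto simp: bracket_zero_right bracket_add_right bracket_scale_right)
  ultimately have "span G <= {y. bracket (coroot ga) y = 0}" by (rule span_minimal)
  hence 0: "bracket (coroot ga) y = 0" for y using U by auto
  obtain e where e: "e \<in> root_space ga" "e ~= 0" by (rule root_space_nonzero[OF ga])
  have "bracket (coroot ga) e = scale 2 e" using e(1) coroot_h[OF ga] coroot_2[OF ga] by (simp add: root_space_def)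
  thus False using 0 e(2) by simp
 qed
 thus ?thesis using c(1) by (auto simp: R_def)
next case True
 thus ?thesis by (intro exI[of _ 1]) simp
qed

text \<open>The Killing form divided by the common scalar of \<open>K_coroot_uniform\<close>. A root
  vector and its partner with bracket the coroot then pair to 1 (\<open>kap_pair\<close>), so the
  central value 1 means level one.\<close>

definition kap :: "'g => 'g => complex" where
 "kap x y = K x y / (SOME c. c ~= 0 & (\<forall>al\<in>roots. \<forall>H\<in>h. K H (coroot al) = c * al H))"

lemma kap_eq:
 obtains c where "c ~= 0" "!!x y. kap x y = K x y / c"
  "!!al H. al \<in> roots ==> H \<in> h ==> K H (coroot al) = c * al H" using someI_ex[OF K_coroot_uniform] that unfolding kap_def by blast

lemma kap_simps:
 "kap (x + x') y = kap x y + kap x' y" "kap x (y + y') = kap x y + kap x y'"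
 "kap (scale c x) y = c * kap x y" "kap x (scale c y) = c * kap x y" "kap 0 y = 0" "kap x 0 = 0"
 by (simp_all add: kap_def K_add K_add_right K_scale K_scale_right K_zero add_divide_distrib)

lemma kap_sym: "kap x y = kap y x" by (simp add: kap_def K_sym)

lemma kap_invariant: "kap (bracket x y) z = kap x (bracket y z)" by (simp add: kap_def K_invariant)

lemma kap_orthogonal:
 "x \<in> root_space al ==> y \<in> root_space bt ==> al \<in> WT ==> bt \<in> WT ==> al + bt ~= 0 ==> kap x y = 0"
 using K_orthogonal[of x al y bt] root_space_gw[of al] root_space_gw[of bt] WT_onh by (auto simp: kap_def)

lemma kap_bracket:
 assumes al: "al \<in> roots" and x: "x \<in> root_space al" and y: "y \<in> root_space (- al)"
 shows "bracket x y = scale (kap x y) (coroot al)"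
proof -
 obtain c where c: "c ~= 0" "!!x y. kap x y = K x y / c"
  "!!al H. al \<in> roots ==> H \<in> h ==> K H (coroot al) = c * al H" by (rule kap_eq) blast
 have h1: "bracket x y \<in> h" using root_space_bracket[OF x y] root_space_0 by simp
 have "bracket x y - scale (kap x y) (coroot al) = 0"
 proof (rule K_nondegenerate_h)
  show "bracket x y - scale (kap x y) (coroot al) \<in> h"
   using h1 coroot_h[OF al] by (simp add: subspace_diff[OF h_subspace] subspace_scale[OF h_subspace])
  fix H assume H: "H \<in> h"
  have "K H (bracket x y) = al H * K x y" using K_bracket_h[OF H] x H by (simp add: root_space_def)
  thus "K (bracket x y - scale (kap x y) (coroot al)) H = 0" using c(1) c(3)[OF al H]
   by (simp add: K_diff K_scale c(2) K_sym[of "coroot al" H] K_sym[of "bracket x y" H])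
 qed
 thus ?thesis by simp
qed

lemma kap_pair:
 assumes al: "al \<in> roots" and x: "x \<in> root_space al" and y: "y \<in> root_space (- al)" and xy: "bracket x y = coroot al"
 shows "kap x y = 1"
proof -
 have "al (coroot al) = kap x y * al (coroot al)" using kap_bracket[OF al x y] xy dual_props(2)[OF rootD(3)[OF al] coroot_h[OF al]] by metis
 thus ?thesis using coroot_2[OF al] by simp
qed

text \<open>Three brackets raise the pairing with \<open>al\<close> by 6, but weights pair with
  \<open>al\<close> to values between -2 and 2.\<close>

lemma bracket_cube:
 assumes al: "al \<in> roots" and x: "x \<in> root_space al" and z: "z \<in> root_space bt" "bt \<in> WT"
 shows "bracket x (bracket x (bracket x z)) = 0"
proof (rule ccontr)
 assume n: "bracket x (bracket x (bracket x z)) ~= 0"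
 have "bracket x (bracket x (bracket x z)) \<in> root_space (al + (al + (al + bt)))" by (intro root_space_bracket x z)
 moreover have on: "onh (al + (al + (al + bt)))" by (intro onh_simps(3)) (simp_all add: WT_onh rootD(1)[OF al] z(2))
 ultimately have w: "al + (al + (al + bt)) \<in> WT" using not_WT[OF on] root_space_gw n by (metis subsetD)
 have b: "ga \<in> intw & - 2 \<le> ip ga al & ip ga al \<le> 2" if "ga \<in> WT" for ga
  using WT_cases[OF that] ip_bound_cases[OF _ al, of ga] intw_0 roots_intw by force
 note i = roots_intw[OF al]
 have bti: "bt \<in> intw" using b z by simp
 have "ip (al + (al + (al + bt))) al = 6 + ip bt al"
  unfolding ip_add[OF i intw_add[OF i intw_add[OF i bti]] al] ip_add[OF i intw_add[OF i bti] al]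
   ip_add[OF i bti al] ip_self[OF al] by presburger
 thus False using b[OF w] b[OF z(2)] by simp
qed

end

section \<open>The vacuum functional of level one\<close>

type_synonym 'g word = "('g \<times> int) list"

context ade
begin

text \<open>The letter \<open>(x, n)\<close> stands for \<open>x \<otimes> t\<^sup>n\<close> in the affine Lie algebra; \<open>cen\<close> is its cocycle, the
  central element acting as 1. The functional \<open>vac\<close> is the vacuum expectation value: it kills
  words that begin with a letter of degree at most 0 or end with one of degree at least 0.\<close>

definition br :: "'g \<times> int => 'g \<times> int => 'g \<times> int" where
 "br y z = (bracket (fst y) (fst z), snd y + snd z)"

definition cen :: "'g \<times> int => 'g \<times> int => complex" where
 "cen y z = (if snd y + snd z = 0 then of_int (snd y) * kap (fst y) (fst z) else 0)"

text \<open>What is left of \<open>Ps (y # w)\<close> when \<open>y\<close> is moved to the right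
  end and dropped there: for each letter of \<open>w\<close>, one term with that letter bracketed by
  \<open>y\<close> and one with both contracted by the cocycle.\<close>

primrec adw :: "'g \<times> int => ('g word => complex) => 'g word => complex" where
 "adw y Ps [] = 0"
| "adw y Ps (z # w) = Ps (br y z # w) + cen y z * Ps w + adw y (%v. Ps (z # v)) w"

text \<open>The recursion runs through changed words and is not structural, so a bound on the length
  serves as fuel; \<open>vacn_eq\<close> disposes of it.\<close>

primrec vacn :: "nat => 'g word => complex" where
 "vacn 0 w = (if w = [] then 1 else 0)"
| "vacn (Suc n) w = (case w of [] => 1 | y # v => if snd y \<le> 0 then 0 else adw y (vacn n) v)"

definition vac :: "'g word => complex" where
 "vac w = vacn (length w) w"

lemma adw_cong: "(!!v. length v \<le> length w ==> Ps v = Ph v) ==> adw y Ps w = adw y Ph w"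
proof (induction w arbitrary: Ps Ph)
 case (Cons z w)
 have "adw y (%v. Ps (z # v)) w = adw y (%v. Ph (z # v)) w" by (rule Cons.IH) (simp add: Cons.prems)
 thus ?case by (simp add: Cons.prems)
qed simp

lemma vacn_eq: "length w \<le> n ==> vacn n w = vac w"
proof (induction n arbitrary: w rule: less_induct)
 case (less n)
 show ?case
 proof (cases w)
  case Nil
  thus ?thesis by (cases n) (simp_all add: vac_def)
 next case (Cons y v)
  then obtain m where m: "n = Suc m" using less.prems by (cases n) auto
  have "adw y (vacn m) v = adw y (vacn (length v)) v"
  proof (rule adw_cong)
   fix u :: "'g word" assume u: "length u \<le> length v"
   show "vacn m u = vacn (length v) u" using less.IH[of m u] less.IH[of "length v" u] u m Cons less.prems by simp
  qed
  thus ?thesis by (simp add: vac_def m Cons)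
 qed
qed

lemma vac_Nil: "vac [] = 1" by (simp add: vac_def)

lemma vac_Cons: "vac (y # w) = (if snd y \<le> 0 then 0 else adw y vac w)"
proof -
 have "adw y (vacn (length w)) w = adw y vac w" by (rule adw_cong) (simp add: vacn_eq)
 thus ?thesis by (simp add: vac_def)
qed

lemma adw_add: "adw y (%v. Ps v + Ph v) w = adw y Ps w + adw y Ph w" by (induction w arbitrary: Ps Ph) (simp_all add: algebra_simps)

lemma adw_scale: "adw y (%v. c * Ps v) w = c * adw y Ps w" by (induction w arbitrary: Ps) (simp_all add: algebra_simps)

lemma adw_zero: "adw y (%v. 0) w = 0" by (induction w) simp_all

lemma br_simps: "br y (x + x', k) = (fst (br y (x, k)) + fst (br y (x', k)), snd y + k)"
 "br y (scale c x, k) = (scale c (fst (br y (x, k))), snd y + k)"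
 "br (x + x', k) y = (fst (br (x, k) y) + fst (br (x', k) y), k + snd y)"
 "br (scale c x, k) y = (scale c (fst (br (x, k) y)), k + snd y)"
 by (simp_all add: br_def bracket_add_left bracket_add_right bracket_scale_left bracket_scale_right)

lemma cen_simps: "cen y (x + x', k) = cen y (x, k) + cen y (x', k)" "cen y (scale c x, k) = c * cen y (x, k)"
 "cen (x + x', k) y = cen (x, k) y + cen (x', k) y" "cen (scale c x, k) y = c * cen (x, k) y"
 by (simp_all add: cen_def kap_simps algebra_simps)

lemma cen_antisym: "cen y z = - cen z y" by (auto simp: cen_def kap_sym[of "fst y"] add_eq_0_iff)

lemma cen_cocycle: "cen u (br v z) - cen v (br u z) = cen (br u v) z"
proof -
 have 1: "kap (fst u) (bracket (fst v) (fst z)) = kap (bracket (fst u) (fst v)) (fst z)" by (simp add: kap_invariant)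
 have "kap (fst v) (bracket (fst u) (fst z)) = kap (bracket (fst v) (fst u)) (fst z)" by (simp add: kap_invariant)
 also have "\<dots> = - kap (bracket (fst u) (fst v)) (fst z)"
  using kap_simps(3)[of "- 1" "bracket (fst u) (fst v)"] by (simp add: bracket_antisym[of "fst v" "fst u"])
 finally show ?thesis by (auto simp: cen_def br_def 1 algebra_simps)
qed

text \<open>Like \<open>CM\<close> below it is bounded by word length, because both are proved for
  \<open>vac\<close> by induction on the length, and \<open>adw\<close> never lengthens a
  word.\<close>

definition mlin :: "nat => ('g word => complex) => bool" where
 "mlin n Ps \<longleftrightarrow> (\<forall>u w x x' k c. length u + length w < n -->
   Ps (u @ (x + x', k) # w) = Ps (u @ (x, k) # w) + Ps (u @ (x', k) # w) &
   Ps (u @ (scale c x, k) # w) = c * Ps (u @ (x, k) # w))"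

lemma mlinD: "mlin n Ps ==> length u + length w < n ==> Ps (u @ (x + x', k) # w) = Ps (u @ (x, k) # w) + Ps (u @ (x', k) # w)"
 "mlin n Ps ==> length u + length w < n ==> Ps (u @ (scale c x, k) # w) = c * Ps (u @ (x, k) # w)" unfolding mlin_def by blast+

lemmas mlinD1 = mlinD[of _ _ "[]", simplified]

lemma mlin_Cons: "mlin (Suc n) Ps ==> mlin n (%v. Ps (z # v))" using mlinD[of "Suc n" Ps "z # _"] by (simp add: mlin_def)

lemma adw_mlin: "mlin n Ps ==> length u + length w < n ==>
  adw y Ps (u @ (x + x', k) # w) = adw y Ps (u @ (x, k) # w) + adw y Ps (u @ (x', k) # w) &
  adw y Ps (u @ (scale c x, k) # w) = c * adw y Ps (u @ (x, k) # w)"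
proof (induction u arbitrary: Ps n)
 case Nil
 have 1: "adw y (%v. Ps ((x + x', k) # v)) w = adw y (%v. Ps ((x, k) # v) + Ps ((x', k) # v)) w"
  by (rule adw_cong) (rule mlinD1[OF Nil(1)], use Nil(2) in simp)
 have 2: "adw y (%v. Ps ((scale c x, k) # v)) w = adw y (%v. c * Ps ((x, k) # v)) w"
  by (rule adw_cong) (rule mlinD1[OF Nil(1)], use Nil(2) in simp)
 have b: "(fst (br y (z, k)), snd y + k) = br y (z, k)" for z by (simp add: br_def)
 show ?case using Nil(2) by (simp add: 1 2 adw_add adw_scale cen_simps br_simps mlinD1[OF Nil(1)] b distrib_left distrib_right)
next case (Cons z u)
 obtain m where m: "n = Suc m" using Cons.prems(2) by (cases n) auto
 have IH: "adw y (%v. Ps (z # v)) (u @ (x + x', k) # w) =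
   adw y (%v. Ps (z # v)) (u @ (x, k) # w) + adw y (%v. Ps (z # v)) (u @ (x', k) # w) &
  adw y (%v. Ps (z # v)) (u @ (scale c x, k) # w) = c * adw y (%v. Ps (z # v)) (u @ (x, k) # w)"
  by (rule Cons.IH[OF mlin_Cons[OF Cons.prems(1)[unfolded m]]]) (use Cons.prems m in simp)
 show ?case using Cons.prems IH mlinD[OF Cons.prems(1), of "br y z # u" w] mlinD[OF Cons.prems(1), of u w] by (simp add: algebra_simps)
qed

lemma adw_linear: "mlin n Ps ==> length w \<le> n ==>
  adw (x + x', k) Ps w = adw (x, k) Ps w + adw (x', k) Ps w & adw (scale c x, k) Ps w = c * adw (x, k) Ps w"
proof (induction w arbitrary: Ps n)
 case (Cons z w)
 obtain m where m: "n = Suc m" using Cons.prems(2) by (cases n) auto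
 have "(fst (br (y, k) z), k + snd z) = br (y, k) z" for y by (simp add: br_def)
 thus ?case using Cons.IH[OF mlin_Cons[OF Cons.prems(1)[unfolded m]]] Cons.prems m
  by (simp add: br_simps cen_simps mlinD1[OF Cons.prems(1)] algebra_simps)
qed simp

lemma mlin_vac: "mlin n vac"
proof (induction n)
 case (Suc n)
 have "vac (u @ (x + x', k) # w) = vac (u @ (x, k) # w) + vac (u @ (x', k) # w) &
   vac (u @ (scale c x, k) # w) = c * vac (u @ (x, k) # w)" if "length u + length w < Suc n" for u w x x' k c
 proof (cases u)
  case Nil
  thus ?thesis using adw_linear[OF Suc, of w x x' k c] that by (simp add: vac_Cons)
 next case (Cons y u')
  thus ?thesis using adw_mlin[OF Suc, of u' w] that by (simp add: vac_Cons)
 qed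
 thus ?case by (simp add: mlin_def)
qed (simp add: mlin_def)

text \<open>Letter by letter this is the Jacobi identity together with the cocycle identity.\<close>

lemma adw_commute:
 "mlin n Ps ==> length c \<le> n ==> adw v (adw u Ps) c - adw u (adw v Ps) c = adw (br u v) Ps c"
proof (induction c arbitrary: Ps n)
 case (Cons z w)
 obtain m where m: "n = Suc m" using Cons.prems(2) by (cases n) auto
 have 1: "adw v (adw u Ps) (z # w) = Ps (br u (br v z) # w) + cen u (br v z) * Ps w + adw u (%s. Ps (br v z # s)) w
   + cen v z * adw u Ps w + adw v (%s. Ps (br u z # s)) w + cen u z * adw v Ps w
   + adw v (adw u (%s. Ps (z # s))) w" for u v by (simp add: adw_add adw_scale)
 have j: "br u (br v z) = (fst (br (br u v) z) + fst (br v (br u z)), snd u + snd v + snd z)"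
  by (simp add: br_def bracket_bracket_right[of "fst u"])
 have "(fst (br (br u v) z), snd u + snd v + snd z) = br (br u v) z"
   "(fst (br v (br u z)), snd u + snd v + snd z) = br v (br u z)" by (simp_all add: br_def)
 hence 2: "Ps (br u (br v z) # w) = Ps (br (br u v) z # w) + Ps (br v (br u z) # w)"
  unfolding j using mlinD1(1)[OF Cons.prems(1)] Cons.prems(2) by simp
 have 3: "adw v (adw u (%s. Ps (z # s))) w - adw u (adw v (%s. Ps (z # s))) w = adw (br u v) (%s. Ps (z # s)) w"
  by (rule Cons.IH[OF mlin_Cons[OF Cons.prems(1)[unfolded m]]]) (use Cons.prems m in simp)
 have 4: "cen u (br v z) = cen v (br u z) + cen (br u v) z" using cen_cocycle[of u v z] by (simp add: algebra_simps)
 show ?case unfolding 1 using 3 by (simp add: 2 4 algebra_simps)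
qed simp

definition CM :: "nat => ('g word => complex) => bool" where
 "CM n Ps \<longleftrightarrow> (\<forall>p u v c. length p + length c + 2 \<le> n -->
   Ps (p @ u # v # c) = Ps (p @ v # u # c) + Ps (p @ br u v # c) + cen u v * Ps (p @ c))"

lemma CMD: "CM n Ps ==> length p + length c + 2 \<le> n ==>
  Ps (p @ u # v # c) = Ps (p @ v # u # c) + Ps (p @ br u v # c) + cen u v * Ps (p @ c)" unfolding CM_def by blast

lemmas CMD1 = CMD[of _ _ "[]", simplified]

lemma CM_Cons: "CM (Suc n) Ps ==> CM n (%v. Ps (z # v))"
 using CMD[of "Suc n" Ps "z # _"] unfolding CM_def[of n] by (intro allI impI) (metis append_Cons add_Suc length_Cons Suc_le_mono)

lemma adw_CM: "CM n Ps ==> mlin n Ps ==> length p + length c + 2 \<le> n ==>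
  adw y Ps (p @ u # v # c) = adw y Ps (p @ v # u # c) + adw y Ps (p @ br u v # c) + cen u v * adw y Ps (p @ c)"
proof (induction p arbitrary: Ps n)
 case Nil
 have "adw y (%s. Ps (u # v # s)) c = adw y (%s. Ps (v # u # s) + Ps (br u v # s) + cen u v * Ps s) c"
  by (rule adw_cong) (rule CMD1[OF Nil(1)], use Nil(3) in simp)
 hence 1: "adw y (%s. Ps (u # v # s)) c =
   adw y (%s. Ps (v # u # s)) c + adw y (%s. Ps (br u v # s)) c + cen u v * adw y Ps c" by (simp add: adw_add adw_scale)
 have l: "length c + 2 \<le> n" using Nil(3) by simp
 have j: "br y (br u v) = (fst (br (br y u) v) + fst (br u (br y v)), snd y + (snd u + snd v))"
  by (simp add: br_def bracket_bracket_right[of "fst y"])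
 have "(fst (br (br y u) v), snd y + (snd u + snd v)) = br (br y u) v"
   "(fst (br u (br y v)), snd y + (snd u + snd v)) = br u (br y v)" by (simp_all add: br_def)
 hence 2: "Ps (br y (br u v) # c) = Ps (br (br y u) v # c) + Ps (br u (br y v) # c)" unfolding j using mlinD1(1)[OF Nil(2)] Nil(3) by simp
 have 3: "cen y (br u v) = cen u (br y v) + cen (br y u) v" using cen_cocycle[of y u v] by (simp add: algebra_simps)
 have 4: "Ps (br y u # v # c) = Ps (v # br y u # c) + Ps (br (br y u) v # c) + cen (br y u) v * Ps c"
   "Ps (u # br y v # c) = Ps (br y v # u # c) + Ps (br u (br y v) # c) + cen u (br y v) * Ps c" by (rule CMD1[OF Nil(1)], use l in simp)+
 show ?case by (simp add: 1 2 3 4 adw_add adw_scale algebra_simps)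
next case (Cons z p)
 obtain m where m: "n = Suc m" using Cons.prems(3) by (cases n) auto
 have IH: "adw y (%s. Ps (z # s)) (p @ u # v # c) = adw y (%s. Ps (z # s)) (p @ v # u # c) +
   adw y (%s. Ps (z # s)) (p @ br u v # c) + cen u v * adw y (%s. Ps (z # s)) (p @ c)"
  by (rule Cons.IH[OF CM_Cons[OF Cons.prems(1)[unfolded m]] mlin_Cons[OF Cons.prems(2)[unfolded m]]])
   (use Cons.prems m in simp)
 show ?case using Cons.prems(3) IH CMD[OF Cons.prems(1), of "br y z # p" c u v] CMD[OF Cons.prems(1), of p c u v]
  by (simp add: algebra_simps)
qed

text \<open>Behind a first letter the relation is inherited through \<open>adw_CM\<close>. At the
  front of the word the signs of the two degrees decide: two positive degrees need
  \<open>adw_commute\<close>; otherwise at least one of the two orders vanishes, and the first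
  clause of \<open>adw\<close> supplies the bracket and the contraction.\<close>

lemma CM_vac: "CM n vac"
proof (induction n)
 case (Suc n)
 have "vac (p @ u # v # c) = vac (p @ v # u # c) + vac (p @ br u v # c) + cen u v * vac (p @ c)"
  if l: "length p + length c + 2 \<le> Suc n" for p u v c
 proof (cases p)
  case (Cons y p')
  have A: "adw y vac (p' @ u # v # c) =
    adw y vac (p' @ v # u # c) + adw y vac (p' @ br u v # c) + cen u v * adw y vac (p' @ c)"
   by (rule adw_CM[OF Suc mlin_vac]) (use l Cons in simp)
  show ?thesis unfolding Cons append_Cons vac_Cons[of y] A by simp
 next case Nil
  have antib: "vac (br v u # c) = - vac (br u v # c)"
  proof -
   have "br v u = (scale (- 1) (fst (br u v)), snd (br u v))" by (simp add: br_def bracket_antisym[of "fst v" "fst u"])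
   hence "vac (br v u # c) = (- 1) * vac ((fst (br u v), snd (br u v)) # c)"
    using mlinD1(2)[OF mlin_vac[of "Suc (length c)"], of c "- 1"] by simp
   thus ?thesis by simp
  qed
  have sb: "snd (br u v) = snd u + snd v" by (simp add: br_def)
  consider "snd u > 0" "snd v > 0" | "snd u > 0" "snd v \<le> 0" | "snd u \<le> 0" "snd v > 0" | "snd u \<le> 0" "snd v \<le> 0" by linarith
  thus ?thesis
  proof cases
   case 1
   have c0: "cen u v = 0" "cen v u = 0" using 1 by (simp_all add: cen_def)
   have w: "vac (u # v # c) = vac (br u v # c) + adw u (adw v vac) c"
     "vac (v # u # c) = vac (br v u # c) + adw v (adw u vac) c"
    using 1 c0 by (simp_all add: vac_Cons[of _ "_ # _"]) (simp_all add: vac_Cons)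
   have "adw v (adw u vac) c - adw u (adw v vac) c = vac (br u v # c)"
    using adw_commute[OF mlin_vac order_refl, of v u c] 1 sb by (simp add: vac_Cons)
   thus ?thesis using w antib c0 Nil by (simp add: algebra_simps)
  next case 2
   thus ?thesis using Nil by (simp add: vac_Cons[of u] vac_Cons[of v] adw_zero)
  next case 3
   thus ?thesis using Nil antib cen_antisym[of u v] by (simp add: vac_Cons[of u] vac_Cons[of v] adw_zero)
  next case 4
   have "cen u v = 0" using 4 by (auto simp: cen_def)
   thus ?thesis using 4 Nil sb by (simp add: vac_Cons)
  qed
 qed
 thus ?case unfolding CM_def by blast
qed (simp add: CM_def)

text \<open>Bracketing with a letter of nonnegative degree leaves the last degree nonnegative, and
  contraction with the last letter would need total degree 0.\<close>

lemma adw_end_zero: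
 assumes "snd y \<ge> 0" "n \<ge> 0" "snd y > 0 \<or> n > 0"
 shows "(!!v x n. length v \<le> length w ==> n \<ge> 0 ==> Ps (v @ [(x, n)]) = 0) ==> adw y Ps (w @ [(x, n)]) = 0"
proof (induction w arbitrary: Ps)
 case Nil
 thus ?case using Nil[of "[]"] assms by (simp add: br_def cen_def)
next case (Cons z w)
 have "adw y (%v. Ps (z # v)) (w @ [(x, n)]) = 0" by (rule Cons.IH) (use Cons.prems[of "z # _"] in simp)
 thus ?case using Cons.prems[of "br y z # w" n x] Cons.prems[of w n x] assms by simp
qed

lemma vac_end: "n \<ge> 0 ==> vac (w @ [(x, n)]) = 0"
proof (induction "length w" arbitrary: w x n rule: less_induct)
 case less
 show ?case
 proof (cases w)
  case Nil
  thus ?thesis by (simp add: vac_Cons)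
 next case (Cons y w')
  have "adw y vac (w' @ [(x, n)]) = 0" if "snd y > 0" by (rule adw_end_zero) (use less Cons that in auto)
  thus ?thesis using Cons by (simp add: vac_Cons)
 qed
qed

end

section \<open>Graded modules over parts of the affine Lie algebra\<close>

text \<open>The axioms concern vectors of \<open>M\<close> and letters homogeneous of a weight and
  degree in \<open>P\<close>. The vacuum and the coinduced modules are cut out of full function
  types, and \<open>P\<close> ranges over the affine algebra, the current algebra, the Iwahori
  subalgebra and their rank one parts.\<close>

locale lmod = ade scale bracket h b Basis form + V: vector_space scaleV
 for scale :: "complex => 'g::ab_group_add => 'g" and bracket and h b Basis :: "'g set" and form
  and scaleV :: "complex => 'v::ab_group_add => 'v" +
 fixes P :: "('g wt \<times> int) set" and M :: "'v set" and act :: "'g => int => 'v => 'v"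
 assumes P_WT: "(bt, n) \<in> P ==> bt \<in> WT"
  and P_closed: "(bt, m) \<in> P ==> (ga, n) \<in> P ==> bt + ga \<in> WT ==> (bt + ga, m + n) \<in> P"
  and M_subspace: "V.subspace M"
  and act_add: "act x n (v + w) = act x n v + act x n w"
  and act_scale: "act x n (scaleV c v) = scaleV c (act x n v)"
  and act_M: "(bt, n) \<in> P ==> x \<in> root_space bt ==> v \<in> M ==> act x n v \<in> M"
  and act_zero_left: "v \<in> M ==> act 0 n v = 0"
  and act_add_left: "(bt, n) \<in> P ==> x \<in> root_space bt ==> y \<in> root_space bt ==> v \<in> M ==>
    act (x + y) n v = act x n v + act y n v"
  and act_scale_left: "(bt, n) \<in> P ==> x \<in> root_space bt ==> v \<in> M ==>
    act (scale c x) n v = scaleV c (act x n v)"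
  and comm: "(bt, m) \<in> P ==> (ga, n) \<in> P ==> x \<in> root_space bt ==> y \<in> root_space ga ==> v \<in> M ==>
    act x m (act y n v) = act y n (act x m v) + act (bracket x y) (m + n) v + scaleV (cen (x, m) (y, n)) v"

text \<open>\<open>ug P v\<^sub>0 nu\<^sub>0 N\<^sub>0 nu N\<close> is the piece of weight \<open>nu\<close> and degree \<open>N\<close> of the module generated by
  \<open>v\<^sub>0\<close> (placed in weight \<open>nu\<^sub>0\<close> and degree \<open>N\<^sub>0\<close>) under the letters from \<open>P\<close>;
  \<open>cl F R\<close> closes a family \<open>R\<close> of such pieces under the letters from \<open>F\<close>.\<close>

context ade
begin

inductive ug :: "(complex => 'v::ab_group_add => 'v) => ('g => int => 'v => 'v) => ('g wt \<times> int) set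
  => 'v => 'g wt => int => 'g wt => int => 'v => bool"
 for scaleV act P v0 nu0 N0 where
 ug_base: "ug scaleV act P v0 nu0 N0 nu0 N0 v0"
| ug_zero: "ug scaleV act P v0 nu0 N0 nu N 0"
| ug_add: "ug scaleV act P v0 nu0 N0 nu N v ==> ug scaleV act P v0 nu0 N0 nu N w ==> ug scaleV act P v0 nu0 N0 nu N (v + w)"
| ug_scale: "ug scaleV act P v0 nu0 N0 nu N v ==> ug scaleV act P v0 nu0 N0 nu N (scaleV c v)"
| ug_act: "ug scaleV act P v0 nu0 N0 nu N v ==> (bt, n) \<in> P ==> x \<in> root_space bt ==>
  ug scaleV act P v0 nu0 N0 (nu + bt) (N + n) (act x n v)"

inductive cl :: "(complex => 'v::ab_group_add => 'v) => ('g => int => 'v => 'v) => ('g wt \<times> int) set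
  => ('g wt => int => 'v => bool) => 'g wt => int => 'v => bool"
 for s act F D where
 cl_base: "D nu N w ==> cl s act F D nu N w"
| cl_zero: "cl s act F D nu N 0"
| cl_add: "cl s act F D nu N v ==> cl s act F D nu N w ==> cl s act F D nu N (v + w)"
| cl_scale: "cl s act F D nu N v ==> cl s act F D nu N (s c v)"
| cl_act: "cl s act F D nu N v ==> (bt, n) \<in> F ==> x \<in> root_space bt ==> cl s act F D (nu + bt) (N + n) (act x n v)"

lemma ug_mono: "ug scaleV act Q v0 nu0 N0 nu N w ==> Q <= P ==> ug scaleV act P v0 nu0 N0 nu N w"
proof (induction rule: ug.induct)
 case (ug_act nu N v bt n x)
 hence "ug scaleV act P v0 nu0 N0 (nu + bt) (N + n) (act x n v)" by (intro ug.ug_act) auto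
 thus ?case .
qed (auto intro: ug.intros)

lemma ug_act': "ug scaleV act P v0 nu0 N0 nu N v ==> (bt, n) \<in> P ==> x \<in> root_space bt ==>
  nu' = nu + bt ==> N' = N + n ==> ug scaleV act P v0 nu0 N0 nu' N' (act x n v)" using ug_act by simp

section \<open>The excess and affine reflections\<close>

definition Exc :: "'g wt => int => real" where
 "Exc nu N = - Re (form nu nu) / 2 - of_int N"

lemma form_add_root:
 assumes nu: "nu \<in> dual" and al: "al \<in> roots"
 shows "form (%x. nu x + c * al x) (%x. nu x + c * al x) = form nu nu + 2 * c * nu (coroot al) + 2 * c\<^sup>2"
proof -
 note ald = rootD(3)[OF al]
 define al' where "al' = (%x. c * al x)"
 have al'd: "al' \<in> dual" unfolding al'_def by (rule dual_scale[OF ald])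
 have e: "(%x. nu x + c * al x) = nu + al'" by (auto simp: al'_def fun_eq_iff)
 note d = dual_add[OF nu al'd]
 have alf: "form al' \<mu> = c * form al \<mu>" if "\<mu> \<in> dual" for \<mu> unfolding al'_def by (rule form_facts(3)[OF ald that])
 have "form (nu + al') (nu + al') = form nu (nu + al') + form al' (nu + al')" by (rule form_facts(2)[OF nu d al'd])
 also have "form nu (nu + al') = form (nu + al') nu" by (rule form_facts(1)[OF nu d])
 also have "\<dots> = form nu nu + form al' nu" by (rule form_facts(2)[OF nu nu al'd])
 also have "form al' (nu + al') = c * form (nu + al') al" using alf[OF d] form_facts(1)[OF ald d] by simp
 also have "form (nu + al') al = form nu al + form al' al" by (rule form_facts(2)[OF nu ald al'd])
 also have "form al' nu = c * form nu al" using alf[OF nu] form_facts(1)[OF ald nu] by simp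
 also have "form al' al = c * 2" using alf[OF ald] form_facts(5)[OF ald ald al] by simp
 also have "form nu al = nu (coroot al)" by (rule form_root[OF al nu])
 finally have s: "form (nu + al') (nu + al') = form nu nu + c * nu (coroot al) + c * (nu (coroot al) + c * 2)" .
 show ?thesis unfolding e s by (simp add: algebra_simps power2_eq_square)
qed

definition plus_mult :: "'g wt => int => 'g wt => 'g => complex" where
 "plus_mult nu k al = (%x. nu x + of_int k * al x)"

lemma plus_mult_simps: "plus_mult nu 0 al = nu" "plus_mult nu 1 al = nu + al" "plus_mult nu (- 1) al = nu - al"
 "plus_mult nu k al + al = plus_mult nu (k + 1) al" "plus_mult nu k al - al = plus_mult nu (k - 1) al"
 "plus_mult nu k al + - al = plus_mult nu (k - 1) al"
 "plus_mult nu k (- al) = plus_mult nu (- k) al" "plus_mult (plus_mult nu j al) k al = plus_mult nu (j + k) al"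
 "plus_mult (nu + \<mu>) k al = plus_mult nu k al + \<mu>" by (auto simp: plus_mult_def fun_eq_iff algebra_simps)

lemma intw_mult: "al \<in> roots ==> (%x. of_int k * al x) \<in> intw"
 using roots_intw[of al] dual_scale[of al "of_int k"] by (auto simp: intw_def)

lemma plus_mult_intw: "nu \<in> intw ==> al \<in> roots ==> plus_mult nu k al \<in> intw"
 using intw_add[OF _ intw_mult[of al k], of nu] by (simp add: plus_mult_def plus_fun_def)

lemma ip_plus_mult: "nu \<in> intw ==> al \<in> roots ==> ga \<in> roots ==> ip (plus_mult nu k al) ga = ip nu ga + k * ip al ga"
 by (rule ipI) (simp add: plus_mult_def ip roots_intw)

lemma Exc_plus_mult:
 assumes "nu \<in> intw" "al \<in> roots"
 shows "Exc (plus_mult nu k al) N = Exc nu 0 - of_int (k * ip nu al + k\<^sup>2 + N)"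
proof -
 have "form (plus_mult nu k al) (plus_mult nu k al) = form nu nu + of_int (2 * (k * ip nu al + k\<^sup>2))"
  unfolding plus_mult_def form_add_root[OF intw_dual[OF assms(1)] assms(2)] ip[OF assms] by simp
 hence "Re (form (plus_mult nu k al) (plus_mult nu k al)) = Re (form nu nu) + of_int (2 * (k * ip nu al + k\<^sup>2))"
  by (simp only: plus_complex.sel complex_Re_of_int)
 thus ?thesis by (simp add: Exc_def)
qed

lemma Exc_shift: "Exc nu N = Exc nu 0 - of_int N" by (simp add: Exc_def)

text \<open>The excess is invariant under the reflection in the affine root \<open>(al, n)\<close>.\<close>

lemma Exc_reflect:
 assumes "nu \<in> intw" "al \<in> roots" "m = - (ip nu al + n)"
 shows "Exc (plus_mult nu m al) (N + m * n) = Exc nu N" unfolding Exc_plus_mult[OF assms(1,2)] Exc_shift[of nu N] assms(3)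
 by (simp add: algebra_simps power2_eq_square)

lemma WT_intw: "bt \<in> WT ==> bt \<in> intw" using WT_cases intw_0 roots_intw by metis

end

context lmod
begin

abbreviation U :: "'v => 'g wt => int => 'g wt => int => 'v => bool" where
 "U == ug scaleV act P"

lemma act_0: "act x n 0 = 0" using act_scale[of x n 0 0] by simp

lemma act_pow_lin: "(act x n ^^ k) (v + w) = (act x n ^^ k) v + (act x n ^^ k) w"
  "(act x n ^^ k) (scaleV c v) = scaleV c ((act x n ^^ k) v)" "(act x n ^^ k) 0 = 0"
 by (induction k) (simp_all add: act_add act_scale act_0)

lemma act_pow_zero_mono: "(act x n ^^ k) v = 0 ==> k \<le> j ==> (act x n ^^ j) v = 0"
 using act_pow_lin(3)[where k = "j - k" and x = x and n = n] funpow_add[of "j - k" k "act x n"] by simp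

lemma act_pow_M: "(bt, n) \<in> P ==> x \<in> root_space bt ==> v \<in> M ==> (act x n ^^ k) v \<in> M" by (induction k) (auto intro: act_M)

lemma M_add: "v \<in> M ==> w \<in> M ==> v + w \<in> M" and M_scale: "v \<in> M ==> scaleV c v \<in> M" and M_0: "0 \<in> M"
 using M_subspace by (auto simp: V.subspace_def)

lemma U_M: "U v0 nu0 N0 nu N w ==> v0 \<in> M ==> w \<in> M" by (induction rule: ug.induct) (auto intro: M_add M_scale M_0 act_M)

lemma U_intw: "U v0 nu0 N0 nu N w ==> w ~= 0 ==> nu0 \<in> intw ==> nu \<in> intw"
proof (induction rule: ug.induct)
 case (ug_add nu N v w)
 thus ?case by (cases "v = 0") auto
next case (ug_act nu N v bt n x)
 have "v ~= 0" using ug_act act_0 by auto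
 hence "nu + bt \<in> intw" using ug_act WT_intw P_WT by (intro intw_add) auto
 thus ?case .
qed auto

lemma U_weight:
 assumes "(0, 0) \<in> P" "v0 \<in> M" "!!H. H \<in> h ==> act H 0 v0 = scaleV (nu0 H) v0" and H: "H \<in> h"
 shows "U v0 nu0 N0 nu N w ==> act H 0 w = scaleV (nu H) w"
proof (induction rule: ug.induct)
 case (ug_act nu N v bt n x)
 have x: "bracket H x = scale (bt H) x" using ug_act.hyps H by (simp add: root_space_def)
 have "act H 0 (act x n v) = act x n (act H 0 v) + act (bracket H x) (0 + n) v + scaleV (cen (H, 0) (x, n)) v"
  by (rule comm[OF assms(1) ug_act.hyps(2) _ ug_act.hyps(3) U_M[OF ug_act.hyps(1) assms(2)]])
   (simp add: root_space_0 H)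
 also have "\<dots> = scaleV ((nu + bt) H) (act x n v)" using ug_act.IH act_scale_left[OF ug_act.hyps(2,3) U_M[OF ug_act.hyps(1) assms(2)]]
  by (simp add: x cen_def act_scale V.scale_left_distrib)
 finally show ?case .
qed (use assms(3)[OF H] in "simp_all add: act_0 act_add act_scale V.scale_right_distrib mult.commute")

lemma U_pow: "U v0 nu0 N0 nu N w ==> (bt, n) \<in> P ==> x \<in> root_space bt ==>
  U v0 nu0 N0 (plus_mult nu (int k) bt) (N + int k * n) ((act x n ^^ k) w)"
proof (induction k)
 case (Suc k)
 have "plus_mult nu (int (Suc k)) bt = plus_mult nu (int k) bt + bt" by (simp add: plus_mult_simps(4) add.commute[of 1])
 moreover have "N + int (Suc k) * n = N + int k * n + n" by (simp add: algebra_simps)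
 ultimately have "U v0 nu0 N0 (plus_mult nu (int (Suc k)) bt) (N + int (Suc k) * n) (act x n ((act x n ^^ k) w))"
  by (rule ug_act'[OF Suc.IH[OF Suc.prems] Suc.prems(2,3)])
 thus ?case by (simp only: funpow.simps comp_apply)
qed (simp add: plus_mult_simps)

lemma lmod_mono:
 assumes "Q <= P" "!!bt m ga n. (bt, m) \<in> Q ==> (ga, n) \<in> Q ==> bt + ga \<in> WT ==> (bt + ga, m + n) \<in> Q"
 shows "lmod scale bracket h b Basis form scaleV Q M act"
proof (unfold_locales, goal_cases)
 case (1 bt n) thus ?case using assms(1) P_WT by blast
next case (2 bt m ga n) thus ?case using assms(2) by blast
next case 3 show ?case by (rule M_subspace)
next case 4 show ?case by (rule act_add)
next case 5 show ?case by (rule act_scale)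
next case (6 bt n) thus ?case using assms(1) act_M by blast
next case 7 thus ?case by (rule act_zero_left)
next case (8 bt n) thus ?case using assms(1) act_add_left[of bt] by blast
next case (9 bt n) thus ?case using assms(1) act_scale_left[of bt] by blast
next case (10 bt m ga n) thus ?case using assms(1) comm[of bt m ga n] by blast
qed

text \<open>A letter of \<open>G\<close> is commuted past the leftmost letter of \<open>F\<close>.
  The bracket is again a letter of \<open>G\<close> or \<open>F\<close>, and a nonzero central term
  has the original weight and degree. So only the action of \<open>G\<close> on the generating
  pieces \<open>R\<close> has to be known.\<close>

lemma cl_letter:
 assumes FG: "F <= P" "G <= P" "!!bt m ga n. (bt, m) \<in> G ==> (ga, n) \<in> F ==> bt + ga \<in> WT ==> (bt + ga, m + n) \<in> G \<union> F"
  and RM: "!!nu N w. R nu N w ==> w \<in> M"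
  and R: "!!nu N w bt n x. R nu N w ==> (bt, n) \<in> G ==> x \<in> root_space bt ==> cl scaleV act F R (nu + bt) (N + n) (act x n w)"
 shows "cl scaleV act F R nu N w ==> w \<in> M &
  (\<forall>bt n x. (bt, n) \<in> G \<union> F --> x \<in> root_space bt --> cl scaleV act F R (nu + bt) (N + n) (act x n w))"
proof (induction rule: cl.induct)
 case (cl_base nu N w)
 thus ?case using RM R cl.cl_act[OF cl.cl_base[of R]] by blast
next case (cl_act nu N v bt n z)
 have z: "(bt, n) \<in> P" and vM: "v \<in> M" using FG(1) cl_act by auto
 have zM: "act z n v \<in> M" using act_M[OF z cl_act.hyps(3) vM] .
 have "cl scaleV act F R ((nu + bt) + ga) ((N + n) + k) (act x k (act z n v))"
  if g: "(ga, k) \<in> G \<union> F" "x \<in> root_space ga" for ga k x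
 proof (cases "(ga, k) \<in> F")
  case True
  show ?thesis by (rule cl.cl_act[OF cl.cl_act[OF cl_act.hyps] True g(2)])
 next case False
  hence gG: "(ga, k) \<in> G" and gP: "(ga, k) \<in> P" using g FG(2) by auto
  have e: "(nu + ga) + bt = (nu + bt) + ga" "(N + k) + n = (N + n) + k"
   "nu + (ga + bt) = (nu + bt) + ga" "N + (k + n) = (N + n) + k" by (simp_all add: algebra_simps)
  have "cl scaleV act F R (nu + ga) (N + k) (act x k v)" using cl_act.IH g by blast
  from cl.cl_act[OF this cl_act.hyps(2,3)]
  have 1: "cl scaleV act F R ((nu + bt) + ga) ((N + n) + k) (act z n (act x k v))" unfolding e .
  have 2: "cl scaleV act F R ((nu + bt) + ga) ((N + n) + k) (act (bracket x z) (k + n) v)"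
  proof (cases "ga + bt \<in> WT")
   case True
   have "cl scaleV act F R (nu + (ga + bt)) (N + (k + n)) (act (bracket x z) (k + n) v)"
    using cl_act.IH FG(3)[OF gG cl_act.hyps(2) True] root_space_bracket[OF g(2) cl_act.hyps(3)] by blast
   thus ?thesis unfolding e .
  next case False
   hence "bracket x z = 0" using WT_bracket[OF g(2) cl_act.hyps(3)] P_WT[OF gP] P_WT[OF z] WT_onh by blast
   thus ?thesis using act_zero_left[OF vM] by (simp add: cl.cl_zero)
  qed
  have 3: "cl scaleV act F R ((nu + bt) + ga) ((N + n) + k) (scaleV (cen (x, k) (z, n)) v)"
  proof (cases "cen (x, k) (z, n) = 0")
   case True
   thus ?thesis by (simp add: cl.cl_zero)
  next case False
   hence "k + n = 0" "ga + bt = 0"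
    using kap_orthogonal[OF g(2) cl_act.hyps(3) P_WT[OF gP] P_WT[OF z]] by (auto simp: cen_def split: if_splits)
   hence e: "(nu + bt) + ga = nu" "(N + n) + k = N" by (simp_all add: algebra_simps add_eq_0_iff)
   show ?thesis unfolding e by (rule cl.cl_scale[OF cl_act.hyps(1)])
  qed
  show ?thesis unfolding comm[OF gP z g(2) cl_act.hyps(3) vM] by (intro cl.cl_add 1 2 3)
 qed
 thus ?case using zM by blast
qed (auto simp: M_0 M_add M_scale act_0 act_add act_scale intro: cl.cl_zero cl.cl_add cl.cl_scale)

text \<open>A weak form of the Poincare-Birkhoff-Witt theorem: letters that are harmless on \<open>v\<^sub>0\<close> are not needed.\<close>

lemma U_restrict:
 assumes Q: "Q <= P" and v0: "v0 \<in> M"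
  and harmless: "!!ga k x. (ga, k) \<in> P ==> (ga, k) \<notin> Q ==> x \<in> root_space ga ==>
   ug scaleV act Q v0 nu0 N0 (nu0 + ga) (N0 + k) (act x k v0)"
  and U: "U v0 nu0 N0 nu N w"
 shows "ug scaleV act Q v0 nu0 N0 nu N w"
proof -
 let ?D = "ug scaleV act Q v0 nu0 N0" and ?E = "%nu N w. nu = nu0 & N = N0 & w = v0"
 have ug: "cl scaleV act Q ?E nu N w" if "?D nu N w" for nu N w using that by (induction rule: ug.induct) (blast intro: cl.intros)+
 have cl: "?D nu N w" if "cl scaleV act Q ?E nu N w" for nu N w using that by (induction rule: cl.induct) (blast intro: ug.intros)+
 have step: "cl scaleV act Q ?E (nu + bt) (N + n) (act x n w)"
  if "cl scaleV act Q ?E nu N w" "(bt, n) \<in> P" "x \<in> root_space bt" for nu N w bt n x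
 proof -
  have *: "cl scaleV act Q ?E (nu0 + bt) (N0 + n) (act x n v0)" if "(bt, n) \<in> P" "x \<in> root_space bt" for bt n x
   by (rule ug) (use harmless[OF that(1) _ that(2)] ug.ug_act[OF ug.ug_base _ that(2)] in blast)
  show ?thesis using cl_letter[OF Q order_refl _ _ _ that(1)] that(2,3) P_closed Q v0 * by blast
 qed
 show ?thesis using U by (intro cl, induction rule: ug.induct) (blast intro: cl.intros step)+
qed

text \<open>Commuting one power of \<open>f\<close> past \<open>y\<close> leaves a bracket term, for
  which \<open>d\<close> additional powers suffice; \<open>y\<close> needs one more than
  that.\<close>

lemma nil_step:
 assumes f: "(al, n) \<in> P" "f \<in> root_space al" and y: "(ga, k) \<in> P" "y \<in> root_space ga"
  and d: "!!s v. v \<in> M ==> (act f n ^^ s) v = 0 ==> (act f n ^^ (s + d)) (act (bracket f y) (n + k) v) = 0"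
 shows "v \<in> M ==> (act f n ^^ s) v = 0 ==> (act f n ^^ (s + Suc d)) (act y k v) = 0"
proof (induction s arbitrary: v)
 case 0
 thus ?case by (simp add: act_0 act_pow_lin del: funpow.simps)
next case (Suc s)
 have 1: "(act f n ^^ (s + Suc d)) (act y k (act f n v)) = 0"
  by (rule Suc.IH[OF act_M[OF f Suc.prems(1)]]) (use Suc.prems(2) in "simp add: funpow_swap1")
 have 2: "(act f n ^^ (s + Suc d)) (act (bracket f y) (n + k) v) = 0" using d[OF Suc.prems] by simp
 have 3: "(act f n ^^ (s + Suc d)) v = 0" by (rule act_pow_zero_mono[OF Suc.prems(2)]) simp
 have "(act f n ^^ (Suc s + Suc d)) (act y k v) = (act f n ^^ (s + Suc d)) (act f n (act y k v))" by (simp add: funpow_swap1)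
 also have "\<dots> = 0" unfolding comm[OF f(1) y(1) f(2) y(2) Suc.prems(1)] by (simp only: act_pow_lin 1 2 3) simp
 finally show ?case .
qed

text \<open>The 3 counts the uses of \<open>nil_step\<close> along \<open>y\<close>, its bracket
  with \<open>f\<close> and its double bracket; the triple bracket is zero by
  \<open>bracket_cube\<close>.\<close>

lemma nil_letter:
 assumes al: "al \<in> roots" and f: "(al, n) \<in> P" "f \<in> root_space al" and y: "(ga, k) \<in> P" "y \<in> root_space ga"
  and v: "v \<in> M" "(act f n ^^ s) v = 0"
 shows "(act f n ^^ (s + 3)) (act y k v) = 0"
proof -
 have nz: "(act f n ^^ j) (act 0 i v) = 0" if "v \<in> M" for j i v using act_zero_left[OF that] act_pow_lin(3) by simp
 have st: "(act f n ^^ (s + Suc d)) (act z j v) = 0"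
  if z: "z ~= 0 ==> (de, j) \<in> P" "z \<in> root_space de" and v: "v \<in> M" "(act f n ^^ s) v = 0"
   and d: "!!s v. v \<in> M ==> (act f n ^^ s) v = 0 ==> (act f n ^^ (s + d)) (act (bracket f z) (n + j) v) = 0"
  for z j de d s v
 proof (cases "z = 0")
  case True
  show ?thesis unfolding True by (rule nz[OF v(1)])
 next case False
  show ?thesis by (rule nil_step[OF f z(1)[OF False] z(2) d v])
 qed
 have P: "(al + de, n + j) \<in> P" if "(de, j) \<in> P" "z \<in> root_space de" "bracket f z ~= 0" for z de j
  by (rule P_closed[OF f(1) that(1) WT_bracket[OF f(2) that(2,3) WT_onh[OF P_WT[OF f(1)]] WT_onh[OF P_WT[OF that(1)]]]])
 let ?y1 = "bracket f y" and ?y2 = "bracket f (bracket f y)"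
 have y1: "?y1 \<in> root_space (al + ga)" "?y1 ~= 0 ==> (al + ga, n + k) \<in> P" by (rule root_space_bracket[OF f(2) y(2)], rule P[OF y])
 have y2: "?y2 \<in> root_space (al + (al + ga))" "?y2 ~= 0 ==> (al + (al + ga), n + (n + k)) \<in> P"
 proof -
  show "?y2 \<in> root_space (al + (al + ga))" by (rule root_space_bracket[OF f(2) y1(1)])
  show "(al + (al + ga), n + (n + k)) \<in> P" if nz: "?y2 ~= 0"
  proof -
   have "?y1 ~= 0" using nz bracket_zero_right by auto
   from P[OF y1(2)[OF this] y1(1) nz] show ?thesis .
  qed
 qed
 have y3: "bracket f ?y2 = 0" by (rule bracket_cube[OF al f(2) y(2) P_WT[OF y(1)]])
 have s2: "(act f n ^^ (s + Suc 0)) (act ?y2 (n + (n + k)) v) = 0" if "v \<in> M" "(act f n ^^ s) v = 0" for s v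
  by (rule st[OF _ y2(1) that], rule y2(2), assumption) (simp add: y3 act_zero_left act_pow_lin)
 have s1: "(act f n ^^ (s + Suc (Suc 0))) (act ?y1 (n + k) v) = 0" if "v \<in> M" "(act f n ^^ s) v = 0" for s v
  by (rule st[OF _ y1(1) that], rule y1(2), assumption) (rule s2)
 have "(act f n ^^ (s + Suc (Suc (Suc 0)))) (act y k v) = 0" by (rule nil_step[OF f y s1 v])
 thus ?thesis by (simp add: numeral_3_eq_3)
qed

lemma U_nilpotent:
 assumes al: "al \<in> roots" and f: "(al, n) \<in> P" "f \<in> root_space al" and v0: "v0 \<in> M" "(act f n ^^ s) v0 = 0"
 shows "U v0 nu0 N0 nu N w ==> \<exists>s. (act f n ^^ s) w = 0"
proof (induction rule: ug.induct)
 case (ug_zero nu N)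
 thus ?case by (intro exI[of _ 0]) simp
next case (ug_add nu N v w)
 then obtain s t where st: "(act f n ^^ s) v = 0" "(act f n ^^ t) w = 0" by blast
 hence "(act f n ^^ (s + t)) (v + w) = 0" using act_pow_zero_mono[OF st(1), of "s + t"] act_pow_zero_mono[OF st(2), of "s + t"]
  by (simp only: act_pow_lin) simp
 thus ?case by blast
next case (ug_scale nu N v c)
 thus ?case using act_pow_lin(2) V.scale_zero_right by metis
next case (ug_act nu N v bt k x)
 thus ?case using nil_letter[OF al f ug_act.hyps(2,3) U_M[OF ug_act.hyps(1) v0(1)]] by blast
qed (use v0 in blast)

text \<open>The commutator of \<open>e\<close> at degree \<open>n\<close> with \<open>f\<close> at
  degree \<open>- n\<close> is the coroot plus the cocycle value \<open>n\<close>, whence the shift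
  by \<open>n\<close> in the family of weight spaces.\<close>

lemma affine_sl2:
 assumes al: "al \<in> roots" and P: "(al, n) \<in> P" "(- al, - n) \<in> P" "(0, 0) \<in> P"
  and e: "e \<in> root_space al" and f: "f \<in> root_space (- al)" and ef: "bracket e f = coroot al"
 shows "sl2_weights scaleV (act e n) (act f (- n)) (%c. {w \<in> M. act (coroot al) 0 w = scaleV (c - of_int n) w})"
proof unfold_locales
 note H = coroot_h[OF al] coroot_2[OF al]
 have H0: "coroot al \<in> root_space 0" using H root_space_0 by simp
 have he: "bracket (coroot al) e = scale 2 e" "bracket (coroot al) f = scale (- 2) f" using e f H by (simp_all add: root_space_def)
 show "act e n w \<in> {w \<in> M. act (coroot al) 0 w = scaleV (c + 2 - of_int n) w}"
  if w: "w \<in> {w \<in> M. act (coroot al) 0 w = scaleV (c - of_int n) w}" for w c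
 proof -
  have wM: "w \<in> M" using w by simp
  have "act (coroot al) 0 (act e n w) = act e n (scaleV (c - of_int n) w) + scaleV 2 (act e n w)"
   using comm[OF P(3,1) H0 e wM] act_scale_left[OF P(1) e wM, of 2] w by (simp add: he cen_def)
  thus ?thesis unfolding act_scale using act_M[OF P(1) e wM] by (simp add: algebra_simps)
 qed
 show "act f (- n) w \<in> {w \<in> M. act (coroot al) 0 w = scaleV (c - 2 - of_int n) w}"
  if w: "w \<in> {w \<in> M. act (coroot al) 0 w = scaleV (c - of_int n) w}" for w c
 proof -
  have wM: "w \<in> M" using w by simp
  have "act (coroot al) 0 (act f (- n) w) = act f (- n) (scaleV (c - of_int n) w) + scaleV (- 2) (act f (- n) w)"
   using comm[OF P(3,2) H0 f wM] act_scale_left[OF P(2) f wM, of "- 2"] w by (simp add: he cen_def)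
  thus ?thesis unfolding act_scale using act_M[OF P(2) f wM] by (simp add: algebra_simps)
 qed
 show "act e n (act f (- n) w) - act f (- n) (act e n w) = scaleV c w"
  if w: "w \<in> {w \<in> M. act (coroot al) 0 w = scaleV (c - of_int n) w}" for w c
 proof -
  have wM: "w \<in> M" using w by simp
  show ?thesis using comm[OF P(1,2) e f wM] w kap_pair[OF al e f ef] by (simp add: ef cen_def algebra_simps)
 qed
qed (simp_all add: act_add act_scale)

lemma affine_injective:
 assumes al: "al \<in> roots" and P: "(al, n) \<in> P" "(- al, - n) \<in> P" "(0, 0) \<in> P"
  and e: "e \<in> root_space al" and f: "f \<in> root_space (- al)" and ef: "bracket e f = coroot al"
  and w: "w \<in> M" "act (coroot al) 0 w = scaleV (of_int k) w" "k + n = - int p"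
  and nil: "(act f (- n) ^^ s) w = 0" and z: "(act e n ^^ p) w = 0"
 shows "w = 0"
proof -
 interpret S: sl2_weights scaleV "act e n" "act f (- n)" "%c. {w \<in> M. act (coroot al) 0 w = scaleV (c - of_int n) w}"
  by (rule affine_sl2[OF al P e f ef])
 have k: "k = - int p - n" using w(3) by simp
 have "w \<in> {w \<in> M. act (coroot al) 0 w = scaleV (- of_nat p - of_int n) w}" using w(1,2) unfolding k by simp
 thus ?thesis using S.e_pow_injective nil z by blast
qed

end

section \<open>The vacuum module of level one\<close>

definition scaleF :: "complex => ('a => complex) => 'a => complex" where
 "scaleF c Ps = (%w. c * Ps w)"

lemma vector_space_scaleF: "vector_space scaleF" by unfold_locales (auto simp: scaleF_def fun_eq_iff algebra_simps)

text \<open>Vectors are functionals on words: \<open>Ps w\<close> is the vacuum coefficient of the word \<open>w\<close> applied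
  to the vector \<open>Ps\<close>, so letters act by appending.\<close>

definition rt :: "'a => int => (('a \<times> int) list => complex) => ('a \<times> int) list => complex" where
 "rt x n Ps = (%p. Ps (p @ [(x, n)]))"

context ade
begin

lemma roots_nonempty: "roots ~= {}"
proof
 assume "roots = {}"
 hence WT: "WT <= {0}" by (auto simp: roots_WT)
 have h: "x \<in> h" for x by (rule span_gw_induct[OF _ h_subspace]) (use WT gw_zero in auto)
 hence "bracket x y = 0" for x y by (intro h_abelian h)
 thus False using simple by (simp add: simple_def)
qed

lemma zero_WT: "0 \<in> WT"
proof -
 obtain al where "al \<in> roots" using roots_nonempty by blast
 hence "coroot al \<in> h" "coroot al ~= 0" using coroot_h coroot_2[of al] dual_props(4)[OF rootD(3)[of al]] by auto
 thus ?thesis using gw_zero by (auto simp: WT_def)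
qed

text \<open>Functionals respecting the relations of the affine algebra at every place of a word;
  only on these is appending letters an action.\<close>

definition Lc :: "('g word => complex) set" where
 "Lc = {Ps. \<forall>n. mlin n Ps & CM n Ps}"

lemma LcD:
 assumes "Ps \<in> Lc"
 shows "Ps (u @ (x + x', k) # w) = Ps (u @ (x, k) # w) + Ps (u @ (x', k) # w)"
  "Ps (u @ (scale c x, k) # w) = c * Ps (u @ (x, k) # w)"
  "Ps (p @ y # z # w) = Ps (p @ z # y # w) + Ps (p @ br y z # w) + cen y z * Ps (p @ w)"
proof -
 have m: "mlin n Ps" "CM n Ps" for n using assms by (simp_all add: Lc_def)
 show "Ps (u @ (x + x', k) # w) = Ps (u @ (x, k) # w) + Ps (u @ (x', k) # w)" by (rule mlinD(1)[OF m(1) lessI])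
 show "Ps (u @ (scale c x, k) # w) = c * Ps (u @ (x, k) # w)" by (rule mlinD(2)[OF m(1) lessI])
 show "Ps (p @ y # z # w) = Ps (p @ z # y # w) + Ps (p @ br y z # w) + cen y z * Ps (p @ w)" by (rule CMD[OF m(2) order_refl])
qed

lemma LcI:
 assumes "!!u w x x' k. Ps (u @ (x + x', k) # w) = Ps (u @ (x, k) # w) + Ps (u @ (x', k) # w)"
  "!!u w c x k. Ps (u @ (scale c x, k) # w) = c * Ps (u @ (x, k) # w)"
  "!!p y z w. Ps (p @ y # z # w) = Ps (p @ z # y # w) + Ps (p @ br y z # w) + cen y z * Ps (p @ w)"
 shows "Ps \<in> Lc" unfolding Lc_def mlin_def CM_def by (intro CollectI conjI allI impI assms)

lemma vac_Lc: "vac \<in> Lc" by (simp add: Lc_def mlin_vac CM_vac)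

lemma rt_Lc:
 assumes L: "Ps \<in> Lc"
 shows "rt x n Ps \<in> Lc" unfolding rt_def by (rule LcI; unfold append_assoc append_Cons) (rule LcD[OF L])+

lemma rt_comm:
 "Ps \<in> Lc ==> rt x m (rt y n Ps) = rt y n (rt x m Ps) + rt (bracket x y) (m + n) Ps + scaleF (cen (x, m) (y, n)) Ps"
 using LcD(3)[of Ps _ "(x, m)" "(y, n)" "[]"] by (auto simp: rt_def br_def scaleF_def)

lemma rt_add_left: "Ps \<in> Lc ==> rt (x + y) n Ps = rt x n Ps + rt y n Ps"
 and rt_scale_left: "Ps \<in> Lc ==> rt (scale c x) n Ps = scaleF c (rt x n Ps)"
 using LcD(1,2)[of Ps _ _ _ _ "[]"] by (simp_all add: rt_def fun_eq_iff scaleF_def)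

lemma rt_add: "rt x n (Ps + Ph) = rt x n Ps + rt x n Ph"
 and rt_scale: "rt x n (scaleF c Ps) = scaleF c (rt x n Ps)" by (simp_all add: rt_def fun_eq_iff scaleF_def)

lemma rt_zero_left: "Ps \<in> Lc ==> rt 0 n Ps = 0" using rt_scale_left[of Ps 0 0 n] by (simp add: scaleF_def fun_eq_iff)

lemma lmod_rt: "lmod scale bracket h b Basis form scaleF (WT \<times> UNIV) Lc rt"
proof -
 interpret F: vector_space "scaleF :: complex => ('g word => complex) => _" by (rule vector_space_scaleF)
 show ?thesis
 proof (unfold_locales, goal_cases)
  case 3
  have "0 \<in> Lc" by (rule LcI) simp_all
  moreover have "Ps + Ph \<in> Lc" if L: "Ps \<in> Lc" "Ph \<in> Lc" for Ps Ph
  proof (rule LcI)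
   fix p y z w
   show "(Ps + Ph) (p @ y # z # w) = (Ps + Ph) (p @ z # y # w) + (Ps + Ph) (p @ br y z # w) + cen y z * (Ps + Ph) (p @ w)"
    using LcD(3)[OF L(1), of p y z w] LcD(3)[OF L(2), of p y z w] by (simp add: algebra_simps)
  qed (simp_all add: LcD(1,2)[OF L(1)] LcD(1,2)[OF L(2)] algebra_simps)
  moreover have "scaleF c Ps \<in> Lc" if L: "Ps \<in> Lc" for Ps c
  proof (rule LcI)
   fix p y z w
   show "scaleF c Ps (p @ y # z # w) = scaleF c Ps (p @ z # y # w) + scaleF c Ps (p @ br y z # w) + cen y z * scaleF c Ps (p @ w)"
    using LcD(3)[OF L, of p y z w] by (simp add: scaleF_def algebra_simps)
  qed (simp_all add: LcD(1,2)[OF L] scaleF_def algebra_simps)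
  ultimately show ?case by (simp add: F.subspace_def)
 next case (10 bt m ga n x y v)
  from rt_comm[OF 10(5)] show ?case .
 qed (auto simp: rt_add rt_scale rt_Lc rt_zero_left rt_add_left rt_scale_left)
qed

interpretation L: lmod scale bracket h b Basis form scaleF "WT \<times> UNIV" Lc rt by (rule lmod_rt)

lemma rt_vac: "n \<ge> 0 ==> rt x n vac = 0" by (simp add: rt_def fun_eq_iff vac_end)

lemma vac_nonzero: "vac ~= 0" using vac_Nil by (metis zero_fun_apply zero_neq_one)

text \<open>Moving the first letter to the end costs only values on shorter words. A letter of
  degree at most 0 gives zero at the front, one of positive degree gives zero at the end. In this
  respect the realization by functionals behaves like the simple quotient of the vacuum
  module.\<close>

lemma singular_zero:
 assumes Ps: "Ps \<in> Lc" and nil: "Ps [] = 0" and low: "!!y w. snd y \<le> 0 ==> Ps (y # w) = 0"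
  and sing: "!!x n. n > 0 ==> rt x n Ps = 0"
 shows "Ps = 0"
proof -
 have "Ps w = 0" for w
 proof (induction "length w" arbitrary: w rule: less_induct)
  case less
  show ?case
  proof (cases w)
   case (Cons y c)
   have "Ps (y # c1 @ c2) = Ps (c1 @ y # c2)" if "length c1 + length c2 = length c" for c1 c2 using that
   proof (induction c1 arbitrary: c2 rule: rev_induct)
    case (snoc z c1)
    have "Ps (c1 @ y # z # c2) = Ps (c1 @ z # y # c2) + Ps (c1 @ br y z # c2) + cen y z * Ps (c1 @ c2)" by (rule LcD(3)[OF Ps])
    moreover have "Ps (c1 @ br y z # c2) = 0" "Ps (c1 @ c2) = 0" by (rule less, use snoc.prems Cons in simp)+
    ultimately show ?case using snoc.IH[of "z # c2"] snoc.prems by simp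
   qed simp
   from this[of c "[]"] have e: "Ps w = Ps (c @ [y])" using Cons by simp
   show ?thesis
   proof (cases "snd y \<le> 0")
    case True
    thus ?thesis using low Cons by simp
   next case False
    hence "rt (fst y) (snd y) Ps = 0" using sing by simp
    hence "rt (fst y) (snd y) Ps c = 0" by simp
    thus ?thesis by (simp add: e rt_def)
   qed
  qed (use nil in simp)
 qed
 thus ?thesis by (simp add: fun_eq_iff)
qed

text \<open>Only the component of \<open>y\<close> at \<open>- al\<close> contributes; from any
  other weight, adding \<open>al\<close> twice leaves the set of weights.\<close>

lemma ad_square:
 assumes al: "al \<in> roots" and x: "x \<in> root_space al"
 shows "bracket (bracket y x) x = scale (- 2 * kap y x) x"
proof -
 have "y \<in> {y. bracket (bracket y x) x = scale (- 2 * kap y x) x}"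
 proof (rule span_gw_induct)
  show "subspace {y. bracket (bracket y x) x = scale (- 2 * kap y x) x}"
   by (auto simp: subspace_def bracket_zero_left kap_simps bracket_add_left bracket_scale_left algebra_simps
     simp flip: scale_left_distrib)
  fix ga y assume ga: "ga \<in> WT" and y': "y \<in> gw ga"
  hence y: "y \<in> root_space ga" by (simp add: gw_root_space)
  show "y \<in> {y. bracket (bracket y x) x = scale (- 2 * kap y x) x}"
  proof (cases "ga = - al")
   case True
   have k: "bracket x y = scale (kap x y) (coroot al)" by (rule kap_bracket[OF al x]) (use y True in simp)
   have "bracket y x = scale (- kap y x) (coroot al)" unfolding bracket_antisym[of y x] k kap_sym[of y x] by simp
   moreover have "bracket (coroot al) x = scale 2 x" using x coroot_h[OF al] coroot_2[OF al] by (simp add: root_space_def)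
   ultimately show ?thesis by (simp add: bracket_scale_left bracket_minus_left mult.commute)
  next case False
   hence k: "kap y x = 0" using kap_orthogonal[OF y x ga rootD(1)[OF al]] eq_neg_iff_add_eq_0[of ga al] by blast
   have "bracket (bracket y x) x = 0"
   proof (rule ccontr)
    assume nz: "bracket (bracket y x) x ~= 0"
    note o = WT_onh[OF ga] WT_onh[OF rootD(1)[OF al]]
    have w: "ga + al + al \<in> WT" by (rule WT_bracket[OF root_space_bracket[OF y x] x nz]) (use o in simp_all)
    have g0: "ga ~= 0"
    proof
     assume "ga = 0"
     hence "al + al \<in> WT" using w by (simp only: add_0)
     moreover have "al + al ~= 0"
     proof
      assume "al + al = 0"
      hence "al (coroot al) + al (coroot al) = 0" by (metis plus_fun_apply zero_fun_apply)
      thus False using coroot_2[OF al] by simp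
     qed
     ultimately show False using WT_cases root_double[OF al] by blast
    qed
    hence gar: "ga \<in> roots" using WT_cases[OF ga] by blast
    define de where "de = ga + al + al"
    have s: "ip de al = ip ga al + 4"
     unfolding de_def using ip_add[OF intw_add[OF roots_intw[OF gar] roots_intw[OF al]] roots_intw[OF al] al]
      ip_add[OF roots_intw[OF gar] roots_intw[OF al] al] ip_self[OF al] by linarith
    have "de = 0 \<or> de \<in> roots" unfolding de_def by (rule WT_cases[OF w])
    hence "ip de al \<le> 2" using ip_bound_cases[OF _ al, of de] ip_0[of al] by auto
    thus False using ip_bound_cases[OF gar al] False s by (smt (verit) add.inverse_inverse)
   qed
   thus ?thesis using k by simp
  qed
 qed
 thus ?thesis by simp
qed

text \<open>The characteristic relation of level one. A letter \<open>y\<close> of degree 1 produces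
  the double bracket of \<open>ad_square\<close>, with coefficient \<open>- 2 * kap y x\<close>, and
  twice the cocycle value \<open>kap y x\<close>; these cancel because the central element acts as
  1. Letters of higher degree give zero at once, and \<open>singular_zero\<close> finishes.\<close>

lemma vac_null:
 assumes al: "al \<in> roots" and x: "x \<in> root_space al"
 shows "rt x (- 1) (rt x (- 1) vac) = 0"
proof (rule singular_zero)
 interpret F: vector_space "scaleF :: complex => ('g word => complex) => _" by (rule vector_space_scaleF)
 let ?f = "rt x (- 1)"
 show "?f (?f vac) \<in> Lc" by (intro rt_Lc vac_Lc)
 show "?f (?f vac) [] = 0" by (simp add: rt_def vac_Cons)
 show "?f (?f vac) (y # w) = 0" if "snd y \<le> 0" for y w using that by (simp add: rt_def vac_Cons)
 fix y :: 'g and n :: int assume n: "n > 0"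
 note v = vac_Lc rt_Lc[OF vac_Lc]
 have 1: "rt y n (?f vac) = rt (bracket y x) (n - 1) vac + scaleF (cen (y, n) (x, - 1)) vac"
  using rt_comm[OF v(1), of y n x "- 1"] n by (simp add: rt_vac L.act_0)
 have 2: "rt (bracket y x) (n - 1) vac = 0" using n by (simp add: rt_vac)
 have 3: "rt (bracket y x) (n - 1) (?f vac) =
   rt (bracket (bracket y x) x) (n - 2) vac + scaleF (cen (bracket y x, n - 1) (x, - 1)) vac"
  using rt_comm[OF v(1), of "bracket y x" "n - 1" x "- 1"] 2 by (simp add: L.act_0)
 have c: "cen (bracket y x, n - 1) (x, - 1) = 0" using kap_invariant[of y x x] by (simp add: cen_def bracket_self kap_simps)
 have "rt y n (?f (?f vac)) = ?f (rt y n (?f vac)) + rt (bracket y x) (n - 1) (?f vac)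
   + scaleF (cen (y, n) (x, - 1)) (?f vac)" using rt_comm[OF v(2), of y n x "- 1"] by simp
 also have "\<dots> = rt (bracket (bracket y x) x) (n - 2) vac + scaleF (2 * cen (y, n) (x, - 1)) (?f vac)"
  unfolding 1 2 3 c by (simp add: rt_scale) (simp add: scaleF_def fun_eq_iff)
 also have "\<dots> = 0"
 proof (cases "n = 1")
  case True
  hence "rt (bracket (bracket y x) x) (n - 2) vac = scaleF (- 2 * kap y x) (?f vac)"
   by (simp only: ad_square[OF al x] rt_scale_left[OF v(1)]) simp
  thus ?thesis using True by (simp add: cen_def flip: L.V.scale_left_distrib)
 next case False
  thus ?thesis using n by (simp add: cen_def rt_vac)
 qed
 finally show "rt y n (?f (?f vac)) = 0" .
qed

lemma U_vac_degree:
 assumes "L.U vac 0 0 nu N w" "N > 0"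
 shows "w = 0"
proof -
 have "ug scaleF rt (WT \<times> {..< 0}) vac 0 0 nu N w"
 proof (rule L.U_restrict[OF _ vac_Lc _ assms(1)])
  fix ga k x assume "(ga, k) \<notin> WT \<times> {..< 0}" "(ga, k) \<in> WT \<times> (UNIV :: int set)"
  hence "rt x k vac = 0" by (intro rt_vac) auto
  thus "ug scaleF rt (WT \<times> {..< 0}) vac 0 0 (0 + ga) (0 + k) (rt x k vac)" by (simp add: ug.ug_zero)
 qed auto
 hence "N \<le> 0 \<or> w = 0"
 proof (induction rule: ug.induct)
  case (ug_act nu N v bt n x)
  have "N + n \<le> 0 \<or> rt x n v = 0"
  proof (cases "v = 0")
   case True
   show ?thesis unfolding True using L.act_0 by blast
  next case False
   thus ?thesis using ug_act by auto
  qed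
  thus ?case .
 qed (auto simp: scaleF_def fun_eq_iff)
 thus ?thesis using assms(2) by simp
qed

section \<open>Weights of the vacuum module and the excess bound there\<close>

lemma ug_lattice:
 assumes "ug scaleV act P v0 0 N0 nu N w" "w ~= 0" "P <= WT \<times> UNIV" "!!x n. act x n 0 = 0" "!!c. scaleV c 0 = 0"
 shows "\<exists>xs. set xs <= roots & nu = sum_list xs" using assms(1,2)
proof (induction rule: ug.induct)
 case ug_base
 show ?case by (rule exI[of _ "[]"]) simp
next case (ug_add nu N v w)
 thus ?case by (cases "v = 0") auto
next case (ug_scale nu N v c)
 thus ?case using assms(5) by (cases "v = 0") auto
next case (ug_act nu N v bt n x)
 have "v ~= 0" using ug_act.prems assms(4) by auto
 then obtain xs where xs: "set xs <= roots" "nu = sum_list xs" using ug_act.IH by blast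
 have "bt \<in> WT" using ug_act.hyps assms(3) by auto
 then consider "bt = 0" | "bt \<in> roots" using WT_cases by blast
 hence "\<exists>xs. set xs <= roots & nu + bt = sum_list xs"
 proof cases
  case 1
  thus ?thesis using xs by auto
 next case 2
  hence "set (bt # xs) <= roots & nu + bt = sum_list (bt # xs)" using xs by (simp add: add.commute)
  thus ?thesis by blast
 qed
 thus ?case .
qed simp

text \<open>Merging the first member \<open>bt\<close> with one that pairs negatively with it
  shortens the list. If there is none, the sum pairs with \<open>bt\<close> to at least 2. In other
  terms, a root lattice contains no nonzero minuscule weight.\<close>

lemma lattice_small:
 assumes "set xs <= roots" "!!al. al \<in> roots ==> ip (sum_list xs) al \<le> 1"
 shows "sum_list xs = 0" using assms
proof (induction "length xs" arbitrary: xs rule: less_induct)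
 case less
 show ?case
 proof (cases xs)
  case (Cons bt ys)
  have r: "bt \<in> roots" "set ys <= roots" using less.prems Cons by auto
  show ?thesis
  proof (cases "\<exists>ga\<in>set ys. ip ga bt < 0")
   case True
   then obtain ga where ga: "ga \<in> set ys" "ip ga bt < 0" by blast
   then obtain us vs where ys: "ys = us @ ga # vs" using split_list by metis
   have c: "ga + bt = 0 \<or> ga + bt \<in> roots" using ip_neg_cases[of ga bt] ga r by auto
   define zs where "zs = (if ga + bt = 0 then [] else [ga + bt]) @ us @ vs"
   have s: "sum_list zs = sum_list xs" by (simp add: zs_def Cons ys algebra_simps)
   have "sum_list zs = 0"
   proof (rule less.hyps)
    show "length zs < length xs" by (simp add: zs_def Cons ys)
    show "set zs <= roots" using c r ys by (auto simp: zs_def)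
    show "ip (sum_list zs) al \<le> 1" if "al \<in> roots" for al unfolding s using less.prems(2)[OF that] .
   qed
   thus ?thesis using s by simp
  next case False
   hence "0 \<le> (\<Sum>ga\<leftarrow>ys. ip ga bt)" by (intro sum_list_nonneg) (auto simp: not_less)
   hence "ip (sum_list xs) bt \<ge> 2" using ip_sum_list[OF less.prems(1) r(1)] Cons ip_self[OF r(1)] by simp
   thus ?thesis using less.prems(2)[OF r(1)] by simp
  qed
 qed simp
qed

lemma Exc_0: "Exc 0 N = - of_int N" using form_facts(2)[OF dual_0 dual_0 dual_0] by (simp add: Exc_def)

text \<open>Reflecting a weight with \<open>ip nu al \<ge> 2\<close> in the affine root \<open>(- al, 1)\<close> raises the degree, which is bounded above.\<close>

lemma vac_bound:
 assumes "L.U vac 0 0 nu N w" "Exc nu N < 0"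
 shows "w = 0" using assms
proof (induction "nat (1 - N)" arbitrary: nu N w rule: less_induct)
 case less
 show ?case
 proof (rule ccontr)
  assume nz: "w ~= 0"
  have wM: "w \<in> Lc" by (rule L.U_M[OF less.prems(1) vac_Lc])
  have nu: "nu \<in> intw" by (rule L.U_intw[OF less.prems(1) nz intw_0])
  have N: "N \<le> 0" using U_vac_degree[OF less.prems(1)] nz by linarith
  obtain xs where xs: "set xs <= roots" "nu = sum_list xs" using ug_lattice[OF less.prems(1) nz] L.act_0 by auto
  show False
  proof (cases "\<exists>al\<in>roots. ip nu al \<ge> 2")
   case False
   hence "nu = 0" unfolding xs(2) by (intro lattice_small xs(1)) (auto simp: xs(2) not_le)
   thus False using less.prems(2) N by (simp add: Exc_0)
  next case True
   then obtain al where al: "al \<in> roots" "ip nu al \<ge> 2" by blast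
   obtain e f where ef: "e \<in> root_space (- al)" "f \<in> root_space (- (- al))" "bracket e f = coroot (- al)"
    by (rule coroot_exists[OF root_minus[OF al(1)]])
   have f: "f \<in> root_space al" using ef(2) by simp
   note m = root_minus[OF al(1)]
   \<comment> \<open>Minus the pairing of \<open>nu\<close> with the affine root
     \<open>(- al, 1)\<close>; it is at least 1, so the degree really grows.\<close>
   define p where "p = nat (ip nu al - 1)"
   have P: "(ga, n) \<in> WT \<times> UNIV" if "ga \<in> roots" for ga and n :: int using rootD(1)[OF that] by simp
   have P0: "(0, 0) \<in> WT \<times> UNIV" using zero_WT by simp
   have z: "(rt e 1 ^^ p) w = 0"
   proof (rule less.hyps)
    have "L.U vac 0 0 (plus_mult nu (int p) (- al)) (N + int p * 1) ((rt e 1 ^^ p) w)" by (rule L.U_pow[OF less.prems(1) P[OF m] ef(1)])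
    thus "L.U vac 0 0 (plus_mult nu (int p) (- al)) (N + int p * 1) ((rt e 1 ^^ p) w)" .
    show "nat (1 - (N + int p * 1)) < nat (1 - N)" using al(2) N by (simp add: p_def)
    have "Exc (plus_mult nu (int p) (- al)) (N + int p * 1) = Exc nu N"
     by (rule Exc_reflect[OF nu m]) (use al(2) in "simp add: ip_coroot_minus nu al(1) p_def")
    thus "Exc (plus_mult nu (int p) (- al)) (N + int p * 1) < 0" using less.prems(2) by simp
   qed
   have "\<exists>s. (rt f (- 1) ^^ s) w = 0" by (rule L.U_nilpotent[OF al(1) P[OF al(1)] f vac_Lc _ less.prems(1), of 2])
     (simp add: numeral_2_eq_2 vac_null[OF al(1) f])
   then obtain s where s: "(rt f (- 1) ^^ s) w = 0" by blast
   have H: "rt (coroot (- al)) 0 w = scaleF (of_int (ip nu (- al))) w" unfolding ip[OF nu m, symmetric]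
    by (rule L.U_weight[OF P0 vac_Lc _ coroot_h[OF m] less.prems(1)]) (simp add: rt_vac scaleF_def zero_fun_def)
   have k: "ip nu (- al) + 1 = - int p" using al(2) by (simp add: ip_coroot_minus nu al(1) p_def)
   show False using L.affine_injective[OF m P[OF m] P[OF root_minus[OF m]] P0 ef wM H k s z] nz by blast
  qed
 qed
qed

text \<open>The power \<open>k\<close> would have excess \<open>- k * (k + n)\<close>, which is
  negative.\<close>

lemma vac_letter_nilpotent:
 assumes al: "al \<in> roots" and x: "x \<in> root_space al" and k: "int k > - n" "k ~= 0"
 shows "(rt x n ^^ k) vac = 0"
proof -
 have U: "L.U vac 0 0 (plus_mult 0 (int k) al) (0 + int k * n) ((rt x n ^^ k) vac)"
  by (rule L.U_pow[OF ug.ug_base _ x]) (simp add: rootD(1)[OF al])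
 have "int k * (int k + n) > 0" using k by simp
 hence "Exc (plus_mult 0 (int k) al) (0 + int k * n) < 0"
  unfolding Exc_plus_mult[OF intw_0 al] Exc_0 by (simp add: power2_eq_square algebra_simps flip: of_int_mult of_int_add)
 thus ?thesis by (rule vac_bound[OF U])
qed

end

section \<open>Evaluation of words\<close>

lemma apply_word_append: "apply_word act (as @ bs) v = apply_word act as (apply_word act bs v)" by (simp add: apply_word_def)

lemma apply_word_Cons: "apply_word act (x # bs) v = act x (apply_word act bs v)" "apply_word act [] v = v" by (simp_all add: apply_word_def)

locale evaluation = vector_space scale for scale :: "complex => 'v::ab_group_add => 'v"
begin

lemma evaluate_superset:
 "finite S ==> Poly_Mapping.keys p <= S ==>
  evaluate scale act v p = (\<Sum>xs\<in>S. scale (Poly_Mapping.lookup p xs) (apply_word act xs v))"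
 unfolding evaluate_def by (rule sum.mono_neutral_left) (auto simp: in_keys_iff)

lemma evaluate_add: "evaluate scale act v (p + q) = evaluate scale act v p + evaluate scale act v q"
proof -
 let ?S = "Poly_Mapping.keys p \<union> Poly_Mapping.keys q"
 have "Poly_Mapping.keys (p + q) <= ?S" by (rule Poly_Mapping.keys_add)
 thus ?thesis by (simp add: evaluate_superset[of ?S] Poly_Mapping.lookup_add scale_left_distrib sum.distrib)
qed

lemma evaluate_scale: "evaluate scale act v (free_scale c p) = scale c (evaluate scale act v p)"
proof -
 have "Poly_Mapping.keys (free_scale c p) <= Poly_Mapping.keys p" by (auto simp: in_keys_iff lookup_free_scale)
 thus ?thesis by (simp add: evaluate_superset[of "Poly_Mapping.keys p"] lookup_free_scale scale_sum_right)
qed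

lemma evaluate_word: "evaluate scale act v (word xs) = apply_word act xs v" by (simp add: evaluate_def)

lemma evaluate_0: "evaluate scale act v 0 = 0" by (simp add: evaluate_def)

lemma evaluate_diff: "evaluate scale act v (p - q) = evaluate scale act v p - evaluate scale act v q"
 using evaluate_add[of act v "p - q" q] by simp

lemma evaluate_sum: "evaluate scale act v (sum f A) = (\<Sum>a\<in>A. evaluate scale act v (f a))"
 by (induction A rule: infinite_finite_induct) (simp_all add: evaluate_0 evaluate_add)

end

definition prepend :: "'a => ('a list \<Rightarrow>\<^sub>0 complex) => ('a list \<Rightarrow>\<^sub>0 complex)" where
 "prepend x p = (\<Sum>xs\<in>Poly_Mapping.keys p. free_scale (Poly_Mapping.lookup p xs) (word (x # xs)))"

lemma (in evaluation) evaluate_prepend: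
 assumes "!!v w. act x (v + w) = act x v + act x w" "!!c v. act x (scale c v) = scale c (act x v)"
 shows "evaluate scale act v (prepend x p) = act x (evaluate scale act v p)"
proof -
 have 0: "act x 0 = 0" using assms(2)[of 0 0] by simp
 have "act x (\<Sum>xs\<in>S. scale (c xs) (g xs)) = (\<Sum>xs\<in>S. scale (c xs) (act x (g xs)))" for S and c :: "'x list => complex" and g
  by (induction S rule: infinite_finite_induct) (simp_all add: 0 assms)
 hence "act x (evaluate scale act v p) =
   (\<Sum>xs\<in>Poly_Mapping.keys p. scale (Poly_Mapping.lookup p xs) (act x (apply_word act xs v)))" unfolding evaluate_def .
 thus ?thesis by (simp add: prepend_def evaluate_sum evaluate_scale evaluate_word apply_word_Cons)
qed

lemma (in evaluation) evaluate_kernel: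
 assumes "!!r. r \<in> R ==> evaluate scale act v r = 0" "p \<in> module.span free_scale R"
 shows "evaluate scale act v p = 0"
proof -
 interpret F: vector_space free_scale by (rule free_vector_space)
 have "F.span R <= {p. evaluate scale act v p = 0}"
  by (rule F.span_minimal) (auto simp: F.subspace_def evaluate_0 evaluate_add evaluate_scale assms(1))
 thus ?thesis using assms(2) by auto
qed

section \<open>The twisted action of the current algebra on the vacuum module\<close>

context ade
begin

definition comp :: "'g => 'g wt => 'g" where
 "comp x = (SOME y. (\<forall>ga\<in>WT. y ga \<in> root_space ga) & x = sum y WT)"

lemma comp: "ga \<in> WT ==> comp x ga \<in> root_space ga" "sum (comp x) WT = x"
proof -
 obtain y where y: "!!ga. ga \<in> WT ==> y ga \<in> root_space ga" "x = sum y WT" using all_components[of x] by metis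
 have "(\<forall>ga\<in>WT. comp x ga \<in> root_space ga) & x = sum (comp x) WT"
  unfolding comp_def by (rule someI[where x = y]) (use y in blast)
 thus "ga \<in> WT ==> comp x ga \<in> root_space ga" "sum (comp x) WT = x" by auto
qed

lemma comp_eq:
 assumes y: "!!ga. ga \<in> WT ==> y ga \<in> root_space ga" "sum y WT = x" and ga: "ga \<in> WT"
 shows "comp x ga = y ga"
proof -
 have "comp x ga - y ga = 0"
 proof (rule gw_indep[of WT "%ga. comp x ga - y ga"])
  show "comp x bt - y bt \<in> gw bt" if "bt \<in> WT" for bt
   unfolding gw_root_space[OF that] by (intro subspace_diff root_space_sub comp(1) y(1) that)
 qed (simp_all add: finite_WT WT_onh ga sum_subtractf comp(2) y(2))
 thus ?thesis by simp
qed

lemma comp_add: "ga \<in> WT ==> comp (x + y) ga = comp x ga + comp y ga"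
 by (rule comp_eq) (simp_all add: comp sum.distrib subspace_add root_space_sub)

lemma comp_scale: "ga \<in> WT ==> comp (scale c x) ga = scale c (comp x ga)"
 by (rule comp_eq) (simp_all add: comp subspace_scale root_space_sub flip: scale_sum_right)

lemma comp_root: "x \<in> root_space bt ==> bt \<in> WT ==> ga \<in> WT ==> comp x ga = (if ga = bt then x else 0)"
 by (rule comp_eq) (auto simp: finite_WT subspace_0 root_space_sub)

text \<open>Degree shift of the root space of \<open>bt\<close> under translation by
  \<open>lam\<close>. Weight 0 has no coroot and is set apart.\<close>

definition sh :: "'g wt => 'g wt => int" where
 "sh lam bt = (if bt = 0 then 0 else ip lam bt)"

lemma sh_add:
 assumes "lam \<in> intw" "bt \<in> WT" "ga \<in> WT" "bt + ga \<in> WT"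
 shows "sh lam (bt + ga) = sh lam bt + sh lam ga"
proof (cases "bt = 0 \<or> ga = 0 \<or> bt + ga = 0")
 case True
 have "sh lam (- bt) = - sh lam bt" using assms(1) WT_cases[OF assms(2)] by (auto simp: sh_def ip_coroot_minus)
 thus ?thesis using True eq_neg_iff_add_eq_0[of ga bt] by (auto simp: sh_def add.commute)
next case False
 hence "bt \<in> roots" "ga \<in> roots" "bt + ga \<in> roots" using WT_cases assms by blast+
 thus ?thesis using False ip_coroot_add[OF assms(1)] by (simp add: sh_def)
qed

interpretation L: lmod scale bracket h b Basis form scaleF "WT \<times> UNIV" Lc rt by (rule lmod_rt)

interpretation E: evaluation "scaleF :: complex => ('g word => complex) => _" by (rule evaluation.intro[OF vector_space_scaleF])

text \<open>The translation automorphism of the affine algebra attached to \<open>lam\<close>: root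
  spaces are shifted in degree, and elements of \<open>h\<close> at degree 0 gain the scalar
  \<open>lam\<close>, which gives the vacuum the weight \<open>lam\<close>.\<close>

definition tw :: "'g wt => 'g => int => ('g word => complex) => 'g word => complex" where
 "tw lam x n Ps = (\<Sum>ga\<in>WT. rt (comp x ga) (n + sh lam ga) Ps) + scaleF (if n = 0 then lam (comp x 0) else 0) Ps"

lemma tw_Lc: "Ps \<in> Lc ==> tw lam x n Ps \<in> Lc" unfolding tw_def by (intro L.M_add L.M_scale L.V.subspace_sum[OF L.M_subspace] rt_Lc)

lemma tw_add: "tw lam x n (Ps + Ph) = tw lam x n Ps + tw lam x n Ph" by (simp add: tw_def rt_add sum.distrib L.V.scale_right_distrib)

lemma tw_scale: "tw lam x n (scaleF c Ps) = scaleF c (tw lam x n Ps)"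
 by (simp add: tw_def rt_scale L.V.scale_right_distrib mult.commute flip: L.V.scale_sum_right)

lemma lam_comp:
 assumes "lam \<in> dual"
 shows "lam (comp (x + y) 0) = lam (comp x 0) + lam (comp y 0)" "lam (comp (scale c x) 0) = c * lam (comp x 0)"
 using comp(1)[OF zero_WT] dual_props(1,2)[OF assms] by (simp_all add: comp_add[OF zero_WT] comp_scale[OF zero_WT] root_space_0)

lemma tw_add_left: "lam \<in> dual ==> Ps \<in> Lc ==> tw lam (x + y) n Ps = tw lam x n Ps + tw lam y n Ps"
 by (simp add: tw_def comp_add rt_add_left sum.distrib lam_comp L.V.scale_left_distrib)

lemma tw_scale_left: "lam \<in> dual ==> Ps \<in> Lc ==> tw lam (scale c x) n Ps = scaleF c (tw lam x n Ps)"
 by (simp add: tw_def comp_scale rt_scale_left lam_comp L.V.scale_right_distrib flip: L.V.scale_sum_right)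

lemma tw_zero_left: "lam \<in> dual ==> Ps \<in> Lc ==> tw lam 0 n Ps = 0" using tw_scale_left[of lam Ps 0 0 n] by simp

lemma tw_root:
 assumes "x \<in> root_space bt" "bt \<in> WT" "Ps \<in> Lc" "lam \<in> dual"
 shows "tw lam x n Ps = rt x (n + sh lam bt) Ps + scaleF (if n = 0 & bt = 0 then lam x else 0) Ps"
proof -
 have "(\<Sum>ga\<in>WT. rt (comp x ga) (n + sh lam ga) Ps) = (\<Sum>ga\<in>WT. if ga = bt then rt x (n + sh lam bt) Ps else 0)"
  by (intro sum.cong) (auto simp: comp_root[OF assms(1,2)] rt_zero_left assms(3))
 also have "\<dots> = rt x (n + sh lam bt) Ps" using assms(2) by (simp add: finite_WT)
 finally show ?thesis using comp_root[OF assms(1,2) zero_WT] dual_props(4)[OF assms(4)] by (auto simp: tw_def)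
qed

lemma span_WT_induct:
 assumes "!!ga x. ga \<in> WT ==> x \<in> root_space ga ==> Q x" "!!x y. Q x ==> Q y ==> Q (x + y)"
 shows "Q x"
proof -
 have "Q (sum (comp x) F)" if "finite F" "F <= WT" for F using that
 proof (induction rule: finite_induct)
  case empty
  thus ?case using assms(1)[OF zero_WT, of 0] by (simp add: subspace_0 root_space_sub)
 next case (insert ga F)
  have "Q (comp x ga)" "Q (sum (comp x) F)" using insert assms(1)[OF _ comp(1)] by auto
  thus ?case using assms(2) insert.hyps by simp
 qed
 from this[OF finite_WT subset_refl] show ?thesis by (simp add: comp(2))
qed

text \<open>The cocycle of the shifted letters has to reproduce the scalar that \<open>lam\<close>
  attaches to the bracket. For opposite roots and \<open>m = n = 0\<close> it is
  \<open>ip lam bt * kap x y\<close>, which is \<open>lam\<close> of \<open>kap x y\<close> times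
  the coroot. In all other cases with nonnegative \<open>m\<close> and \<open>n\<close> both scalars
  are zero.\<close>

lemma tw_comm:
 assumes lam: "lam \<in> intw" and mn: "m \<ge> 0" "n \<ge> 0" and Ps: "Ps \<in> Lc"
 shows "tw lam (bracket x y) (m + n) Ps = tw lam x m (tw lam y n Ps) - tw lam y n (tw lam x m Ps)"
proof (rule span_WT_induct[where x = x], goal_cases)
 case (2 x x')
 note l = tw_add_left[OF intw_dual[OF lam]]
 show ?case unfolding bracket_add_left l[OF Ps] l[OF tw_Lc[OF Ps]] tw_add 2 by (simp add: fun_eq_iff)
next case (1 bt x)
 show ?case
 proof (rule span_WT_induct[where x = y], goal_cases)
  case (2 y y')
  note l = tw_add_left[OF intw_dual[OF lam]]
  show ?case unfolding bracket_add_right l[OF Ps] l[OF tw_Lc[OF Ps]] tw_add 2 by (simp add: fun_eq_iff)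
 next case (1 ga y)
  note bt = \<open>bt \<in> WT\<close> \<open>x \<in> root_space bt\<close> and ga = \<open>ga \<in> WT\<close> \<open>y \<in> root_space ga\<close> and d = intw_dual[OF lam]
  define p q where "p = (if m = 0 & bt = 0 then lam x else 0)" and "q = (if n = 0 & ga = 0 then lam y else 0)"
  note tx = tw_root[OF bt(2,1) _ d, where n = m, folded p_def] and ty = tw_root[OF ga(2,1) _ d, where n = n, folded q_def]
  define c where "c = cen (x, m + sh lam bt) (y, n + sh lam ga)"
  have "tw lam x m (tw lam y n Ps) - tw lam y n (tw lam x m Ps) =
    rt x (m + sh lam bt) (rt y (n + sh lam ga) Ps) - rt y (n + sh lam ga) (rt x (m + sh lam bt) Ps)"
   unfolding tx[OF tw_Lc[OF Ps]] ty[OF tw_Lc[OF Ps]] unfolding tx[OF Ps] ty[OF Ps] rt_add rt_scale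
   by (simp add: scaleF_def fun_eq_iff algebra_simps)
  also have "\<dots> = rt (bracket x y) (m + n + (sh lam bt + sh lam ga)) Ps + scaleF c Ps"
   unfolding c_def using rt_comm[OF Ps, of x "m + sh lam bt" y "n + sh lam ga"] by (simp add: ac_simps)
  finally have e: "tw lam x m (tw lam y n Ps) - tw lam y n (tw lam x m Ps) =
   rt (bracket x y) (m + n + (sh lam bt + sh lam ga)) Ps + scaleF c Ps" .
  show ?case
  proof (cases "bt + ga \<in> WT")
   case False
   hence b: "bracket x y = 0" using WT_bracket[OF bt(2) ga(2)] WT_onh bt(1) ga(1) by blast
   have "kap x y = 0" using False zero_WT kap_orthogonal[OF bt(2) ga(2) bt(1) ga(1)] by metis
   thus ?thesis using Ps by (simp add: e b tw_zero_left d rt_zero_left c_def cen_def)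
  next case True
   have s: "sh lam (bt + ga) = sh lam bt + sh lam ga" by (rule sh_add[OF lam bt(1) ga(1) True])
   have "c = (if m + n = 0 & bt + ga = 0 then lam (bracket x y) else 0)"
   proof (cases "bt + ga = 0")
    case False
    thus ?thesis using kap_orthogonal[OF bt(2) ga(2) bt(1) ga(1)] by (simp add: c_def cen_def)
   next case ga': True
    have s0: "sh lam bt + sh lam ga = 0" using s ga' by (simp add: sh_def)
    show ?thesis
    proof (cases "bt = 0")
     case True
     hence "ga = 0" using ga' by simp
     hence "bracket x y = 0" using h_abelian bt ga True root_space_0 by auto
     thus ?thesis using mn True \<open>ga = 0\<close> dual_props(4)[OF d] by (auto simp: c_def cen_def sh_def)
    next case False
     hence btr: "bt \<in> roots" using WT_cases[OF bt(1)] by blast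
     have "ga = - bt" using ga' by (simp add: add_eq_0_iff)
     hence "bracket x y = scale (kap x y) (coroot bt)" using kap_bracket[OF btr bt(2), of y] ga(2) by simp
     hence "lam (bracket x y) = kap x y * of_int (ip lam bt)" using dual_props(2)[OF d coroot_h[OF btr]] ip[OF lam btr] by simp
     thus ?thesis using mn s0 ga' False by (auto simp: c_def cen_def sh_def)
    qed
   qed
   thus ?thesis unfolding e tw_root[OF root_space_bracket[OF bt(2) ga(2)] True Ps d] s by simp
  qed
 qed
qed

definition twp :: "'g wt => 'g poly => ('g word => complex) => 'g word => complex" where
 "twp lam p Ps = (\<Sum>i\<le>degree p. tw lam (coeff p i) (int i) Ps)"

lemma twp_bound:
 assumes "lam \<in> dual" "Ps \<in> Lc" "degree p \<le> n"
 shows "twp lam p Ps = (\<Sum>i\<le>n. tw lam (coeff p i) (int i) Ps)"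
 unfolding twp_def using assms by (intro sum.mono_neutral_left) (auto simp: coeff_eq_0 tw_zero_left)

lemma twp_monom: "lam \<in> dual ==> Ps \<in> Lc ==> twp lam (monom x n) Ps = tw lam x (int n) Ps"
proof -
 assume a: "lam \<in> dual" "Ps \<in> Lc"
 have "twp lam (monom x n) Ps = (\<Sum>i\<le>n. if i = n then tw lam x (int n) Ps else 0)"
  unfolding twp_bound[OF a degree_monom_le] by (intro sum.cong) (auto simp: tw_zero_left a)
 thus ?thesis by simp
qed

lemma twp_Lc: "Ps \<in> Lc ==> twp lam p Ps \<in> Lc" unfolding twp_def by (intro L.V.subspace_sum[OF L.M_subspace] tw_Lc)

lemma twp_add: "twp lam p (Ps + Ph) = twp lam p Ps + twp lam p Ph" by (simp add: twp_def tw_add sum.distrib)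

lemma twp_scale: "twp lam p (scaleF c Ps) = scaleF c (twp lam p Ps)" by (simp add: twp_def tw_scale L.V.scale_sum_right)

lemma twp_add_left:
 assumes "lam \<in> dual" "Ps \<in> Lc"
 shows "twp lam (p + q) Ps = twp lam p Ps + twp lam q Ps"
proof -
 define n where "n = max (degree p) (degree q)"
 have "degree (p + q) \<le> n" "degree p \<le> n" "degree q \<le> n" by (auto simp: n_def degree_add_le_max)
 thus ?thesis using assms by (simp add: twp_bound[of _ _ _ n] tw_add_left sum.distrib)
qed

lemma twp_scale_left:
 assumes "lam \<in> dual" "Ps \<in> Lc"
 shows "twp lam (current_scale scale c p) Ps = scaleF c (twp lam p Ps)"
proof -
 have "degree (current_scale scale c p) \<le> degree p" by (rule degree_le) (simp add: coeff_current_scale coeff_eq_0)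
 thus ?thesis using assms by (simp add: twp_bound[of _ _ _ "degree p"] coeff_current_scale tw_scale_left L.V.scale_sum_right)
qed

lemma poly_induct_monom:
 fixes p :: "'x::ab_group_add poly"
 assumes "!!a n. Q (monom a n)" "!!p q. Q p ==> Q q ==> Q (p + q)"
 shows "Q p"
proof -
 have "Q (\<Sum>i\<le>n. monom (coeff p i) i)" for n by (induction n) (simp_all add: assms)
 thus ?thesis using poly_as_sum_of_monoms[of p] by metis
qed

lemma twp_bracket:
 assumes lam: "lam \<in> intw" and Ps: "Ps \<in> Lc"
 shows "twp lam (current_bracket bracket p q) Ps = twp lam p (twp lam q Ps) - twp lam q (twp lam p Ps)"
proof (rule poly_induct_monom[where p = p], goal_cases)
 case (2 p p')
 note l = twp_add_left[OF intw_dual[OF lam]]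
 show ?case unfolding current_bracket_add_left l[OF Ps] l[OF twp_Lc[OF Ps]] twp_add 2 by (simp add: fun_eq_iff)
next case (1 x m)
 show ?case
 proof (rule poly_induct_monom[where p = q], goal_cases)
  case (2 p p')
  note l = twp_add_left[OF intw_dual[OF lam]]
  show ?case unfolding current_bracket_add_right l[OF Ps] l[OF twp_Lc[OF Ps]] twp_add 2 by (simp add: fun_eq_iff)
 next case (1 y n)
  show ?case using Ps intw_dual[OF lam] tw_comm[OF lam _ _ Ps, of "int m" "int n" x y] by (simp add: current_bracket_monom twp_monom tw_Lc)
 qed
qed

lemma apply_twp:
 shows "apply_word (twp lam) xs (Ps + Ph) = apply_word (twp lam) xs Ps + apply_word (twp lam) xs Ph"
  "apply_word (twp lam) xs (scaleF c Ps) = scaleF c (apply_word (twp lam) xs Ps)"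
  "Ps \<in> Lc ==> apply_word (twp lam) xs Ps \<in> Lc" by (induction xs) (simp_all add: apply_word_Cons twp_add twp_scale twp_Lc)

lemma apply_twp_diff: "apply_word (twp lam) xs (Ps - Ph) = apply_word (twp lam) xs Ps - apply_word (twp lam) xs Ph"
 and apply_twp_0: "apply_word (twp lam) xs 0 = 0" using apply_twp(1)[of lam xs "Ps - Ph" Ph] apply_twp(2)[of lam xs 0 0] by simp_all

lemma twp_enveloping:
 assumes "lam \<in> intw" "r \<in> enveloping_relations"
 shows "evaluate scaleF (twp lam) vac r = 0"
proof -
 note s = E.evaluate_diff E.evaluate_word E.evaluate_scale apply_word_append apply_word_Cons
 have L: "apply_word (twp lam) xs vac \<in> Lc" for xs by (rule apply_twp(3)[OF vac_Lc])
 note d = intw_dual[OF assms(1)]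
 from assms(2) consider as bs x y where "r = word (as @ [x + y] @ bs) - word (as @ [x] @ bs) - word (as @ [y] @ bs)"
  | as bs c x where "r = word (as @ [current_scale scale c x] @ bs) - free_scale c (word (as @ [x] @ bs))"
  | as bs x y where "r = word (as @ [x, y] @ bs) - word (as @ [y, x] @ bs) - word (as @ [current_bracket bracket x y] @ bs)"
  unfolding enveloping_relations_def by blast
 thus ?thesis
 proof cases
  case 1
  show ?thesis unfolding 1 s twp_add_left[OF d L] apply_twp by simp
 next case 2
  show ?thesis unfolding 2 s twp_scale_left[OF d L] apply_twp by simp
 next case 3
  show ?thesis unfolding 3 s twp_bracket[OF assms(1) L] apply_twp_diff by simp
 qed
qed

lemma twp_vac_nplus:
 assumes lam: "dominant_integral lam" and x: "x \<in> nplus" and n: "n \<ge> 0"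
 shows "tw lam x n vac = 0"
proof -
 note d = intw_dual[OF dominant_intw(1)[OF lam]]
 have "nplus <= {x. tw lam x n vac = 0}" unfolding nplus_def
 proof (rule span_minimal)
  show "subspace {x. tw lam x n vac = 0}" using vac_Lc d by (simp add: subspace_def tw_zero_left tw_add_left tw_scale_left)
  have "tw lam x n vac = 0" if al: "al \<in> pos" and x: "x \<in> root_space al" for al x
  proof -
   note r = rootD[OF pos_roots[OF al]]
   have "n + sh lam al \<ge> 0" using n dominant_intw(2)[OF lam al] by (simp add: sh_def)
   thus ?thesis unfolding tw_root[OF x r(1) vac_Lc d] using r(2) by (simp add: rt_vac)
  qed
  thus "(\<Union>al\<in>pos. root_space al) <= {x. tw lam x n vac = 0}" by auto
 qed
 thus ?thesis using x by auto
qed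

text \<open>Dominance shifts positive root spaces to nonnegative degrees and \<open>h\<close> is not
  shifted, so these letters kill the vacuum as required. The space of a negative simple root is
  shifted by \<open>- n\<close>, and there \<open>vac_letter_nilpotent\<close> kills the power
  \<open>n + 1\<close>.\<close>

lemma twp_local_weyl:
 assumes lam: "dominant_integral lam" and r: "r \<in> local_weyl_relations lam"
 shows "evaluate scaleF (twp lam) vac r = 0"
proof -
 note i = dominant_intw(1)[OF lam] and d = intw_dual[OF dominant_intw(1)[OF lam]]
 note s = E.evaluate_diff E.evaluate_word E.evaluate_scale apply_word_append apply_word_Cons
 from r consider as x where "r = word (as @ [x])" "\<forall>i. coeff x i \<in> nplus"
  | as x where "r = word (as @ [x])" "coeff x 0 = 0" "\<forall>i. coeff x i \<in> h"
  | as H where "r = word (as @ [monom H 0]) - free_scale (lam H) (word as)" "H \<in> h"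
  | as Ys al n where "r = word (as @ map (%Y. monom Y 0) Ys)" "al \<in> simple_roots" "lam (coroot al) = of_nat n"
    "length Ys = n + 1" "set Ys <= root_space (%x. - al x)" unfolding local_weyl_relations_def by blast
 thus ?thesis
 proof cases
  case 1
  hence "twp lam x vac = 0" unfolding twp_def by (intro sum.neutral) (simp add: twp_vac_nplus[OF lam])
  thus ?thesis by (simp add: 1 s apply_twp_0)
 next case 2
  have "tw lam (coeff x i) (int i) vac = 0" for i
  proof (cases "i = 0")
   case True
   thus ?thesis using 2 vac_Lc d by (simp add: tw_zero_left)
  next case False
   have "coeff x i \<in> root_space 0" using 2 by (simp add: root_space_0)
   thus ?thesis using False by (simp add: tw_root[OF _ zero_WT vac_Lc d] sh_def rt_vac)
  qed
  hence "twp lam x vac = 0" unfolding twp_def by simp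
  thus ?thesis by (simp add: 2 s apply_twp_0)
 next case 3
  have "H \<in> root_space 0" using 3 by (simp add: root_space_0)
  hence "twp lam (monom H 0) vac = scaleF (lam H) vac" using vac_Lc d by (simp add: twp_monom tw_root[OF _ zero_WT] sh_def rt_vac)
  thus ?thesis by (simp add: 3 s apply_twp)
 next case 4
  note al = pos_roots[OF simple_pos[OF 4(2)]]
  note m = root_minus[OF al]
  obtain f where f: "f \<in> root_space (- al)" "f ~= 0" by (rule root_space_nonzero[OF m])
  have n: "ip lam al = int n" using 4(3) by (intro ipI) simp
  have "\<exists>c. apply_word (twp lam) (map (%Y. monom Y 0) Ys) vac = scaleF c ((rt f (- int n) ^^ length Ys) vac)"
   if "set Ys <= root_space (%x. - al x)" for Ys using that
  proof (induction Ys)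
   case Nil
   show ?case by (rule exI[of _ 1]) (simp add: apply_word_Cons)
  next case (Cons Y Ys)
   obtain c where c: "apply_word (twp lam) (map (%Y. monom Y 0) Ys) vac = scaleF c ((rt f (- int n) ^^ length Ys) vac)" using Cons by auto
   have "Y \<in> root_space (- al)" using Cons.prems by (simp add: fun_Compl_def)
   then obtain a where a: "Y = scale a f" by (rule root_space_line[OF m f])
   have L: "(rt f (- int n) ^^ k) vac \<in> Lc" for k by (induction k) (simp_all add: vac_Lc rt_Lc)
   have "twp lam (monom Y 0) ((rt f (- int n) ^^ length Ys) vac) = scaleF a (rt f (- int n) ((rt f (- int n) ^^ length Ys) vac))"
    unfolding a using L d f rootD(2)[OF m]
    by (simp add: twp_monom tw_scale_left tw_root[OF f(1) rootD(1)[OF m]] sh_def ip_coroot_minus i al n)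
   hence "apply_word (twp lam) (map (%Y. monom Y 0) (Y # Ys)) vac = scaleF (c * a) ((rt f (- int n) ^^ length (Y # Ys)) vac)"
    by (simp add: apply_word_Cons c twp_scale)
   thus ?case by blast
  qed
  then obtain c where "apply_word (twp lam) (map (%Y. monom Y 0) Ys) vac = scaleF c ((rt f (- int n) ^^ length Ys) vac)" using 4(5) by blast
  moreover have "(rt f (- int n) ^^ length Ys) vac = 0" by (rule vac_letter_nilpotent[OF m f(1)]) (simp_all add: 4(4))
  ultimately show ?thesis by (simp add: 4(1) s apply_twp_0)
 qed
qed

end

section \<open>Weights of the irreducible module\<close>

lemma (in vector_space) weight_vectors_independent:
 assumes T: "!!i x y. i \<in> I ==> T i (x + y) = T i x + T i y" "!!i c x. i \<in> I ==> T i (scale c x) = scale c (T i x)"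
  and F: "finite F" "!!\<mu> nu. \<mu> \<in> F ==> nu \<in> F ==> \<mu> ~= nu ==> \<exists>i\<in>I. \<mu> i ~= nu i"
 shows "(!!nu i. nu \<in> F ==> i \<in> I ==> T i (x nu) = scale (nu i) (x nu)) ==> sum x F = 0 ==> nu \<in> F ==> x nu = 0" using F
proof (induction arbitrary: x nu rule: finite_induct)
 case (insert nu0 F)
 have T0: "T i 0 = 0" if "i \<in> I" for i using T(2)[OF that, of 0 0] by simp
 have Ts: "T i (sum g G) = (\<Sum>a\<in>G. T i (g a))" if "i \<in> I" for i g G
  by (induction G rule: infinite_finite_induct) (simp_all add: T0 T that)
 have x: "x nu = 0" if nu: "nu \<in> F" for nu
 proof -
  obtain i where i: "i \<in> I" "nu i ~= nu0 i" using insert.prems(4)[of nu nu0] insert.hyps nu by auto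
  define y where "y nu = scale (nu i - nu0 i) (x nu)" for nu
  have "y nu = 0"
  proof (rule insert.IH)
   show "T j (y nu) = scale (nu j) (y nu)" if "nu \<in> F" "j \<in> I" for nu j
    using insert.prems(1)[of nu j] that by (simp add: y_def T mult.commute)
   have "T i (sum x (insert nu0 F)) - scale (nu0 i) (sum x (insert nu0 F)) = (\<Sum>nu\<in>insert nu0 F. y nu)"
    unfolding Ts[OF i(1)] scale_sum_right y_def sum_subtractf[symmetric]
    by (rule sum.cong[OF refl]) (simp add: insert.prems(1) i(1) scale_left_diff_distrib)
   thus "sum y F = 0" using insert.hyps insert.prems(2) by (simp add: T0 i y_def)
   show "\<exists>i\<in>I. \<mu> i ~= nu i" if "\<mu> \<in> F" "nu \<in> F" "\<mu> ~= nu" for \<mu> nu using insert.prems(4) that by blast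
  qed (rule nu)
  thus ?thesis using i by (simp add: y_def)
 qed
 hence "x nu0 = 0" using insert.prems(2) insert.hyps by (simp add: sum.neutral)
 thus ?case using x insert.prems(3) by auto
qed simp

context lmod
begin

text \<open>Vectors of different weights are independent, so in a sum of homogeneous vectors that
  has weight \<open>\<mu>\<close> all other components cancel.\<close>

lemma U_component:
 assumes P: "(0, 0) \<in> P" and v0: "v0 \<in> M" "!!H. H \<in> h ==> act H 0 v0 = scaleV (nu0 H) v0" "nu0 \<in> intw"
  and w: "w \<in> V.span {w. \<exists>nu. U v0 nu0 N0 nu N w}" and \<mu>: "\<mu> \<in> dual" "!!H. H \<in> h ==> act H 0 w = scaleV (\<mu> H) w"
 shows "U v0 nu0 N0 \<mu> N w"
proof -
 have "\<exists>F y. finite F & F <= intw & (\<forall>nu\<in>F. U v0 nu0 N0 nu N (y nu)) & w = sum y F" using w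
 proof (induction rule: V.span_induct_alt)
  case base
  show ?case by (rule exI[of _ "{}"]) simp
 next case (step c x z)
  obtain nu where nu: "U v0 nu0 N0 nu N x" using step.hyps by blast
  obtain F y where F: "finite F" "F <= intw" "\<forall>nu\<in>F. U v0 nu0 N0 nu N (y nu)" "z = sum y F" using step.IH by blast
  show ?case
  proof (cases "x = 0")
   case True
   thus ?thesis using F by (intro exI[of _ F] exI[of _ y]) simp
  next case False
   have nui: "nu \<in> intw" by (rule U_intw[OF nu False v0(3)])
   define y' where "y' = (%ga. (if ga = nu then scaleV c x else 0) + (if ga \<in> F then y ga else 0))"
   have "sum y' (insert nu F) = scaleV c x + (\<Sum>ga\<in>insert nu F. if ga \<in> F then y ga else 0)"
    unfolding y'_def sum.distrib using F(1) by simp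
   also have "(\<Sum>ga\<in>insert nu F. if ga \<in> F then y ga else 0) = sum y F" using F(1) by (intro sum.mono_neutral_cong_right) auto
   finally have s: "scaleV c x + z = sum y' (insert nu F)" using F(4) by simp
   have "U v0 nu0 N0 ga N (y' ga)" if "ga \<in> insert nu F" for ga
    unfolding y'_def using nu F(3) that by (intro ug.ug_add) (auto intro: ug.intros)
   thus ?thesis using s F nui by (intro exI[of _ "insert nu F"] exI[of _ y']) auto
  qed
 qed
 then obtain F y where F: "finite F" "F <= intw" "!!nu. nu \<in> F ==> U v0 nu0 N0 nu N (y nu)" "w = sum y F" by blast
 \<comment> \<open>The difference of two decompositions of \<open>w\<close>: the given one and
   \<open>w\<close> itself placed at \<open>\<mu>\<close>.\<close>
 define y' where "y' = (%ga. (if ga \<in> F then y ga else 0) - (if ga = \<mu> then w else 0))"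
 have s: "sum y' (insert \<mu> F) = 0"
 proof -
  have "(\<Sum>ga\<in>insert \<mu> F. if ga \<in> F then y ga else 0) = sum y F" using F(1) by (intro sum.mono_neutral_cong_right) auto
  thus ?thesis unfolding y'_def sum_subtractf using F(1,4) by simp
 qed
 have "y' \<mu> = 0"
 proof (rule V.weight_vectors_independent[where T = "%H. act H 0" and I = h and F = "insert \<mu> F"])
  show "act H 0 (y' nu) = scaleV (nu H) (y' nu)" if "nu \<in> insert \<mu> F" "H \<in> h" for nu H
  proof -
   have m: "act H 0 (a - b) = act H 0 a - act H 0 b" for a b using act_add[of H 0 "a - b" b] by simp
   show ?thesis unfolding y'_def m using that \<mu>(2)[OF that(2)] U_weight[OF P v0(1,2) that(2) F(3)]
    by (auto simp: act_0 V.scale_right_diff_distrib)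
  qed
  show "\<exists>i\<in>h. al i ~= bt i" if "al \<in> insert \<mu> F" "bt \<in> insert \<mu> F" "al ~= bt" for al bt
  proof -
   have "al \<in> dual" "bt \<in> dual" using that F(2) intw_dual \<mu>(1) by auto
   thus ?thesis using that(3) dual_props(3) by (metis ext)
  qed
 qed (simp_all add: s F(1) act_add act_scale)
 hence "w = (if \<mu> \<in> F then y \<mu> else 0)" by (simp add: y'_def)
 thus ?thesis using F(3) by (auto intro: ug.ug_zero)
qed

lemma U_span_step:
 assumes "(bt, n) \<in> P" "x \<in> root_space bt" "w \<in> V.span {w. \<exists>nu. U v0 nu0 N0 nu N w}"
 shows "act x n w \<in> V.span {w. \<exists>nu. U v0 nu0 N0 nu (N + n) w}" using assms(3)
proof (induction rule: V.span_induct_alt)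
 case base
 show ?case by (simp add: act_0 V.span_zero)
next case (step c y z)
 then obtain nu where "U v0 nu0 N0 nu N y" by blast
 from ug.ug_act[OF this assms(1,2)] have "act x n y \<in> V.span {w. \<exists>nu. U v0 nu0 N0 nu (N + n) w}" by (intro V.span_base) blast
 thus ?case using step.IH by (simp add: act_add act_scale V.span_add V.span_scale)
qed

end

context ade
begin

definition Pneg :: "('g wt \<times> int) set" where
 "Pneg = {(bt, n). bt = 0 \<or> - bt \<in> pos}"

lemma ug_Pneg:
 assumes "ug scaleV act Pneg v0 nu0 N0 nu N w" "w ~= 0" "nu0 \<in> intw" "!!x n. act x n 0 = 0" "!!c. scaleV c 0 = 0"
 shows "nu \<in> intw & (nu = nu0 \<or> ht nu < ht nu0)" using assms(1,2)
proof (induction rule: ug.induct)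
 case (ug_add nu N v w)
 thus ?case by (cases "v = 0") auto
next case (ug_scale nu N v c)
 thus ?case using assms(5) by (cases "v = 0") auto
next case (ug_act nu N v bt n x)
 have "v ~= 0" using ug_act.prems assms(4) by auto
 hence IH: "nu \<in> intw" "nu = nu0 \<or> ht nu < ht nu0" using ug_act.IH by auto
 have "bt = 0 \<or> - bt \<in> pos" using ug_act.hyps by (auto simp: Pneg_def)
 hence "nu + bt \<in> intw & (nu + bt = nu0 \<or> ht (nu + bt) < ht nu0)"
 proof
  assume "- bt \<in> pos"
  hence r: "- bt \<in> intw" "ht (- bt) > 0" using ht_pos roots_intw pos_roots by force+
  hence "bt \<in> intw" using intw_minus[OF r(1)] by simp
  thus ?thesis using IH r ht_minus[of bt] by (auto simp: intw_add ht_add)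
 qed (use IH in simp)
 thus ?case .
qed (use assms(3) in auto)

end

locale irr_mod = ade scale bracket h b Basis form + lie_module scale bracket scaleV act
 for scale :: "complex => 'g::ab_group_add => 'g" and bracket and h b Basis :: "'g set" and form
  and scaleV :: "complex => 'v::ab_group_add => 'v" and act +
 fixes lam :: "'g => complex" and v :: 'v
 assumes lam: "dominant_integral lam"
  and irr: "irreducible_module"
  and v: "v ~= 0" "v \<in> weight_space scaleV act lam" "!!x. x \<in> nplus ==> act x v = 0"
begin

text \<open>A module over the finite dimensional algebra is treated as one over letters of degree 0,
  where the cocycle vanishes.\<close>

definition P0 :: "('g wt \<times> int) set" where
 "P0 = WT \<times> {0}"

lemma lmod_V: "lmod scale bracket h b Basis form scaleV P0 UNIV (%x n. act x)"
proof (unfold_locales, goal_cases)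
 case (7 v n)
 thus ?case using act_add_left[of 0 0 v] by simp
qed (auto simp: P0_def act_add_left act_add_right act_scale_left act_scale_right act_bracket cen_def V.subspace_UNIV)

interpretation X: lmod scale bracket h b Basis form scaleV P0 UNIV "%x n. act x" by (rule lmod_V)

lemma P00: "(0, 0) \<in> P0" using zero_WT by (simp add: P0_def)

lemma generated:
 assumes "w ~= 0"
 shows "x \<in> V.span {y. \<exists>nu. X.U w nu0 0 nu 0 y}"
proof -
 let ?S = "V.span {y. \<exists>nu. X.U w nu0 0 nu 0 y}"
 have "act x y \<in> ?S" if y: "y \<in> ?S" for x y
 proof (rule span_WT_induct[where x = x])
  fix ga x assume "ga \<in> WT" "x \<in> root_space ga"
  thus "act x y \<in> ?S" using X.U_span_step[of ga 0 x, OF _ _ y] by (simp add: P0_def)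
 qed (simp add: act_add_left V.span_add)
 hence "?S = {0} \<or> ?S = UNIV" using irr by (simp add: irreducible_module_def V.subspace_span)
 moreover have "w \<in> ?S" using ug.ug_base by (intro V.span_base) blast
 ultimately show ?thesis using assms by auto
qed

lemma killed_by_pos:
 assumes "!!bt x. bt \<in> simple_roots ==> x \<in> root_space bt ==> act x w = 0" "ga \<in> pos"
 shows "x \<in> root_space ga ==> act x w = 0" using assms(2)
proof (induction arbitrary: x rule: pos_induct)
 case (add al bt)
 note r = pos_roots[OF simple_pos[OF add(1)]] pos_roots[OF add(2)] pos_roots[OF add(3)]
 obtain y z where y: "y \<in> root_space al" and z: "z \<in> root_space bt" and "x = bracket y z" by (rule root_sum_bracket[OF r add(5)])
 moreover have "act y 0 = 0" using act_scale_right[of y 0 0] by simp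
 moreover have "act z 0 = 0" using act_scale_right[of z 0 0] by simp
 ultimately show ?case using add(4)[OF z] assms(1)[OF add(1) y] by (simp add: act_bracket)
qed (use assms in blast)

lemma singular_U_neg:
 assumes w: "!!ga x. ga \<in> pos ==> x \<in> root_space ga ==> act x w = 0" and U: "X.U w nu0 0 nu N y"
 shows "ug scaleV (%x n. act x) Pneg w nu0 0 nu N y"
proof (rule ug_mono[OF X.U_restrict[OF Int_lower2 UNIV_I _ U] Int_lower1])
 fix ga k x assume a: "(ga, k) \<in> P0" "(ga, k) \<notin> Pneg \<inter> P0" "x \<in> root_space ga"
 hence "ga \<in> pos" using WT_cases pos_or_neg by (auto simp: P0_def Pneg_def)
 thus "ug scaleV (%x n. act x) (Pneg \<inter> P0) w nu0 0 (nu0 + ga) (0 + k) (act x w)" using w a by (simp add: ug.ug_zero)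
qed

lemma v_weight: "H \<in> h ==> act H v = scaleV (lam H) v" using v(2) by (simp add: weight_space_def)

lemma v_pos: "ga \<in> pos ==> x \<in> root_space ga ==> act x v = 0" by (rule v(3)) (auto simp: nplus_def intro: span_base)

lemma v_generates: "\<mu> \<in> dual ==> w \<in> weight_space scaleV act \<mu> ==> X.U v lam 0 \<mu> 0 w"
 by (rule X.U_component[OF P00 UNIV_I v_weight dominant_intw(1)[OF lam] generated[OF v(1)]])
  (auto simp: weight_space_def)

lemma weights_ht:
 assumes "\<mu> \<in> weights scaleV act"
 shows "\<mu> \<in> intw & (\<mu> = lam \<or> ht \<mu> < ht lam)"
proof -
 have "weight_space scaleV act \<mu> ~= {0}" "\<mu> \<in> dual" "0 \<in> weight_space scaleV act \<mu>"
  using assms act_scale_right[of _ 0 0] by (auto simp: weights_def weight_space_def)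
 then obtain w where w: "w \<in> weight_space scaleV act \<mu>" "w ~= 0" by blast
 show ?thesis by (rule ug_Pneg[OF singular_U_neg[OF v_pos v_generates[OF _ w(1)]] w(2) dominant_intw(1)[OF lam]])
   (use \<open>\<mu> \<in> dual\<close> X.act_0 in auto)
qed

text \<open>Both \<open>v\<close> and \<open>w\<close> generate the module by lowering letters, so
  each of the two weights equals the other or has smaller height.\<close>

lemma singular_weight:
 assumes w: "w \<in> weight_space scaleV act \<mu>" "w ~= 0" "\<mu> \<in> dual"
  and s: "!!bt x. bt \<in> simple_roots ==> x \<in> root_space bt ==> act x w = 0"
 shows "\<mu> = lam"
proof -
 have "\<mu> \<in> weights scaleV act" using w by (auto simp: weights_def)
 hence \<mu>: "\<mu> \<in> intw" "\<mu> = lam \<or> ht \<mu> < ht lam" using weights_ht by auto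
 have "X.U w \<mu> 0 lam 0 v"
  by (rule X.U_component[OF P00 UNIV_I _ \<mu>(1) generated[OF w(2)] intw_dual[OF dominant_intw(1)[OF lam]] v_weight])
   (use w(1) in "simp_all add: weight_space_def")
 hence "ug scaleV (%x n. act x) Pneg w \<mu> 0 lam 0 v" using singular_U_neg[of w \<mu> lam 0 v] killed_by_pos[of w] s by blast
 hence "lam = \<mu> \<or> ht lam < ht \<mu>" using ug_Pneg[of scaleV "%x n. act x" w \<mu> 0 lam 0 v] v(1) \<mu>(1) X.act_0 by auto
 thus ?thesis using \<mu>(2) by auto
qed

lemma weight_raise:
 assumes \<mu>: "\<mu> \<in> weights scaleV act" "\<mu> ~= lam"
 obtains al where "al \<in> simple_roots" "\<mu> + al \<in> weights scaleV act"
proof -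
 have 1: "weight_space scaleV act \<mu> ~= {0}" "\<mu> \<in> dual" "0 \<in> weight_space scaleV act \<mu>"
  using assms act_scale_right[of _ 0 0] by (auto simp: weights_def weight_space_def)
 then obtain w where w: "w \<in> weight_space scaleV act \<mu>" "w ~= 0" by blast
 obtain bt x where bt: "bt \<in> simple_roots" "x \<in> root_space bt" "act x w ~= 0" using singular_weight[OF w 1(2)] \<mu>(2) by blast
 note r = pos_roots[OF simple_pos[OF bt(1)]]
 have "X.U v lam 0 (\<mu> + bt) (0 + 0) (act x w)"
  by (rule ug.ug_act[OF v_generates[OF 1(2) w(1)] _ bt(2)]) (simp add: P0_def rootD(1)[OF r])
 hence "act x w \<in> weight_space scaleV act (\<mu> + bt)" using X.U_weight[OF P00 UNIV_I v_weight] by (auto simp: weight_space_def)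
 hence "\<mu> + bt \<in> weights scaleV act" using bt(3) dual_add[OF 1(2) rootD(3)[OF r]] by (auto simp: weights_def)
 thus ?thesis using that bt(1) by blast
qed

text \<open>The vector is killed by \<open>e\<close>, as the coefficient from \<open>sl_2\<close>
  theory vanishes at this exponent, and by the other simple root vectors, which commute with
  \<open>f\<close>. Being singular of a weight other than \<open>lam\<close>, it is zero.\<close>

lemma f_pow_v:
 assumes al: "al \<in> simple_roots" and f: "f \<in> root_space (- al)" "f ~= 0"
 shows "(act f ^^ Suc (nat (ip lam al))) v = 0"
proof (rule ccontr)
 define k where "k = nat (ip lam al)"
 assume nz: "(act f ^^ Suc (nat (ip lam al))) v ~= 0"
 note r = pos_roots[OF simple_pos[OF al]]
 note m = root_minus[OF r]
 note i = dominant_intw(1)[OF lam]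
 have ik: "ip lam al = int k" using dominant_intw(2)[OF lam simple_pos[OF al]] by (simp add: k_def)
 obtain e where e: "e \<in> root_space al" "bracket f e = coroot (- al)" using root_partner[OF m f] by auto
 have ef: "bracket e f = coroot al" using e(2) bracket_antisym[of e f] coroot_minus[OF r] by simp
 have P: "(al, 0) \<in> P0" "(- al, - 0) \<in> P0" "(- al, 0) \<in> P0" by (simp_all add: P0_def rootD(1)[OF r] rootD(1)[OF m])
 have S: "sl2_weights scaleV (act e) (act f) (%c. {w \<in> UNIV. act (coroot al) w = scaleV (c - of_int 0) w})"
  by (rule X.affine_sl2[OF r P(1,2) P00 e(1) f(1) ef])
 interpret S: sl2_weights scaleV "act f" "act e" "%c. {w \<in> UNIV. act (coroot al) w = scaleV (- c - of_int 0) w}"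
  by (rule sl2_weights_swap[OF S])
 have "v \<in> {w \<in> UNIV. act (coroot al) w = scaleV (- (- of_nat k) - of_int 0) w}"
  using v_weight[OF coroot_h[OF r]] ip[OF i r] by (simp add: ik)
 from S.lowest_e_pow[OF this, of "Suc k"] have z: "act e ((act f ^^ Suc k) v) = 0" using v_pos[OF simple_pos[OF al] e(1)] by simp
 have U: "X.U v lam 0 (plus_mult lam (int (Suc k)) (- al)) (0 + int (Suc k) * 0) ((act f ^^ Suc k) v)"
  by (rule X.U_pow[OF ug.ug_base P(3) f(1)])
 have "plus_mult lam (int (Suc k)) (- al) = lam"
 proof (rule singular_weight)
  show "(act f ^^ Suc k) v \<in> weight_space scaleV act (plus_mult lam (int (Suc k)) (- al))"
   using X.U_weight[OF P00 UNIV_I v_weight _ U] by (auto simp: weight_space_def)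
  show "(act f ^^ Suc k) v ~= 0" using nz by (simp add: k_def)
  show "plus_mult lam (int (Suc k)) (- al) \<in> dual" by (rule intw_dual[OF plus_mult_intw[OF i m]])
  fix bt x assume bt: "bt \<in> simple_roots" "x \<in> root_space bt"
  show "act x ((act f ^^ Suc k) v) = 0"
  proof (cases "bt = al")
   case True
   then obtain c where "x = scale c e"
    using root_space_line[OF r e(1) _ bt(2)[unfolded True]] ef coroot_2[OF r] dual_props(4)[OF rootD(3)[OF r]]
     bracket_zero_left by (metis zero_neq_numeral)
   thus ?thesis using z by (simp add: act_scale_left del: funpow.simps)
  next case False
   note rb = pos_roots[OF simple_pos[OF bt(1)]]
   have "bt + - al \<notin> roots"
   proof
    assume "bt + - al \<in> roots"
    hence p: "bt - al \<in> pos" using pos_minus_simple[OF al simple_pos[OF bt(1)]] by simp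
    have "bt = (bt - al) + al" by simp
    thus False using simple_indecomposable[OF bt(1) p simple_pos[OF al]] by blast
   qed
   hence b: "bracket x f = 0" using bracket_not_root[OF rb m _ _ bt(2) f(1)] False by simp
   have c: "act x (act f w) = act f (act x w)" for w using act_bracket[of x f w] X.act_zero_left[of w] by (simp add: b)
   have "act x ((act f ^^ j) v) = 0" for j by (induction j) (simp_all add: v_pos[OF simple_pos[OF bt(1)] bt(2)] c X.act_0)
   thus ?thesis .
  qed
 qed
 hence "plus_mult lam (int (Suc k)) (- al) (coroot al) = lam (coroot al)" by simp
 thus False using coroot_2[OF r] by (simp add: plus_mult_def of_nat_neq_0 flip: of_nat_Suc)
qed

lemma weight_reflect:
 assumes \<mu>: "\<mu> \<in> weights scaleV act" and al: "al \<in> simple_roots" and k: "ip \<mu> al = - int k"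
 shows "plus_mult \<mu> (int k) al \<in> weights scaleV act"
proof -
 have 1: "weight_space scaleV act \<mu> ~= {0}" "\<mu> \<in> dual" "0 \<in> weight_space scaleV act \<mu>"
  using assms act_scale_right[of _ 0 0] by (auto simp: weights_def weight_space_def)
 then obtain w where w: "w \<in> weight_space scaleV act \<mu>" "w ~= 0" by blast
 have \<mu>i: "\<mu> \<in> intw" using weights_ht[OF \<mu>] by blast
 note r = pos_roots[OF simple_pos[OF al]]
 note m = root_minus[OF r]
 obtain e f where ef: "e \<in> root_space al" "f \<in> root_space (- al)" "bracket e f = coroot al" "f ~= 0" by (rule coroot_exists[OF r])
 have P: "(al, 0) \<in> P0" "(- al, - 0) \<in> P0" "(- al, 0) \<in> P0" by (simp_all add: P0_def rootD(1)[OF r] rootD(1)[OF m])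
 note U = v_generates[OF 1(2) w(1)]
 obtain s where s: "(act f ^^ s) w = 0" using X.U_nilpotent[OF m P(3) ef(2) UNIV_I f_pow_v[OF al ef(2,4)] U] by blast
 have H: "act (coroot al) w = scaleV (of_int (ip \<mu> al)) w" using w(1) coroot_h[OF r] ip[OF \<mu>i r] by (simp add: weight_space_def)
 have nz: "(act e ^^ k) w ~= 0" using X.affine_injective[OF r P(1,2) P00 ef(1,2,3) UNIV_I H _ s, of k] k w(2) by auto
 have U': "X.U v lam 0 (plus_mult \<mu> (int k) al) (0 + int k * 0) ((act e ^^ k) w)" by (rule X.U_pow[OF U P(1) ef(1)])
 have "(act e ^^ k) w \<in> weight_space scaleV act (plus_mult \<mu> (int k) al)"
  using X.U_weight[OF P00 UNIV_I v_weight _ U'] by (auto simp: weight_space_def)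
 thus ?thesis using nz intw_dual[OF plus_mult_intw[OF \<mu>i r]] by (auto simp: weights_def)
qed

end

section \<open>The local Weyl module and the lower bound\<close>

locale weyl = ade scale bracket h b Basis form
 for scale :: "complex => 'g::ab_group_add => 'g" and bracket and h b Basis :: "'g set" and form +
 fixes scaleW :: "complex => 'w::ab_group_add => 'w" and actW :: "'g poly => 'w => 'w" and u :: 'w
  and lam :: "'g => complex"
 assumes lam: "dominant_integral lam" and W: "local_weyl_module scaleW actW u lam"
begin

lemma lie_W: "lie_module (current_scale scale) (current_bracket bracket) scaleW actW" using W by (simp add: local_weyl_module_def)

interpretation Z: lie_module "current_scale scale" "current_bracket bracket" scaleW actW by (rule lie_W)

interpretation E: evaluation scaleW by unfold_locales

interpretation F: evaluation "scaleF :: complex => ('g word => complex) => _" by (rule evaluation.intro[OF vector_space_scaleF])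

interpretation FV: vector_space free_scale by (rule free_vector_space)

abbreviation actn :: "'g => int => 'w => 'w" where
 "actn x n == actW (monom x (nat n))"

definition PW :: "('g wt \<times> int) set" where
 "PW = WT \<times> {0..}"

lemma lam_intw: "lam \<in> intw" and lam_dual: "lam \<in> dual" using dominant_intw[OF lam] intw_dual by auto

lemma lmod_W: "lmod scale bracket h b Basis form scaleW PW UNIV actn"
proof (unfold_locales, goal_cases)
 case (7 w n)
 thus ?case using Z.act_add_left[of 0 0 w] by simp
next case (8 bt n x y w)
 thus ?case by (simp add: Z.act_add_left flip: add_monom)
next case (9 bt n x w c)
 thus ?case by (simp add: Z.act_scale_left flip: current_scale_monom)
next case (10 bt m ga n x y w)
 hence mn: "m \<ge> 0" "n \<ge> 0" by (auto simp: PW_def)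
 hence c: "cen (x, m) (y, n) = 0" by (auto simp: cen_def)
 have "monom (bracket x y) (nat (m + n)) = current_bracket bracket (monom x (nat m)) (monom y (nat n))"
  by (simp add: current_bracket_monom nat_add_distrib mn)
 thus ?case by (simp add: c Z.act_bracket)
qed (auto simp: PW_def Z.act_add_right Z.act_scale_right)

interpretation X: lmod scale bracket h b Basis form scaleW PW UNIV actn by (rule lmod_W)

lemma kernel: "evaluate scaleW actW u p = 0 \<longleftrightarrow> p \<in> module.span free_scale (enveloping_relations \<union> local_weyl_relations lam)"
 using W by (auto simp: local_weyl_module_def)

lemma relation:
 assumes "r \<in> local_weyl_relations lam"
 shows "evaluate scaleW actW u r = 0" unfolding kernel using assms by (intro FV.span_base) simp

lemma u_nplus: "x \<in> nplus ==> actW (monom x n) u = 0"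
proof -
 assume x: "x \<in> nplus"
 have 0: "0 \<in> nplus" by (simp add: nplus_def span_zero)
 have "word ([] @ [monom x n]) \<in> local_weyl_relations lam" unfolding local_weyl_relations_def
  by (intro UnI1 CollectI exI[of _ "[]"] exI[of _ "monom x n"]) (simp add: x 0)
 from relation[OF this] show ?thesis by (simp add: E.evaluate_word apply_word_Cons)
qed

lemma u_ht: "H \<in> h ==> n > 0 ==> actW (monom H n) u = 0"
proof -
 assume H: "H \<in> h" "n > 0"
 have 0: "0 \<in> h" using h_subspace by (simp add: subspace_def)
 have "word ([] @ [monom H n]) \<in> local_weyl_relations lam" unfolding local_weyl_relations_def
  by (rule UnI1, rule UnI1, rule UnI2, intro CollectI exI[of _ "[]"] exI[of _ "monom H n"]) (use H 0 in auto)
 from relation[OF this] show ?thesis by (simp add: E.evaluate_word apply_word_Cons)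
qed

lemma u_weight: "H \<in> h ==> actW (monom H 0) u = scaleW (lam H) u"
proof -
 assume H: "H \<in> h"
 have "word ([] @ [monom H 0]) - free_scale (lam H) (word []) \<in> local_weyl_relations lam"
  unfolding local_weyl_relations_def using H by (auto simp del: append.simps)
 from relation[OF this] show ?thesis by (simp add: E.evaluate_diff E.evaluate_scale E.evaluate_word apply_word_Cons)
qed

lemma u_simple:
 assumes al: "al \<in> simple_roots" and f: "f \<in> root_space (- al)"
 shows "(actW (monom f 0) ^^ Suc (nat (ip lam al))) u = 0"
proof -
 define n where "n = nat (ip lam al)"
 have "lam (coroot al) = of_nat n"
  using ip[OF lam_intw pos_roots[OF simple_pos[OF al]]] dominant_intw(2)[OF lam simple_pos[OF al]] by (simp add: n_def)
 moreover have "f \<in> root_space (%x. - al x)" using f by (simp add: fun_Compl_def)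
 ultimately have "word ([] @ map (%Y. monom Y 0) (replicate (Suc n) f)) \<in> local_weyl_relations lam"
  unfolding local_weyl_relations_def using al
  by (intro UnI2 CollectI exI[of _ "[]"] exI[of _ "replicate (Suc n) f"] exI[of _ al] exI[of _ n]) auto
 from relation[OF this] have "apply_word actW (replicate (Suc n) (monom f 0)) u = 0"
  by (simp only: E.evaluate_word append_Nil map_replicate)
 moreover have "apply_word actW (replicate k (monom f 0)) u = (actW (monom f 0) ^^ k) u" for k
  by (induction k) (simp_all add: apply_word_Cons)
 ultimately have "(actW (monom f 0) ^^ Suc n) u = 0" by metis
 thus ?thesis unfolding n_def .
qed

text \<open>The homomorphism from the local Weyl module to the twisted vacuum module, as a relation.\<close>

definition img :: "('w \<times> ('g word => complex)) set" where
 "img = {(evaluate scaleW actW u p, evaluate scaleF (twp lam) vac p) | p. True}"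

lemma img_vac: "(u, vac) \<in> img"
proof -
 have "(evaluate scaleW actW u (word []), evaluate scaleF (twp lam) vac (word [])) \<in> img" unfolding img_def by blast
 thus ?thesis by (simp add: E.evaluate_word F.evaluate_word apply_word_Cons)
qed

lemma img_act: "(w, Ph) \<in> img ==> (actW x w, twp lam x Ph) \<in> img"
proof -
 assume "(w, Ph) \<in> img"
 then obtain p where p: "w = evaluate scaleW actW u p" "Ph = evaluate scaleF (twp lam) vac p" by (auto simp: img_def)
 have "(evaluate scaleW actW u (prepend x p), evaluate scaleF (twp lam) vac (prepend x p)) \<in> img" unfolding img_def by blast
 thus ?thesis by (simp add: E.evaluate_prepend Z.act_add_right Z.act_scale_right F.evaluate_prepend twp_add twp_scale p)
qed

lemma img_zero: "(0, Ph) \<in> img ==> Ph = 0"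
proof -
 assume "(0, Ph) \<in> img"
 then obtain p where p: "0 = evaluate scaleW actW u p" "Ph = evaluate scaleF (twp lam) vac p" by (auto simp: img_def)
 have "evaluate scaleF (twp lam) vac p = 0" by (rule F.evaluate_kernel[of "enveloping_relations \<union> local_weyl_relations lam"])
   (use p(1) kernel[of p] twp_enveloping[OF lam_intw] twp_local_weyl[OF lam] in auto)
 thus ?thesis using p(2) by simp
qed

interpretation L: lmod scale bracket h b Basis form scaleF "WT \<times> UNIV" Lc rt by (rule lmod_rt)

text \<open>The partner \<open>Ph\<close> in \<open>img\<close> certifies that \<open>w\<close> is
  nonzero: nonvanishing is decided in the vacuum module, where both root vectors of an affine
  \<open>sl_2\<close> are available. The weight there is \<open>nu - lam\<close> because the twist
  contributes \<open>lam\<close>.\<close>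

definition good :: "'g wt => int => bool" where
 "good nu N \<longleftrightarrow> nu \<in> intw & 2 * of_int N = form lam lam - form nu nu &
  (\<exists>w Ph N'. (w, Ph) \<in> img & Ph ~= 0 & X.U u lam 0 nu N w & L.U vac 0 0 (nu - lam) N' Ph)"

lemma good_base: "good lam 0"
proof -
 have "L.U vac 0 0 (lam - lam) 0 vac" by (simp add: ug.ug_base)
 thus ?thesis unfolding good_def using img_vac vac_nonzero lam_intw ug.ug_base by force
qed

text \<open>Under the twist the letter for \<open>- al\<close> of degree \<open>n\<close> gets
  degree \<open>k = n - ip lam al\<close>, and \<open>- p\<close> is its affine pairing with the
  weight of \<open>Ph\<close>, so \<open>affine_injective\<close> prevents vanishing. As
  \<open>ip nu al = p + n\<close>, passing to \<open>nu - p al\<close> lowers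
  \<open>form nu nu\<close> by \<open>2 p n\<close>, in accordance with the degree
  \<open>p n\<close> gained.\<close>

lemma good_step:
 assumes good: "good nu N" and al: "al \<in> roots" and n: "n \<ge> 0" "ip nu al - n = int p"
 shows "good (plus_mult nu (- int p) al) (N + int p * n)"
proof -
 obtain w Ph N' where w: "(w, Ph) \<in> img" "Ph ~= 0" "X.U u lam 0 nu N w" "L.U vac 0 0 (nu - lam) N' Ph"
  and nu: "nu \<in> intw" and fnu: "2 * of_int N = form lam lam - form nu nu" using good by (auto simp: good_def)
 note m = root_minus[OF al]
 obtain e f where ef: "e \<in> root_space (- al)" "f \<in> root_space (- (- al))" "bracket e f = coroot (- al)" "f ~= 0"
  by (rule coroot_exists[OF m])
 have f: "f \<in> root_space al" using ef(2) by simp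
 define k where "k = n - ip lam al"
 have P: "(ga, j) \<in> WT \<times> UNIV" if "ga \<in> roots" for ga and j :: int using rootD(1)[OF that] by simp
 have P0: "(0, 0) \<in> WT \<times> UNIV" and PE: "(- al, n) \<in> PW" using zero_WT rootD(1)[OF m] n by (simp_all add: PW_def)
 note PhL = L.U_M[OF w(4) vac_Lc]
 have H: "rt (coroot (- al)) 0 Ph = scaleF (of_int (ip (nu - lam) (- al))) Ph" unfolding ip[OF intw_diff[OF nu lam_intw] m, symmetric]
  by (rule L.U_weight[OF P0 vac_Lc _ coroot_h[OF m] w(4)]) (simp add: rt_vac scaleF_def zero_fun_def)
 have kp: "ip (nu - lam) (- al) + k = - int p" using n(2) by (simp add: ip_coroot_minus nu al intw_diff lam_intw ip_diff k_def)
 have "(rt f (- k) ^^ Suc (nat (\<bar>k\<bar>))) vac = 0" by (rule vac_letter_nilpotent[OF al f]) linarith+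
 then obtain s where s: "(rt f (- k) ^^ s) Ph = 0" using L.U_nilpotent[OF al P[OF al] f vac_Lc _ w(4)] by blast
 have nz: "(rt e k ^^ p) Ph ~= 0" using L.affine_injective[OF m P[OF m] P[OF root_minus[OF m]] P0 ef(1,2,3) PhL H kp s] w(2) by blast
 have eL: "(rt e k ^^ j) Ph \<in> Lc" for j by (induction j) (simp_all add: PhL rt_Lc)
 have step: "twp lam (monom e (nat n)) Ps = rt e k Ps" if "Ps \<in> Lc" for Ps using n(1) rootD(2)[OF m] that
  by (simp add: twp_monom[OF lam_dual] tw_root[OF ef(1) rootD(1)[OF m] _ lam_dual] sh_def ip_coroot_minus lam_intw al k_def)
 have im: "((actn e n ^^ j) w, (rt e k ^^ j) Ph) \<in> img" for j
 proof (induction j)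
  case (Suc j)
  from img_act[OF this, of "monom e (nat n)"] show ?case by (simp add: step[OF eL])
 qed (simp add: w(1))
 have pm: "plus_mult nu (int p) (- al) = plus_mult nu (- int p) al"
   "plus_mult (nu - lam) (int p) (- al) = plus_mult nu (- int p) al - lam" by (simp_all add: plus_mult_def fun_eq_iff)
 have 1: "X.U u lam 0 (plus_mult nu (- int p) al) (N + int p * n) ((actn e n ^^ p) w)" using X.U_pow[OF w(3) PE ef(1), of p] unfolding pm .
 have 2: "L.U vac 0 0 (plus_mult nu (- int p) al - lam) (N' + int p * k) ((rt e k ^^ p) Ph)"
  using L.U_pow[OF w(4) P[OF m] ef(1), of p k] unfolding pm .
 have "form (plus_mult nu (- int p) al) (plus_mult nu (- int p) al) = form nu nu + of_int (2 * (- int p) * ip nu al + 2 * (- int p)\<^sup>2)"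
  unfolding plus_mult_def form_add_root[OF intw_dual[OF nu] al] ip[OF nu al] by simp
 moreover have "ip nu al = int p + n" using n(2) by simp
 ultimately have "2 * of_int (N + int p * n) = form lam lam - form (plus_mult nu (- int p) al) (plus_mult nu (- int p) al)"
  using fnu by (simp add: algebra_simps power2_eq_square)
 thus ?thesis unfolding good_def using 1 2 im nz plus_mult_intw[OF nu al] by blast
qed

lemma good_nonzero:
 assumes "good nu N"
 obtains w where "X.U u lam 0 nu N w" "w ~= 0"
proof -
 obtain w Ph where "(w, Ph) \<in> img" "Ph ~= 0" "X.U u lam 0 nu N w" using assms by (auto simp: good_def)
 moreover have "w ~= 0" using calculation img_zero by blast
 ultimately show ?thesis using that by blast
qed

text \<open>Descends from \<open>lam\<close> by height. From the weight \<open>\<mu> + al\<close>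
  one letter of degree \<open>ip \<mu> al + 1\<close> leads to \<open>\<mu>\<close>. If that degree
  would be negative, the start is the reflected weight, with \<open>- ip \<mu> al\<close> letters of
  degree 0.\<close>

lemma good_weights:
 assumes V: "irr_mod scale bracket h b Basis form scaleV act lam v" and \<mu>: "\<mu> \<in> weights scaleV act"
 shows "\<exists>N. good \<mu> N" using \<mu>
proof (induction "nat (ht lam - ht \<mu>)" arbitrary: \<mu> rule: less_induct)
 case less
 interpret V: irr_mod scale bracket h b Basis form scaleV act lam v by (rule V)
 note w = V.weights_ht[OF less.prems]
 have le: "ht \<mu>' \<le> ht lam" if "\<mu>' \<in> weights scaleV act" for \<mu>' using V.weights_ht[OF that] by auto
 show ?case
 proof (cases "\<mu> = lam")
  case True
  thus ?thesis using good_base by blast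
 next case False
  obtain al where al: "al \<in> simple_roots" "\<mu> + al \<in> weights scaleV act" by (rule V.weight_raise[OF less.prems False])
  note r = pos_roots[OF simple_pos[OF al(1)]]
  have \<mu>: "\<mu> \<in> intw" and lt: "ht \<mu> < ht lam" using w False by auto
  show ?thesis
  proof (cases "ip \<mu> al \<ge> - 1")
   case True
   have "ht (\<mu> + al) = ht \<mu> + 2" using ht_add[OF \<mu> roots_intw[OF r]] ht_simple[OF al(1)] by simp
   then obtain N where N: "good (\<mu> + al) N" using less.hyps[OF _ al(2)] lt by fastforce
   have "ip (\<mu> + al) al - (ip \<mu> al + 1) = int 1" using ip_add[OF \<mu> roots_intw[OF r] r] ip_self[OF r] by simp
   from good_step[OF N r _ this] True have "good (plus_mult (\<mu> + al) (- int 1) al) (N + int 1 * (ip \<mu> al + 1))" by simp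
   thus ?thesis by (auto simp: plus_mult_simps)
  next case False
   define k where "k = nat (- ip \<mu> al)"
   have k: "ip \<mu> al = - int k" "k > 0" using False by (simp_all add: k_def)
   have w': "plus_mult \<mu> (int k) al \<in> weights scaleV act" by (rule V.weight_reflect[OF less.prems al(1) k(1)])
   have "ht (plus_mult \<mu> (int j) al) = ht \<mu> + 2 * int j" for j
   proof (induction j)
    case (Suc j)
    have "plus_mult \<mu> (int (Suc j)) al = plus_mult \<mu> (int j) al + al" by (simp add: plus_mult_simps(4) add.commute[of 1])
    hence "ht (plus_mult \<mu> (int (Suc j)) al) = ht (plus_mult \<mu> (int j) al) + ht al"
     by (simp only: ht_add[OF plus_mult_intw[OF \<mu> r] roots_intw[OF r]])
    thus ?case using Suc ht_simple[OF al(1)] by simp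
   qed (simp add: plus_mult_simps)
   then obtain N where N: "good (plus_mult \<mu> (int k) al) N" using less.hyps[OF _ w'] lt k(2) by fastforce
   have "ip (plus_mult \<mu> (int k) al) al - 0 = int k" by (simp add: ip_plus_mult \<mu> r ip_self k(1))
   from good_step[OF N r _ this] have "good (plus_mult (plus_mult \<mu> (int k) al) (- int k) al) (N + int k * 0)" by simp
   thus ?thesis by (auto simp: plus_mult_simps)
  qed
 qed
qed

end

section \<open>Affine simple reflections\<close>

context ade
begin

text \<open>\<open>Pb\<close> are the weights of the Iwahori subalgebra, \<open>PE\<close> those of its rank one part for \<open>(al, n0)\<close>.\<close>

definition Pb :: "('g wt \<times> int) set" where
 "Pb = {(bt, n). bt \<in> WT & (n \<ge> 1 \<or> n = 0 & (bt = 0 \<or> bt \<in> pos))}"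

definition PE :: "'g wt => int => ('g wt \<times> int) set" where
 "PE al n0 = {(bt, n). bt = al & n \<ge> n0 \<or> bt = - al & n \<ge> 1 - n0 \<or> bt = 0 & n \<ge> 0}"

text \<open>\<open>(al, n0)\<close> is a root of \<open>Pb\<close> whose negative may be added to \<open>Pb\<close>.\<close>

definition asimple :: "'g wt => int => bool" where
 "asimple al n0 \<longleftrightarrow> al \<in> roots & (\<forall>n. (al, n) \<in> Pb \<longleftrightarrow> n \<ge> n0) & (\<forall>n. (- al, n) \<in> Pb \<longleftrightarrow> n \<ge> 1 - n0) &
  (\<forall>bt n. (bt, n) \<in> Pb --> bt - al \<in> WT --> (bt - al, n - n0) \<in> insert (- al, - n0) Pb)"

lemma WT_double: "al \<in> roots ==> al + al \<notin> WT"
proof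
 assume al: "al \<in> roots" and "al + al \<in> WT"
 hence "al + al = 0" using WT_cases root_double by blast
 hence "al (coroot al) + al (coroot al) = 0" by (metis plus_fun_apply zero_fun_apply)
 thus False using coroot_2[OF al] by simp
qed

lemma Pb_closed: "(bt, m) \<in> Pb ==> (ga, n) \<in> Pb ==> bt + ga \<in> WT ==> (bt + ga, m + n) \<in> Pb"
 using pos_add[of bt ga] WT_cases[of "bt + ga"] by (auto simp: Pb_def)

lemma root_neq_minus: "al \<in> roots ==> - al ~= al" using WT_double zero_WT by (metis add.left_inverse)

lemma PE_closed:
 assumes al: "al \<in> roots" and b: "(bt, m) \<in> PE al n0" and c: "(ga, n) \<in> PE al n0" and s: "bt + ga \<in> WT"
 shows "(bt + ga, m + n) \<in> PE al n0"
proof -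
 have "\<not> (bt = al & ga = al)" "\<not> (bt = - al & ga = - al)" using s WT_double[OF al] WT_double[OF root_minus[OF al]] by metis+
 thus ?thesis using b c by (auto simp: PE_def)
qed

lemma asimple_PE: "asimple al n0 ==> PE al n0 <= Pb" using zero_WT by (auto simp: asimple_def PE_def) (auto simp: Pb_def)

lemma PE_swap: "PE (- al) (1 - n0) = PE al n0" by (auto simp: PE_def)

lemma asimple_simple:
 assumes al: "al \<in> simple_roots"
 shows "asimple al 0"
proof -
 note p = simple_pos[OF al]
 note r = rootD[OF pos_roots[OF p]] rootD[OF root_minus[OF pos_roots[OF p]]]
 have "(bt - al, n - 0) \<in> insert (- al, - 0) Pb" if "(bt, n) \<in> Pb" "bt - al \<in> WT" for bt n
  using that WT_cases[OF that(2)] pos_minus_simple[OF al, of bt] by (auto simp: Pb_def)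
 thus ?thesis using p r pos_not_neg[OF p] by (auto simp: asimple_def pos_roots) (auto simp: Pb_def)
qed

text \<open>Here \<open>tht\<close> plays the part of the highest root, and
  \<open>(- tht, 1)\<close> is the affine simple root outside the finite root system.\<close>

lemma asimple_minus:
 assumes tht: "tht \<in> pos" and mx: "!!bt. bt \<in> pos ==> tht + bt \<notin> roots"
 shows "asimple (- tht) 1"
proof -
 note r = rootD[OF pos_roots[OF tht]] rootD[OF root_minus[OF pos_roots[OF tht]]]
 have "(bt - (- tht), n - 1) \<in> insert (- (- tht), - 1) Pb" if b: "(bt, n) \<in> Pb" "bt - (- tht) \<in> WT" for bt n
 proof -
  have s: "tht + bt \<in> WT" using b(2) by (simp add: add.commute)
  have "bt ~= 0 ==> bt \<notin> pos"
  proof -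
   assume "bt ~= 0"
   have "tht + bt ~= 0" if "bt \<in> pos" using that pos_not_neg[OF tht] by (auto simp: add_eq_0_iff)
   thus "bt \<notin> pos" using mx[of bt] WT_cases[OF s] by blast
  qed
  moreover have "tht + bt ~= 0 ==> tht + bt \<in> pos"
  proof (rule ccontr)
   assume a: "tht + bt ~= 0" "tht + bt \<notin> pos"
   hence rt: "tht + bt \<in> roots" using WT_cases[OF s] by blast
   hence "- (tht + bt) \<in> pos" using pos_or_neg a by blast
   moreover have "tht + - (tht + bt) = - bt" by simp
   moreover have "bt ~= 0" using a tht by auto
   hence "- bt \<in> roots" using b(1) WT_cases root_minus by (auto simp: Pb_def)
   ultimately show False using mx by metis
  qed
  ultimately show ?thesis using b by (auto simp: Pb_def add.commute)
 qed
 thus ?thesis using tht r pos_not_neg[OF tht] root_minus[OF pos_roots[OF tht]] by (auto simp: asimple_def) (auto simp: Pb_def)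
qed

section \<open>A well-founded measure decreased by affine simple reflections\<close>

definition sq :: "'g wt => int" where
 "sq xi = (\<Sum>bt\<in>roots. (ip xi bt)\<^sup>2)"

text \<open>Reflecting where the pairing is negative, a finite simple root keeps \<open>sq\<close>
  and raises \<open>ht\<close>, while the remaining affine simple root lowers \<open>sq\<close>. The
  second entry is a genuine difference by \<open>ht_le_sq\<close>.\<close>

definition msr :: "'g wt => nat \<times> nat" where
 "msr xi = (nat (sq xi), nat (sq xi - ht xi))"

lemma ip_reflect:
 assumes xi: "xi \<in> intw" and al: "al \<in> roots" and bt: "bt \<in> roots"
 shows "ip xi (plus_mult bt (- ip bt al) al) = ip xi bt - ip bt al * ip xi al"
proof -
 note s = ip_sym[OF al bt]
 consider "bt = al" "ip bt al = 2" | "bt = - al" "ip bt al = - 2" | "al + bt \<in> roots" "ip bt al = - 1"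
  | "al - bt \<in> roots" "ip bt al = 1" | "ip bt al = 0" using ip_bound_cases[OF al bt] s by metis
 thus ?thesis
 proof cases
  case 1
  have "plus_mult al (- 2) al = - al" by (simp add: plus_mult_def fun_eq_iff)
  thus ?thesis using 1 xi al by (simp add: ip_coroot_minus)
 next case 2
  have "plus_mult (- al) 2 al = al" by (simp add: plus_mult_def fun_eq_iff)
  thus ?thesis using 2 xi al by (simp add: ip_coroot_minus)
 next case 3
  hence "ip xi (bt + al) = ip xi bt + ip xi al" using ip_coroot_add[OF xi al bt 3(1)] by (simp add: add.commute)
  thus ?thesis unfolding 3(2) by (simp add: plus_mult_simps)
 next case 4
  hence r: "bt - al \<in> roots" using root_minus[OF 4(1)] by simp
  have "ip xi bt = ip xi (bt - al) + ip xi al" using ip_coroot_add[OF xi r al] bt by simp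
  thus ?thesis unfolding 4(2) by (simp add: plus_mult_simps)
 qed (simp add: plus_mult_simps)
qed

text \<open>The mixed sum \<open>S\<close> is found by substituting reflected roots: reflection in
  \<open>al\<close> permutes the roots and negates their pairings with \<open>al\<close>, so
  \<open>2 * S\<close> is \<open>ip xi al\<close> times the sum of squares.\<close>

lemma sq_plus_mult:
 assumes xi: "xi \<in> intw" and al: "al \<in> roots"
 shows "sq (plus_mult xi k al) = sq xi + k * (ip xi al + k) * (\<Sum>bt\<in>roots. (ip bt al)\<^sup>2)"
proof -
 let ?r = "%bt. plus_mult bt (- ip bt al) al"
 define S where "S = (\<Sum>bt\<in>roots. ip xi bt * ip bt al)"
 define T where "T = (\<Sum>bt\<in>roots. (ip bt al)\<^sup>2)"
 have r: "?r bt \<in> roots" "ip (?r bt) al = - ip bt al" "?r (?r bt) = bt" if bt: "bt \<in> roots" for bt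
 proof -
  have "?r bt = bt - (%x. of_int (ip bt al) * al x)" by (simp add: plus_mult_def fun_eq_iff)
  thus "?r bt \<in> roots" using reflect_root[OF al bt] by simp
  show i: "ip (?r bt) al = - ip bt al" by (simp add: ip_plus_mult al roots_intw[OF bt] ip_self)
  show "?r (?r bt) = bt" unfolding i by (simp add: plus_mult_simps)
 qed
 have "S = (\<Sum>bt\<in>roots. ip xi (?r bt) * ip (?r bt) al)"
  unfolding S_def by (rule sum.reindex_bij_witness[of _ ?r ?r]) (auto simp: r plus_mult_simps)
 also have "\<dots> = (\<Sum>bt\<in>roots. ip xi al * (ip bt al)\<^sup>2 - ip xi bt * ip bt al)"
  by (intro sum.cong refl) (simp add: r ip_reflect xi al algebra_simps power2_eq_square)
 also have "\<dots> = ip xi al * T - S" by (simp add: sum_subtractf S_def T_def sum_distrib_left)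
 finally have S: "2 * S = ip xi al * T" by simp
 have "sq (plus_mult xi k al) = (\<Sum>bt\<in>roots. (ip xi bt)\<^sup>2 + 2 * k * (ip xi bt * ip bt al) + k\<^sup>2 * (ip bt al)\<^sup>2)"
  unfolding sq_def by (intro sum.cong refl)
   (simp add: ip_plus_mult xi al ip_sym[OF al] algebra_simps power2_eq_square)
 also have "\<dots> = sq xi + 2 * k * S + k\<^sup>2 * T" by (simp add: sq_def S_def T_def sum.distrib sum_distrib_left)
 also have "2 * k * S = k * ip xi al * T" using S by (simp add: algebra_simps)
 finally show ?thesis unfolding T_def by (simp add: algebra_simps power2_eq_square)
qed

lemma ht_plus_mult:
 assumes "xi \<in> intw" "al \<in> roots"
 shows "ht (plus_mult xi k al) = ht xi + k * ht al" by (simp add: ht_def ip_plus_mult assms pos_roots sum.distrib sum_distrib_left)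

lemma ht_le_sq: "ht xi \<le> sq xi"
proof -
 have le: "i \<le> i\<^sup>2" for i :: int
  by (cases "i \<ge> 1") (auto simp: power2_eq_square mult_le_cancel_right1 intro: order_trans[OF _ zero_le_square])
 have "ht xi \<le> (\<Sum>bt\<in>pos. (ip xi bt)\<^sup>2)" unfolding ht_def by (intro sum_mono le)
 also have "\<dots> \<le> sq xi" unfolding sq_def by (intro sum_mono2 finite_roots) (auto simp: pos_roots)
 finally show ?thesis .
qed

text \<open>If no simple root pairs negatively, \<open>xi\<close> is dominant; if moreover positive
  roots pair to at most 1, it lies in the closed fundamental alcove of level one. Otherwise choose
  \<open>tht\<close> of maximal height among the positive roots pairing to at least 2. No positive
  root can be added to it, since by dominance the sum would pair to at least 2 as well.\<close>

lemma affine_step: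
 assumes xi: "xi \<in> intw"
 shows "(\<forall>bt n. (bt, n) \<in> Pb --> bt \<in> roots --> ip xi bt + n \<ge> 0) \<or>
  (\<exists>al n0. asimple al n0 & ip xi al + n0 < 0 &
   (msr (plus_mult xi (- (ip xi al + n0)) al), msr xi) \<in> less_than <*lex*> less_than)"
proof (cases "\<exists>al\<in>simple_roots. ip xi al < 0")
 case True
 then obtain al where al: "al \<in> simple_roots" "ip xi al < 0" by blast
 note r = pos_roots[OF simple_pos[OF al(1)]]
 let ?xi = "plus_mult xi (- ip xi al) al"
 have "sq ?xi = sq xi" "ht ?xi > ht xi"
  using sq_plus_mult[OF xi r, of "- ip xi al"] ht_plus_mult[OF xi r, of "- ip xi al"] ht_simple[OF al(1)] al(2) by simp_all
 hence "(msr ?xi, msr xi) \<in> less_than <*lex*> less_than" using ht_le_sq[of ?xi] by (auto simp: msr_def)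
 thus ?thesis using asimple_simple[OF al(1)] al(2) by (intro disjI2 exI[of _ al] exI[of _ 0]) simp
next case False
 have dom: "ip xi bt \<ge> 0" if "bt \<in> pos" for bt using that
 proof (induction rule: pos_induct)
  case (add al bt)
  have "0 \<le> ip xi al + ip xi bt" using add False by (auto simp: not_less)
  thus ?case by (simp only: ip_coroot_add[OF xi pos_roots[OF simple_pos[OF add(1)]] pos_roots[OF add(2)] pos_roots[OF add(3)]])
 qed (use False in "auto simp: not_less")
 show ?thesis
 proof (cases "\<exists>tht\<in>pos. ip xi tht \<ge> 2")
  case True
  define S where "S = {tht \<in> pos. ip xi tht \<ge> 2}"
  have fS: "finite S" "S ~= {}" using True finite_pos by (auto simp: S_def)
  hence "Max (ht ` S) \<in> ht ` S" by simp
  then obtain tht where tht: "tht \<in> S" "ht tht = Max (ht ` S)" by auto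
  have tht': "tht \<in> pos" "ip xi tht \<ge> 2" using tht(1) by (auto simp: S_def)
  note r = pos_roots[OF tht'(1)]
  have "asimple (- tht) 1"
  proof (rule asimple_minus[OF tht'(1)])
   fix bt assume bt: "bt \<in> pos"
   show "tht + bt \<notin> roots"
   proof
    assume s: "tht + bt \<in> roots"
    have "tht + bt \<in> S" using pos_add[OF tht'(1) bt s] ip_coroot_add[OF xi r pos_roots[OF bt] s] dom[OF bt] tht'(2) by (simp add: S_def)
    hence "ht (tht + bt) \<le> ht tht" unfolding tht(2) using fS by simp
    thus False using ht_add[OF roots_intw[OF r] roots_intw[OF pos_roots[OF bt]]] ht_pos[OF bt] by simp
   qed
  qed
  moreover have i: "ip xi (- tht) = - ip xi tht" by (rule ip_coroot_minus[OF xi r])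
  moreover have "(msr (plus_mult xi (- (ip xi (- tht) + 1)) (- tht)), msr xi) \<in> less_than <*lex*> less_than"
  proof -
   let ?T = "\<Sum>bt\<in>roots. (ip bt (- tht))\<^sup>2"
   have "(ip tht (- tht))\<^sup>2 \<le> ?T" by (rule member_le_sum[OF r _ finite_roots]) simp
   hence "?T > 0" using ip_self[OF r] ip_coroot_minus[OF roots_intw[OF r] r] by simp
   hence "(ip xi tht - 1) * ?T > 0" using tht'(2) by simp
   hence "sq (plus_mult xi (- (ip xi (- tht) + 1)) (- tht)) < sq xi"
    using sq_plus_mult[OF xi root_minus[OF r], of "- (ip xi (- tht) + 1)"] by (simp add: i algebra_simps)
   moreover have "sq nu \<ge> 0" for nu by (simp add: sq_def sum_nonneg)
   ultimately show ?thesis using le_less_trans by (fastforce simp: msr_def)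
  qed
  ultimately show ?thesis using tht'(2) by (intro disjI2 exI[of _ "- tht"] exI[of _ 1]) simp
 next case le: False
  have "ip xi bt + n \<ge> 0" if b: "(bt, n) \<in> Pb" "bt \<in> roots" for bt n
  proof (cases "bt \<in> pos")
   case True
   thus ?thesis using dom[OF True] b(1) by (auto simp: Pb_def)
  next case False
   hence m: "- bt \<in> pos" using pos_or_neg[OF b(2)] by blast
   hence "ip xi (- bt) \<le> 1" using le by force
   thus ?thesis using ip_coroot_minus[OF xi b(2)] b False rootD(2)[OF b(2)] by (auto simp: Pb_def)
  qed
  thus ?thesis by blast
 qed
qed

end

section \<open>Operators whose commutator is central\<close>

text \<open>Models two root vectors whose roots add up to a root: in simply laced type their bracket
  commutes with both (\<open>heis_letters\<close>).\<close>

locale heisenberg = vector_space scale for scale :: "complex => 'v::ab_group_add => 'v" +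
 fixes M :: "'v set" and a b c :: "'v => 'v"
 assumes lin: "a (x + y) = a x + a y" "b (x + y) = b x + b y" "c (x + y) = c x + c y"
   "a (scale r x) = scale r (a x)" "b (scale r x) = scale r (b x)" "c (scale r x) = scale r (c x)"
  and stable: "x \<in> M ==> a x \<in> M" "x \<in> M ==> b x \<in> M" "x \<in> M ==> c x \<in> M"
  and ab: "x \<in> M ==> a (b x) = b (a x) + c x"
  and ac: "x \<in> M ==> a (c x) = c (a x)" and bc: "x \<in> M ==> b (c x) = c (b x)"
begin

lemma zero: "a 0 = 0" "b 0 = 0" "c 0 = 0" "(a ^^ n) 0 = 0" "(b ^^ n) 0 = 0" "(c ^^ n) 0 = 0"
proof -
 show z: "a 0 = 0" "b 0 = 0" "c 0 = 0" using lin(4-6)[of 0 0] by simp_all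
 show "(a ^^ n) 0 = 0" "(b ^^ n) 0 = 0" "(c ^^ n) 0 = 0" by (induction n) (simp_all add: z)
qed

lemma pow_lin: "(c ^^ n) (x + y) = (c ^^ n) x + (c ^^ n) y" "(c ^^ n) (scale r x) = scale r ((c ^^ n) x)"
 by (induction n) (simp_all add: lin)

lemma pow_stable: "x \<in> M ==> (a ^^ n) x \<in> M" "x \<in> M ==> (b ^^ n) x \<in> M" "x \<in> M ==> (c ^^ n) x \<in> M"
 by (induction n) (simp_all add: stable)

lemma a_c_pow: "x \<in> M ==> a ((c ^^ n) x) = (c ^^ n) (a x)" by (induction n) (simp_all add: ac pow_stable)

lemma b_c_pow: "x \<in> M ==> b ((c ^^ n) x) = (c ^^ n) (b x)" by (induction n) (simp_all add: bc pow_stable)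

lemma c_b_pow: "x \<in> M ==> c ((b ^^ n) x) = (b ^^ n) (c x)" by (induction n) (simp_all add: pow_stable flip: bc)

lemma a_b_pow: "x \<in> M ==> a ((b ^^ Suc n) x) = (b ^^ Suc n) (a x) + scale (of_nat (Suc n)) (c ((b ^^ n) x))"
proof (induction n)
 case (Suc n)
 have "a ((b ^^ Suc (Suc n)) x) = b (a ((b ^^ Suc n) x)) + c ((b ^^ Suc n) x)" using ab[OF pow_stable(2)[OF Suc.prems, of "Suc n"]] by simp
 thus ?case unfolding Suc.IH[OF Suc.prems] of_nat_Suc[of "Suc n"] scale_left_distrib using bc[OF pow_stable(2)[OF Suc.prems, of n]]
  by (simp add: lin add_ac del: of_nat_Suc)
qed (simp add: ab)

text \<open>Apply \<open>a\<close> to the vector with one \<open>c\<close> replaced by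
  \<open>b\<close>, which vanishes by the inner induction on \<open>p\<close>. Commuting
  \<open>a\<close> through yields a nonzero multiple of the wanted vector and a term with
  \<open>a x\<close>. For \<open>a x\<close> one power of \<open>a\<close> less and one power of
  \<open>b\<close> more suffice, so the outer induction on the exponent of \<open>a\<close> covers
  it.\<close>

lemma central_pow_zero:
 assumes "x \<in> M" "(a ^^ Suc m) x = 0" "(b ^^ Suc k) x = 0" "p + q \<ge> m + k + 1"
 shows "(c ^^ p) ((b ^^ q) x) = 0" using assms
proof (induction m arbitrary: x k p q)
 case (0 x k p q)
 note x = 0(1) and a = 0(2) and b = 0(3)
 have bz: "(b ^^ q) x = 0" if "q \<ge> Suc k" for q using funpow_add[of "q - Suc k" "Suc k" b] b that zero(5) by simp
 show ?case using 0(4)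
 proof (induction p arbitrary: q)
  case (Suc p)
  have "0 = a ((c ^^ p) ((b ^^ Suc q) x))" using Suc.IH[of "Suc q"] Suc.prems zero(1) by simp
  also have "\<dots> = (c ^^ p) ((b ^^ Suc q) (a x)) + scale (of_nat (Suc q)) ((c ^^ p) (c ((b ^^ q) x)))"
   by (simp only: a_c_pow[OF pow_stable(2)[OF x]] a_b_pow[OF x] pow_lin)
  also have "(c ^^ p) ((b ^^ Suc q) (a x)) = 0" using a by (simp only: funpow_0 funpow_Suc_right comp_apply funpow.simps(1) id_apply zero)
  finally have "scale (of_nat (Suc q)) ((c ^^ Suc p) ((b ^^ q) x)) = 0" by (simp add: funpow_swap1)
  thus ?case using of_nat_neq_0[where 'a = complex, of q] by (simp only: scale_eq_0_iff) simp
 qed (use bz in simp)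
next case (Suc m x k p q)
 note IH = Suc.IH and x = Suc.prems(1) and b = Suc.prems(3) and am = Suc.prems(2)
 have bz: "(b ^^ q) x = 0" if "q \<ge> Suc k" for q using funpow_add[of "q - Suc k" "Suc k" b] b that zero(5) by simp
 have b': "(b ^^ Suc (Suc k)) (a x) = 0"
  using a_b_pow[OF x, of "Suc k"] bz[of "Suc k"] bz[of "Suc (Suc k)"] zero by (simp del: funpow.simps)
 show ?case using Suc.prems(4)
 proof (induction p arbitrary: q)
  case (Suc p)
  have "0 = a ((c ^^ p) ((b ^^ Suc q) x))" using Suc.IH[of "Suc q"] Suc.prems zero(1) by simp
  also have "\<dots> = (c ^^ p) ((b ^^ Suc q) (a x)) + scale (of_nat (Suc q)) ((c ^^ p) (c ((b ^^ q) x)))"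
   by (simp only: a_c_pow[OF pow_stable(2)[OF x]] a_b_pow[OF x] pow_lin)
  also have "(c ^^ p) ((b ^^ Suc q) (a x)) = 0" by (rule IH[OF stable(1)[OF x] _ b']) (use am Suc.prems in "simp_all add: funpow_swap1")
  finally have "scale (of_nat (Suc q)) ((c ^^ Suc p) ((b ^^ q) x)) = 0" by (simp add: funpow_swap1)
  thus ?case using of_nat_neq_0[where 'a = complex, of q] by (simp only: scale_eq_0_iff) simp
 qed (use bz in simp)
qed

text \<open>Commuting \<open>a\<close> inwards trades one \<open>b\<close> for one \<open>c\<close>,
  so vanishing of all mixed powers of fixed total exponent passes to \<open>a x\<close>.\<close>

lemma mixed_pow_zero:
 assumes "x \<in> M" "!!p q. p + q = K ==> (c ^^ p) ((b ^^ q) x) = 0"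
 shows "p + q = K ==> (c ^^ p) ((b ^^ q) ((a ^^ n) x)) = 0"
proof (induction n arbitrary: p q)
 case (Suc n)
 let ?y = "(a ^^ n) x"
 have y: "?y \<in> M" by (rule pow_stable(1)[OF assms(1)])
 have "0 = a ((c ^^ p) ((b ^^ q) ?y))" using Suc zero(1) by simp
 also have "\<dots> = (c ^^ p) (a ((b ^^ q) ?y))" by (rule a_c_pow[OF pow_stable(2)[OF y]])
 also have "\<dots> = (c ^^ p) ((b ^^ q) (a ?y))"
 proof (cases q)
  case (Suc q')
  have "(c ^^ p) (c ((b ^^ q') ?y)) = 0" using Suc.IH[of "Suc p" q'] Suc.prems Suc by (simp add: funpow_swap1)
  thus ?thesis unfolding Suc a_b_pow[OF y] pow_lin by simp
 qed simp
 finally show ?case by simp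
qed (simp add: assms)

end

section \<open>Coinduction\<close>

definition scaleS :: "(complex => 'v => 'v) => complex => (nat => 'v) => nat => 'v" where
 "scaleS s c ph = (%j. s c (ph j))"

lemma vector_space_scaleS: "vector_space s ==> vector_space (scaleS s)" unfolding vector_space_def by (auto simp: scaleS_def fun_eq_iff)

text \<open>A sequence \<open>ph\<close> stands for the \<open>U(P)\<close>-linear map on \<open>U(P') = \<Oplus>\<^sub>j U(P) f\<^sup>j\<close> with \<open>f\<^sup>j \<mapsto> ph j\<close>.\<close>

locale coind = lmod scale bracket h b Basis form scaleV P M act
 for scale :: "complex => 'g::ab_group_add => 'g" and bracket and h b Basis :: "'g set" and form
  and scaleV :: "complex => 'v::ab_group_add => 'v" and P M act +
 fixes al :: "'g => complex" and n0 :: int and f :: 'g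
 assumes al: "al \<in> roots" and f: "f \<in> root_space (- al)" "f ~= 0"
  and f_notin: "(- al, - n0) \<notin> P"
  and f_closed: "(bt, n) \<in> P ==> bt - al \<in> WT ==> (bt - al, n - n0) \<in> insert (- al, - n0) P"
  and P_e: "(al, n0) \<in> P" and P_h: "(0, 0) \<in> P"
begin

abbreviation P' where "P' == insert (- al, - n0) P"

definition cf :: "'g => complex" where "cf x = (SOME c. x = scale c f)"

text \<open>The value of \<open>x\<close> times \<open>ph\<close> at \<open>f^j\<close> is
  \<open>ph\<close> at \<open>f^j x\<close>, found by moving \<open>x\<close> to the left past one
  \<open>f\<close> at a time: \<open>f x\<close> is the bracket plus the cocycle plus
  \<open>x f\<close>, and the \<open>f\<close> on the right shifts the sequence. At
  \<open>j = 0\<close> a letter of \<open>P\<close> acts on entry 0, and a multiple of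
  \<open>f\<close> picks entry 1.\<close>

primrec cact :: "nat => 'g => int => (nat => 'v) => 'v" where
 "cact 0 x n ph = (if n = - n0 & x \<in> root_space (- al) then scaleV (cf x) (ph 1) else act x n (ph 0))"
| "cact (Suc j) x n ph = cact j (bracket f x) (n - n0) ph + scaleV (cen (f, - n0) (x, n)) (ph j)
  + cact j x n (%i. ph (Suc i))"

abbreviation cac :: "'g => int => (nat => 'v) => nat => 'v" where
 "cac x n ph == (%j. cact j x n ph)"

definition M' :: "(nat => 'v) set" where
 "M' = {ph. \<forall>j. ph j \<in> M}"

definition Lt :: "'g => int => bool" where
 "Lt x n \<longleftrightarrow> x = 0 \<or> (\<exists>bt. (bt, n) \<in> P' & x \<in> root_space bt)"

lemma M'D: "ph \<in> M' ==> ph j \<in> M" by (simp add: M'_def)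

lemma shift_M': "ph \<in> M' ==> (%i. ph (Suc i)) \<in> M'" by (simp add: M'_def)

lemma mal: "- al \<in> roots" by (rule root_minus[OF al])

lemma cf:
 assumes "x \<in> root_space (- al)"
 shows "x = scale (cf x) f"
proof -
 obtain c where "x = scale c f" by (rule root_space_line[OF mal f assms])
 thus ?thesis unfolding cf_def by (rule someI)
qed

lemma cf_scale: "cf (scale c f) = c"
proof -
 have "scale c f \<in> root_space (- al)" using f(1) root_space_sub by (simp add: subspace_scale)
 from cf[OF this] show ?thesis using f(2) by (metis scale_cancel_right)
qed

lemma bracket_ff: "x \<in> root_space (- al) ==> bracket f x = 0" and cen_ff: "x \<in> root_space (- al) ==> cen (f, k) (x, n) = 0"
proof -
 assume x: "x \<in> root_space (- al)"
 show "bracket f x = 0" by (subst cf[OF x]) (simp add: bracket_scale_right bracket_self)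
 have "- al + - al ~= 0" using WT_double[OF mal] zero_WT by metis
 thus "cen (f, k) (x, n) = 0" using kap_orthogonal[OF f(1) x rootD(1)[OF mal] rootD(1)[OF mal]] by (simp add: cen_def)
qed

lemma cact_zero: "ph \<in> M' ==> cact j 0 n ph = 0"
proof (induction j arbitrary: ph n)
 case 0
 thus ?case using cf_scale[of 0] by (simp add: act_zero_left M'D)
next case (Suc j)
 thus ?case using shift_M' by (simp add: bracket_zero_right cen_def kap_simps)
qed

lemma root_space_disjoint:
 assumes "x \<in> root_space bt" "x \<in> root_space ga" "onh bt" "onh ga" "x ~= 0"
 shows "bt = ga" using gw_disjoint[of x bt ga] root_space_gw assms by blast

lemma cact_0:
 assumes "(bt, n) \<in> P" "x \<in> root_space bt" "ph \<in> M'"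
 shows "cact 0 x n ph = act x n (ph 0)"
proof (cases "x = 0")
 case True
 thus ?thesis using cact_zero[OF assms(3), of 0] act_zero_left[OF M'D[OF assms(3)]] by simp
next case False
 have "\<not> (n = - n0 & x \<in> root_space (- al))"
  using root_space_disjoint[OF assms(2) _ WT_onh[OF P_WT[OF assms(1)]] WT_onh[OF rootD(1)[OF mal]] False]
   f_notin assms(1) by blast
 thus ?thesis by auto
qed

lemma cact_f:
 assumes "x \<in> root_space (- al)" "ph \<in> M'"
 shows "cact j x (- n0) ph = scaleV (cf x) (ph (Suc j))" using assms(2)
proof (induction j arbitrary: ph)
 case (Suc j)
 thus ?case using Suc.IH[OF shift_M'[OF Suc.prems]] by (simp add: bracket_ff cen_ff assms(1) cact_zero)
qed (simp add: assms(1))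

lemma P'_WT: "(bt, n) \<in> P' ==> bt \<in> WT" using P_WT rootD(1)[OF mal] by auto

lemma P'_closed: "(bt, m) \<in> P' ==> (ga, n) \<in> P' ==> bt + ga \<in> WT ==> (bt + ga, m + n) \<in> P'"
 using P_closed[of bt m ga n] f_closed[of bt m] f_closed[of ga n] WT_double[OF mal] by (auto simp: algebra_simps)

lemma Lt_bracket: "Lt x m ==> Lt y n ==> Lt (bracket x y) (m + n)"
proof -
 assume L: "Lt x m" "Lt y n"
 show ?thesis
 proof (cases "bracket x y = 0")
  case False
  hence "x ~= 0" "y ~= 0" using bracket_zero_left bracket_zero_right by auto
  then obtain bt ga where bg: "(bt, m) \<in> P'" "x \<in> root_space bt" "(ga, n) \<in> P'" "y \<in> root_space ga"
   using L by (auto simp: Lt_def)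
  hence "bt + ga \<in> WT" using WT_bracket[OF bg(2,4) False] WT_onh P'_WT by blast
  thus ?thesis using P'_closed[OF bg(1,3)] root_space_bracket[OF bg(2,4)] unfolding Lt_def by blast
 qed (simp add: Lt_def)
qed

lemma Lt_f: "Lt f (- n0)" using f by (auto simp: Lt_def)

lemma Lt_ad: "Lt x n ==> Lt (bracket f x) (n - n0)" using Lt_bracket[OF Lt_f, of x n] by simp

lemma LtI: "(bt, n) \<in> P' ==> x \<in> root_space bt ==> Lt x n" by (auto simp: Lt_def)

lemma cact_M: "Lt x n ==> ph \<in> M' ==> cact j x n ph \<in> M"
proof (induction j arbitrary: x n ph)
 case 0
 then consider "x = 0" | bt where "(bt, n) \<in> P" "x \<in> root_space bt" | "n = - n0" "x \<in> root_space (- al)" by (auto simp: Lt_def)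
 thus ?case
 proof cases
  case 2
  show ?thesis unfolding cact_0[OF 2 0(2)] by (rule act_M[OF 2 M'D[OF 0(2)]])
 qed (simp_all add: cact_zero 0 cact_f M'D M_scale M_0 del: cact.simps)
next case (Suc j)
 thus ?case using shift_M' by (simp add: Lt_ad M_add M_scale M'D)
qed

lemma cac_M': "Lt x n ==> ph \<in> M' ==> cac x n ph \<in> M'" using cact_M by (simp add: M'_def)

lemma cact_lin: "cact j x n (ph + \<psi>) = cact j x n ph + cact j x n \<psi>"
  "cact j x n (scaleS scaleV c ph) = scaleV c (cact j x n ph)"
proof (induction j arbitrary: x n ph \<psi>)
 case 0
 case 1
 show ?case by (simp add: act_add V.scale_right_distrib)
 case 2
 show ?case by (simp add: act_scale scaleS_def mult.commute)
next case (Suc j)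
 have s: "(%i. (ph + \<psi>) (Suc i)) = (%i. ph (Suc i)) + (%i. \<psi> (Suc i))"
   "(%i. scaleS scaleV c ph (Suc i)) = scaleS scaleV c (%i. ph (Suc i))" for ph \<psi> :: "nat => 'v"
  by (simp_all add: fun_eq_iff scaleS_def)
 case 1
 show ?case unfolding cact.simps s Suc unfolding plus_fun_apply V.scale_right_distrib by (simp only: add_ac)
 case 2
 show ?case unfolding cact.simps s Suc by (simp add: scaleS_def V.scale_right_distrib mult.commute)
qed

lemma cact_scale_left:
 assumes "Lt x n" "ph \<in> M'"
 shows "cact j (scale c x) n ph = scaleV c (cact j x n ph)" using assms
proof (induction j arbitrary: x n ph)
 case 0
 then consider "x = 0" | bt where "(bt, n) \<in> P" "x \<in> root_space bt" | "n = - n0" "x \<in> root_space (- al)" by (auto simp: Lt_def)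
 thus ?case
 proof cases
  case 1
  thus ?thesis by (simp add: cact_zero 0 del: cact.simps)
 next case 2
  hence "scale c x \<in> root_space bt" using root_space_sub by (simp add: subspace_scale)
  thus ?thesis using 2 by (simp add: cact_0[OF 2(1)] 0 act_scale_left[OF 2] M'D del: cact.simps)
 next case 3
  hence "scale c x \<in> root_space (- al)" using root_space_sub by (simp add: subspace_scale)
  moreover have "cf (scale c x) = c * cf x" using cf[OF 3(2)] cf_scale[of "c * cf x"] by (metis scale_scale)
  ultimately show ?thesis using 3 by (simp add: cact_f 0 del: cact.simps)
 qed
next case (Suc j)
 thus ?case using Suc.IH[OF Lt_ad[OF Suc.prems(1)] Suc.prems(2)] Suc.IH[OF Suc.prems(1) shift_M'[OF Suc.prems(2)]]
  by (simp add: bracket_scale_right cen_simps V.scale_right_distrib)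
qed

lemma cact_add_left:
 assumes "Lt x n" "Lt y n" "x \<in> root_space de" "y \<in> root_space de" "onh de" "ph \<in> M'"
 shows "cact j (x + y) n ph = cact j x n ph + cact j y n ph"
proof (cases "x = 0 \<or> y = 0")
 case True
 thus ?thesis using assms(6) by (auto simp: cact_zero)
next case False
 hence "(de, n) \<in> P'" using assms(1) root_space_disjoint[OF assms(3) _ assms(5)] WT_onh[OF P'_WT] unfolding Lt_def by metis
 thus ?thesis using assms(3,4,6)
 proof (induction j arbitrary: x y n de ph)
  case 0
  hence xy: "x + y \<in> root_space de" using root_space_sub by (simp add: subspace_add)
  consider "(de, n) \<in> P" | "n = - n0" "de = - al" using 0(1) by blast
  thus ?case
  proof cases
   case 1
   thus ?thesis using 0 xy by (simp add: cact_0[OF 1] act_add_left[OF 1] M'D del: cact.simps)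
  next case 2
   note r = 0(2,3) xy
   have "scale (cf (x + y)) f = scale (cf x + cf y) f"
    unfolding scale_left_distrib by (simp only: cf[OF r(1)[unfolded 2(2)], symmetric] cf[OF r(2)[unfolded 2(2)], symmetric]
      cf[OF r(3)[unfolded 2(2)], symmetric])
   hence "cf (x + y) = cf x + cf y" using f(2) by simp
   thus ?thesis unfolding 2(1) cact_f[OF r(1)[unfolded 2(2)] 0(4)] cact_f[OF r(2)[unfolded 2(2)] 0(4)] cact_f[OF r(3)[unfolded 2(2)] 0(4)]
    by (simp add: V.scale_left_distrib)
  qed
 next case (Suc j)
  note IH = Suc.IH[OF Suc.prems(1,2,3) shift_M'[OF Suc.prems(4)]]
  have "cact j (bracket f x + bracket f y) (n - n0) ph = cact j (bracket f x) (n - n0) ph + cact j (bracket f y) (n - n0) ph"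
  proof (cases "- al + de \<in> WT")
   case True
   have "(- al + de, - n0 + n) \<in> P'" by (rule P'_closed[OF _ Suc.prems(1) True]) simp
   hence "(- al + de, n - n0) \<in> P'" by simp
   from Suc.IH[OF this root_space_bracket[OF f(1) Suc.prems(2)] root_space_bracket[OF f(1) Suc.prems(3)] Suc.prems(4)]
   show ?thesis .
  next case False
   hence "bracket f x = 0" "bracket f y = 0"
    using WT_bracket[OF f(1)] Suc.prems WT_onh[OF rootD(1)[OF mal]] WT_onh[OF P'_WT[OF Suc.prems(1)]] by blast+
   thus ?thesis using Suc.prems(4) by (simp add: cact_zero)
  qed
  thus ?case unfolding cact.simps bracket_add_right IH cen_simps V.scale_left_distrib by (simp only: add_ac)
 qed
qed

lemma cact_comm_sym:
 assumes L: "Lt x m" "Lt y n" "ph \<in> M'"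
  and e: "cact j y n (cac x m ph) = cact j x m (cac y n ph) + cact j (bracket y x) (n + m) ph + scaleV (cen (y, n) (x, m)) (ph j)"
 shows "cact j x m (cac y n ph) = cact j y n (cac x m ph) + cact j (bracket x y) (m + n) ph + scaleV (cen (x, m) (y, n)) (ph j)"
proof -
 have "cact j (bracket x y) (m + n) ph = scaleV (- 1) (cact j (bracket y x) (n + m) ph)"
  using cact_scale_left[OF Lt_bracket[OF L(2,1)] L(3), of j "- 1"] bracket_antisym[of y x] by (simp add: add.commute)
 moreover have "cen (x, m) (y, n) = - cen (y, n) (x, m)" by (rule cen_antisym)
 ultimately show ?thesis unfolding e by simp
qed

text \<open>Since \<open>f\<close> acts as the shift, this is the recursive clause of
  \<open>cact\<close> solved for its last term.\<close>

lemma cact_comm_f: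
 assumes L: "Lt x m" "ph \<in> M'" and y: "y \<in> root_space (- al)"
 shows "cact j x m (cac y (- n0) ph) = cact j y (- n0) (cac x m ph) + cact j (bracket x y) (m + - n0) ph + scaleV (cen (x, m) (y, - n0)) (ph j)"
proof -
 define c where "c = cf y"
 have yc: "y = scale c f" unfolding c_def by (rule cf[OF y])
 have "cac y (- n0) ph = scaleS scaleV c (%i. ph (Suc i))" using cact_f[OF y L(2)] by (simp add: fun_eq_iff scaleS_def c_def)
 hence 1: "cact j x m (cac y (- n0) ph) = scaleV c (cact j x m (%i. ph (Suc i)))" by (simp only: cact_lin)
 have 2: "cact j y (- n0) (cac x m ph) = scaleV c (cact (Suc j) x m ph)" using cact_f[OF y cac_M'[OF L]] by (simp only: c_def)
 have "bracket x y = scale (- c) (bracket f x)" unfolding yc bracket_scale_right bracket_antisym[of x f] by simp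
 hence 3: "cact j (bracket x y) (m + - n0) ph = scaleV (- c) (cact j (bracket f x) (m - n0) ph)"
  using cact_scale_left[OF Lt_ad[OF L(1)] L(2), of j "- c"] by simp
 have 4: "cen (x, m) (y, - n0) = - c * cen (f, - n0) (x, m)" unfolding yc cen_simps cen_antisym[of "(x, m)"] by simp
 show ?thesis unfolding 1 2 3 4 cact.simps by (simp add: V.scale_right_distrib)
qed

text \<open>At entry 0 it is the relation of the original module, or \<open>cact_comm_f\<close> if a
  multiple of \<open>f\<close> is involved. In the step both sides are expanded by the recursive
  clause, and the Jacobi and cocycle identities for \<open>f\<close>, \<open>x\<close>,
  \<open>y\<close> match the additional terms.\<close>

lemma cact_comm:
 assumes "Lt x m" "Lt y n" "ph \<in> M'"
 shows "cact j x m (cac y n ph) = cact j y n (cac x m ph) + cact j (bracket x y) (m + n) ph + scaleV (cen (x, m) (y, n)) (ph j)" using assms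
proof (induction j arbitrary: x m y n ph)
 case (0 x m y n ph)
 note L = 0
 have z: "cac 0 k ph = 0" for k using L(3) cact_zero by (simp add: fun_eq_iff del: cact.simps)
 have z': "cact 0 w k 0 = 0" for w k using cact_lin(2)[of 0 w k 0 0] by (simp add: scaleS_def zero_fun_def)
 have zc: "cen (0, k) w = 0" "cen w (0, k) = 0" for k w by (simp_all add: cen_def kap_simps)
 consider "x = 0" | "y = 0" | "n = - n0" "y \<in> root_space (- al)" | "m = - n0" "x \<in> root_space (- al)"
  | bt ga where "(bt, m) \<in> P" "x \<in> root_space bt" "(ga, n) \<in> P" "y \<in> root_space ga" using L(1,2) unfolding Lt_def by blast
 thus ?case
 proof cases
  case 1
  show ?thesis unfolding 1 zc bracket_zero_left cact_zero[OF cac_M'[OF L(2,3)]] unfolding z unfolding z' cact_zero[OF L(3)] by simp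
 next case 2
  show ?thesis unfolding 2 zc bracket_zero_right cact_zero[OF cac_M'[OF L(1,3)]] unfolding z unfolding z' cact_zero[OF L(3)] by simp
 next case 3
  show ?thesis unfolding 3(1) by (rule cact_comm_f[OF L(1,3) 3(2)])
 next case 4
  show ?thesis by (rule cact_comm_sym[OF L]) (unfold 4(1), rule cact_comm_f[OF L(2,3) 4(2)])
 next case 5
  have "cact 0 (bracket x y) (m + n) ph = act (bracket x y) (m + n) (ph 0)"
  proof (cases "bt + ga \<in> WT")
   case True
   show ?thesis by (rule cact_0[OF P_closed[OF 5(1,3) True] root_space_bracket[OF 5(2,4)] L(3)])
  next case False
   hence "bracket x y = 0" using WT_bracket[OF 5(2,4)] WT_onh P_WT 5 by blast
   thus ?thesis using cact_zero[OF L(3), of 0] act_zero_left[OF M'D[OF L(3)]] by simp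
  qed
  thus ?thesis unfolding cact_0[OF 5(1,2) cac_M'[OF L(2,3)]] cact_0[OF 5(3,4) cac_M'[OF L(1,3)]]
    cact_0[OF 5(1,2) L(3)] cact_0[OF 5(3,4) L(3)] using comm[OF 5(1,3,2,4) M'D[OF L(3)]] by simp
 qed
next case (Suc j x m y n ph)
 note L = Suc.prems
 let ?S = "%i. ph (Suc i)" and ?fx = "bracket f x" and ?fy = "bracket f y"
 have sh: "(%i. cac w k ph (Suc i)) = cac (bracket f w) (k - n0) ph + scaleS scaleV (cen (f, - n0) (w, k)) ph + cac w k ?S" for w k
  by (simp add: fun_eq_iff scaleS_def)
 have e: "cact (Suc j) w k (cac z l ph) = cact j (bracket f w) (k - n0) (cac z l ph)
   + scaleV (cen (f, - n0) (w, k)) (cact j z l ph)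
   + (cact j w k (cac (bracket f z) (l - n0) ph) + scaleV (cen (f, - n0) (z, l)) (cact j w k ph) + cact j w k (cac z l ?S))"
  for w k z l by (simp only: cact.simps(2)[of j w k "cac z l ph"] sh cact_lin)
 note LS = shift_M'[OF L(3)]
 have k: "m + (n - n0) = m + n - n0" "m - n0 + n = m + n - n0" by simp_all
 have 1: "cact j ?fx (m - n0) (cac y n ph) = cact j y n (cac ?fx (m - n0) ph) + cact j (bracket ?fx y) (m + n - n0) ph
   + scaleV (cen (?fx, m - n0) (y, n)) (ph j)" using Suc.IH[OF Lt_ad[OF L(1)] L(2,3)] unfolding k .
 have 2: "cact j x m (cac ?fy (n - n0) ph) = cact j ?fy (n - n0) (cac x m ph) + cact j (bracket x ?fy) (m + n - n0) ph
   + scaleV (cen (x, m) (?fy, n - n0)) (ph j)" using Suc.IH[OF L(1) Lt_ad[OF L(2)] L(3)] unfolding k .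
 note 3 = Suc.IH[OF L(1,2) LS]
 have 4: "cact j (bracket f (bracket x y)) (m + n - n0) ph =
   cact j (bracket ?fx y) (m + n - n0) ph + cact j (bracket x ?fy) (m + n - n0) ph"
 proof (cases "x = 0 \<or> y = 0")
  case True
  thus ?thesis using L(3) by (auto simp: bracket_zero_left bracket_zero_right cact_zero)
 next case False
  then obtain bt ga where bg: "(bt, m) \<in> P'" "x \<in> root_space bt" "(ga, n) \<in> P'" "y \<in> root_space ga"
   using L(1,2) unfolding Lt_def by blast
  have o: "onh (- al + bt + ga)" by (intro onh_simps(3) WT_onh[OF rootD(1)[OF mal]] WT_onh[OF P'_WT[OF bg(1)]] WT_onh[OF P'_WT[OF bg(3)]])
  have "bracket x ?fy \<in> root_space (- al + bt + ga)"
   using root_space_bracket[OF bg(2) root_space_bracket[OF f(1) bg(4)]] by (simp only: add_ac)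
  moreover have "bracket ?fx y \<in> root_space (- al + bt + ga)" by (rule root_space_bracket[OF root_space_bracket[OF f(1) bg(2)] bg(4)])
  ultimately show ?thesis unfolding bracket_bracket_right[of f]
   using cact_add_left[OF _ _ _ _ o L(3)] Lt_bracket[OF Lt_ad[OF L(1)] L(2)] Lt_bracket[OF L(1) Lt_ad[OF L(2)]] k by simp
 qed
 have 5: "cen (f, - n0) (bracket x y, m + n) = cen (x, m) (?fy, n - n0) + cen (?fx, m - n0) (y, n)"
  using cen_cocycle[of "(f, - n0)" "(x, m)" "(y, n)"] by (simp add: br_def algebra_simps)
 show ?case unfolding e cact.simps(2)[of j "bracket x y"] 1 2 3 4 5 V.scale_left_distrib by (simp only: add_ac)
qed

lemma lmod_coind: "lmod scale bracket h b Basis form (scaleS scaleV) P' M' cac"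
proof -
 interpret S: vector_space "scaleS scaleV" by (rule vector_space_scaleS) (rule V.vector_space_axioms)
 show ?thesis
 proof (unfold_locales, goal_cases)
  case (1 bt n) thus ?case by (rule P'_WT)
 next case (2 bt m ga n) thus ?case by (rule P'_closed)
 next case 3
  show ?case by (simp add: S.subspace_def M'_def scaleS_def M_0 M_add M_scale)
 next case 4 show ?case by (simp only: fun_eq_iff cact_lin plus_fun_apply) simp
 next case 5 show ?case by (simp only: fun_eq_iff cact_lin scaleS_def[of _ _ "cac _ _ _"]) simp
 next case (6 bt n x v) thus ?case by (intro cac_M' LtI)
 next case (7 v n) thus ?case by (simp add: cact_zero zero_fun_def)
 next case (8 bt n x y v)
  have "cact j (x + y) n v = cact j x n v + cact j y n v" for j
   by (rule cact_add_left[OF LtI[OF 8(1,2)] LtI[OF 8(1,3)] 8(2,3) WT_onh[OF P'_WT[OF 8(1)]] 8(4)])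
  thus ?case by (simp only: fun_eq_iff plus_fun_apply) simp
 next case (9 bt n x v c)
  thus ?case using cact_scale_left[OF LtI[OF 9(1,2)] 9(3)] by (simp only: fun_eq_iff scaleS_def) simp
 next case (10 bt m ga n x y v)
  from cact_comm[OF LtI[OF 10(1,3)] LtI[OF 10(2,4)] 10(5)] show ?case by (simp only: fun_eq_iff scaleS_def plus_fun_apply) simp
 qed
qed

end

section \<open>Transfer of the bound\<close>

context ade
begin

text \<open>The second clause says that the homogeneous pieces with the excess of the generator are
  at most lines.\<close>

definition bounded :: "(complex => 'v::ab_group_add => 'v) => ('g => int => 'v => 'v) => ('g wt \<times> int) set
  => 'v => 'g wt => int => bool" where
 "bounded s act P v xi N0 \<longleftrightarrow>
  (\<forall>nu N w. ug s act P v xi N0 nu N w --> Exc nu N < Exc xi N0 --> w = 0) &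
  (\<forall>nu N. Exc nu N = Exc xi N0 --> (\<exists>z. \<forall>w. ug s act P v xi N0 nu N w --> (\<exists>c. w = s c z)))"

lemma boundedD: "bounded s act P v xi N0 ==> ug s act P v xi N0 nu N w ==> Exc nu N < Exc xi N0 ==> w = 0" by (auto simp: bounded_def)

lemma ug_trans: "ug s act P v nu0 N0 nu N w ==> ug s act P v0 nu1 N1 nu0 N0 v ==> ug s act P v0 nu1 N1 nu N w"
proof (induction rule: ug.induct)
 case (ug_act nu N v bt n x)
 hence "ug s act P v0 nu1 N1 (nu + bt) (N + n) (act x n v)" by (intro ug.ug_act)
 thus ?case .
qed (auto intro: ug.intros)

text \<open>Pulls a line back along a linear map that is injective on the piece.\<close>

lemma ug_line:
 assumes "vector_space s" "vector_space t" "!!x y. F (x + y) = F x + F y" "!!c x. F (s c x) = t c (F x)"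
  and inj: "!!w. ug s act P v xi N0 nu N w ==> F w = 0 ==> w = 0"
  and z: "!!w. ug s act P v xi N0 nu N w ==> \<exists>c. F w = t c z"
 shows "\<exists>z. \<forall>w. ug s act P v xi N0 nu N w --> (\<exists>c. w = s c z)"
proof (cases "\<exists>w. ug s act P v xi N0 nu N w & w ~= 0")
 case True
 interpret S: vector_space s by (rule assms(1))
 interpret T: vector_space t by (rule assms(2))
 obtain w1 where w1: "ug s act P v xi N0 nu N w1" "w1 ~= 0" using True by blast
 obtain c1 where c1: "F w1 = t c1 z" using z[OF w1(1)] by blast
 have c1': "c1 ~= 0" using inj[OF w1(1)] w1(2) c1 by auto
 have "\<exists>c. w = s c w1" if w: "ug s act P v xi N0 nu N w" for w
 proof -
  obtain c where c: "F w = t c z" using z[OF w] by blast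
  have "F (w + s (- c / c1) w1) = 0" unfolding assms(3,4) c c1 using c1' by simp
  hence "w + s (- c / c1) w1 = 0" by (intro inj ug.ug_add ug.ug_scale w w1(1))
  thus ?thesis by (intro exI[of _ "c / c1"]) (simp add: add_eq_0_iff)
 qed
 thus ?thesis by blast
next case False
 interpret S: vector_space s by (rule assms(1))
 show ?thesis using False S.scale_zero_right by metis
qed

lemma bounded_inj:
 assumes s: "vector_space s" and t: "vector_space t" and T: "!!x y. T (x + y) = T x + T y" "!!c x. T (s c x) = t c (T x)"
  and inj: "!!w. T w = 0 ==> w = 0" and act: "!!x n w. act' x n (T w) = T (act x n w)"
  and b: "bounded t act' P (T v) xi N0"
 shows "bounded s act P v xi N0"
proof -
 interpret S: vector_space s by (rule s)
 interpret R: vector_space t by (rule t)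
 have T0: "T 0 = 0" using T(2)[of 0 0] by simp
 have u: "ug s act P v xi N0 nu N w ==> ug t act' P (T v) xi N0 nu N (T w)" for nu N w
 proof (induction rule: ug.induct)
  case (ug_act nu N w bt n x)
  have "ug t act' P (T v) xi N0 (nu + bt) (N + n) (T (act x n w))" using ug.ug_act[OF ug_act.IH ug_act.hyps(2,3)] by (simp only: act)
  thus ?case .
 qed (auto simp: T T0 intro: ug.intros)
 show ?thesis unfolding bounded_def
 proof (intro conjI allI impI)
  show "w = 0" if "ug s act P v xi N0 nu N w" "Exc nu N < Exc xi N0" for nu N w using boundedD[OF b u[OF that(1)] that(2)] inj by blast
  fix nu N assume "Exc nu N = Exc xi N0"
  then obtain z where "!!w. ug t act' P (T v) xi N0 nu N w ==> \<exists>c. w = t c z" using b unfolding bounded_def by metis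
  thus "\<exists>z. \<forall>w. ug s act P v xi N0 nu N w --> (\<exists>c. w = s c z)"
   by (intro ug_line[OF s t, where F = T, OF T]) (auto intro: inj u)
 qed
qed

end

lemma (in lmod) transport:
 assumes Y: "vector_space t" and T: "!!x y. T (x + y) = T x + T y" "!!c x. T (scaleV c x) = t c (T x)"
  and Ti: "!!x. Ti (T x) = x" "!!y. T (Ti y) = y"
 defines "act' == %x n y. T (act x n (Ti y))"
 shows "lmod scale bracket h b Basis form t P (T ` M) act'"
  "bounded t act' P (T v) xi N0 ==> bounded scaleV act P v xi N0"
  "(act' x n ^^ k) (T w) = T ((act x n ^^ k) w)"
proof -
 interpret Y: vector_space t by (rule Y)
 have Ti': "Ti (x + y) = Ti x + Ti y" "Ti (t c x) = scaleV c (Ti x)" for x y c using Ti T by metis+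
 have T0: "T 0 = 0" using T(2)[of 0 0] by simp
 show "lmod scale bracket h b Basis form t P (T ` M) act'"
 proof (unfold_locales, goal_cases)
  case (1 bt n) thus ?case by (rule P_WT)
 next case (2 bt m ga n) thus ?case by (rule P_closed)
 next case 3
  have "x + y \<in> T ` M" "t c x \<in> T ` M" if xy: "x \<in> T ` M" "y \<in> T ` M" for x y c
  proof -
   obtain a d where "x = T a" "a \<in> M" "y = T d" "d \<in> M" using xy by blast
   thus "x + y \<in> T ` M" "t c x \<in> T ` M" using M_add M_scale T by (metis imageI)+
  qed
  thus ?case unfolding Y.subspace_def using M_0 T0 by (metis imageI)
 next case (6 bt n x v) thus ?case using act_M[of bt n x] by (auto simp: act'_def Ti)
 next case (8 bt n x y v) thus ?case using act_add_left[of bt n x y] by (auto simp: act'_def Ti T)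
 next case (9 bt n x v c) thus ?case using act_scale_left[of bt n x] by (auto simp: act'_def Ti T)
 next case (10 bt m ga n x y v)
  then obtain w where w: "v = T w" "w \<in> M" by blast
  show ?case unfolding act'_def w(1) Ti comm[OF 10(1-4) w(2)] T ..
 qed (auto simp: act'_def Ti Ti' T act_add act_scale act_zero_left T0)
 have inj: "w = 0" if "T w = 0" for w using Ti(1)[of w] Ti(1)[of 0] that T0 by simp
 show "bounded scaleV act P v xi N0" if "bounded t act' P (T v) xi N0"
  by (rule bounded_inj[OF V.vector_space_axioms Y, where T = T and act' = act', OF T inj _ that]) (simp_all add: act'_def Ti)
 show "(act' x n ^^ k) (T w) = T ((act x n ^^ k) w)" by (induction k) (simp_all add: act'_def Ti)
qed

context coind
begin

interpretation Y: lmod scale bracket h b Basis form "scaleS scaleV" P' M' cac by (rule lmod_coind)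

text \<open>The lift of \<open>v\<close> that \<open>f\<close> kills: entry 0 is \<open>v\<close>,
  and \<open>f\<close> acts as the shift.\<close>

definition st :: "'v => nat => 'v" where
 "st v = (%j. if j = 0 then v else 0)"

lemma st_M': "v \<in> M ==> st v \<in> M'" by (simp add: st_def M'_def M_0)

lemma f_shift: "\<psi> \<in> M' ==> cac f (- n0) \<psi> = (%j. \<psi> (Suc j))" using cf_scale[of 1] by (simp add: cact_f f(1) fun_eq_iff)

lemma f_st: "v \<in> M ==> cac f (- n0) (st v) = 0" by (simp add: f_shift st_M') (simp add: st_def zero_fun_def)

text \<open>A sequence killed by the shift is concentrated at entry 0. The relations satisfied by
  \<open>st v\<close> are verified through this criterion.\<close>

lemma coind_zero:
 assumes "\<psi> \<in> M'" "\<psi> 0 = 0" "cac f (- n0) \<psi> = 0"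
 shows "\<psi> = 0"
proof
 have "\<psi> (Suc j) = 0" for j using assms(3) unfolding f_shift[OF assms(1)] by (metis zero_fun_apply)
 thus "\<psi> j = 0 j" for j using assms(2) by (cases j) auto
qed

lemma eval_pow:
 assumes "(bt, n) \<in> P" "x \<in> root_space bt" "ph \<in> M'"
 shows "(cac x n ^^ k) ph 0 = (act x n ^^ k) (ph 0)"
proof (induction k)
 case (Suc k)
 have "(cac x n ^^ k) ph \<in> M'" using assms by (intro Y.act_pow_M[of bt]) auto
 thus ?case using Suc cact_0[OF assms(1,2)] by (simp del: cact.simps)
qed simp

text \<open>Taking entry 0 commutes with the letters of \<open>P\<close>; this is how bounds descend
  from the coinduced module to the original one.\<close>

lemma eval_ug:
 assumes "v \<in> M" "ug scaleV act P v xi N0 nu N w"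
 shows "\<exists>W. ug (scaleS scaleV) cac P (st v) xi N0 nu N W & W 0 = w & W \<in> M'" using assms(2)
proof (induction rule: ug.induct)
 case ug_base
 have "st v 0 = v" by (simp add: st_def)
 thus ?case using ug.ug_base st_M'[OF assms(1)] by metis
next case (ug_zero nu N)
 show ?case by (intro exI[of _ 0] conjI ug.ug_zero Y.M_0) simp
next case (ug_add nu N v' w)
 then obtain V W where W: "ug (scaleS scaleV) cac P (st v) xi N0 nu N V" "V 0 = v'" "V \<in> M'"
   "ug (scaleS scaleV) cac P (st v) xi N0 nu N W" "W 0 = w" "W \<in> M'" by blast
 thus ?case by (intro exI[of _ "V + W"] conjI ug.ug_add Y.M_add) simp_all
next case (ug_scale nu N w c)
 then obtain W where W: "ug (scaleS scaleV) cac P (st v) xi N0 nu N W" "W 0 = w" "W \<in> M'" by blast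
 have "scaleS scaleV c W 0 = scaleV c w" using W(2) by (simp add: scaleS_def)
 thus ?case using ug.ug_scale[OF W(1)] Y.M_scale[OF W(3)] by metis
next case (ug_act nu N w bt n x)
 then obtain W where W: "ug (scaleS scaleV) cac P (st v) xi N0 nu N W" "W 0 = w" "W \<in> M'" by blast
 have "cac x n W 0 = act x n w" using cact_0[OF ug_act.hyps(2,3) W(3)] W(2) by simp
 moreover have "cac x n W \<in> M'" by (rule cac_M'[OF LtI[OF _ ug_act.hyps(3)] W(3)]) (use ug_act.hyps(2) in simp)
 ultimately have "\<exists>W. ug (scaleS scaleV) cac P (st v) xi N0 (nu + bt) (N + n) W & W 0 = act x n w & W \<in> M'"
  using ug.ug_act[OF W(1) ug_act.hyps(2,3)] by metis
 thus ?case .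
qed

lemma st_weight:
 assumes v: "v \<in> M" "act H 0 v = scaleV c v" and H: "H \<in> h"
 shows "cac H 0 (st v) = scaleS scaleV c (st v)"
proof -
 have HP: "(0, 0) \<in> P'" "H \<in> root_space 0" using P_h H by (simp_all add: root_space_0)
 note s = st_M'[OF v(1)]
 let ?\<psi> = "cac H 0 (st v) + scaleS scaleV (- c) (st v)"
 have bf: "bracket f H = scale (al H) f" using f(1) H bracket_antisym[of f H] by (simp add: root_space_def)
 have "?\<psi> = 0"
 proof (rule coind_zero)
  show "?\<psi> \<in> M'" by (intro Y.M_add Y.M_scale s Y.act_M[OF HP])
  show "?\<psi> 0 = 0" using cact_0[OF P_h HP(2) s] v(2) by (simp add: scaleS_def st_def del: cact.simps)
  have "cac f (- n0) (cac H 0 (st v)) = cac H 0 (cac f (- n0) (st v)) + cac (bracket f H) (- n0 + 0) (st v)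
    + scaleS scaleV (cen (f, - n0) (H, 0)) (st v)" by (rule Y.comm[OF _ HP(1) f(1) HP(2) s]) simp
  also have "cac (bracket f H) (- n0 + 0) (st v) = scaleS scaleV (al H) (cac f (- n0) (st v))"
   unfolding bf add_0_right by (rule Y.act_scale_left[OF _ f(1) s]) simp
  also have "cen (f, - n0) (H, 0) = 0" using kap_orthogonal[OF f(1) HP(2) rootD(1)[OF mal] zero_WT] rootD(2)[OF mal] by (simp add: cen_def)
  finally have "cac f (- n0) (cac H 0 (st v)) = 0"
   unfolding f_st[OF v(1)] Y.act_0 by (simp only: Y.V.scale_zero_right Y.V.scale_zero_left add_0_right)
  thus "cac f (- n0) ?\<psi> = 0" unfolding Y.act_add Y.act_scale f_st[OF v(1)] by (simp only: Y.V.scale_zero_right add_0_right)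
 qed
 thus ?thesis by (simp add: add_eq_0_iff)
qed

text \<open>The coefficient with which \<open>f\<close> lowers the power \<open>m + 1\<close> of
  \<open>e\<close> contains the factor \<open>- m + (m + 1) - 1 = 0\<close>, and entry 0 vanishes by
  \<open>em\<close>.\<close>

lemma e_pow_st:
 assumes v: "v \<in> M" "!!H. H \<in> h ==> act H 0 v = scaleV (xi H) v" and xi: "xi \<in> intw" and m: "ip xi al + n0 = - int m"
  and e: "e \<in> root_space al" "bracket e f = coroot al" and em: "(act e n0 ^^ Suc m) v = 0"
 shows "(cac e n0 ^^ Suc m) (st v) = 0"
proof (rule coind_zero)
 have PP: "(al, n0) \<in> P'" "(- al, - n0) \<in> P'" "(0, 0) \<in> P'" using P_e P_h by simp_all
 note s = st_M'[OF v(1)]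
 interpret S: sl2_weights "scaleS scaleV" "cac e n0" "cac f (- n0)"
   "%c. {w \<in> M'. cac (coroot al) 0 w = scaleS scaleV (c - of_int n0) w}" by (rule Y.affine_sl2[OF al PP e(1) f(1) e(2)])
 have i: "ip xi al = - int m - n0" using m by simp
 have "xi (coroot al) = of_int (- int m - n0)" using ip[OF xi al] unfolding i .
 hence C: "st v \<in> {w \<in> M'. cac (coroot al) 0 w = scaleS scaleV (- of_nat m - of_int n0) w}"
  using st_weight[OF v(1) v(2)[OF coroot_h[OF al]] coroot_h[OF al]] s by simp
 show "(cac e n0 ^^ Suc m) (st v) \<in> M'" by (rule Y.act_pow_M[OF PP(1) e(1) s])
 show "(cac e n0 ^^ Suc m) (st v) 0 = 0" unfolding eval_pow[OF P_e e(1) s] using em by (simp add: st_def)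
 show "cac f (- n0) ((cac e n0 ^^ Suc m) (st v)) = 0"
  using S.lowest_e_pow[OF C f_st[OF v(1)], of "Suc m"] by (simp del: funpow.simps cact.simps)
qed

lemma st_f:
 assumes v: "v \<in> M" "act x n v = 0" and x: "(- al, n) \<in> P" "x \<in> root_space (- al)"
 shows "cac x n (st v) = 0"
proof (rule coind_zero)
 note s = st_M'[OF v(1)]
 have P: "(- al, - n0) \<in> P'" "(- al, n) \<in> P'" using x(1) by simp_all
 show "cac x n (st v) \<in> M'" by (rule Y.act_M[OF P(2) x(2) s])
 show "cac x n (st v) 0 = 0" unfolding cact_0[OF x s] using v(2) by (simp add: st_def)
 have "cac 0 (- n0 + n) (st v) = 0" by (rule Y.act_zero_left[OF s])
 thus "cac f (- n0) (cac x n (st v)) = 0" unfolding Y.comm[OF P f(1) x(2) s] bracket_ff[OF x(2)] cen_ff[OF x(2)] f_st[OF v(1)] Y.act_0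
  by (simp only: Y.V.scale_zero_left add_0_right)
qed

lemma st_h:
 assumes v: "v \<in> M" "act H n v = 0" and H: "(0, n) \<in> P" "H \<in> h"
  and k: "!!x. x \<in> root_space (- al) ==> cac x (- n0 + n) (st v) = 0"
 shows "cac H n (st v) = 0"
proof (rule coind_zero)
 note s = st_M'[OF v(1)]
 have H0: "H \<in> root_space 0" using H by (simp add: root_space_0)
 have P: "(- al, - n0) \<in> P'" "(0, n) \<in> P'" using H(1) by simp_all
 show "cac H n (st v) \<in> M'" by (rule Y.act_M[OF P(2) H0 s])
 show "cac H n (st v) 0 = 0" unfolding cact_0[OF H(1) H0 s] using v(2) by (simp add: st_def)
 have "cac (bracket f H) (- n0 + n) (st v) = 0" using root_space_bracket[OF f(1) H0] by (intro k) simp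
 moreover have "cen (f, - n0) (H, n) = 0" using kap_orthogonal[OF f(1) H0 rootD(1)[OF mal] zero_WT] rootD(2)[OF mal] by (simp add: cen_def)
 ultimately show "cac f (- n0) (cac H n (st v)) = 0"
  unfolding Y.comm[OF P f(1) H0 s] f_st[OF v(1)] Y.act_0 by (simp only: Y.V.scale_zero_left add_0_right)
qed

section \<open>Extending a bound from \<open>P\<close> to \<open>P'\<close> and returning to the
  original module\<close>

abbreviation fcl :: "(nat => 'v) => 'g wt => int => 'g wt => int => (nat => 'v) => bool" where
 "fcl ph' xi' N' == cl (scaleS scaleV) cac {(- al, - n0)} (ug (scaleS scaleV) cac P ph' xi' N')"

lemma ug_fcl:
 assumes ph': "ph' \<in> M'"
 shows "Y.U ph' xi' N' nu N w ==> fcl ph' xi' N' nu N w"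
proof (induction rule: ug.induct)
 case (ug_act nu N v bt n x)
 have D: "fcl ph' xi' N' (nu + bt) (N + n) (cac x n w)"
  if w: "ug (scaleS scaleV) cac P ph' xi' N' nu N w" and x: "(bt, n) \<in> P'" "x \<in> root_space bt" for nu N w bt n x
 proof (cases "(bt, n) \<in> P")
  case True
  show ?thesis by (rule cl.cl_base, rule ug.ug_act[OF w True x(2)])
 next case False
  show ?thesis by (rule cl.cl_act[OF _ _ x(2)], rule cl.cl_base, rule w) (use x False in blast)
 qed
 have M: "w \<in> M'" if "ug (scaleS scaleV) cac P ph' xi' N' nu N w" for nu N w using Y.U_M[OF ug_mono[OF that] ph'] by blast
 have "\<forall>bt n x. (bt, n) \<in> P' \<union> {(- al, - n0)} --> x \<in> root_space bt --> fcl ph' xi' N' (nu + bt) (N + n) (cac x n v)"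
  by (rule conjunct2[OF Y.cl_letter[OF _ order_refl UnI1[OF P'_closed] M D ug_act.IH]]) auto
 hence "fcl ph' xi' N' (nu + bt) (N + n) (cac x n v)" using ug_act.hyps by blast
 thus ?case .
qed (rule cl.intros; (assumption | rule ug.ug_base))+

text \<open>If the last letter applied is \<open>f\<close>, its argument has the weight raised by
  \<open>al\<close>, so it is dominant for \<open>(al, n0)\<close> as well and has strictly smaller
  excess. By induction it comes from \<open>P\<close>, and by the bound it vanishes.\<close>

lemma fcl_dominant:
 assumes bnd: "bounded (scaleS scaleV) cac P ph' xi' N'"
 shows "fcl ph' xi' N' nu N w ==> nu \<in> intw ==> ip nu al + n0 \<ge> 0 ==> Exc nu N \<le> Exc xi' N' ==>
  ug (scaleS scaleV) cac P ph' xi' N' nu N w"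
proof (induction rule: cl.induct)
 case (cl_act nu N w bt n x)
 hence b: "nu + bt = nu - al" "N + n = N - n0" by simp_all
 note prems = cl_act.prems[unfolded b]
 have nu: "nu \<in> intw" using intw_add[OF prems(1) roots_intw[OF al]] by (simp only: diff_add_cancel)
 have "ip (nu - al) al = ip nu al - 2" using ip_diff[OF nu roots_intw[OF al] al] ip_self[OF al] by simp
 moreover have "Exc (nu - al) (N - n0) = Exc nu N + of_int (ip nu al - 1 + n0)"
  using Exc_plus_mult[OF nu al, of "- 1" "N - n0"] Exc_shift[of nu N] by (simp add: plus_mult_simps)
 ultimately have i: "ip nu al + n0 \<ge> 0" "Exc nu N < Exc xi' N'" using prems(2,3) by linarith+
 hence "w = 0" using boundedD[OF bnd cl_act.IH[OF nu i(1)] i(2)] by simp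
 hence "ug (scaleS scaleV) cac P ph' xi' N' (nu + bt) (N + n) (cac x n w)" by (simp only: Y.act_0 ug.ug_zero)
 thus ?case .
qed (auto intro: ug.intros)

lemma transfer:
 assumes v: "v \<in> M" "!!H. H \<in> h ==> act H 0 v = scaleV (xi H) v" and xi: "xi \<in> intw" and m: "ip xi al + n0 = - int m"
  and e: "e \<in> root_space al" "bracket e f = coroot al"
  and bnd: "bounded (scaleS scaleV) cac P ((cac e n0 ^^ m) (st v)) (plus_mult xi (int m) al) (N0 + int m * n0)"
 shows "bounded scaleV act P v xi N0"
proof -
 define ph' xi' N' where "ph' = (cac e n0 ^^ m) (st v)" and "xi' = plus_mult xi (int m) al" and "N' = N0 + int m * n0"
 have PP: "(al, n0) \<in> P'" "(- al, - n0) \<in> P'" "(0, 0) \<in> P'" using P_e P_h by simp_all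
 note s = st_M'[OF v(1)]
 have ph'M: "ph' \<in> M'" unfolding ph'_def by (rule Y.act_pow_M[OF PP(1) e(1) s])
 note wt = st_weight[OF v(1) v(2)]
 have ph'U: "Y.U (st v) xi N0 xi' N' ph'" unfolding ph'_def xi'_def N'_def by (rule Y.U_pow[OF ug.ug_base PP(1) e(1)])
 have wt': "cac H 0 ph' = scaleS scaleV (xi' H) ph'" if "H \<in> h" for H by (rule Y.U_weight[OF PP(3) s wt that ph'U])
 have xi': "xi' \<in> intw" unfolding xi'_def by (rule plus_mult_intw[OF xi al])
 interpret S: sl2_weights "scaleS scaleV" "cac e n0" "cac f (- n0)"
   "%c. {w \<in> M'. cac (coroot al) 0 w = scaleS scaleV (c - of_int n0) w}" by (rule Y.affine_sl2[OF al PP e(1) f(1) e(2)])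
 have i: "ip xi al = - int m - n0" using m by simp
 have "xi (coroot al) = of_int (- int m - n0)" using ip[OF xi al] unfolding i .
 hence C: "st v \<in> {w \<in> M'. cac (coroot al) 0 w = scaleS scaleV (- of_nat m - of_int n0) w}"
  using wt[OF coroot_h[OF al] coroot_h[OF al]] s by simp
 have "j \<le> m ==> \<exists>c. c ~= 0 & (cac f (- n0) ^^ j) ph' = scaleS scaleV c ((cac e n0 ^^ (m - j)) (st v))" for j
 proof (induction j)
  case 0
  show ?case by (rule exI[of _ 1]) (simp add: ph'_def)
 next case (Suc j)
  then obtain c where c: "c ~= 0" "(cac f (- n0) ^^ j) ph' = scaleS scaleV c ((cac e n0 ^^ (m - j)) (st v))" by auto
  \<comment> \<open>The coefficient of one step down the string. It equals
    \<open>(m - j) * (j + 1)\<close>, nonzero for \<open>j < m\<close>, so \<open>m\<close> steps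
    lead back to \<open>st v\<close>.\<close>
  define d where "d = - of_nat (m - j) * (- of_nat m + of_nat (m - j) - 1 :: complex)"
  have d: "d = of_nat ((m - j) * (j + 1))"
  proof -
   obtain k where k: "m = j + k" using Suc.prems le_Suc_ex Suc_leD by blast
   show ?thesis unfolding d_def k by (simp add: algebra_simps)
  qed
  have "cac f (- n0) ((cac e n0 ^^ (m - j)) (st v)) = scaleS scaleV d ((cac e n0 ^^ (m - j - 1)) (st v))"
   unfolding d_def by (rule S.lowest_e_pow[OF C f_st[OF v(1)]])
  hence "(cac f (- n0) ^^ Suc j) ph' = scaleS scaleV (c * d) ((cac e n0 ^^ (m - Suc j)) (st v))"
   unfolding funpow.simps comp_apply c(2) Y.act_scale by (simp add: Y.V.scale_scale)
  moreover have "c * d ~= 0" unfolding d mult_eq_0_iff of_nat_eq_0_iff using c(1) Suc.prems by simp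
  ultimately show ?case by blast
 qed
 from this[of m] obtain c where c: "c ~= 0" "(cac f (- n0) ^^ m) ph' = scaleS scaleV c (st v)" by auto
 have nil: "(cac f (- n0) ^^ Suc m) ph' = 0" unfolding funpow.simps comp_apply c(2) Y.act_scale f_st[OF v(1)] by simp
 have st_U: "Y.U ph' xi' N' xi N0 (st v)"
 proof -
  have "Y.U ph' xi' N' (plus_mult xi' (int m) (- al)) (N' + int m * (- n0)) ((cac f (- n0) ^^ m) ph')"
   by (rule Y.U_pow[OF ug.ug_base PP(2) f(1)])
  hence "Y.U ph' xi' N' xi N0 (scaleS scaleV c (st v))" unfolding c(2) by (simp add: xi'_def N'_def plus_mult_simps)
  from ug.ug_scale[OF this, of "1 / c"] show ?thesis using c(1) by simp
 qed
 have E: "Exc xi' N' = Exc xi N0" unfolding xi'_def N'_def by (rule Exc_reflect[OF xi al]) (use m in simp)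
 note bnd' = bnd[folded ph'_def xi'_def N'_def]
 have dom: "ug (scaleS scaleV) cac P ph' xi' N' nu N W"
  if "Y.U ph' xi' N' nu N W" "nu \<in> intw" "ip nu al + n0 \<ge> 0" "Exc nu N \<le> Exc xi' N'" for nu N W
  by (rule fcl_dominant[OF bnd' ug_fcl[OF ph'M that(1)] that(2-4)])
 have neg: "Y.U ph' xi' N' (plus_mult nu (int p) al) (N + int p * n0) ((cac e n0 ^^ p) W)"
   "(cac e n0 ^^ p) W = 0 ==> W = 0" "Exc (plus_mult nu (int p) al) (N + int p * n0) = Exc nu N"
   "ip (plus_mult nu (int p) al) al + n0 \<ge> 0"
  if W: "Y.U ph' xi' N' nu N W" "nu \<in> intw" and p: "ip nu al + n0 = - int p" for nu N W p
 proof -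
  note WM = Y.U_M[OF W(1) ph'M]
  show "Y.U ph' xi' N' (plus_mult nu (int p) al) (N + int p * n0) ((cac e n0 ^^ p) W)" by (rule Y.U_pow[OF W(1) PP(1) e(1)])
  obtain t where t: "(cac f (- n0) ^^ t) W = 0" using Y.U_nilpotent[OF mal PP(2) f(1) ph'M nil W(1)] by blast
  have H: "cac (coroot al) 0 W = scaleS scaleV (of_int (ip nu al)) W"
   unfolding ip[OF W(2) al, symmetric] by (rule Y.U_weight[OF PP(3) ph'M wt' coroot_h[OF al] W(1)])
  show "(cac e n0 ^^ p) W = 0 ==> W = 0" by (rule Y.affine_injective[OF al PP e(1) f(1) e(2) WM H p t])
  show "Exc (plus_mult nu (int p) al) (N + int p * n0) = Exc nu N" by (rule Exc_reflect[OF W(2) al]) (use p in simp)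
  show "ip (plus_mult nu (int p) al) al + n0 \<ge> 0" using p by (simp add: ip_plus_mult W(2) al ip_self)
 qed
 have U0: "W = 0" if W: "Y.U ph' xi' N' nu N W" and ex: "Exc nu N < Exc xi' N'" for nu N W
 proof (rule ccontr)
  assume nz: "W ~= 0"
  have nu: "nu \<in> intw" by (rule Y.U_intw[OF W nz xi'])
  show False
  proof (cases "ip nu al + n0 \<ge> 0")
   case True
   thus False using boundedD[OF bnd' dom[OF W nu True] ex] ex nz by simp
  next case False
   then obtain p where p: "ip nu al + n0 = - int p" by (metis int_cases nle_le of_nat_0_le_iff)
   note n = neg[OF W nu p]
   show False using boundedD[OF bnd' dom[OF n(1) plus_mult_intw[OF nu al] n(4)]] n(2,3) ex nz by simp
  qed
 qed
 have U1: "\<exists>z. \<forall>W. Y.U ph' xi' N' nu N W --> (\<exists>c. W = scaleS scaleV c z)" if ex: "Exc nu N = Exc xi' N'" for nu N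
 proof (cases "nu \<in> intw")
  case False
  thus ?thesis using Y.U_intw[OF _ _ xi'] Y.V.scale_zero_right by metis
 next case nu: True
  show ?thesis
  proof (cases "ip nu al + n0 \<ge> 0")
   case True
   obtain z where "!!W. ug (scaleS scaleV) cac P ph' xi' N' nu N W ==> \<exists>c. W = scaleS scaleV c z"
    using bnd' ex unfolding bounded_def by metis
   thus ?thesis using dom[OF _ nu True] ex by (intro exI[of _ z]) simp
  next case False
   then obtain p where p: "ip nu al + n0 = - int p" by (metis int_cases nle_le of_nat_0_le_iff)
   note n = neg[OF _ nu p]
   have ex': "Exc (plus_mult nu (int p) al) (N + int p * n0) = Exc xi' N'" using Exc_reflect[OF nu al, of "int p" n0 N] p ex by simp
   obtain z where z: "!!W. ug (scaleS scaleV) cac P ph' xi' N' (plus_mult nu (int p) al) (N + int p * n0) W ==> \<exists>c. W = scaleS scaleV c z"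
    using bnd' ex' unfolding bounded_def by metis
   show ?thesis
   proof (rule ug_line[OF Y.V.vector_space_axioms Y.V.vector_space_axioms, where F = "cac e n0 ^^ p" and z = z])
    fix W assume W: "Y.U ph' xi' N' nu N W"
    show "(cac e n0 ^^ p) W = 0 ==> W = 0" by (rule n(2)[OF W])
    show "\<exists>c. (cac e n0 ^^ p) W = scaleS scaleV c z"
     by (rule z[OF dom[OF n(1)[OF W] plus_mult_intw[OF nu al] n(4)[OF W]]]) (simp add: ex')
   qed (rule Y.act_pow_lin)+
  qed
 qed
 have lift: "\<exists>W. Y.U ph' xi' N' nu N W & W 0 = w" if w: "ug scaleV act P v xi N0 nu N w" for nu N w
 proof -
  obtain W where W: "ug (scaleS scaleV) cac P (st v) xi N0 nu N W" "W 0 = w" using eval_ug[OF v(1) w] by blast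
  have "Y.U (st v) xi N0 nu N W" by (rule ug_mono[OF W(1)]) blast
  from ug_trans[OF this st_U] show ?thesis using W(2) by blast
 qed
 show ?thesis unfolding bounded_def
 proof (intro conjI allI impI)
  show "w = 0" if w: "ug scaleV act P v xi N0 nu N w" "Exc nu N < Exc xi N0" for nu N w
  proof -
   obtain W where W: "Y.U ph' xi' N' nu N W" "W 0 = w" using lift[OF w(1)] by blast
   have "W = 0" by (rule U0[OF W(1)]) (use w(2) E in simp)
   thus ?thesis using W(2) by simp
  qed
  fix nu N assume "Exc nu N = Exc xi N0"
  then obtain z where z: "!!W. Y.U ph' xi' N' nu N W ==> \<exists>c. W = scaleS scaleV c z" using U1 E by metis
  have "\<exists>c. w = scaleV c (z 0)" if w: "ug scaleV act P v xi N0 nu N w" for w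
  proof -
   obtain W where W: "Y.U ph' xi' N' nu N W" "W 0 = w" using lift[OF w] by blast
   obtain c where "W = scaleS scaleV c z" using z[OF W(1)] by blast
   hence "w = scaleV c (z 0)" using W(2) by (simp add: scaleS_def)
   thus ?thesis by blast
  qed
  thus "\<exists>z. \<forall>w. ug scaleV act P v xi N0 nu N w --> (\<exists>c. w = scaleV c z)" by blast
 qed
qed

end

section \<open>The bound in rank one\<close>

text \<open>Sequences of sequences are packed into sequences, so that the inductions below can pass to
  coinduced modules without leaving the type.\<close>

definition pk :: "(nat => nat => 'w) => nat => 'w" where
 "pk s = (%k. s (fst (prod_decode k)) (snd (prod_decode k)))"

definition upk :: "(nat => 'w) => nat => nat => 'w" where
 "upk t = (%j i. t (prod_encode (j, i)))"

lemma pk_lin: "pk (x + y) = pk x + pk y" "pk (scaleS (scaleS s) c z) = scaleS s c (pk z)"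
  "upk (pk w) = w" "pk (upk v) = v" by (simp_all add: pk_def upk_def scaleS_def fun_eq_iff)

context ade
begin

abbreviation pact :: "('g => int => (nat => nat => 'w) => nat => nat => 'w) => 'g => int => (nat => 'w) => nat => 'w" where
 "pact act == %x n y. pk (act x n (upk y))"

abbreviation lm :: "(complex => 'v::ab_group_add => 'v) => ('g wt \<times> int) set => 'v set => ('g => int => 'v => 'v) => bool" where
 "lm == lmod scale bracket h b Basis form"

lemma packed:
 assumes s: "vector_space s" and l: "lm (scaleS (scaleS s)) P M act"
 shows "lm (scaleS s) P (pk ` M) (pact act)"
  "bounded (scaleS s) (pact act) P (pk v) xi N0 ==> bounded (scaleS (scaleS s)) act P v xi N0"
  "(pact act x n ^^ k) (pk w) = pk ((act x n ^^ k) w)" "pk w = 0 \<longleftrightarrow> w = 0"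
proof -
 interpret l: lmod scale bracket h b Basis form "scaleS (scaleS s)" P M act by (rule l)
 note t = l.transport[OF vector_space_scaleS[OF s] pk_lin]
 show "lm (scaleS s) P (pk ` M) (pact act)" by (rule t(1))
 show "bounded (scaleS s) (pact act) P (pk v) xi N0 ==> bounded (scaleS (scaleS s)) act P v xi N0" by (rule t(2))
 show "(pact act x n ^^ k) (pk w) = pk ((act x n ^^ k) w)" by (rule t(3))
 have "pk 0 = (0 :: nat => 'a)" by (simp add: pk_def fun_eq_iff)
 thus "pk w = 0 \<longleftrightarrow> w = 0" using pk_lin(3)[of w] pk_lin(3)[of 0] by metis
qed

end

lemma (in lmod) bounded_trivial:
 assumes v: "v \<in> M" and k: "!!bt n x. (bt, n) \<in> P ==> x \<in> root_space bt ==> act x n v = 0 \<or> bt = 0 & n = 0 & (\<exists>c. act x n v = scaleV c v)"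
 shows "bounded scaleV act P v xi N0"
proof -
 have *: "w = 0 \<or> nu = xi & N = N0 & (\<exists>c. w = scaleV c v)" if "U v xi N0 nu N w" for nu N w
 proof -
  have "ug scaleV act {} v xi N0 nu N w"
  proof (rule U_restrict[OF _ v _ that])
   fix ga j x assume "(ga, j) \<in> P" "x \<in> root_space ga"
   thus "ug scaleV act {} v xi N0 (xi + ga) (N0 + j) (act x j v)" using k[of ga j x] by (auto intro: ug.ug_zero ug.ug_scale[OF ug.ug_base])
  qed simp
  thus ?thesis
  proof (induction rule: ug.induct)
   case ug_base
   show ?case by (intro disjI2 conjI refl exI[of _ 1]) simp
  next case (ug_add nu N v' w)
   thus ?case by (metis V.scale_left_distrib add_0_right add_0_left)
  next case (ug_scale nu N w c)
   thus ?case by (metis V.scale_scale V.scale_zero_right)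
  qed auto
 qed
 show ?thesis unfolding bounded_def using * V.scale_zero_left by (metis order_less_irrefl)
qed

context ade
begin

lemma cen_root: "x \<in> root_space bt ==> y \<in> root_space ga ==> bt \<in> WT ==> ga \<in> WT ==> bt + ga ~= 0 ==> cen (x, m) (y, n) = 0"
 using kap_orthogonal by (simp add: cen_def)

text \<open>The induction alternates between the two simple affine roots of the rank one part,
  \<open>(al, n0)\<close> and \<open>(- al, 1 - n0)\<close>. In the step the first pairs with
  \<open>xi\<close> to \<open>- (m + 1)\<close>; after reflection in it the second pairs with the
  new weight to \<open>- m\<close>. The hypotheses for the reflected generator hold because all
  weights of the module of \<open>st v\<close> are of the form \<open>xi + j al\<close> with
  \<open>j >= 0\<close>.\<close>

lemma rank_one:
 fixes s :: "complex => 'w::ab_group_add => 'w"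
 assumes s: "vector_space s"
 shows "lm (scaleS s) (PE al n0) M act ==> al \<in> roots ==> v \<in> M ==> xi \<in> intw ==> ip xi al + n0 = - int m ==>
  (!!H. H \<in> h ==> act H 0 v = scaleS s (xi H) v) ==>
  (!!x n. x \<in> root_space (- al) ==> n \<ge> 1 - n0 ==> act x n v = 0) ==>
  (!!H n. H \<in> h ==> n \<ge> 1 ==> act H n v = 0) ==>
  e \<in> root_space al ==> e ~= 0 ==> (act e n0 ^^ Suc m) v = 0 ==> bounded (scaleS s) act (PE al n0) v xi N0"
proof (induction m arbitrary: al n0 M act v xi N0 e)
 case 0
 note al = 0(2) and vM = 0(3)
 interpret l: lmod scale bracket h b Basis form "scaleS s" "PE al n0" M act by (rule 0(1))
 have e0: "act x n0 v = 0" if x: "x \<in> root_space al" for x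
 proof -
  obtain c where x: "x = scale c e" by (rule root_space_line[OF al 0(9,10) x])
  have "act e n0 v = 0" by (rule trans[OF _ 0(11)]) simp
  thus ?thesis unfolding x using l.act_scale_left[OF _ 0(9) vM] by (simp add: PE_def)
 qed
 have e: "act x n v = 0" if x: "x \<in> root_space al" and n: "n \<ge> n0" for x n
 proof (cases "n = n0")
  case True
  show ?thesis unfolding True by (rule e0[OF x])
 next case False
  \<comment> \<open>Higher degrees reduce to \<open>n0\<close>: the coroot at degree
    \<open>n - n0\<close> bracketed with \<open>x\<close> at degree \<open>n0\<close> is twice
    \<open>x\<close> at degree \<open>n\<close>.\<close>
  note H = coroot_h[OF al] coroot_2[OF al]
  have H0: "coroot al \<in> root_space 0" using H by (simp add: root_space_0)
  have P: "(0, n - n0) \<in> PE al n0" "(al, n0) \<in> PE al n0" "(al, n) \<in> PE al n0" using n by (simp_all add: PE_def)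
  have "act (coroot al) (n - n0) (act x n0 v) = act x n0 (act (coroot al) (n - n0) v)
    + act (bracket (coroot al) x) (n - n0 + n0) v + scaleS s (cen (coroot al, n - n0) (x, n0)) v" by (rule l.comm[OF P(1,2) H0 x vM])
  moreover note e0[OF x]
  moreover have "act (coroot al) (n - n0) v = 0" by (rule 0(8)[OF H(1)]) (use n False in simp)
  moreover have "cen (coroot al, n - n0) (x, n0) = 0" using cen_root[OF H0 x zero_WT rootD(1)[OF al]] rootD(2)[OF al] by simp
  moreover have "bracket (coroot al) x = scale 2 x" using x H by (simp add: root_space_def)
  ultimately have "scaleS s 2 (act x n v) = 0" using l.act_scale_left[OF P(3) x vM, of 2] by (simp add: l.act_0)
  thus ?thesis by simp
 qed
 show ?case
 proof (rule l.bounded_trivial[OF vM])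
  fix bt n x assume b: "(bt, n) \<in> PE al n0" and x: "x \<in> root_space bt"
  then consider "bt = al" "n \<ge> n0" | "bt = - al" "n \<ge> 1 - n0" | "bt = 0" "n = 0" | "bt = 0" "n \<ge> 1" by (force simp: PE_def)
  thus "act x n v = 0 \<or> bt = 0 & n = 0 & (\<exists>c. act x n v = scaleS s c v)"
  proof cases
   case 1
   show ?thesis by (rule disjI1[OF e[OF x[unfolded 1(1)] 1(2)]])
  next case 2
   show ?thesis by (rule disjI1[OF 0(7)[OF x[unfolded 2(1)] 2(2)]])
  next case 3
   have "act x n v = scaleS s (xi x) v" unfolding 3 by (rule 0(6)) (use x 3 root_space_0 in simp)
   thus ?thesis using 3 by blast
  next case 4
   show ?thesis by (rule disjI1[OF 0(8)[OF _ 4(2)]]) (use x 4 root_space_0 in simp)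
  qed
 qed
next case (Suc m)
 note al = Suc.prems(2) and vM = Suc.prems(3) and xi = Suc.prems(4) and w = Suc.prems(5) and wt = Suc.prems(6)
  and kf = Suc.prems(7) and kh = Suc.prems(8) and e = Suc.prems(9,10) and ke = Suc.prems(11)
 note mal = root_minus[OF al]
 interpret l: lmod scale bracket h b Basis form "scaleS s" "PE al n0" M act by (rule Suc.prems(1))
 obtain f where f: "f \<in> root_space (- al)" "bracket e f = coroot al" "f ~= 0" by (rule root_partner[OF al e])
 note ef = e(1) f
 have fe: "bracket f e = coroot (- al)" using ef(3) bracket_antisym[of f e] by (simp add: coroot_minus al)
 have ne: "al ~= 0" "- al ~= al" "- al ~= 0" "- al + - al \<notin> WT"
  using rootD(2)[OF al] root_neq_minus[OF al] rootD(2)[OF mal] WT_double[OF mal] by blast+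
 interpret c: coind scale bracket h b Basis form "scaleS s" "PE al n0" M act al n0 f
 proof unfold_locales
  show "(- al, - n0) \<notin> PE al n0" using ne by (simp add: PE_def)
  show "(bt - al, n - n0) \<in> insert (- al, - n0) (PE al n0)" if "(bt, n) \<in> PE al n0" "bt - al \<in> WT" for bt n
   using that ne(4) by (auto simp: PE_def)
 qed (use al ef in "simp_all add: PE_def")
 interpret Y: lmod scale bracket h b Basis form "scaleS (scaleS s)" c.P' c.M' c.cac by (rule c.lmod_coind)
 let ?ph = "c.st v"
 note phM = c.st_M'[OF vM]
 have PP: "(al, n0) \<in> c.P'" "(- al, - n0) \<in> c.P'" "(0, 0) \<in> c.P'" by (simp_all add: PE_def)
 have st0: "?ph 0 = v" by (simp add: c.st_def)
 have A1: "c.cac x n ?ph = 0" if x: "x \<in> root_space (- al)" "n \<ge> 1 - n0" for x n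
  by (rule c.st_f[OF vM kf[OF x] _ x(1)]) (use x in "simp add: PE_def")
 have A2: "c.cac H n ?ph = 0" if H: "H \<in> h" "n \<ge> 1" for H n
  by (rule c.st_h[OF vM kh[OF H] _ H(1) A1]) (use H in "simp_all add: PE_def")
 have A3: "(c.cac e n0 ^^ Suc (Suc m)) ?ph = 0" by (rule c.e_pow_st[OF vM wt xi w ef(1,3) ke])
 define Q where "Q = {(bt, n). bt = al & n \<ge> n0}"
 have only: "W = 0 \<or> (\<exists>j. nu = plus_mult xi (int j) al & (j = 0 --> N = N0))" if U: "Y.U ?ph xi N0 nu N W" for nu N W
 proof -
  have "ug (scaleS (scaleS s)) c.cac Q ?ph xi N0 nu N W"
  proof (rule Y.U_restrict[OF _ phM _ U])
   show "Q <= c.P'" by (auto simp: Q_def PE_def)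
   fix ga k x assume g: "(ga, k) \<in> c.P'" "(ga, k) \<notin> Q" "x \<in> root_space ga"
   consider "ga = - al" "k = - n0" | "ga = - al" "k \<ge> 1 - n0" | "ga = 0" "k = 0" | "ga = 0" "k \<ge> 1"
    using g(1,2) by (force simp: Q_def PE_def)
   thus "ug (scaleS (scaleS s)) c.cac Q ?ph xi N0 (xi + ga) (N0 + k) (c.cac x k ?ph)"
   proof cases
    case 1
    have x: "x \<in> root_space (- al)" using g(3) unfolding 1(1) .
    have "c.cac x k ?ph = scaleS (scaleS s) (c.cf x) (c.cac f (- n0) ?ph)"
     unfolding 1(2) using Y.act_scale_left[OF PP(2) ef(2) phM, of "c.cf x"] by (simp only: c.cf[OF x, symmetric])
    hence "c.cac x k ?ph = 0" unfolding c.f_st[OF vM] by (simp only: Y.V.scale_zero_right)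
    thus ?thesis by (simp only: ug.ug_zero)
   next case 2
    have "c.cac x k ?ph = 0" by (rule A1[OF g(3)[unfolded 2(1)] 2(2)])
    thus ?thesis by (simp only: ug.ug_zero)
   next case 3
    have "x \<in> h" using g(3) 3 root_space_0 by simp
    hence e: "c.cac x k ?ph = scaleS (scaleS s) (xi x) ?ph" unfolding 3(2) by (intro c.st_weight[OF vM wt])
    show ?thesis unfolding 3 e[unfolded 3] add_0_right by (intro ug.ug_scale ug.ug_base)
   next case 4
    have "c.cac x k ?ph = 0" using A2[OF _ 4(2)] g(3) 4(1) root_space_0 by simp
    thus ?thesis by (simp only: ug.ug_zero)
   qed
  qed
  thus ?thesis
  proof (induction rule: ug.induct)
   case ug_base
   show ?case by (intro disjI2 exI[of _ 0]) (simp add: plus_mult_simps)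
  next case (ug_add nu N V W)
   thus ?case by (cases "V = 0") auto
  next case (ug_scale nu N W c)
   thus ?case using Y.V.scale_zero_right by metis
  next case (ug_act nu N W bt n x)
   have "c.cac x n W = 0 \<or> (\<exists>j. nu + bt = plus_mult xi (int j) al & (j = 0 --> N + n = N0))" using ug_act.IH
   proof
    assume W: "W = 0"
    show ?thesis unfolding W by (rule disjI1[OF Y.act_0])
   next
    assume "\<exists>j. nu = plus_mult xi (int j) al & (j = 0 --> N = N0)"
    then obtain j where "nu = plus_mult xi (int j) al" by blast
    moreover have "bt = al" using ug_act.hyps(2) by (simp add: Q_def)
    ultimately have "nu + bt = plus_mult xi (int (Suc j)) al" by (simp only: plus_mult_simps(4) of_nat_Suc add.commute[of 1])
    thus ?thesis by blast
   qed
   thus ?case .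
  qed simp
 qed
 define ph' xi' N' where "ph' = (c.cac e n0 ^^ Suc m) ?ph" and "xi' = plus_mult xi (int (Suc m)) al" and "N' = N0 + int (Suc m) * n0"
 note wtph = c.st_weight[OF vM wt]
 have ph'U: "Y.U ?ph xi N0 xi' N' ph'" unfolding ph'_def xi'_def N'_def by (rule Y.U_pow[OF ug.ug_base PP(1) ef(1)])
 note ph'M = Y.U_M[OF ph'U phM]
 have xi': "xi' \<in> intw" unfolding xi'_def by (rule plus_mult_intw[OF xi al])
 have ixi': "ip xi' al + n0 = int (Suc m)" using w by (simp add: xi'_def ip_plus_mult xi al ip_self)
 have inj_pm: "i = j" if "plus_mult xi i al = plus_mult xi j al" for i j
 proof -
  have "plus_mult xi i al (coroot al) = plus_mult xi j al (coroot al)" using that by simp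
  thus ?thesis using coroot_2[OF al] by (simp add: plus_mult_def)
 qed
  text \<open>A vector whose reflection has a weight or degree excluded by \<open>only\<close> vanishes.\<close>
 have vanish: "W = 0" if U: "Y.U ?ph xi N0 (plus_mult xi a al) N W" and p: "ip (plus_mult xi a al) al + n0 = int p"
   and a: "a < int p \<or> a = int p & N ~= N0 + int p * n0" for a N W p
 proof -
  have wa: "plus_mult xi a al \<in> intw" by (rule plus_mult_intw[OF xi al])
  have "Y.U ?ph xi N0 (plus_mult (plus_mult xi a al) (int p) (- al)) (N + int p * (- n0)) ((c.cac f (- n0) ^^ p) W)"
   by (rule Y.U_pow[OF U PP(2) ef(2)])
  hence "Y.U ?ph xi N0 (plus_mult xi (a - int p) al) (N - int p * n0) ((c.cac f (- n0) ^^ p) W)" by (simp add: plus_mult_simps)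
  hence "(c.cac f (- n0) ^^ p) W = 0 \<or> (\<exists>j. a - int p = int j & (j = 0 --> N - int p * n0 = N0))" using only inj_pm by metis
  hence z: "(c.cac f (- n0) ^^ p) W = 0" using a by auto
  obtain t where t: "(c.cac e n0 ^^ t) W = 0" using Y.U_nilpotent[OF al PP(1) ef(1) phM A3 U] by blast
  have H: "c.cac (coroot (- al)) 0 W = scaleS (scaleS s) (of_int (ip (plus_mult xi a al) (- al))) W"
   unfolding ip[OF wa mal, symmetric] by (rule Y.U_weight[OF PP(3) phM wtph coroot_h[OF mal] U])
  show ?thesis using Y.affine_injective[of "- al" "- n0" f e W _ p t, OF mal PP(2) _ PP(3) ef(2) _ fe Y.U_M[OF U phM] H] PP(1) ef(1) p t z
   by (simp add: ip_coroot_minus wa al)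
 qed
 have B1: "c.cac x n ph' = 0" if x: "x \<in> root_space al" "n \<ge> n0" for x n
 proof (rule vanish)
  have "Y.U ?ph xi N0 (xi' + al) (N' + n) (c.cac x n ph')" by (rule ug.ug_act[OF ph'U _ x(1)]) (use x(2) in "simp add: PE_def")
  thus "Y.U ?ph xi N0 (plus_mult xi (int (Suc m) + 1) al) (N' + n) (c.cac x n ph')" by (simp only: xi'_def plus_mult_simps(4))
  show "ip (plus_mult xi (int (Suc m) + 1) al) al + n0 = int (m + 3)" using w by (simp add: ip_plus_mult xi al ip_self)
 qed simp
 have B2: "c.cac H n ph' = 0" if H: "H \<in> h" "n \<ge> 1" for H n
 proof (rule vanish)
  have "Y.U ?ph xi N0 (xi' + 0) (N' + n) (c.cac H n ph')" by (rule ug.ug_act[OF ph'U]) (use H in "simp_all add: PE_def root_space_0")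
  thus "Y.U ?ph xi N0 (plus_mult xi (int (Suc m)) al) (N' + n) (c.cac H n ph')" by (simp only: xi'_def add_0_right)
  show "ip (plus_mult xi (int (Suc m)) al) al + n0 = int (Suc m)" using ixi' by (simp only: xi'_def)
 qed (use H(2) in "simp add: N'_def")
 \<comment> \<open>These \<open>m + 1\<close> letters return to the weight \<open>xi\<close>, but in
   degree \<open>N0 + m + 1\<close>, where \<open>only\<close> leaves nothing but 0.\<close>
 have B3: "(c.cac f (1 - n0) ^^ Suc m) ph' = 0"
 proof -
  have "Y.U ?ph xi N0 (plus_mult xi' (int (Suc m)) (- al)) (N' + int (Suc m) * (1 - n0)) ((c.cac f (1 - n0) ^^ Suc m) ph')"
   by (rule Y.U_pow[OF ph'U _ f(1)]) (simp add: PE_def)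
  moreover have "plus_mult xi' (int (Suc m)) (- al) = plus_mult xi 0 al" by (simp add: xi'_def plus_mult_simps)
  ultimately have "(c.cac f (1 - n0) ^^ Suc m) ph' = 0 \<or> (\<exists>j. 0 = int j & (j = 0 --> N' + int (Suc m) * (1 - n0) = N0))"
   using only inj_pm by metis
  thus ?thesis by (simp add: N'_def algebra_simps del: funpow.simps)
 qed
 have sub: "PE al n0 <= c.P'" by blast
 have lE: "lm (scaleS (scaleS s)) (PE (- al) (1 - n0)) c.M' c.cac" unfolding PE_swap by (rule Y.lmod_mono[OF sub PE_closed[OF al]])
 note pk = packed[OF s lE]
 have "bounded (scaleS s) (pact c.cac) (PE (- al) (1 - n0)) (pk ph') xi' N'"
 proof (rule Suc.IH[OF pk(1) mal imageI[OF ph'M] xi'])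
  show "ip xi' (- al) + (1 - n0) = - int m" using ixi' by (simp add: ip_coroot_minus xi' al)
  show "pact c.cac H 0 (pk ph') = scaleS s (xi' H) (pk ph')" if "H \<in> h" for H
   using Y.U_weight[OF PP(3) phM wtph that ph'U] by (simp only: pk_lin)
  show "pact c.cac x n (pk ph') = 0" if "x \<in> root_space (- (- al))" "n \<ge> 1 - (1 - n0)" for x n
   using B1[of x n] that pk(4) by (simp add: pk_lin del: c.cact.simps)
  show "pact c.cac H n (pk ph') = 0" if "H \<in> h" "n \<ge> 1" for H n using B2[OF that] pk(4) by (simp only: pk_lin)
  show "(pact c.cac f (1 - n0) ^^ Suc m) (pk ph') = 0" unfolding pk(3) B3 by (simp only: pk(4))
 qed (rule f)+
 from pk(2)[OF this] have bd: "bounded (scaleS (scaleS s)) c.cac (PE al n0) ph' xi' N'" unfolding PE_swap .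
 show ?case by (rule c.transfer[OF vM wt xi w ef(1,3) bd[unfolded ph'_def xi'_def N'_def]])
qed

end

section \<open>The upper bound\<close>

context lmod
begin

lemma commute_letters:
 assumes P: "(bt, m) \<in> P" "(ga, n) \<in> P" and xy: "x \<in> root_space bt" "y \<in> root_space ga" and s: "bt + ga \<notin> WT" and w: "w \<in> M"
 shows "act x m (act y n w) = act y n (act x m w)" "act x m ((act y n ^^ k) w) = (act y n ^^ k) (act x m w)"
  "(act x m ^^ j) ((act y n ^^ k) w) = (act y n ^^ k) ((act x m ^^ j) w)"
proof -
 note o = P_WT[OF P(1)] P_WT[OF P(2)]
 have "bracket x y = 0" using WT_bracket[OF xy] WT_onh o s by blast
 moreover have "cen (x, m) (y, n) = 0" using cen_root[OF xy o] s zero_WT by metis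
 ultimately have c: "act x m (act y n w) = act y n (act x m w)" if "w \<in> M" for w using comm[OF P xy that] act_zero_left[OF that] by simp
 thus "act x m (act y n w) = act y n (act x m w)" using w by blast
 have cp: "act x m ((act y n ^^ k) w) = (act y n ^^ k) (act x m w)" if "w \<in> M" for w
  by (induction k) (simp_all add: c act_pow_M[OF P(2) xy(2) that])
 thus "act x m ((act y n ^^ k) w) = (act y n ^^ k) (act x m w)" using w by blast
 show "(act x m ^^ j) ((act y n ^^ k) w) = (act y n ^^ k) ((act x m ^^ j) w)" by (induction j) (simp_all add: cp act_pow_M[OF P(1) xy(1) w])
qed

text \<open>In simply laced type adding either root once more to their sum leaves the set of
  weights, so the bracket commutes with both letters.\<close>

lemma heis_letters:
 assumes P: "(bt, m) \<in> P" "(ga, n) \<in> P" and xy: "x \<in> root_space bt" "y \<in> root_space ga"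
  and r: "bt \<in> roots" "ga \<in> roots" "bt + ga \<in> roots"
 shows "heisenberg scaleV M (act x m) (act y n) (act (bracket x y) (m + n))"
proof -
 note z = P_closed[OF P rootD(1)[OF r(3)]] root_space_bracket[OF xy]
 have nw: "de + (de + ep) \<notin> WT" if d: "de \<in> roots" "ep \<in> roots" "de + ep \<in> roots" for de ep
 proof
  have i: "ip de (de + ep) = 1" using ip_coroot_add[OF roots_intw[OF d(1)] d] ip_self[OF d(1)] ip_add_root[OF d] by simp
  assume "de + (de + ep) \<in> WT"
  then consider "de + ep = - de" | "de + (de + ep) \<in> roots" using WT_cases by (metis add_eq_0_iff)
  thus False
  proof cases
   case 1
   show False using i ip_coroot_minus[OF roots_intw[OF d(1)] d(1)] ip_self[OF d(1)] unfolding 1 by simp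
  next case 2
   thus False using i ip_add_root[OF d(1,3)] by simp
  qed
 qed
 have 1: "bt + (bt + ga) \<notin> WT" and 2: "ga + (bt + ga) \<notin> WT"
  using nw[OF r] nw[of ga bt] r unfolding add.commute[of ga bt] by blast+
 have c0: "cen (x, m) (y, n) = 0" using cen_root[OF xy rootD(1)[OF r(1)] rootD(1)[OF r(2)]] rootD(2)[OF r(3)] by simp
 show ?thesis
 proof unfold_locales
  show "act x m (act y n w) = act y n (act x m w) + act (bracket x y) (m + n) w" if "w \<in> M" for w using comm[OF P xy that] c0 by simp
  show "act x m (act (bracket x y) (m + n) w) = act (bracket x y) (m + n) (act x m w)" if "w \<in> M" for w
   by (rule commute_letters(1)[OF P(1) z(1) xy(1) z(2) 1 that])
  show "act y n (act (bracket x y) (m + n) w) = act (bracket x y) (m + n) (act y n w)" if "w \<in> M" for w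
   by (rule commute_letters(1)[OF P(2) z(1) xy(2) z(2) 2 that])
 qed (simp_all add: act_add act_scale act_M[OF P(1) xy(1)] act_M[OF P(2) xy(2)] act_M[OF z])
qed

end

context ade
begin

text \<open>The relations of an extremal vector: a real root vector whose affine pairing with the
  weight is \<open>- k\<close> is killed by its power \<open>k + 1\<close>, and by its first power
  if the pairing is nonnegative. Such relations are known from Demazure modules.\<close>

definition Rel :: "(complex => 'v::ab_group_add => 'v) => ('g => int => 'v => 'v) => 'g wt => 'v => bool" where
 "Rel s act xi v \<longleftrightarrow> (\<forall>H\<in>h. act H 0 v = s (xi H) v) & (\<forall>H\<in>h. \<forall>n\<ge>1. act H n v = 0) &
  (\<forall>bt n x. (bt, n) \<in> Pb --> bt \<in> roots --> x \<in> root_space bt --> (act x n ^^ Suc (nat (- ip xi bt - n))) v = 0)"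

lemma bracket_bracket_line:
 assumes al: "al \<in> roots" and bt: "bt \<in> roots" and e: "e \<in> root_space al" and f: "f \<in> root_space (- al)" and ef: "bracket e f = coroot al"
  and x: "x \<in> root_space bt"
 shows "ip bt al = 1 ==> bracket e (bracket f x) = x" "ip bt al = - 1 ==> bracket f (bracket e x) = x"
proof -
 have H: "bracket (coroot al) x = scale (of_int (ip bt al)) x"
  using x coroot_h[OF al] ip[OF roots_intw[OF bt] al] by (simp add: root_space_def)
 have fe: "bracket f e = - coroot al" using ef bracket_antisym[of f e] by simp
 note z = bracket_not_root[OF _ bt]
 show "bracket e (bracket f x) = x" if i: "ip bt al = 1"
 proof -
  have "al + bt \<notin> roots" "bt ~= - al"
   using i ip_add_root[OF al bt] ip_sym[OF al bt] ip_minus[OF roots_intw[OF al] al] ip_self[OF al] by auto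
  hence "bracket e x = 0" by (intro z[OF al] e x)
  thus ?thesis using bracket_bracket_right[of e f x] by (simp add: ef H i bracket_zero_right)
 qed
 show "bracket f (bracket e x) = x" if i: "ip bt al = - 1"
 proof -
  have "- al + bt \<notin> roots" "bt ~= - (- al)"
   using i ip_add_root[OF root_minus[OF al] bt] ip_sym[OF al bt] ip_minus[OF roots_intw[OF al] bt] ip_self[OF al] by auto
  hence "bracket f x = 0" by (intro z[OF root_minus[OF al]] f x)
  thus ?thesis using bracket_bracket_right[of f e x] by (simp add: fe H i bracket_zero_right bracket_minus_left)
 qed
qed

lemma (in lmod) bounded_pow:
 assumes bd: "bounded scaleV act P v xi N0" and w: "U v xi N0 nu N w" "nu \<in> intw" "Exc nu N = Exc xi N0"
  and x: "(bt, n) \<in> P" "bt \<in> roots" "x \<in> root_space bt"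
 shows "(act x n ^^ Suc (nat (- ip nu bt - n))) w = 0"
proof (rule boundedD[OF bd U_pow[OF w(1) x(1,3)]])
 define j where "j = int (Suc (nat (- ip nu bt - n)))"
 have "j > 0" "ip nu bt + j + n > 0" by (simp_all add: j_def)
 hence "0 < j * (ip nu bt + j + n)" by simp
 hence lt: "N < j * ip nu bt + j\<^sup>2 + (N + j * n)" by (simp add: algebra_simps power2_eq_square)
 show "Exc (plus_mult nu (int (Suc (nat (- ip nu bt - n)))) bt) (N + int (Suc (nat (- ip nu bt - n))) * n) < Exc xi N0"
  unfolding w(3)[symmetric] Exc_plus_mult[OF w(2) x(2)] j_def[symmetric] Exc_shift[of nu N]
  by (rule diff_strict_left_mono) (simp only: of_int_less_iff lt)
qed

text \<open>In the alcove every letter kills the generator or scales it. Otherwise reflect in the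
  affine simple root of \<open>affine_step\<close>: the lift \<open>st v\<close> satisfies the
  relations for \<open>xi\<close> (\<open>F3\<close>), the power \<open>ph'\<close> those for the
  reflected weight (\<open>kr'\<close>), and \<open>transfer\<close> brings the bound back.
  Relations at multiples of \<open>al\<close> come from \<open>rank_one\<close>; those at the other
  roots are carried along by commutation or by the Heisenberg lemmas.\<close>

theorem upper_bound:
 fixes s :: "complex => 'w::ab_group_add => 'w"
 assumes s: "vector_space s"
 shows "lm (scaleS s) Pb M act ==> v \<in> M ==> xi \<in> intw ==> Rel (scaleS s) act xi v ==> bounded (scaleS s) act Pb v xi N0"
proof (induction "msr xi" arbitrary: xi M act v N0 rule: wf_induct_rule[OF wf_lex_prod[OF wf_less_than wf_less_than]])
 case (1 xi M act v N0)
 note IH = 1(1) and vM = 1(3) and xi = 1(4)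
 interpret l: lmod scale bracket h b Basis form "scaleS s" Pb M act by (rule 1(2))
 have wt: "H \<in> h ==> act H 0 v = scaleS s (xi H) v" and kh: "H \<in> h ==> n \<ge> 1 ==> act H n v = 0" for H n
  using 1(5) by (simp_all add: Rel_def)
 have kr: "(act x n ^^ Suc (nat (- ip xi bt - n))) v = 0" if "(bt, n) \<in> Pb" "bt \<in> roots" "x \<in> root_space bt" for bt n x
  using 1(5) that unfolding Rel_def by blast
 consider "\<forall>bt n. (bt, n) \<in> Pb --> bt \<in> roots --> ip xi bt + n \<ge> 0"
  | al n0 where "asimple al n0" "ip xi al + n0 < 0"
    "(msr (plus_mult xi (- (ip xi al + n0)) al), msr xi) \<in> less_than <*lex*> less_than" using affine_step[OF xi] by blast
 thus ?case
 proof cases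
  case 1
  show ?thesis
  proof (rule l.bounded_trivial[OF vM])
   fix bt n x assume b: "(bt, n) \<in> Pb" and x: "x \<in> root_space bt"
   consider "bt \<in> roots" | "bt = 0" "n = 0" | "bt = 0" "n \<ge> 1" using b WT_cases by (force simp: Pb_def)
   thus "act x n v = 0 \<or> bt = 0 & n = 0 & (\<exists>c. act x n v = scaleS s c v)"
   proof cases
    case r: 1
    have k0: "nat (- ip xi bt - n) = 0" using 1 b r by force
    have "act x n v = 0" by (rule trans[OF _ kr[OF b r x]]) (simp add: k0)
    thus ?thesis by blast
   next case 2
    have "act x n v = scaleS s (xi x) v" unfolding 2 by (rule wt) (use x 2 root_space_0 in simp)
    thus ?thesis using 2 by blast
   next case 3
    show ?thesis by (rule disjI1[OF kh[OF _ 3(2)]]) (use x 3 root_space_0 in simp)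
   qed
  qed
 next case (2 al n0)
  define m where "m = nat (- (ip xi al + n0))"
  have m: "ip xi al + n0 = - int m" "m > 0" using 2(2) by (simp_all add: m_def)
  have al: "al \<in> roots" and Pal: "(al, n) \<in> Pb \<longleftrightarrow> n \<ge> n0" and Pmal: "(- al, n) \<in> Pb \<longleftrightarrow> n \<ge> 1 - n0" for n
   using 2(1) by (simp_all add: asimple_def)
  have clo: "(bt, n) \<in> Pb ==> bt - al \<in> WT ==> (bt - al, n - n0) \<in> insert (- al, - n0) Pb" for bt n
   using 2(1) unfolding asimple_def by blast
  note mal = root_minus[OF al]
  obtain e f where ef: "e \<in> root_space al" "f \<in> root_space (- al)" "bracket e f = coroot al" "e ~= 0" "f ~= 0"
   by (rule coroot_exists[OF al])
  have P00: "(0, 0) \<in> Pb" using zero_WT by (simp add: Pb_def)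
  interpret c: coind scale bracket h b Basis form "scaleS s" Pb M act al n0 f by unfold_locales (use al ef clo Pal Pmal P00 in auto)
  interpret Y: lmod scale bracket h b Basis form "scaleS (scaleS s)" c.P' c.M' c.cac by (rule c.lmod_coind)
  let ?ph = "c.st v"
  note phM = c.st_M'[OF vM]
  have PP: "(al, n0) \<in> c.P'" "(- al, - n0) \<in> c.P'" "(0, 0) \<in> c.P'" using Pal P00 by simp_all
  have PI: "(bt, n) \<in> c.P'" if "(bt, n) \<in> Pb" for bt n using that by simp
  have st0: "?ph 0 = v" by (simp add: c.st_def)
  have emv: "(act e n0 ^^ Suc m) v = 0"
  proof -
   have k: "nat (- ip xi al - n0) = m" by (simp add: m_def)
   show ?thesis using kr[of al n0 e] Pal al ef(1) unfolding k by blast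
  qed
  have eph: "(c.cac e n0 ^^ Suc m) ?ph = 0" by (rule c.e_pow_st[OF vM wt xi m(1) ef(1,3) emv])
  have F1: "c.cac x n ?ph = 0" if x: "x \<in> root_space (- al)" "n \<ge> 1 - n0" for x n
  proof (rule c.st_f[OF vM _ _ x(1)])
   show P: "(- al, n) \<in> Pb" using x Pmal by simp
   have k: "nat (- ip xi (- al) - n) = 0" using x(2) m by (simp add: ip_coroot_minus xi al)
   show "act x n v = 0" by (rule trans[OF _ kr[OF P mal x(1)]]) (simp add: k)
  qed
  have F2: "c.cac H n ?ph = 0" if H: "H \<in> h" "n \<ge> 1" for H n
   by (rule c.st_h[OF vM kh[OF H] _ H(1) F1]) (use H zero_WT in "simp_all add: Pb_def")
  note wtph = c.st_weight[OF vM wt]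
  have sub: "PE al n0 <= c.P'" using asimple_PE[OF 2(1)] by blast
  interpret E: lmod scale bracket h b Basis form "scaleS (scaleS s)" "PE al n0" c.M' c.cac by (rule Y.lmod_mono[OF sub PE_closed[OF al]])
  have bE: "bounded (scaleS (scaleS s)) c.cac (PE al n0) ?ph xi N0"
  proof -
   note pk = packed[OF s E.lmod_axioms]
   show ?thesis
   proof (rule pk(2), rule rank_one[OF s pk(1) al imageI[OF phM] xi m(1)])
    show "pact c.cac H 0 (pk ?ph) = scaleS s (xi H) (pk ?ph)" if "H \<in> h" for H using wtph[OF that that] by (simp only: pk_lin)
    show "pact c.cac x n (pk ?ph) = 0" if "x \<in> root_space (- al)" "n \<ge> 1 - n0" for x n
     using F1[OF that] pk(4) by (simp only: pk_lin)
    show "pact c.cac H n (pk ?ph) = 0" if "H \<in> h" "n \<ge> 1" for H n using F2[OF that] pk(4) by (simp only: pk_lin)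
    show "(pact c.cac e n0 ^^ Suc m) (pk ?ph) = 0" unfolding pk(3) eph by (simp only: pk(4))
   qed (rule ef)+
  qed
  note E_pow = E.bounded_pow[OF bE]
  have PEp: "(bt, n) \<in> PE al n0" if "(bt, n) \<in> Pb" "bt = al \<or> bt = - al" for bt n using that Pal Pmal by (auto simp: PE_def)
  have fph: "c.cac f (- n0) ?ph = 0" by (rule c.f_st[OF vM])
  have F3: "(c.cac x n ^^ Suc (nat (- ip xi bt - n))) ?ph = 0"
   if b: "(bt, n) \<in> Pb" "bt \<in> roots" and x: "x \<in> root_space bt" for bt n x
  proof -
   define k where "k = nat (- ip xi bt - n)"
   have at0: "(c.cac x n ^^ Suc k) ?ph 0 = 0" unfolding c.eval_pow[OF b(1) x phM] st0 k_def by (rule kr[OF b x])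
   note xM = Y.act_pow_M[OF PI[OF b(1)] x phM]
   consider "bt = al \<or> bt = - al" | "- al + bt \<notin> WT" | "bt - al \<in> roots" "ip al bt = 1"
   proof -
    have "- al + bt \<in> WT ==> bt = al \<or> bt - al \<in> roots & ip al bt = 1"
    proof -
     assume w: "- al + bt \<in> WT"
     have "ip al bt = 1" if "- al + bt \<in> roots" using ip_add_root[OF mal b(2) that] ip_minus[OF roots_intw[OF al] b(2)] by simp
     thus ?thesis using WT_cases[OF w] by (auto simp: add_eq_0_iff)
    qed
    thus thesis using that by blast
   qed
   hence "(c.cac x n ^^ Suc k) ?ph = 0"
   proof cases
    case 1
    show ?thesis unfolding k_def by (rule E_pow[OF ug.ug_base xi refl PEp[OF b(1) 1] b(2) x])
   next case 2
    show ?thesis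
    proof (rule c.coind_zero[OF xM at0])
     show "c.cac f (- n0) ((c.cac x n ^^ Suc k) ?ph) = 0"
      unfolding Y.commute_letters(2)[OF PP(2) PI[OF b(1)] ef(2) x 2 phM] fph by (rule Y.act_pow_lin(3))
    qed
   next case 3
    let ?y = "bracket f x"
    have r: "- al + bt \<in> roots" using 3(1) by simp
    have yP: "(- al + bt, - n0 + n) \<in> Pb" using clo[OF b(1) rootD(1)[OF 3(1)]] rootD(2)[OF b(2)] by simp
    note y = root_space_bracket[OF ef(2) x]
    have ey: "bracket e ?y = x" using bracket_bracket_line(1)[OF al b(2) ef(1,2,3) x] 3(2) ip_sym[OF al b(2)] by simp
    interpret H: heisenberg "scaleS (scaleS s)" c.M' "c.cac f (- n0)" "c.cac x n" "c.cac ?y (- n0 + n)"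
     by (rule Y.heis_letters[OF PP(2) PI[OF b(1)] ef(2) x mal b(2) r])
    \<comment> \<open>Not only the power of \<open>x\<close> has to vanish at entry 0 but all mixed
      powers with \<open>bracket f x\<close> of the same total exponent, since \<open>f\<close>
      turns one \<open>x\<close> into \<open>bracket f x\<close>.\<close>
    have v0: "(act x n ^^ p) ((act ?y (- n0 + n) ^^ q) v) = 0" if pq: "p + q = Suc k" for p q
    proof -
     define ky where "ky = nat (- ip xi (- al + bt) - (- n0 + n))"
     have "ip xi (- al + bt) = ip xi bt - ip xi al" using ip_coroot_add[OF xi mal b(2) r] ip_coroot_minus[OF xi al] by simp
     hence ky: "ky = nat (- ip xi bt - n - int m)" using m(1) by (simp add: ky_def algebra_simps)
     have y0: "(act ?y (- n0 + n) ^^ Suc ky) v = 0" unfolding ky_def by (rule kr[OF yP r y])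
     show ?thesis
     proof (cases "int m \<le> - ip xi bt - n")
      case True
      have a: "al + (- al + bt) \<in> roots" using b(2) by simp
      have "heisenberg (scaleS s) M (act e n0) (act ?y (- n0 + n)) (act (bracket e ?y) (n0 + (- n0 + n)))"
       by (rule l.heis_letters[OF _ yP ef(1) y al r a]) (simp add: Pal)
      then interpret X: heisenberg "scaleS s" M "act e n0" "act ?y (- n0 + n)" "act x n" unfolding ey by simp
      \<comment> \<open>\<open>x\<close> is the bracket of \<open>e\<close> and \<open>?y\<close>,
        and their exponents satisfy \<open>m + ky = k\<close>, so total exponent
        \<open>k + 1\<close> is just enough.\<close>
      show ?thesis by (rule X.central_pow_zero[OF vM emv y0]) (use True pq ky k_def in simp)
     next case False
      hence "ky = 0" by (simp add: ky)
      hence yv: "act ?y (- n0 + n) v = 0" using y0 by (intro trans[OF _ y0]) simp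
      show ?thesis
      proof (cases q)
       case 0
       thus ?thesis using kr[OF b x] pq unfolding k_def[symmetric] by simp
      next case (Suc q')
       have "(act ?y (- n0 + n) ^^ q) v = (act ?y (- n0 + n) ^^ q') (act ?y (- n0 + n) v)" unfolding Suc by (simp add: funpow_swap1)
       thus ?thesis unfolding yv l.act_pow_lin by (simp only: l.act_pow_lin)
      qed
     qed
    qed
    have yM: "(c.cac ?y (- n0 + n) ^^ q) ?ph \<in> c.M'" for q by (rule H.pow_stable(3)[OF phM])
    have "(c.cac x n ^^ p) ((c.cac ?y (- n0 + n) ^^ q) ?ph) = 0" if "p + q = Suc k" for p q using that
    proof (induction p arbitrary: q)
     case (0 q)
     show ?case
     proof (rule c.coind_zero)
      show "(c.cac x n ^^ 0) ((c.cac ?y (- n0 + n) ^^ q) ?ph) \<in> c.M'" using yM by simp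
      show "(c.cac x n ^^ 0) ((c.cac ?y (- n0 + n) ^^ q) ?ph) 0 = 0" using v0[OF 0] c.eval_pow[OF yP y phM, of q] st0 by simp
      show "c.cac f (- n0) ((c.cac x n ^^ 0) ((c.cac ?y (- n0 + n) ^^ q) ?ph)) = 0"
       using H.a_c_pow[OF phM, of q] H.zero(6)[of q] fph by simp
     qed
    next case (Suc p q)
     let ?w = "(c.cac ?y (- n0 + n) ^^ q) ?ph"
     show ?case
     proof (rule c.coind_zero)
      show "(c.cac x n ^^ Suc p) ?w \<in> c.M'" by (rule Y.act_pow_M[OF PI[OF b(1)] x yM])
      show "(c.cac x n ^^ Suc p) ?w 0 = 0" unfolding c.eval_pow[OF b(1) x yM] c.eval_pow[OF yP y phM] st0 by (rule v0[OF Suc.prems])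
      have 1: "c.cac f (- n0) ?w = 0" unfolding H.a_c_pow[OF phM] fph by (rule H.zero(6))
      have "(c.cac x n ^^ p) ((c.cac ?y (- n0 + n) ^^ Suc q) ?ph) = 0" by (rule Suc.IH) (use Suc.prems in simp)
      hence 2: "c.cac ?y (- n0 + n) ((c.cac x n ^^ p) ?w) = 0" unfolding H.c_b_pow[OF yM] by (simp only: funpow.simps comp_apply)
      show "c.cac f (- n0) ((c.cac x n ^^ Suc p) ?w) = 0"
       unfolding H.a_b_pow[OF yM] 1 2 by (simp only: H.zero Y.V.scale_zero_right add_0_right)
     qed
    qed
    from this[of "Suc k" 0] show ?thesis by (simp only: funpow_0 add_0_right)
   qed
   thus ?thesis by (simp only: k_def)
  qed
  define ph' xi' N' where "ph' = (c.cac e n0 ^^ m) ?ph" and "xi' = plus_mult xi (int m) al" and "N' = N0 + int m * n0"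
  have ph'E: "E.U ?ph xi N0 xi' N' ph'" unfolding ph'_def xi'_def N'_def by (rule E.U_pow[OF ug.ug_base _ ef(1)]) (simp add: PE_def)
  have ph'M: "ph' \<in> c.M'" unfolding ph'_def by (rule Y.act_pow_M[OF PP(1) ef(1) phM])
  have xi': "xi' \<in> intw" unfolding xi'_def by (rule plus_mult_intw[OF xi al])
  have ixi': "ip xi' bt = ip xi bt + int m * ip al bt" if "bt \<in> roots" for bt unfolding xi'_def by (rule ip_plus_mult[OF xi al that])
  have Ex: "Exc xi' N' = Exc xi N0" unfolding xi'_def N'_def by (rule Exc_reflect[OF xi al]) (use m in simp)
  have wt': "c.cac H 0 ph' = scaleS (scaleS s) (xi' H) ph'" if "H \<in> h" for H
   by (rule Y.U_weight[OF PP(3) phM wtph that ug_mono[OF ph'E sub]])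
  have kh': "c.cac H n ph' = 0" if H: "H \<in> h" "n \<ge> 1" for H n
  proof (rule boundedD[OF bE])
   show "E.U ?ph xi N0 (xi' + 0) (N' + n) (c.cac H n ph')" by (rule ug.ug_act[OF ph'E]) (use H in "simp_all add: PE_def root_space_0")
   show "Exc (xi' + 0) (N' + n) < Exc xi N0" using H(2) unfolding Ex[symmetric] add_0_right by (simp add: Exc_def)
  qed
  have kr': "(c.cac x n ^^ Suc (nat (- ip xi' bt - n))) ph' = 0"
   if b: "(bt, n) \<in> Pb" "bt \<in> roots" and x: "x \<in> root_space bt" for bt n x
  proof -
   define k where "k = nat (- ip xi' bt - n)"
   note bP = PI[OF b(1)]
   consider "bt = al \<or> bt = - al" | "al + bt \<in> roots" "ip al bt = - 1" | "bt - al \<in> roots" "ip al bt = 1" | "bt + al \<notin> WT" "ip al bt = 0"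
   proof -
    have "bt + al \<notin> WT" if i: "ip al bt = 0"
    proof
     assume "bt + al \<in> WT"
     hence "bt = - al \<or> al + bt \<in> roots" using WT_cases[of "bt + al"] by (auto simp: add_eq_0_iff add.commute)
     thus False using i ip_add_root[OF al b(2)] ip_coroot_minus[OF roots_intw[OF al] al] ip_self[OF al] by auto
    qed
    thus thesis using that ip_bound_cases[OF al b(2)] root_minus[of "al - bt"] by auto
   qed
   hence "(c.cac x n ^^ Suc k) ph' = 0"
   proof cases
    case 1
    show ?thesis unfolding k_def by (rule E_pow[OF ph'E xi' Ex PEp[OF b(1) 1] b(2) x])
   next case 4
    have "k = nat (- ip xi bt - n)" using 4(2) by (simp add: k_def ixi' b(2))
    hence "(c.cac x n ^^ Suc k) ?ph = 0" using F3[OF b x] by blast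
    thus ?thesis unfolding ph'_def Y.commute_letters(3)[OF bP PP(1) x ef(1) 4(1) phM] by (simp only: Y.act_pow_lin)
   next case 3
    let ?y = "bracket x f"
    have r: "bt + - al \<in> roots" "bt + - al + al \<in> roots" using 3(1) b(2) by simp_all
    have yP: "(bt + - al, n + - n0) \<in> Pb" using clo[OF b(1) rootD(1)[OF 3(1)]] rootD(2)[OF b(2)] by simp
    note y = root_space_bracket[OF x ef(2)]
    have "bracket ?y e = bracket e (bracket f x)" using bracket_antisym[of ?y e] bracket_antisym[of x f] by (simp add: bracket_minus_right)
    hence ye: "bracket ?y e = x" using bracket_bracket_line(1)[OF al b(2) ef(1,2,3) x] 3(2) ip_sym[OF al b(2)] by simp
    have "heisenberg (scaleS (scaleS s)) c.M' (c.cac ?y (n + - n0)) (c.cac e n0) (c.cac (bracket ?y e) (n + - n0 + n0))"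
     by (rule Y.heis_letters[OF PI[OF yP] PP(1) y ef(1) r(1) al r(2)])
    then interpret H: heisenberg "scaleS (scaleS s)" c.M' "c.cac ?y (n + - n0)" "c.cac e n0" "c.cac x n" unfolding ye by simp
    have "ip xi (bt + - al) = ip xi bt - ip xi al" using ip_coroot_add[OF xi b(2) mal r(1)] ip_coroot_minus[OF xi al] by simp
    hence "nat (- ip xi (bt + - al) - (n + - n0)) = k" using m(1) 3(2) by (simp add: k_def ixi' b(2) algebra_simps)
    hence "(c.cac ?y (n + - n0) ^^ Suc k) ?ph = 0" using F3[OF yP r(1) y] by metis
    \<comment> \<open>\<open>k + 1\<close> letters \<open>x\<close> and \<open>m\<close> letters
      \<open>e\<close> just exceed the exponents \<open>k\<close> of \<open>?y\<close> and
      \<open>m\<close> of \<open>e\<close>.\<close>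
    thus ?thesis unfolding ph'_def by (rule H.central_pow_zero[OF phM _ eph]) simp
   next case 2: 2
    let ?z = "bracket e x"
    have z: "?z \<in> root_space (al + bt)" "(al + bt, n0 + n) \<in> Pb"
     using root_space_bracket[OF ef(1) x] Pb_closed[OF _ b(1) rootD(1)[OF 2(1)]] Pal by simp_all
    have fz: "bracket f ?z = x" using bracket_bracket_line(2)[OF al b(2) ef(1,2,3) x] 2(2) ip_sym[OF al b(2)] by simp
    interpret H: heisenberg "scaleS (scaleS s)" c.M' "c.cac e n0" "c.cac x n" "c.cac ?z (n0 + n)"
     by (rule Y.heis_letters[OF PP(1) bP ef(1) x al b(2) 2(1)])
    have a: "- al + (al + bt) \<in> roots" using b(2) by simp
    have "heisenberg (scaleS (scaleS s)) c.M' (c.cac f (- n0)) (c.cac ?z (n0 + n)) (c.cac (bracket f ?z) (- n0 + (n0 + n)))"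
     by (rule Y.heis_letters[OF PP(2) PI[OF z(2)] ef(2) z(1) mal 2(1) a])
    then interpret G: heisenberg "scaleS (scaleS s)" c.M' "c.cac f (- n0)" "c.cac ?z (n0 + n)" "c.cac x n" unfolding fz by simp
    have "nat (- ip xi (al + bt) - (n0 + n)) = k"
     using m(1) 2(2) ip_coroot_add[OF xi al b(2) 2(1)] by (simp add: k_def ixi' b(2) algebra_simps)
    hence zk: "(c.cac ?z (n0 + n) ^^ Suc k) ?ph = 0" using F3[OF z(2) 2(1) z(1)] by metis
    have f1: "(c.cac f (- n0) ^^ Suc 0) ?ph = 0" using fph by simp
    have bc: "(c.cac ?z (n0 + n) ^^ p) ((c.cac x n ^^ q) w) = (c.cac x n ^^ q) ((c.cac ?z (n0 + n) ^^ p) w)" if "w \<in> c.M'" for p q w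
     by (induction p) (simp_all add: that G.b_c_pow G.pow_stable)
    \<comment> \<open>\<open>x\<close> is the bracket of \<open>f\<close> and \<open>?z\<close>, and
      \<open>f\<close> kills the lift, so all mixed powers of total exponent \<open>k + 1\<close>
      vanish on it; \<open>mixed_pow_zero\<close> then carries this over to the power
      \<open>m\<close> of \<open>e\<close>.\<close>
    have mz: "(c.cac ?z (n0 + n) ^^ p) ((c.cac x n ^^ q) ?ph) = 0" if "p + q = Suc k" for p q
     unfolding bc[OF phM] by (rule G.central_pow_zero[OF phM f1 zk]) (use that in simp)
    have "(c.cac ?z (n0 + n) ^^ 0) ((c.cac x n ^^ Suc k) ph') = 0"
     unfolding ph'_def by (rule H.mixed_pow_zero[where K = "Suc k", OF phM]) (simp_all add: mz del: funpow.simps)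
    thus ?thesis by (simp only: funpow_0)
   qed
   thus ?thesis by (simp only: k_def)
  qed

  have lY: "lm (scaleS (scaleS s)) Pb c.M' c.cac" by (rule Y.lmod_mono[OF _ Pb_closed]) blast+
  note pk = packed[OF s lY]
  have "bounded (scaleS s) (pact c.cac) Pb (pk ph') xi' N'"
  proof (rule IH[OF _ pk(1) imageI[OF ph'M] xi'])
   show "(msr xi', msr xi) \<in> less_than <*lex*> less_than" using 2(3) m(1) by (simp add: xi'_def)
   show "Rel (scaleS s) (pact c.cac) xi' (pk ph')" unfolding Rel_def
   proof (intro conjI ballI allI impI)
    show "pact c.cac H 0 (pk ph') = scaleS s (xi' H) (pk ph')" if "H \<in> h" for H using wt'[OF that] by (simp only: pk_lin)
    show "pact c.cac H n (pk ph') = 0" if "H \<in> h" "n \<ge> 1" for H n using kh'[OF that] pk(4) by (simp only: pk_lin)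
    show "(pact c.cac x n ^^ Suc (nat (- ip xi' bt - n))) (pk ph') = 0"
     if "(bt, n) \<in> Pb" "bt \<in> roots" "x \<in> root_space bt" for bt n x unfolding pk(3) kr'[OF that] by (simp only: pk(4))
   qed
  qed
  from pk(2)[OF this] show ?thesis by (intro c.transfer[OF vM wt xi m(1) ef(1,3)]) (unfold ph'_def xi'_def N'_def)
 qed
qed

end

section \<open>The local Weyl module: upper bound\<close>

context lmod
begin

text \<open>\<open>rank_one\<close> and \<open>upper_bound\<close> are stated for sequence types;
  constant sequences embed an arbitrary module there.\<close>

lemma const_seq:
 shows "lm (scaleS scaleV) P {t. \<forall>k. t k \<in> M} (%x n t k. act x n (t k))"
  "bounded (scaleS scaleV) (%x n t k. act x n (t k)) P (%k. v) xi N0 ==> bounded scaleV act P v xi N0"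
  "((%t k. act x n (t k)) ^^ j) (%k. w) = (%k. (act x n ^^ j) w)"
proof -
 let ?a = "%x n t k. act x n (t k)"
 note vs = vector_space_scaleS[OF V.vector_space_axioms]
 interpret S: vector_space "scaleS scaleV" by (rule vs)
 show "lm (scaleS scaleV) P {t. \<forall>k. t k \<in> M} ?a"
 proof (unfold_locales, goal_cases)
  case (1 bt n) thus ?case by (rule P_WT)
 next case (2 bt m ga n) thus ?case by (rule P_closed)
 next case 3 show ?case by (simp add: S.subspace_def scaleS_def M_0 M_add M_scale)
 next case (6 bt n x v) thus ?case using act_M[of bt n x] by blast
 next case (7 v n) thus ?case using act_zero_left by (simp add: fun_eq_iff)
 next case (8 bt n x y v) thus ?case using act_add_left[of bt n x y] by (simp add: fun_eq_iff)
 next case (9 bt n x v c) thus ?case using act_scale_left[of bt n x] by (simp add: scaleS_def fun_eq_iff)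
 next case (10 bt m ga n x y v)
  hence "act x m (act y n (v k)) = act y n (act x m (v k)) + act (bracket x y) (m + n) (v k) + scaleV (cen (x, m) (y, n)) (v k)" for k
   by (intro comm) auto
  thus ?case by (simp only: fun_eq_iff scaleS_def plus_fun_apply) simp
 qed (simp_all add: act_add act_scale scaleS_def fun_eq_iff)
 show "bounded scaleV act P v xi N0" if "bounded (scaleS scaleV) ?a P (%k. v) xi N0"
  by (rule bounded_inj[OF V.vector_space_axioms vs, where T = "%w k. w" and act' = ?a, OF _ _ _ _ that])
   (simp_all add: scaleS_def fun_eq_iff)
 show "((%t k. act x n (t k)) ^^ j) (%k. w) = (%k. (act x n ^^ j) w)" by (induction j) simp_all
qed

end

context weyl
begin

interpretation X: lmod scale bracket h b Basis form scaleW PW UNIV actn by (rule lmod_W)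

lemma PW_letter: "ga \<in> roots ==> n \<ge> 0 ==> (ga, n) \<in> PW & (- ga, n) \<in> PW" and PW_0: "n \<ge> 0 ==> (0, n) \<in> PW"
 using rootD(1) root_minus zero_WT by (auto simp: PW_def)

lemma u_pos: "ga \<in> pos ==> x \<in> root_space ga ==> actn x n u = 0" by (rule u_nplus) (auto simp: nplus_def intro: span_base)

text \<open>By \<open>central_pow_zero\<close> the exponents of two root vectors add up for their
  bracket, just as the pairings with coroots do.\<close>

lemma u_neg_pow: "ga \<in> pos ==> x \<in> root_space (- ga) ==> (actn x 0 ^^ Suc (nat (ip lam ga))) u = 0"
proof (induction arbitrary: x rule: pos_induct)
 case (simple al)
 from u_simple[OF simple(1,2), folded nat_0] show ?case .
next case (add al bt)
 note r = pos_roots[OF simple_pos[OF add(1)]] pos_roots[OF add(2)] pos_roots[OF add(3)]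
 obtain y z where m: "- al \<in> roots" "- bt \<in> roots" "- al + - bt \<in> roots"
  and y: "y \<in> root_space (- al)" and z: "z \<in> root_space (- bt)" and x: "x = bracket y z" by (rule neg_root_sum[OF r add(5)])
 have P: "(- al, 0) \<in> PW" "(- bt, 0) \<in> PW" using PW_letter[OF m(1)] PW_letter[OF m(2)] by auto
 interpret H: heisenberg scaleW UNIV "actn y 0" "actn z 0" "actn (bracket y z) (0 + 0)" by (rule X.heis_letters[OF P y z m])
 have "ip lam (al + bt) = ip lam al + ip lam bt" by (rule ip_coroot_add[OF lam_intw r])
 hence "nat (ip lam (al + bt)) = nat (ip lam al) + nat (ip lam bt)"
  using dominant_intw(2)[OF lam simple_pos[OF add(1)]] dominant_intw(2)[OF lam add(2)] by simp
 hence "(actn (bracket y z) (0 + 0) ^^ Suc (nat (ip lam (al + bt)))) ((actn z 0 ^^ 0) u) = 0"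
  by (intro H.central_pow_zero[OF UNIV_I u_simple[OF add(1) y, folded nat_0] add(4)[OF z]]) simp
 thus ?case unfolding x by (simp only: add_0_right funpow_0)
qed

text \<open>For the affine root \<open>(- ga, 0)\<close> all letters of the rank one part belong to
  the current algebra.\<close>

lemma u_neg_bounded:
 assumes ga: "ga \<in> pos"
 shows "bounded scaleW actn (PE (- ga) 0) u lam 0"
proof -
 note r = pos_roots[OF ga]
 note mr = root_minus[OF r]
 have sub: "PE (- ga) 0 <= PW" using PW_letter[OF r] PW_0 by (auto simp: PE_def)
 interpret E: lmod scale bracket h b Basis form scaleW "PE (- ga) 0" UNIV actn by (rule X.lmod_mono[OF sub PE_closed[OF mr]])
 obtain e where e: "e \<in> root_space (- ga)" "e ~= 0" by (rule root_space_nonzero[OF mr])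
 show ?thesis
 proof (rule E.const_seq(2), rule rank_one[OF X.V.vector_space_axioms E.const_seq(1) mr _ lam_intw])
  show "ip lam (- ga) + 0 = - int (nat (ip lam ga))" using dominant_intw(2)[OF lam ga] by (simp add: ip_coroot_minus lam_intw r)
  show "(%k. actn H 0 u) = scaleS scaleW (lam H) (%k. u)" if "H \<in> h" for H using u_weight[OF that] by (simp add: scaleS_def)
  show "(%k::nat. actn x n u) = 0" if "x \<in> root_space (- (- ga))" for x n using u_pos[OF ga] that by (simp add: zero_fun_def)
  show "(%k::nat. actn H n u) = 0" if "H \<in> h" "n \<ge> 1" for H n using u_ht[OF that(1), of "nat n"] that(2) by (simp add: zero_fun_def)
  show "((%t k. actn e 0 (t k)) ^^ Suc (nat (ip lam ga))) (%k. u) = 0"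
   unfolding E.const_seq(3) u_neg_pow[OF ga e(1)] by (simp add: zero_fun_def)
 qed (use e in simp_all)
qed

text \<open>Positive roots kill \<open>u\<close> outright. At a negative root, which the Iwahori
  subalgebra contains in degrees from 1 on, the power is forced by the rank one bound.\<close>

lemma u_Rel: "Rel scaleW actn lam u" unfolding Rel_def
proof (intro conjI ballI allI impI)
 show "actn H 0 u = scaleW (lam H) u" if "H \<in> h" for H using u_weight[OF that] by simp
 show "actn H n u = 0" if "H \<in> h" "n \<ge> 1" for H n using u_ht[OF that(1), of "nat n"] that(2) by simp
 fix bt n x assume b: "(bt, n) \<in> Pb" "bt \<in> roots" and x: "x \<in> root_space bt"
 show "(actn x n ^^ Suc (nat (- ip lam bt - n))) u = 0"
 proof (cases "bt \<in> pos")
  case True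
  have "n \<ge> 0" using b by (auto simp: Pb_def)
  hence "nat (- ip lam bt - n) = 0" using dominant_intw(2)[OF lam True] by simp
  thus ?thesis using u_pos[OF True x] by simp
 next case False
  define ga where "ga = - bt"
  have ga: "ga \<in> pos" "bt = - ga" using pos_or_neg[OF b(2)] False by (simp_all add: ga_def)
  note r = pos_roots[OF ga(1)]
  have sub: "PE (- ga) 0 <= PW" using PW_letter[OF r] PW_0 by (auto simp: PE_def)
  interpret E: lmod scale bracket h b Basis form scaleW "PE (- ga) 0" UNIV actn by (rule X.lmod_mono[OF sub PE_closed[OF root_minus[OF r]]])
  have "(- ga, n) \<in> PE (- ga) 0" using b by (auto simp: PE_def Pb_def)
  thus ?thesis using E.bounded_pow[OF u_neg_bounded[OF ga(1)] ug.ug_base lam_intw refl, of "- ga" n x] b x unfolding ga(2) by blast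
 qed
qed

lemma Pb_PW: "Pb <= PW" by (auto simp: Pb_def PW_def)

lemma u_bounded_Pb: "bounded scaleW actn Pb u lam 0"
proof -
 interpret E: lmod scale bracket h b Basis form scaleW Pb UNIV actn by (rule X.lmod_mono[OF Pb_PW Pb_closed])
 show ?thesis
 proof (rule E.const_seq(2), rule upper_bound[OF X.V.vector_space_axioms E.const_seq(1) _ lam_intw])
  show "Rel (scaleS scaleW) (%x n t k. actn x n (t k)) lam (%k. u)"
   using u_Rel unfolding Rel_def E.const_seq(3) by (auto simp: scaleS_def zero_fun_def)
 qed simp
qed

section \<open>From the Iwahori subalgebra to the current algebra\<close>

abbreviation scl :: "'g wt => int => 'w => bool" where
 "scl == cl scaleW actn {(- al, 0) | al. al \<in> simple_roots} (ug scaleW actn Pb u lam 0)"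

lemma scl_f: "scl nu N w ==> al \<in> simple_roots ==> f \<in> root_space (- al) ==> scl (nu - al) N (actn f 0 w)"
 using cl.cl_act[of scaleW actn _ _ nu N w "- al" 0] by force

lemma simple_PW: "{(- al, 0) | al. al \<in> simple_roots} <= PW" using PW_letter pos_roots simple_pos by blast

lemma scl_U: "scl nu N w ==> X.U u lam 0 nu N w"
proof (induction rule: cl.induct)
 case (cl_base nu N w)
 thus ?case by (rule ug_mono[OF _ Pb_PW])
qed (use simple_PW in "blast intro: ug.intros")+

lemma scl_Pb:
 assumes "scl nu N w" "(bt, n) \<in> Pb" "x \<in> root_space bt"
 shows "scl (nu + bt) (N + n) (actn x n w)"
proof -
 have 1: "(bt + ga, m + n) \<in> Pb \<union> {(- al, 0) | al. al \<in> simple_roots}"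
  if a: "(bt, m) \<in> Pb" "(ga, n) \<in> {(- al, 0) | al. al \<in> simple_roots}" "bt + ga \<in> WT" for bt m ga n
 proof -
  obtain al where al: "al \<in> simple_roots" "ga = - al" "n = 0" using a(2) by blast
  hence "(bt - al, m - 0) \<in> insert (- al, - 0) Pb" using asimple_simple[OF al(1)] a unfolding asimple_def by simp
  thus ?thesis using al by auto
 qed
 show ?thesis using conjunct2[OF X.cl_letter[OF simple_PW Pb_PW 1 UNIV_I _ assms(1)]] assms(2,3) by (blast intro: cl.cl_base ug.ug_act)
qed

lemma scl_neg: "ga \<in> pos ==> x \<in> root_space (- ga) ==> scl nu N w ==> scl (nu - ga) N (actn x 0 w)"
proof (induction arbitrary: x nu w rule: pos_induct)
 case (simple al)
 thus ?case by (intro scl_f)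
next case (add al bt)
 note r = pos_roots[OF simple_pos[OF add(1)]] pos_roots[OF add(2)] pos_roots[OF add(3)]
 obtain y z where m: "- al \<in> roots" "- bt \<in> roots" "- al + - bt \<in> roots"
  and y: "y \<in> root_space (- al)" and z: "z \<in> root_space (- bt)" and x: "x = bracket y z" by (rule neg_root_sum[OF r add(5)])
 have P: "(- al, 0) \<in> PW" "(- bt, 0) \<in> PW" using PW_letter[OF m(1)] PW_letter[OF m(2)] by auto
 have yz: "scl (nu - al - bt) N (actn z 0 (actn y 0 w))" "scl (nu - bt - al) N (actn y 0 (actn z 0 w))"
  by (intro add(4)[OF z] scl_f[OF _ add(1) y] add(6))+
 have e: "nu - bt - al = nu - (al + bt)" "nu - al - bt = nu - (al + bt)" by (simp_all add: algebra_simps)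
 have "actn x 0 w = actn y 0 (actn z 0 w) + scaleW (- 1) (actn z 0 (actn y 0 w))"
  using X.comm[OF P y z UNIV_I, of w] by (simp add: x cen_def)
 thus ?case using yz unfolding e by (simp only: cl.cl_add cl.cl_scale)
qed

lemma U_scl: "X.U u lam 0 nu N w ==> scl nu N w"
proof (induction rule: ug.induct)
 case (ug_act nu N w bt n x)
 have "bt \<in> WT" "n \<ge> 0" using ug_act.hyps(2) by (auto simp: PW_def)
 then consider "(bt, n) \<in> Pb" | "- bt \<in> pos" "n = 0" using WT_cases[of bt] pos_or_neg[of bt] by (force simp: Pb_def)
 hence "scl (nu + bt) (N + n) (actn x n w)"
 proof cases
  case 1
  thus ?thesis using scl_Pb[OF ug_act.IH _ ug_act.hyps(3)] by blast
 next case 2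
  hence "scl (nu - - bt) N (actn x 0 w)" by (intro scl_neg ug_act.IH) (use ug_act.hyps(3) in simp_all)
  thus ?thesis using 2(2) by (simp add: algebra_simps)
 qed
 thus ?case .
qed (auto intro: cl.intros ug.ug_base)

lemma U_height: "X.U u lam 0 nu N w ==> w ~= 0 ==> nu \<in> intw & (nu = lam \<or> ht nu < ht lam)"
proof (rule ug_Pneg)
 assume U: "X.U u lam 0 nu N w"
 show "ug scaleW actn Pneg u lam 0 nu N w"
 proof (rule ug_mono[OF X.U_restrict[OF Int_lower2 UNIV_I _ U] Int_lower1])
  fix ga k x assume a: "(ga, k) \<in> PW" "(ga, k) \<notin> Pneg \<inter> PW" "x \<in> root_space ga"
  hence "ga \<in> pos" using WT_cases pos_or_neg by (auto simp: PW_def Pneg_def)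
  thus "ug scaleW actn (Pneg \<inter> PW) u lam 0 (lam + ga) (0 + k) (actn x k u)" using u_pos a by (simp add: ug.ug_zero)
 qed
qed (simp_all add: lam_intw X.act_0)

text \<open>A lowering letter applied last has its argument in a piece of weight
  \<open>nu + al\<close>, which is zero by assumption.\<close>

lemma scl_Pb_only:
 "scl nu N w ==> (!!al w. al \<in> simple_roots ==> X.U u lam 0 (nu + al) N w ==> w = 0) ==>
  ug scaleW actn Pb u lam 0 nu N w"
proof (induction rule: cl.induct)
 case (cl_act nu N w bt n f)
 then obtain al where al: "al \<in> simple_roots" "bt = - al" "n = 0" by blast
 have "w = 0" by (rule cl_act.prems[OF al(1)]) (use scl_U[OF cl_act.hyps(1)] al in simp)
 hence "ug scaleW actn Pb u lam 0 (nu + bt) (N + n) (actn f n w)" by (simp only: X.act_0 ug.ug_zero)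
 thus ?case .
qed (blast intro: ug.intros)+

text \<open>Downward induction on the height. If a simple root pairs negatively with
  \<open>nu\<close>, a power of \<open>e\<close> embeds the piece into one of greater height and
  equal excess. If \<open>nu\<close> is dominant, the weights \<open>nu + al\<close> have smaller
  excess and their pieces vanish, so the piece is generated by the Iwahori subalgebra alone, where
  \<open>u_bounded_Pb\<close> applies.\<close>

theorem weyl_bounded: "bounded scaleW actn PW u lam 0"
proof -
 have "\<forall>N. (Exc nu N < Exc lam 0 --> (\<forall>w. X.U u lam 0 nu N w --> w = 0)) &
   (Exc nu N = Exc lam 0 --> (\<exists>z. \<forall>w. X.U u lam 0 nu N w --> (\<exists>c. w = scaleW c z)))" for nu
 proof (induction "nat (ht lam + 1 - ht nu)" arbitrary: nu rule: less_induct)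
  case less
  have triv: ?case if "!!N w. X.U u lam 0 nu N w ==> w = 0" using that X.V.scale_zero_right by metis
  show ?case
  proof (cases "nu \<in> intw & ht nu \<le> ht lam")
   case False
   show ?thesis by (rule triv) (use U_height False in fastforce)
  next case True
   hence nu: "nu \<in> intw" and le: "ht nu \<le> ht lam" by auto
   show ?thesis
   proof (cases "\<exists>al\<in>simple_roots. ip nu al < 0")
    case True
    then obtain al where al: "al \<in> simple_roots" "ip nu al < 0" by blast
    note r = pos_roots[OF simple_pos[OF al(1)]]
    define p where "p = nat (- ip nu al)"
    have p: "ip nu al + 0 = - int p" "p > 0" using al(2) by (simp_all add: p_def)
    obtain e f where ef: "e \<in> root_space al" "f \<in> root_space (- al)" "bracket e f = coroot al" "f ~= 0"
     by (rule coroot_exists[OF r])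
    have P: "(al, 0) \<in> PW" "(- al, - 0) \<in> PW" "(0, 0) \<in> PW" "(- al, 0) \<in> PW"
     using PW_letter[OF r, of 0] PW_0[of 0] by simp_all
    let ?nu = "plus_mult nu (int p) al"
    have "ht ?nu > ht nu" unfolding ht_plus_mult[OF nu r] ht_simple[OF al(1)] using p by simp
    hence IH: "(Exc ?nu N < Exc lam 0 --> (\<forall>w. X.U u lam 0 ?nu N w --> w = 0)) &
      (Exc ?nu N = Exc lam 0 --> (\<exists>z. \<forall>w. X.U u lam 0 ?nu N w --> (\<exists>c. w = scaleW c z)))" for N
     using less.hyps[of ?nu] le by simp
    have Ex: "Exc ?nu N = Exc nu N" for N using Exc_reflect[OF nu r, of "int p" 0 N] p by simp
    have up: "X.U u lam 0 ?nu N ((actn e 0 ^^ p) w)" if "X.U u lam 0 nu N w" for N w using X.U_pow[OF that P(1) ef(1), of p] by simp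
    have inj: "w = 0" if U: "X.U u lam 0 nu N w" and z: "(actn e 0 ^^ p) w = 0" for N w
    proof -
     obtain t where t: "(actn f 0 ^^ t) w = 0"
      using X.U_nilpotent[OF root_minus[OF r] P(4) ef(2) UNIV_I _ U] u_simple[OF al(1) ef(2)] by (metis nat_0)
     have H: "actn (coroot al) 0 w = scaleW (of_int (ip nu al)) w"
      unfolding ip[OF nu r, symmetric] using X.U_weight[OF P(3) UNIV_I _ coroot_h[OF r] U] u_weight by simp
     show ?thesis by (rule X.affine_injective[OF r P(1,2,3) ef(1,2,3) UNIV_I H p(1) _ z]) (use t in simp)
    qed
    show ?thesis
    proof (intro allI conjI impI)
     show "w = 0" if "Exc nu N < Exc lam 0" "X.U u lam 0 nu N w" for N w using IH[of N] Ex up[OF that(2)] inj[OF that(2)] that(1) by simp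
     fix N assume "Exc nu N = Exc lam 0"
     then obtain z where z: "!!w. X.U u lam 0 ?nu N w ==> \<exists>c. w = scaleW c z" using IH[of N] Ex[of N] by metis
     thus "\<exists>z. \<forall>w. X.U u lam 0 nu N w --> (\<exists>c. w = scaleW c z)"
      by (intro ug_line[OF X.V.vector_space_axioms X.V.vector_space_axioms, where F = "actn e 0 ^^ p" and z = z])
       (rule X.act_pow_lin, rule X.act_pow_lin, erule inj, assumption, erule z[OF up])
    qed
   next case False
    have Pb: "ug scaleW actn Pb u lam 0 nu N w" if U: "X.U u lam 0 nu N w" and E: "Exc nu N \<le> Exc lam 0" for N w
    proof (rule scl_Pb_only[OF U_scl[OF U]])
     fix al w assume al: "al \<in> simple_roots" and w: "X.U u lam 0 (nu + al) N w"
     note r = pos_roots[OF simple_pos[OF al]]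
     have "ht (nu + al) > ht nu" using ht_add[OF nu roots_intw[OF r]] ht_simple[OF al] by simp
     moreover have "Exc (nu + al) N < Exc lam 0"
      using Exc_plus_mult[OF nu r, of 1 N] Exc_shift[of nu N] E False al by (auto simp: plus_mult_simps not_less)
     ultimately show "w = 0" using less.hyps[of "nu + al"] le w by simp
    qed
    show ?thesis
    proof (intro allI conjI impI)
     show "w = 0" if "Exc nu N < Exc lam 0" "X.U u lam 0 nu N w" for N w using boundedD[OF u_bounded_Pb Pb[OF that(2)]] that(1) by simp
     fix N assume "Exc nu N = Exc lam 0"
     thus "\<exists>z. \<forall>w. X.U u lam 0 nu N w --> (\<exists>c. w = scaleW c z)"
      using u_bounded_Pb Pb[of N] unfolding bounded_def by (metis order_refl)
    qed
   qed
  qed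
 qed
 thus ?thesis unfolding bounded_def by blast
qed

section \<open>Graded pieces of the local Weyl module and the top degree\<close>

interpretation Z: lie_module "current_scale scale" "current_bracket bracket" scaleW actW by (rule lie_W)

text \<open>Words in \<open>graded_piece\<close> use arbitrary elements of the algebra, those in
  \<open>ug\<close> only root vectors. Splitting letters into root components passes from one to the
  other, and \<open>U_component\<close> selects the weight.\<close>

lemma graded_weight_space_U:
 assumes \<mu>: "\<mu> \<in> dual"
 shows "w \<in> graded_weight_space scaleW actW u \<mu> k \<longleftrightarrow> X.U u lam 0 \<mu> (int k) w"
proof
 assume w: "w \<in> graded_weight_space scaleW actW u \<mu> k"
 have "apply_word actW (map (%(Y, n). monom Y n) ys) u \<in> X.V.span {w. \<exists>nu. X.U u lam 0 nu (int (sum_list (map snd ys))) w}" for ys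
 proof (induction ys)
  case Nil
  have "\<exists>nu. X.U u lam 0 nu 0 u" using ug.ug_base by blast
  thus ?case by (simp add: apply_word_Cons X.V.span_base)
 next case (Cons y ys)
  obtain Y n where y: "y = (Y, n)" by force
  let ?w = "apply_word actW (map (%(Y, n). monom Y n) ys) u"
  let ?S = "X.V.span {w. \<exists>nu. X.U u lam 0 nu (int (sum_list (map snd ys)) + int n) w}"
  have "actn Y (int n) ?w \<in> ?S"
  proof (rule span_WT_induct[where x = Y])
   show "actn x (int n) ?w \<in> ?S" if "ga \<in> WT" "x \<in> root_space ga" for ga x
    by (rule X.U_span_step[OF _ that(2) Cons.IH]) (use that in "simp add: PW_def")
   show "actn (x + y) (int n) ?w \<in> ?S" if "actn x (int n) ?w \<in> ?S" "actn y (int n) ?w \<in> ?S" for x y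
    using X.V.span_add[OF that] by (simp add: Z.act_add_left flip: add_monom)
  qed
  thus ?case by (simp add: y apply_word_Cons add.commute)
 qed
 hence "X.V.span {apply_word actW (map (%(Y, n). monom Y n) ys) u | ys. sum_list (map snd ys) = k}
   <= X.V.span {w. \<exists>nu. X.U u lam 0 nu (int k) w}" by (intro X.V.span_minimal X.V.subspace_span) auto
 hence sp: "w \<in> X.V.span {w. \<exists>nu. X.U u lam 0 nu (int k) w}" using w by (auto simp: graded_weight_space_def graded_piece_def)
 show "X.U u lam 0 \<mu> (int k) w" by (rule X.U_component[OF _ UNIV_I _ lam_intw sp \<mu>])
   (use w u_weight in "simp_all add: PW_0 graded_weight_space_def weight_space_def")
next
 assume w: "X.U u lam 0 \<mu> (int k) w"
 have "actW (monom H 0) w = scaleW (\<mu> H) w" if "H \<in> h" for H using X.U_weight[OF PW_0 UNIV_I _ that w] u_weight by simp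
 moreover have "w \<in> graded_piece scaleW actW u (nat N) & (w = 0 \<or> N \<ge> 0)" if "X.U u lam 0 nu N w" for nu N w using that
 proof (induction rule: ug.induct)
  case ug_base
  have "apply_word actW (map (%(Y, n). monom Y n) []) u \<in> graded_piece scaleW actW u 0"
   unfolding graded_piece_def by (intro X.V.span_base CollectI exI[of _ "[]"]) simp
  thus ?case by (simp add: apply_word_Cons)
 next case (ug_act nu N w bt n x)
  have n: "n \<ge> 0" using ug_act.hyps(2) by (auto simp: PW_def)
  have step: "actn x n w \<in> graded_piece scaleW actW u (k + nat n)" if "w \<in> graded_piece scaleW actW u k" for k
   using that unfolding graded_piece_def
  proof (induction rule: X.V.span_induct_alt)
   case (step c y z)
   then obtain ys where ys: "y = apply_word actW (map (%(Y, n). monom Y n) ys) u" "sum_list (map snd ys) = k" by blast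
   have "actn x n y = apply_word actW (map (%(Y, n). monom Y n) ((x, nat n) # ys)) u" by (simp add: ys(1) apply_word_Cons)
   moreover have "sum_list (map snd ((x, nat n) # ys)) = k + nat n" using ys(2) by simp
   ultimately have "actn x n y \<in> X.V.span {apply_word actW (map (%(Y, n). monom Y n) ys) u | ys. sum_list (map snd ys) = k + nat n}"
    by (intro X.V.span_base CollectI exI[of _ "(x, nat n) # ys"] conjI)
   thus ?case using step by (simp add: X.act_add X.act_scale X.V.span_add X.V.span_scale)
  qed (simp add: X.act_0 X.V.span_zero)
  show ?case
  proof (cases "w = 0")
   case True
   show ?thesis unfolding True X.act_0 graded_piece_def by (simp add: X.V.span_zero)
  next case False
   thus ?thesis using step[of "nat N"] ug_act.IH n by (simp add: nat_add_distrib)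
  qed
 qed (auto simp: graded_piece_def X.V.span_zero X.V.span_add X.V.span_scale)
 hence "w \<in> graded_piece scaleW actW u (nat (int k))" using w by blast
 ultimately show "w \<in> graded_weight_space scaleW actW u \<mu> k" by (simp add: graded_weight_space_def weight_space_def)
qed

text \<open>\<open>good_weights\<close> puts a nonzero vector in the degree where the excess equals
  that of \<open>u\<close>, \<open>weyl_bounded\<close> forbids higher degrees, and its clause on
  equal excess gives the dimension.\<close>

theorem top_degree:
 assumes V: "irr_mod scale bracket h b Basis form scaleV act lam v" and \<mu>: "\<mu> \<in> weights scaleV act"
  and nonzero: "graded_weight_space scaleW actW u \<mu> M ~= {0}"
  and largest: "!!k. graded_weight_space scaleW actW u \<mu> k ~= {0} ==> k \<le> M"
 shows "of_nat M = (form lam lam - form \<mu> \<mu>) / 2" "X.V.dim (graded_weight_space scaleW actW u \<mu> M) = 1"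
proof -
 let ?G = "%k. graded_weight_space scaleW actW u \<mu> k"
 obtain N where N: "good \<mu> N" using good_weights[OF V \<mu>] by blast
 hence \<mu>i: "\<mu> \<in> intw" and N2: "2 * of_int N = form lam lam - form \<mu> \<mu>" by (auto simp: good_def)
 note G = graded_weight_space_U[OF intw_dual[OF \<mu>i]]
 have 0: "0 \<in> ?G k" for k unfolding G by (rule ug.ug_zero)
 obtain w where w: "w \<in> ?G M" "w ~= 0" using nonzero 0 by blast
 have E: "Exc \<mu> k \<le> Exc lam 0 \<longleftrightarrow> N \<le> k" "Exc \<mu> k = Exc lam 0 \<longleftrightarrow> N = k" for k
 proof -
  have "2 * of_int N = Re (form lam lam) - Re (form \<mu> \<mu>)" using arg_cong[OF N2, of Re] by simp
  hence "Exc \<mu> k - Exc lam 0 = of_int (N - k)" by (simp add: Exc_def field_simps)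
  thus "Exc \<mu> k \<le> Exc lam 0 \<longleftrightarrow> N \<le> k" "Exc \<mu> k = Exc lam 0 \<longleftrightarrow> N = k" by auto
 qed
 have "int M \<le> N" using boundedD[OF weyl_bounded w(1)[unfolded G]] w(2) E[of "int M"] by fastforce
 moreover obtain w' where w': "X.U u lam 0 \<mu> N w'" "w' ~= 0" using good_nonzero[OF N] by blast
 have "N \<ge> 0" using calculation by simp
 hence "w' \<in> ?G (nat N)" using w'(1) by (simp add: G)
 hence "nat N \<le> M" using w'(2) by (intro largest) auto
 ultimately have NM: "N = int M" using \<open>N \<ge> 0\<close> by simp
 show "of_nat M = (form lam lam - form \<mu> \<mu>) / 2" using N2 by (simp add: NM field_simps)
 obtain z where z: "!!w. w \<in> ?G M ==> \<exists>c. w = scaleW c z" using weyl_bounded E(2)[of N] unfolding bounded_def G NM by metis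
 obtain c where c: "w = scaleW c z" using z[OF w(1)] by blast
 have "y \<in> X.V.span {w}" if y: "y \<in> ?G M" for y
 proof -
  obtain d where "y = scaleW d z" using z[OF y] by blast
  hence "y = scaleW (d / c) w" using c w(2) by auto
  thus ?thesis by (simp add: X.V.span_scale X.V.span_base)
 qed
 hence "X.V.span (?G M) = X.V.span {w}" using w(1) by (intro X.V.span_eq[THEN iffD2] conjI subsetI) (auto intro: X.V.span_base)
 hence "X.V.dim (?G M) = card {w}" using w(2) by (intro X.V.dim_eq_card) simp_all
 thus "X.V.dim (?G M) = 1" by simp
qed

end

theorem proposition4p2:
  fixes scale :: "complex \<Rightarrow> 'g::ab_group_add \<Rightarrow> 'g"
    and bracket :: "'g \<Rightarrow> 'g \<Rightarrow> 'g"
    and h b :: "'g set"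
    and form :: "('g \<Rightarrow> complex) \<Rightarrow> ('g \<Rightarrow> complex) \<Rightarrow> complex"
    and lam \<mu> :: "'g \<Rightarrow> complex"
    and scaleV :: "complex \<Rightarrow> 'v::ab_group_add \<Rightarrow> 'v"
    and actV :: "'g \<Rightarrow> 'v \<Rightarrow> 'v"
    and scaleW :: "complex \<Rightarrow> 'w::ab_group_add \<Rightarrow> 'w"
    and actW :: "'g poly \<Rightarrow> 'w \<Rightarrow> 'w"
    and u :: 'w
    and M :: nat
  assumes g: "simple_lie_algebra scale bracket h b"
    and simply_laced: "simple_lie_algebra.simply_laced scale bracket h b"
    and form: "simple_lie_algebra.normalized_invariant_form scale bracket h form"
    and lam: "simple_lie_algebra.dominant_integral scale bracket h b lam"
    and V: "simple_lie_algebra.irreducible_highest_weight_module scale bracket h b scaleV actV lam"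
    and \<mu>: "\<mu> \<in> simple_lie_algebra.weights scale h scaleV actV"
    and W: "simple_lie_algebra.local_weyl_module scale bracket h b scaleW actW u lam"
    and M_nonzero: "simple_lie_algebra.graded_weight_space h scaleW actW u \<mu> M \<noteq> {0}"
    and M_largest:
      "\<And>k. simple_lie_algebra.graded_weight_space h scaleW actW u \<mu> k \<noteq> {0} \<Longrightarrow> k \<le> M"
  shows "of_nat M = (form lam lam - form \<mu> \<mu>) / 2 \<and>
    vector_space.dim scaleW (simple_lie_algebra.graded_weight_space h scaleW actW u \<mu> M) = 1"
proof -
 interpret g: simple_lie_algebra scale bracket h b by (rule g)
 obtain B where B: "finite B" "g.span B = UNIV" using g.finite_dimensional by (auto simp: g.finite_dimensional_def)
 obtain Basis where Basis: "Basis <= B" "g.independent Basis" "B <= g.span Basis" by (rule g.maximal_independent_subset)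
 have sB: "g.span Basis = UNIV" using B(2) Basis(3) g.span_mono[OF Basis(3)] by (simp add: g.span_span top.extremum_unique)
 interpret a: ade scale bracket h b Basis form by unfold_locales (use finite_subset[OF Basis(1) B(1)] Basis(2) sB form in auto)
 interpret W: weyl scale bracket h b Basis form scaleW actW u lam by unfold_locales (rule lam W)+
 obtain v where v: "v ~= 0" "v \<in> g.weight_space scaleV actV lam" "\<forall>x\<in>g.nplus. actV x v = 0"
  using V unfolding g.irreducible_highest_weight_module_def by blast
 interpret V: lie_module scale bracket scaleV actV using V by (simp add: g.irreducible_highest_weight_module_def)
 have "irr_mod scale bracket h b Basis form scaleV actV lam v"
  by unfold_locales (use V v lam in "auto simp: g.irreducible_highest_weight_module_def")
 from W.top_degree[OF this \<mu> M_nonzero M_largest] show ?thesis by simp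
qed

end
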